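(* Let $N\ge 3$, let $\Sigma$ be a domain in the unit sphere $\mathbb{S}^{N-1}$, let $R>0$, and let $\mathcal{C}_\Sigma^R=\{r\sigma\in\mathbb{R}^N: r\in(0,R),\ \sigma\in\Sigma\}$. Let $c$ satisfy $\lambda_1(\Sigma)<c\le \mu(\mathcal{C}_\Sigma)$, let $p>1$, and let $u\in L^p_{loc}(\mathcal{C}_\Sigma^R)$ be non-negative and satisfy $$-\Delta u-\frac{c}{|x|^2}u\ge u^p\quad\text{in }\mathcal{D}'(\mathcal{C}_\Sigma^R),$$ i.e. $\int u(-\Delta\varphi-c|x|^{-2}\varphi)\,dx\ge\int u^p\varphi\,dx$ for all non-negative $\varphi\in C_c^\infty(\mathcal{C}_\Sigma^R)$. If $p\ge p_\Sigma$, then $u\equiv 0$.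
   Context: $\lambda_1(\Sigma)$ denotes the first Dirichlet eigenvalue of the Laplace–Beltrami operator on $\Sigma$. $\mathcal{C}_\Sigma=\{r\sigma: r>0,\sigma\in\Sigma\}$ and $\mu(\mathcal{C}_\Sigma)=\inf_{u\in C_c^\infty(\mathcal{C}_\Sigma)}\frac{\int|\nabla u|^2dx}{\int|x|^{-2}u^2dx}=\frac{(N-2)^2}{4}+\lambda_1(\Sigma)$. Set $\alpha_\Sigma^-=\frac{N-2}{2}-\sqrt{\mu(\mathcal{C}_\Sigma)-c}$ (which is positive when $c>\lambda_1(\Sigma)$) and $p_\Sigma=1+\frac{2}{\alpha_\Sigma^-}$. *)

theory Defs
  imports "HOL-Analysis.Analysis"
begin

fun dderiv :: "'a::euclidean_space list \<Rightarrow> ('a \<Rightarrow> real) \<Rightarrow> ('a \<Rightarrow> real)" where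
  "dderiv [] f = f"
| "dderiv (v # vs) f = (\<lambda>x. frechet_derivative (dderiv vs f) (at x) v)"

definition smooth_on :: "'a::euclidean_space set \<Rightarrow> ('a \<Rightarrow> real) \<Rightarrow> bool" where
  "smooth_on S f \<longleftrightarrow> (\<forall>vs. dderiv vs f differentiable_on S)"

definition tsupport :: "('a::euclidean_space \<Rightarrow> real) \<Rightarrow> 'a set" where
  "tsupport f = closure {x. f x \<noteq> 0}"

definition test_fun :: "'a::euclidean_space set \<Rightarrow> ('a \<Rightarrow> real) \<Rightarrow> bool" where
  "test_fun \<Omega> \<phi> \<longleftrightarrow> smooth_on UNIV \<phi> \<and> compact (tsupport \<phi>) \<and> tsupport \<phi> \<subseteq> \<Omega>"

definition laplacian :: "('a::euclidean_space \<Rightarrow> real) \<Rightarrow> 'a \<Rightarrow> real" where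
  "laplacian f x = (\<Sum>i\<in>Basis. dderiv [i, i] f x)"

definition grad_sq :: "('a::euclidean_space \<Rightarrow> real) \<Rightarrow> 'a \<Rightarrow> real" where
  "grad_sq f x = (\<Sum>i\<in>Basis. (dderiv [i] f x)\<^sup>2)"

definition sphere_domain :: "'a::euclidean_space set \<Rightarrow> bool" where
  "sphere_domain \<Sigma> \<longleftrightarrow> \<Sigma> \<noteq> {} \<and> connected \<Sigma> \<and> openin (top_of_set (sphere 0 1)) \<Sigma>"

definition cone_of :: "'a::euclidean_space set \<Rightarrow> 'a set" where
  "cone_of \<Sigma> = {r *\<^sub>R \<sigma> | r \<sigma>. 0 < r \<and> \<sigma> \<in> \<Sigma>}"

definition trunc_cone :: "'a::euclidean_space set \<Rightarrow> real \<Rightarrow> 'a set" where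
  "trunc_cone \<Sigma> R = {r *\<^sub>R \<sigma> | r \<sigma>. 0 < r \<and> r < R \<and> \<sigma> \<in> \<Sigma>}"

definition hardy_const :: "'a::euclidean_space set \<Rightarrow> real" where
  "hardy_const \<Sigma> = Inf {(\<integral>x. grad_sq u x \<partial>lebesgue) / (\<integral>x. u x ^ 2 / norm x ^ 2 \<partial>lebesgue) | u.
       test_fun (cone_of \<Sigma>) u \<and> (\<exists>x. u x \<noteq> 0)}"

text \<open>First Dirichlet eigenvalue of the Laplace-Beltrami operator on Sigma, via the Rayleigh
  quotient over smooth phi with compact support in Sigma.  A function phi on the sphere is
  represented through its 0-homogeneous extension psi(x) = phi(x/|x|); then
  |grad_sigma phi (x/|x|)|^2 = |x|^2 |grad psi(x)|^2 and integrating over the unit ball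
  (polar coordinates) gives (1/N) int_Sigma |grad_sigma phi|^2 and (1/N) int_Sigma phi^2.\<close>
definition lambda1 :: "'a::euclidean_space set \<Rightarrow> real" where
  "lambda1 \<Sigma> = Inf {(set_lebesgue_integral lebesgue (ball 0 1)
                          (\<lambda>x. norm x ^ 2 * grad_sq (\<lambda>y. \<phi> (sgn y)) x)) /
                      (set_lebesgue_integral lebesgue (ball 0 1) (\<lambda>x. (\<phi> (sgn x))\<^sup>2)) | \<phi>.
       smooth_on (UNIV - {0}) (\<lambda>y. \<phi> (sgn y)) \<and>
       closure {\<sigma> \<in> sphere 0 1. \<phi> \<sigma> \<noteq> 0} \<subseteq> \<Sigma> \<and> (\<exists>\<sigma>\<in>\<Sigma>. \<phi> \<sigma> \<noteq> 0)}"

definition alpha_minus :: "'a::euclidean_space set \<Rightarrow> real \<Rightarrow> real" where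
  "alpha_minus \<Sigma> c = (real DIM('a) - 2) / 2 - sqrt (hardy_const \<Sigma> - c)"

definition p_Sigma :: "'a::euclidean_space set \<Rightarrow> real \<Rightarrow> real" where
  "p_Sigma \<Sigma> c = 1 + 2 / alpha_minus \<Sigma> c"

definition Lp_loc :: "real \<Rightarrow> 'a::euclidean_space set \<Rightarrow> ('a \<Rightarrow> real) \<Rightarrow> bool" where
  "Lp_loc p \<Omega> u \<longleftrightarrow> u \<in> borel_measurable lebesgue \<and>
     (\<forall>K. compact K \<and> K \<subseteq> \<Omega> \<longrightarrow> (\<integral>\<^sup>+ x\<in>K. ennreal (\<bar>u x\<bar> powr p) \<partial>lebesgue) < \<infinity>)"

end

theory Submission
  imports Defs
begin

text \<open>Let \<open>\<kappa> = sqrt (\<mu> - c)\<close>, \<open>\<alpha> = (N - 2) / 2 - \<kappa>\<close> and \<open>W = |y|^\<alpha> u\<close>, with logarithmic radial variable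
  \<open>t = - ln |y|\<close>.  Testing the inequality with \<open>|y|^(\<alpha> + 2 - N) \<eta>(t)\<close> times a zonal bump centred at
  \<open>\<sigma>\<close> turns it into a pointwise inequality for the smooth function
  \<open>Y(\<sigma>) = \<integral> |y|^(-N) W \<eta>(t) bump(\<sigma> \<bullet> y/|y|) dy\<close> on the sphere.  Because \<open>\<alpha> (p - 1) \<ge> 2\<close>, the nonlinear term is at least
  a multiple of \<open>\<integral> |y|^(-N) W^p \<eta> bump\<close>, hence by Hoelder of \<open>Y (Q Y)^(p - 1)\<close>, where \<open>Q = q^2 + \<kappa> q\<close>
  measures how slowly \<open>\<eta>\<close> decays.  If \<open>u\<close> does not vanish, the strong minimum principle bounds the contribution of
  \<open>1 \<le> t \<le> 2\<close> from below, and balancing the two gives \<open>-\<Delta>Y / Y \<ge> \<lambda> - 65 Q + C Q^((p - 1) / p)\<close> on a large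
  compact part of \<open>\<Sigma>\<close> and \<open>-\<Delta>Y / Y \<ge> \<lambda> - 65 Q\<close> elsewhere.  Integrating against the square of an almost
  minimiser for \<open>\<lambda>\<close>, whose mass does not concentrate near the boundary, yields \<open>C Q^((p - 1) / p) \<le> 132 Q\<close>,
  which fails for small \<open>Q\<close>.\<close>

section \<open>Smooth functions\<close>

lemma dderiv_append: "dderiv (vs @ ws) f = dderiv vs (dderiv ws f)"
  by (induction vs) auto

lemma dderiv_cong_open:
  assumes "open S" "!!x. x \<in> S ==> f x = g x" "x \<in> S"
  shows "dderiv vs f x = dderiv vs g x"
  using \<open>x \<in> S\<close>
proof (induction vs arbitrary: x)
  case (Cons v vs)
  have "(%w. (dderiv vs f has_derivative w) (at x)) = (%w. (dderiv vs g has_derivative w) (at x))"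
    using Cons.IH Cons.prems assms(1)
    by (intro ext iffI) (auto elim: has_derivative_transform_within_open)
  then show ?case by (simp add: frechet_derivative_def)
qed (use assms in auto)

lemma smooth_on_cong:
  assumes "open S" "!!x. x \<in> S ==> f x = g x" "smooth_on S f"
  shows "smooth_on S g"
  unfolding smooth_on_def
proof
  fix vs
  have "dderiv vs f differentiable_on S" using assms(3) by (auto simp: smooth_on_def)
  then show "dderiv vs g differentiable_on S"
    using dderiv_cong_open[OF assms(1,2)] by (auto simp: differentiable_on_def intro: differentiable_transform_within[where d=1])
qed

lemma smooth_on_subset: "smooth_on S f ==> T \<subseteq> S ==> smooth_on T f"
  unfolding smooth_on_def by (meson differentiable_on_subset)

lemma smooth_on_local:
  assumes "!!x. x \<in> S ==> \<exists>U. open U & x \<in> U & smooth_on U f"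
  shows "smooth_on S f"
  unfolding smooth_on_def differentiable_on_def
proof (intro allI ballI)
  fix vs x assume "x \<in> S"
  then obtain U where U: "open U" "x \<in> U" "smooth_on U f" using assms by blast
  then have "dderiv vs f differentiable (at x)"
    using at_within_open[of x U] by (fastforce simp: smooth_on_def differentiable_on_def)
  then show "dderiv vs f differentiable at x within S"
    using differentiable_at_withinI by blast
qed

lemma smooth_on_D: "smooth_on S f ==> smooth_on S (dderiv vs f)"
  unfolding smooth_on_def by (metis dderiv_append)

lemma smooth_on_has_derivative:
  assumes "smooth_on S f" "open S" "x \<in> S"
  shows "(f has_derivative (%v. dderiv [v] f x)) (at x)"
proof -
  have "dderiv [] f differentiable_on S" using assms(1) unfolding smooth_on_def by blast
  then have "f differentiable (at x)" using assms at_within_open[of x S] by (force simp: differentiable_on_def)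
  then show ?thesis by (simp add: frechet_derivative_works[symmetric])
qed

lemma smooth_on_D1: "smooth_on S f ==> smooth_on S (%x. frechet_derivative f (at x) v)"
  using smooth_on_D[of S f "[v]"] by simp

lemma dderiv1_eq: "(f has_derivative D) (at x) ==> dderiv [v] f x = D v"
  using frechet_derivative_at by force

lemma smooth_on_continuous: "smooth_on S f ==> continuous_on S f"
  unfolding smooth_on_def by (metis dderiv.simps(1) differentiable_imp_continuous_on)

text \<open>Smoothness is proved coinductively: it suffices to exhibit a family of differentiable functions
  that is closed under directional derivatives.\<close>

lemma smooth_on_family:
  assumes S: "open S"
    and F: "!!f. f \<in> F ==> \<exists>D. (\<forall>x\<in>S. (f has_derivative D x) (at x)) & (\<forall>v. (%x. D x v) \<in> F)"
    and f: "f \<in> F"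
  shows "smooth_on S f"
proof -
  have *: "\<exists>g\<in>F. \<forall>x\<in>S. dderiv vs f x = g x" for vs
  proof (induction vs)
    case Nil then show ?case using f by auto
  next
    case (Cons v vs)
    then obtain g where g: "g \<in> F" "\<forall>x\<in>S. dderiv vs f x = g x" by blast
    obtain D where D: "\<forall>x\<in>S. (g has_derivative D x) (at x)" "\<forall>v. (%x. D x v) \<in> F"
      using F[OF g(1)] by blast
    have "dderiv (v # vs) f x = D x v" if "x \<in> S" for x
    proof -
      have "(dderiv vs f has_derivative D x) (at x)"
        using D(1) g(2) that S by (auto intro: has_derivative_transform_within_open)
      then show ?thesis using frechet_derivative_at by force
    qed
    then show ?case by (intro bexI[of _ "%x. D x v"]) (use D(2) in auto)
  qed
  show ?thesis unfolding smooth_on_def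
  proof
    fix vs
    obtain g where g: "g \<in> F" "\<forall>x\<in>S. dderiv vs f x = g x" using * by blast
    obtain D where D: "\<forall>x\<in>S. (g has_derivative D x) (at x)" using F[OF g(1)] by blast
    then have "(dderiv vs f has_derivative D x) (at x)" if "x \<in> S" for x
      using g(2) that S by (auto intro: has_derivative_transform_within_open)
    then show "dderiv vs f differentiable_on S"
      by (meson differentiable_at_imp_differentiable_on differentiable_def)
  qed
qed

lemma smooth_on_if_derivative_smooth:
  assumes S: "open S" and D: "!!x. x \<in> S ==> (f has_derivative D x) (at x)"
    and "!!v. smooth_on S (%x. D x v)"
  shows "smooth_on S f"
proof (rule smooth_on_family[OF S, where F = "insert f {g. smooth_on S g}"])
  fix g assume "g \<in> insert f {g. smooth_on S g}"
  then consider "g = f" | "smooth_on S g" by blast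
  then show "\<exists>D. (\<forall>x\<in>S. (g has_derivative D x) (at x)) & (\<forall>v. (%x. D x v) \<in> insert f {g. smooth_on S g})"
  proof cases
    case 1 then show ?thesis using assms by blast
  next
    case 2
    then show ?thesis using smooth_on_has_derivative[OF 2 S] smooth_on_D1[OF 2]
      by (intro exI[of _ "%x v. dderiv [v] g x"]) auto
  qed
qed auto

lemma smooth_on_const: "smooth_on S (%x. c)"
proof -
  have "smooth_on UNIV (%x::'a. c)"
  proof (rule smooth_on_family[where F = "range (%c x. c)"])
    fix f :: "'a => real" assume "f \<in> range (%c x. c)"
    then show "\<exists>D. (\<forall>x\<in>UNIV. (f has_derivative D x) (at x)) & (\<forall>v. (%x. D x v) \<in> range (%c x. c))"
      by (intro exI[of _ "%x v. 0"]) auto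
  qed auto
  then show ?thesis by (rule smooth_on_subset) auto
qed

lemma smooth_on_inner: "smooth_on S (%x. a \<bullet> x)"
proof -
  have "smooth_on UNIV (%x. a \<bullet> x)"
    by (rule smooth_on_if_derivative_smooth[where D = "%x v. a \<bullet> v"])
       (auto intro!: derivative_eq_intros smooth_on_const)
  then show ?thesis by (rule smooth_on_subset) auto
qed

text \<open>The algebra generated by smooth functions under all the operations needed is closed under
  differentiation; this yields all the closure properties of smoothness at once.\<close>

inductive_set smooth_alg :: "'a::euclidean_space set => ('a => real) set" for S :: "'a set" where
  base: "smooth_on S f ==> f \<in> smooth_alg S"
| plus: "f \<in> smooth_alg S ==> g \<in> smooth_alg S ==> (%x. f x + g x) \<in> smooth_alg S"
| times: "f \<in> smooth_alg S ==> g \<in> smooth_alg S ==> (%x. f x * g x) \<in> smooth_alg S"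
| comp_real: "f \<in> smooth_alg S ==> open T ==> smooth_on T (G::real => real) ==> f ` S \<subseteq> T ==>
    (%x. G (f x)) \<in> smooth_alg S"
| comp: "(!!i. i \<in> Basis ==> (%x. h x \<bullet> i) \<in> smooth_alg S) ==> open T ==>
    smooth_on T (Z::'a => real) ==> h ` S \<subseteq> T ==> (%x. Z (h x)) \<in> smooth_alg S"

lemma smooth_alg_sum:
  "finite I ==> (!!i. i \<in> I ==> f i \<in> smooth_alg S) ==> (%x. \<Sum>i\<in>I. f i x) \<in> smooth_alg S"
  by (induction I rule: finite_induct) (auto intro: smooth_alg.plus smooth_alg.base smooth_on_const)

lemma smooth_alg_derivative:
  assumes "open S" "f \<in> smooth_alg S"
  shows "\<exists>D. (\<forall>x\<in>S. (f has_derivative D x) (at x)) & (\<forall>v. (%x. D x v) \<in> smooth_alg S)"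
  using assms(2)
proof induction
  case (base f)
  then show ?case using smooth_on_has_derivative[OF base assms(1)] smooth_on_D1[OF base]
    by (intro exI[of _ "%x v. dderiv [v] f x"]) (auto intro: smooth_alg.base)
next
  case (plus f g)
  then obtain D E where "\<forall>x\<in>S. (f has_derivative D x) (at x)" "\<forall>v. (%x. D x v) \<in> smooth_alg S"
    "\<forall>x\<in>S. (g has_derivative E x) (at x)" "\<forall>v. (%x. E x v) \<in> smooth_alg S" by blast
  then show ?case
    by (intro exI[of _ "%x v. D x v + E x v"]) (auto intro!: derivative_eq_intros smooth_alg.plus)
next
  case (times f g)
  then obtain D E where "\<forall>x\<in>S. (f has_derivative D x) (at x)" "\<forall>v. (%x. D x v) \<in> smooth_alg S"
    "\<forall>x\<in>S. (g has_derivative E x) (at x)" "\<forall>v. (%x. E x v) \<in> smooth_alg S" by blast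
  then show ?case using times.hyps
    by (intro exI[of _ "%x v. f x * E x v + D x v * g x"])
       (auto intro!: derivative_eq_intros smooth_alg.plus smooth_alg.times)
next
  case (comp_real f T G)
  then obtain D where D: "\<forall>x\<in>S. (f has_derivative D x) (at x)" "\<forall>v. (%x. D x v) \<in> smooth_alg S" by blast
  have "((%x. G (f x)) has_derivative (%v. dderiv [1] G (f x) * D x v)) (at x)" if "x \<in> S" for x
  proof -
    have G: "(G has_derivative (%v. dderiv [v] G (f x))) (at (f x))"
      using smooth_on_has_derivative[of T G "f x"] comp_real that by auto
    have "(%v. dderiv [v] G (f x)) = (%v. dderiv [1] G (f x) * v)"
    proof
      fix v
      have "dderiv [v *\<^sub>R 1] G (f x) = v *\<^sub>R dderiv [1] G (f x)"
        by (rule linear_cmul[OF has_derivative_linear[OF G]])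
      then show "dderiv [v] G (f x) = dderiv [1] G (f x) * v"
        unfolding real_scaleR_def mult_1_right by (metis mult.commute)
    qed
    with G have "(G has_derivative (%v. dderiv [1] G (f x) * v)) (at (f x))" by metis
    from has_derivative_compose[OF bspec[OF D(1) that] this] show ?thesis .
  qed
  moreover have "(%x. dderiv [1] G (f x) * D x v) \<in> smooth_alg S" for v
    by (rule smooth_alg.times, rule smooth_alg.comp_real[OF comp_real(1,2) smooth_on_D[OF comp_real(3)] comp_real(4)])
       (use D(2) in auto)
  ultimately show ?case by (intro exI[of _ "%x v. dderiv [1] G (f x) * D x v"]) auto
next
  case (comp h T Z)
  then have "\<exists>D. \<forall>i\<in>Basis. (\<forall>x\<in>S. ((%x. h x \<bullet> i) has_derivative D i x) (at x)) & (\<forall>v. (%x. D i x v) \<in> smooth_alg S)"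
    by (intro bchoice) blast
  then obtain D where D: "!!i x. i \<in> Basis ==> x \<in> S ==> ((%x. h x \<bullet> i) has_derivative D i x) (at x)"
    "!!i v. i \<in> Basis ==> (%x. D i x v) \<in> smooth_alg S" by blast
  have "((%x. Z (h x)) has_derivative (%v. \<Sum>i\<in>Basis. D i x v * dderiv [i] Z (h x))) (at x)" if "x \<in> S" for x
  proof -
    have "(h has_derivative (%v. \<Sum>i\<in>Basis. D i x v *\<^sub>R i)) (at x)"
      using D(1) that by (subst has_derivative_componentwise_within) (auto simp: inner_sum_left inner_Basis if_distrib cong: if_cong)
    moreover have Z: "(Z has_derivative (%v. dderiv [v] Z (h x))) (at (h x))"
      using smooth_on_has_derivative[of T Z "h x"] comp that by auto
    ultimately have C: "((%x. Z (h x)) has_derivative (%v. dderiv [\<Sum>i\<in>Basis. D i x v *\<^sub>R i] Z (h x))) (at x)"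
      by (rule has_derivative_compose)
    have "dderiv [\<Sum>i\<in>Basis. D i x v *\<^sub>R i] Z (h x) = (\<Sum>i\<in>Basis. D i x v * dderiv [i] Z (h x))" for v
      unfolding linear_sum[OF has_derivative_linear[OF Z]] linear_cmul[OF has_derivative_linear[OF Z]]
        real_scaleR_def ..
    then show ?thesis using C by (simp only:)
  qed
  moreover have "(%x. \<Sum>i\<in>Basis. D i x v * dderiv [i] Z (h x)) \<in> smooth_alg S" for v
    by (rule smooth_alg_sum, simp, rule smooth_alg.times, rule D(2), assumption,
        rule smooth_alg.comp[OF _ comp(2) smooth_on_D[OF comp(3)] comp(4)]) (use comp(1) in auto)
  ultimately show ?case by (intro exI[of _ "%x v. \<Sum>i\<in>Basis. D i x v * dderiv [i] Z (h x)"]) auto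
qed

lemma smooth_alg_smooth: "open S ==> f \<in> smooth_alg S ==> smooth_on S f"
  using smooth_on_family[OF _ smooth_alg_derivative] by blast

lemma smooth_on_add: "open S ==> smooth_on S f ==> smooth_on S g ==> smooth_on S (%x. f x + g x)"
  by (rule smooth_alg_smooth, assumption, rule smooth_alg.plus; rule smooth_alg.base; assumption)

lemma smooth_on_mult: "open S ==> smooth_on S f ==> smooth_on S g ==> smooth_on S (%x. f x * g x)"
  by (rule smooth_alg_smooth, assumption, rule smooth_alg.times; rule smooth_alg.base; assumption)

lemma smooth_on_compose_real:
  fixes G :: "real => real"
  shows "open S ==> smooth_on S f ==> open T ==> smooth_on T G ==> f ` S \<subseteq> T ==> smooth_on S (%x. G (f x))"
  by (rule smooth_alg_smooth, assumption, rule smooth_alg.comp_real, rule smooth_alg.base; assumption)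

lemma smooth_on_compose:
  fixes h :: "'a::euclidean_space => 'a"
  shows "open S ==> (!!i. i \<in> Basis ==> smooth_on S (%x. h x \<bullet> i)) ==> open T ==> smooth_on T Z ==>
    h ` S \<subseteq> T ==> smooth_on S (%x. Z (h x))"
  by (rule smooth_alg_smooth, assumption, rule smooth_alg.comp[where T=T]) (auto intro: smooth_alg.base)

lemma smooth_on_sum:
  "open S ==> finite I ==> (!!i. i \<in> I ==> smooth_on S (f i)) ==> smooth_on S (%x. \<Sum>i\<in>I. f i x)"
  by (intro smooth_alg_smooth smooth_alg_sum) (auto intro: smooth_alg.base)

lemma smooth_on_minus: "open S ==> smooth_on S f ==> smooth_on S (%x. - f x)"
  using smooth_on_mult[of S "%x. -1" f] smooth_on_const by auto

lemma smooth_on_diff: "open S ==> smooth_on S f ==> smooth_on S g ==> smooth_on S (%x. f x - g x)"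
  using smooth_on_add[of S f "%x. - g x"] smooth_on_minus by auto

lemma smooth_on_power: "open S ==> smooth_on S f ==> smooth_on S (%x. f x ^ n)"
  by (induction n) (auto intro: smooth_on_const smooth_on_mult)

lemma smooth_on_ident: "smooth_on S (%x::real. x)"
  using smooth_on_inner[of S 1] by simp

lemma smooth_on_if_real_derivative_smooth:
  fixes f :: "real => real"
  assumes S: "open S" and D: "!!x. x \<in> S ==> (f has_real_derivative f' x) (at x)" and f': "smooth_on S f'"
  shows "smooth_on S f"
  by (rule smooth_on_if_derivative_smooth[OF S, where D = "%x v. f' x * v"])
     (use D in \<open>auto simp: has_field_derivative_def intro!: smooth_on_mult S f' smooth_on_const\<close>)

lemma smooth_on_exp: "smooth_on S (exp :: real => real)"
proof -
  have "smooth_on UNIV (%x::real. 1 * exp x)"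
  proof (rule smooth_on_family[where F = "range (%c x. c * exp x)"])
    fix f :: "real => real" assume "f \<in> range (%c x. c * exp x)"
    then obtain c where c: "f = (%x. c * exp x)" by blast
    show "\<exists>D. (\<forall>x\<in>UNIV. (f has_derivative D x) (at x)) & (\<forall>v. (%x. D x v) \<in> range (%c x. c * exp x))"
      unfolding c
      by (intro exI[of _ "%x v. (c * v) * exp x"] conjI) (auto intro!: derivative_eq_intros)
  qed (simp, rule range_eqI, rule refl)
  then show ?thesis by (auto intro: smooth_on_subset)
qed

lemma smooth_on_powr: "smooth_on {0<..} (%x. x powr a :: real)"
proof -
  let ?F = "range (%(c,a) x. c * x powr a :: real)"
  have "smooth_on {0<..} (%x. 1 * x powr a :: real)"
  proof (rule smooth_on_family[where F = ?F])
    fix f assume "f \<in> ?F"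
    then obtain c a where c: "f = (%x. c * x powr a)" by auto
    show "\<exists>D. (\<forall>x\<in>{0<..}. (f has_derivative D x) (at x)) & (\<forall>v. (%x. D x v) \<in> ?F)"
    proof (intro exI[of _ "%x v. (c * a * v) * x powr (a - 1)"] conjI ballI allI)
      fix x :: real assume "x \<in> {0<..}"
      then have "((%x. x powr a) has_real_derivative a * x powr (a - 1)) (at x)"
        by (auto intro: has_real_derivative_powr)
      then have "(f has_real_derivative c * (a * x powr (a - 1))) (at x)" unfolding c by (rule DERIV_cmult)
      then show "(f has_derivative (%v. (c * a * v) * x powr (a - 1))) (at x)"
        unfolding has_field_derivative_def by (rule has_derivative_eq_rhs) (auto simp: algebra_simps)
    qed (auto intro!: image_eqI[where x="(_,_)"])
  qed (simp, rule range_eqI[of _ _ "(1,a)"], simp)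
  then show ?thesis by simp
qed

lemma smooth_on_inverse:
  assumes "open S" "smooth_on S f" "!!x. x \<in> S ==> f x > 0"
  shows "smooth_on S (%x. inverse (f x))"
proof (rule smooth_on_cong[OF assms(1)])
  show "smooth_on S (%x. f x powr (-1))"
    by (rule smooth_on_compose_real[OF assms(1,2) _ smooth_on_powr]) (use assms(3) in auto)
  show "f x powr (-1) = inverse (f x)" if "x \<in> S" for x
    using assms(3)[OF that] by (simp add: powr_minus)
qed

lemma smooth_on_ln: "smooth_on {0<..} (ln :: real => real)"
  by (rule smooth_on_if_real_derivative_smooth[where f'=inverse])
    (auto intro!: derivative_eq_intros smooth_on_inverse smooth_on_ident simp: field_simps)

lemma smooth_on_norm: "smooth_on (UNIV - {0}) (norm :: 'a::euclidean_space => real)"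
proof -
  have "smooth_on (UNIV - {0::'a}) (%x. (\<Sum>i\<in>Basis. (i \<bullet> x) ^ 2) powr (1/2))"
  proof (rule smooth_on_compose_real[OF _ _ _ smooth_on_powr])
    show "(%x. \<Sum>i\<in>Basis. (i \<bullet> x)\<^sup>2) ` (UNIV - {0::'a}) \<subseteq> {0<..}"
      by (auto simp: power2_eq_square euclidean_inner[symmetric] inner_commute)
  qed (auto intro!: smooth_on_sum smooth_on_power smooth_on_inner)
  then show ?thesis
    by (rule smooth_on_cong[rotated 2])
      (auto simp: norm_eq_sqrt_inner powr_half_sqrt sum_nonneg power2_eq_square euclidean_inner[of x x for x] inner_commute)
qed

lemma smooth_on_sgn: "smooth_on (UNIV - {0}) (%x::'a::euclidean_space. sgn x \<bullet> i)"
proof (rule smooth_on_cong[where f="%x. inverse (norm x) * (i \<bullet> x)"])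
  show "smooth_on (UNIV - {0}) (%x::'a. inverse (norm x) * (i \<bullet> x))"
    by (intro smooth_on_mult smooth_on_inverse smooth_on_norm smooth_on_inner) auto
qed (auto simp: sgn_div_norm inner_commute)

lemma smooth_on_compose_sgn:
  assumes "smooth_on UNIV (Z :: 'a::euclidean_space => real)"
  shows "smooth_on (UNIV - {0}) (%x. Z (sgn x))"
  by (rule smooth_on_compose[OF _ smooth_on_sgn _ assms]) auto

subsection \<open>A flat function\<close>

definition flat :: "real => real" where
  "flat t = (if t <= 0 then 0 else exp (- inverse t))"

lemma flat_poly_smooth:
  fixes P :: "real poly"
  shows "smooth_on UNIV (%t. if t <= 0 then 0 else poly P (inverse t) * exp (- inverse t))"
proof -
  define f :: "real poly => real => real"
    where "f = (%P t. if t <= 0 then 0 else poly P (inverse t) * exp (- inverse t))"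
  have lim: "((%y. poly P y / exp y) \<longlongrightarrow> 0) at_top" for P :: "real poly"
  proof -
    have "((%y. \<Sum>i\<le>degree P. coeff P i * (y ^ i / exp y)) \<longlongrightarrow> (\<Sum>i\<le>degree P. coeff P i * 0)) at_top"
      by (intro tendsto_intros tendsto_power_div_exp_0)
    then show ?thesis by (simp add: poly_altdef sum_divide_distrib)
  qed
  have lim0: "((%t. poly P (inverse t) * exp (- inverse t)) \<longlongrightarrow> 0) (at_right 0)" for P :: "real poly"
    using filterlim_compose[OF lim[of P] filterlim_inverse_at_top_right]
    by (simp add: exp_minus field_simps)
  have D: "(f P has_real_derivative f ([:0,0,1:] * (P - pderiv P)) t) (at t)" for P t
  proof -
    consider "t < 0" | "t > 0" | "t = 0" by linarith
    then show ?thesis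
    proof cases
      case 1
      have "(f P has_real_derivative 0) (at t)"
        by (rule has_field_derivative_transform_within_open[where f="%_. 0" and S="{..<0}"])
           (use 1 in \<open>auto simp: f_def\<close>)
      then show ?thesis using 1 by (simp add: f_def)
    next
      case 2
      have "(f P has_real_derivative (poly (pderiv P) (inverse t) * (- (inverse t ^ 2)) * exp (- inverse t)
          + poly P (inverse t) * (exp (- inverse t) * (inverse t ^ 2)))) (at t)"
        by (rule has_field_derivative_transform_within_open[where f="%t. poly P (inverse t) * exp (- inverse t)" and S="{0<..}"])
           (use 2 in \<open>auto simp: f_def power2_eq_square intro!: derivative_eq_intros DERIV_chain2[OF poly_DERIV]\<close>)
      then show ?thesis using 2 by (simp add: f_def algebra_simps power2_eq_square)
    next
      case 3
      have "((%h. f P h / h) \<longlongrightarrow> 0) (at 0)"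
        unfolding filterlim_at_split
      proof
        show "((%h. f P h / h) \<longlongrightarrow> 0) (at_left 0)"
          by (rule tendsto_eventually) (auto simp: f_def eventually_at_filter)
        show "((%h. f P h / h) \<longlongrightarrow> 0) (at_right 0)"
          by (rule Lim_transform_eventually[OF lim0[of "[:0,1:] * P"]])
             (auto simp: f_def eventually_at_filter field_simps)
      qed
      then show ?thesis using 3 by (simp add: has_field_derivative_iff f_def)
    qed
  qed
  have Ds: "f (smult c P) t = f P t * c" for c P t by (simp add: f_def)
  have "smooth_on UNIV (f P)"
  proof (rule smooth_on_family[where F = "range f"])
    fix g assume "g \<in> range f"
    then obtain P where P: "g = f P" by blast
    have "(g has_derivative (%v. f (smult v ([:0,0,1:] * (P - pderiv P))) t)) (at t)" for t
      using D[of P t] unfolding P Ds by (simp only: has_field_derivative_def)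
    then show "\<exists>D. (\<forall>x\<in>UNIV. (g has_derivative D x) (at x)) & (\<forall>v. (%x. D x v) \<in> range f)"
      by (intro exI[of _ "%t v. f (smult v ([:0,0,1:] * (P - pderiv P))) t"]) auto
  qed auto
  then show ?thesis by (simp add: f_def)
qed

lemma flat_smooth: "smooth_on S flat"
proof -
  have "smooth_on UNIV flat"
    using flat_poly_smooth[of "1"] by (simp add: flat_def[abs_def] cong: if_cong)
  then show ?thesis by (rule smooth_on_subset) simp
qed

lemma flat_nonneg: "flat t >= 0" and flat_le_1: "flat t <= 1" and flat_pos: "t > 0 ==> flat t > 0"
  and flat_zero: "t <= 0 ==> flat t = 0"
  by (auto simp: flat_def)

lemma flat_mono: "s <= t ==> flat s <= flat t"
  by (auto simp: flat_def)

lemma flat_deriv_exists: "\<exists>D. (flat has_real_derivative D) (at t)"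
proof -
  have "(flat has_derivative (%v. dderiv [v] flat t)) (at t)"
    using smooth_on_has_derivative[OF flat_smooth[of UNIV]] by auto
  then show ?thesis using real_differentiableE[of flat t] differentiableI by blast
qed

lemma flat_deriv: "(flat has_real_derivative flat t * (inverse t)\<^sup>2) (at t)"
proof -
  consider "t < 0" | "t > 0" | "t = 0" by linarith
  then show ?thesis
  proof cases
    case 1
    have "(flat has_real_derivative 0) (at t)"
      by (rule has_field_derivative_transform_within_open[where f="%_. 0" and S="{..<0}"])
         (use 1 in \<open>auto simp: flat_def\<close>)
    then show ?thesis using 1 by (simp add: flat_def)
  next
    case 2
    show ?thesis
      by (rule has_field_derivative_transform_within_open[where f="%t. exp (- inverse t)" and S="{0<..}"])
         (use 2 in \<open>auto simp: flat_def power2_eq_square intro!: derivative_eq_intros\<close>)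
  next
    case 3
    obtain D where D: "(flat has_real_derivative D) (at 0)" using flat_deriv_exists by blast
    have "D = 0"
      by (rule DERIV_local_min[OF D, of 1]) (auto simp: flat_def)
    then show ?thesis using D 3 by (simp add: flat_def)
  qed
qed

lemma flat_dderiv: "(%t. flat t * (inverse t)\<^sup>2) = dderiv [1] flat"
proof
  fix t
  show "flat t * (inverse t)\<^sup>2 = dderiv [1] flat t"
    using dderiv1_eq[OF flat_deriv[of t, unfolded has_field_derivative_def], of 1] by linarith
qed

lemma flat_deriv2:
  "((%t. flat t * (inverse t)\<^sup>2) has_real_derivative flat t * ((inverse t)^4 - 2 * (inverse t)^3)) (at t)"
proof -
  let ?g = "%t. flat t * (inverse t)\<^sup>2"
  consider "t < 0" | "t > 0" | "t = 0" by linarith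
  then show ?thesis
  proof cases
    case 1
    have "(?g has_real_derivative 0) (at t)"
      by (rule has_field_derivative_transform_within_open[where f="%_. 0" and S="{..<0}"])
         (use 1 in \<open>auto simp: flat_def\<close>)
    then show ?thesis using 1 by (simp add: flat_def)
  next
    case 2
    then show ?thesis
      by (auto intro!: derivative_eq_intros flat_deriv simp: field_simps power2_eq_square power3_eq_cube power4_eq_xxxx)
  next
    case 3
    have "smooth_on UNIV ?g" using smooth_on_D[OF flat_smooth[of UNIV]] flat_dderiv by metis
    then obtain D where D: "(?g has_real_derivative D) (at 0)"
      using smooth_on_has_derivative[of UNIV ?g 0] real_differentiableE[of ?g 0] differentiableI by blast
    have "D = 0"
      by (rule DERIV_local_min[OF D, of 1]) (auto simp: flat_def)
    then show ?thesis using D 3 by (simp add: flat_def)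
  qed
qed

section \<open>Integration\<close>

lemma sgn_borel_measurable [measurable]: "(sgn :: 'a::euclidean_space => 'a) \<in> borel_measurable borel"
  unfolding sgn_div_norm[abs_def] by measurable

lemma sgn_sgn_vector: "sgn (sgn x) = sgn (x :: 'a::real_normed_vector)"
  by (cases "x = 0") (auto simp: sgn_div_norm)

lemma integral_translation:
  fixes f :: "'a::euclidean_space => real"
  shows "(\<integral>x. f (x + a) \<partial>lborel) = (\<integral>x. f x \<partial>lborel)"
proof -
  have "(\<integral>x. f x \<partial>lborel) = (\<integral>x. f x \<partial>distr lborel borel ((+) a))"
    by (simp add: lborel_distr_plus)
  also have "\<dots> = (\<integral>x. f (a + x) \<partial>lborel)" if "f \<in> borel_measurable borel"
    using that by (subst integral_distr) auto
  also have "\<dots> = (\<integral>x. f (x + a) \<partial>lborel)" by (simp add: add.commute)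
  finally have *: ?thesis if "f \<in> borel_measurable borel" using that by simp
  show ?thesis
  proof (cases "f \<in> borel_measurable borel")
    case False
    have "(%x. f (x + a)) \<notin> borel_measurable borel"
    proof
      assume "(%x. f (x + a)) \<in> borel_measurable borel"
      then have "(%x. f ((x - a) + a)) \<in> borel_measurable borel"
        by (rule measurable_compose[rotated]) auto
      then show False using False by simp
    qed
    then have "\<not> integrable lborel (%x. f (x + a))" "\<not> integrable lborel f"
      using False by (auto dest: borel_measurable_integrable)
    then show ?thesis by (simp add: not_integrable_integral_eq)
  qed (rule *)
qed

lemma nn_integral_translation:
  fixes f :: "'a::euclidean_space => ennreal"
  assumes [measurable]: "f \<in> borel_measurable borel"
  shows "(\<integral>\<^sup>+x. f (x + a) \<partial>lborel) = (\<integral>\<^sup>+x. f x \<partial>lborel)"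
proof -
  have "(\<integral>\<^sup>+x. f x \<partial>lborel) = (\<integral>\<^sup>+x. f x \<partial>distr lborel borel ((+) a))"
    by (simp add: lborel_distr_plus)
  also have "\<dots> = (\<integral>\<^sup>+x. f (a + x) \<partial>lborel)" by (subst nn_integral_distr) auto
  finally show ?thesis by (simp add: add.commute)
qed

lemma nn_integral_scale:
  fixes f :: "'a::euclidean_space => ennreal"
  assumes [measurable]: "f \<in> borel_measurable borel" and r: "r > 0"
  shows "(\<integral>\<^sup>+x. f x \<partial>lborel) = ennreal (r ^ DIM('a)) * (\<integral>\<^sup>+x. f (r *\<^sub>R x) \<partial>lborel)"
proof -
  have "(\<integral>\<^sup>+x. f x \<partial>lborel) =
      (\<integral>\<^sup>+x. f x \<partial>density (distr lborel borel (%x::'a. 0 + r *\<^sub>R x)) (%_. \<bar>r\<bar>^DIM('a)))"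
    using lborel_affine[of r "0::'a"] r by simp
  also have "\<dots> = ennreal (r ^ DIM('a)) * (\<integral>\<^sup>+x. f (r *\<^sub>R x) \<partial>lborel)"
    using r by (simp add: nn_integral_density nn_integral_distr nn_integral_cmult)
  finally show ?thesis .
qed

lemma integrable_continuous_compact_support:
  fixes f :: "'a::euclidean_space => real"
  assumes "continuous_on UNIV f" "compact K" "!!x. x \<notin> K ==> f x = 0"
  shows "integrable lborel f"
proof -
  have "integrable lborel (%x. indicator K x *\<^sub>R f x)"
    by (rule borel_integrable_compact) (use assms in \<open>auto intro: continuous_on_subset\<close>)
  moreover have "(%x. indicator K x *\<^sub>R f x) = f"
    by (rule ext) (auto simp: indicator_def assms(3))
  ultimately show ?thesis by simp
qed

lemma integral_derivative_zero:
  fixes f :: "'a::euclidean_space => real"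
  assumes D: "!!x. (f has_derivative D x) (at x)"
    and cont: "continuous_on UNIV (%x. D x v)"
    and K: "compact K" "!!x. x \<notin> K ==> f x = 0"
  shows "(\<integral>x. D x v \<partial>lborel) = 0"
proof -
  have "bounded K" using K by (simp add: compact_imp_bounded)
  then obtain M where M: "!!x. x \<in> K ==> norm x <= M" by (auto simp: bounded_iff)
  define L where "L = cball (0::'a) (M + norm v)"
  have "compact (insert 0 ((%x. D x v) ` L))"
    by (rule compact_insert, rule compact_continuous_image) (auto simp: L_def intro: continuous_on_subset[OF cont])
  then obtain B where B: "!!x. x \<in> L ==> \<bar>D x v\<bar> <= B" "B >= 0"
    by (auto dest!: compact_imp_bounded simp: bounded_iff) blast
  have fcont: "continuous_on UNIV f"
    using D by (meson continuous_at_imp_continuous_on has_derivative_continuous)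
  have [measurable]: "f \<in> borel_measurable borel" "(%x. D x v) \<in> borel_measurable borel"
    using fcont cont by (auto intro: borel_measurable_continuous_onI)
  have line: "((%s. f (x + s *\<^sub>R v)) has_real_derivative D (x + s *\<^sub>R v) v) (at s)" for x s
  proof -
    have "((%s. f (x + s *\<^sub>R v)) has_derivative (%h. D (x + s *\<^sub>R v) (h *\<^sub>R v))) (at s)"
      by (rule has_derivative_compose[OF _ D]) (auto intro!: derivative_eq_intros)
    then show ?thesis
      using linear_cmul[OF has_derivative_linear[OF D]] by (simp add: has_field_derivative_def mult.commute[of _ "D (x + s *\<^sub>R v) v"])
  qed
  have zero: "D x v = 0" if "x \<notin> L" for x
  proof -
    have "\<not> norm x <= M + norm v" using that by (simp add: L_def dist_norm)
    then have "norm x > M" by (smt (verit) norm_ge_zero)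
    have "(f has_derivative (%_. 0)) (at x)"
    proof (rule has_derivative_transform_within_open[where f = "%_. 0" and s = "- cball 0 M"])
      show "x \<in> - cball 0 M" using \<open>M < norm x\<close> by simp
      show "0 = f y" if "y \<in> - cball 0 M" for y
        using that K(2)[of y] M[of y] by (cases "y \<in> K") auto
    qed auto
    then show ?thesis using has_derivative_unique[OF D] by metis
  qed
  let ?q = "%n x. (f (x + (1 / real (Suc n)) *\<^sub>R v) - f x) * real (Suc n)"
  have "(%n. \<integral>x. ?q n x \<partial>lborel) \<longlonglongrightarrow> (\<integral>x. D x v \<partial>lborel)"
  proof (rule integral_dominated_convergence[where w="%x. B * indicator L x"])
    show "integrable lborel (%x. B * indicator L x)"
      by (auto intro!: integrable_mult_right integrable_real_indicator simp: L_def)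
         (metis emeasure_compact_finite compact_cball infinity_ennreal_def)
    show "AE x in lborel. (%n. ?q n x) \<longlonglongrightarrow> D x v"
    proof (intro AE_I2)
      fix x
      have "((%h. (f (x + h *\<^sub>R v) - f x) / h) \<longlongrightarrow> D x v) (at 0)"
        using line[of x 0] by (simp add: has_field_derivative_iff)
      moreover have "filterlim (%n. 1 / real (Suc n)) (at 0) sequentially"
        unfolding filterlim_at using lim_inverse_n'[THEN LIMSEQ_Suc] by (simp add: inverse_eq_divide)
      ultimately show "(%n. ?q n x) \<longlonglongrightarrow> D x v"
        by (drule_tac filterlim_compose) auto
    qed
    fix n
    have "norm (?q n x) <= B * indicator L x" for x
    proof -
      obtain z where z: "0 < z" "z < 1 / real (Suc n)"
        "f (x + (1 / real (Suc n)) *\<^sub>R v) - f (x + 0 *\<^sub>R v) = (1 / real (Suc n) - 0) * D (x + z *\<^sub>R v) v"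
        using MVT2[of 0 "1 / real (Suc n)" "%s. f (x + s *\<^sub>R v)" "%s. D (x + s *\<^sub>R v) v"] line by auto
      then have eq: "?q n x = D (x + z *\<^sub>R v) v" by (simp add: field_simps)
      have le: "\<bar>D (x + z *\<^sub>R v) v\<bar> <= B" using B zero by (cases "x + z *\<^sub>R v \<in> L") auto
      show ?thesis
      proof (cases "x \<in> L")
        case True then show ?thesis using eq le by simp
      next
        case False
        have "norm x > M + norm v" using False by (auto simp: L_def dist_norm)
        moreover have "norm (x + (1 / real (Suc n)) *\<^sub>R v) >= norm x - norm v"
        proof -
          have "norm ((1 / real (Suc n)) *\<^sub>R v) <= norm v" using divide_left_mono[of 1 "1 + real n" "norm v"] by simp
          then show ?thesis using norm_diff_ineq[of x "(1 / real (Suc n)) *\<^sub>R v"] by linarith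
        qed
        ultimately have "f x = 0" "f (x + (1 / real (Suc n)) *\<^sub>R v) = 0"
          using K(2) M norm_ge_zero[of v] by (smt (verit))+
        then show ?thesis using B by simp
      qed
    qed
    then show "AE x in lborel. norm (?q n x) <= B * indicator L x" by simp
  qed measurable
  moreover have "(\<integral>x. ?q n x \<partial>lborel) = 0" for n
  proof -
    have i: "integrable lborel f"
      by (rule integrable_continuous_compact_support[OF fcont K])
    have i': "integrable lborel (%x. f (x + a))" for a
      by (rule integrable_continuous_compact_support[OF _ compact_translation_subtract[OF K(1), of a]])
         (use K(2) in \<open>auto intro!: continuous_intros continuous_on_compose2[OF fcont] simp: image_iff algebra_simps\<close>)
    show ?thesis
      using i i' integral_translation[of f] by simp
  qed
  ultimately show ?thesis by (simp add: LIMSEQ_const_iff)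
qed


subsection \<open>Polar coordinates\<close>

text \<open>The surface measure of the sphere is represented by the image of Lebesgue measure on the
  unit ball under the radial projection sgn.\<close>

lemma nn_integral_power_tail:
  assumes "a > 0" "N >= 1"
  shows "(\<integral>\<^sup>+r. ennreal (1 / r ^ (N + 1)) * indicator {a<..} r \<partial>lborel) = ennreal (1 / (real N * a ^ N))"
proof -
  have "(\<integral>\<^sup>+r. ennreal (1 / r ^ (N + 1)) * indicator {a..} r \<partial>lborel) = ennreal (0 - (- 1 / (real N * a ^ N)))"
  proof (rule nn_integral_FTC_atLeast)
    show "((%x. - 1 / (real N * x ^ N)) has_real_derivative 1 / r ^ (N + 1)) (at r)" if "a <= r" for r
    proof -
      have "r > 0" using that assms by linarith
      obtain M where M: "N = Suc M" using assms by (cases N) auto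
      have "((%x. - (1 / real (Suc M)) * inverse (x ^ Suc M)) has_real_derivative
          - (1 / real (Suc M)) * - (inverse (r ^ Suc M) * (real (Suc M) * r ^ M) * inverse (r ^ Suc M))) (at r)"
        using \<open>r > 0\<close> by (intro DERIV_cmult DERIV_inverse' DERIV_cong[OF DERIV_pow]) (auto simp: mult.assoc)
      moreover have "- (1 / real (Suc M)) * - (inverse (r ^ Suc M) * (real (Suc M) * r ^ M) * inverse (r ^ Suc M)) = 1 / r ^ (Suc M + 1)"
        using \<open>r > 0\<close> by (simp del: of_nat_Suc add: field_simps)
      ultimately show ?thesis unfolding M by (simp del: of_nat_Suc add: field_simps)
    qed
    have "filterlim (%x. real N * x ^ N) at_top at_top"
      using assms by (intro filterlim_tendsto_pos_mult_at_top[OF tendsto_const] filterlim_pow_at_top filterlim_ident) auto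
    then show "((%x. - 1 / (real N * x ^ N)) \<longlongrightarrow> 0) at_top"
      by (intro tendsto_divide_0[OF tendsto_const] filterlim_at_top_imp_at_infinity)
  qed (use assms in auto)
  moreover have "(\<integral>\<^sup>+r. ennreal (1 / r ^ (N + 1)) * indicator {a<..} r \<partial>lborel) =
      (\<integral>\<^sup>+r. ennreal (1 / r ^ (N + 1)) * indicator {a..} r \<partial>lborel)"
    by (rule nn_integral_cong_AE) (use AE_lborel_singleton[of a] in \<open>eventually_elim, auto simp: indicator_def\<close>)
  ultimately show ?thesis by simp
qed

lemma nn_integral_polar:
  fixes f :: "'a::euclidean_space => ennreal"
  defines "N \<equiv> DIM('a)"
  assumes [measurable]: "f \<in> borel_measurable borel"
  shows "(\<integral>\<^sup>+x. f x \<partial>lborel) = of_nat N * (\<integral>\<^sup>+r. ennreal (r ^ (N - 1)) * indicator {0<..} r *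
    (\<integral>\<^sup>+x. f (r *\<^sub>R sgn x) * indicator (ball 0 1) x \<partial>lborel) \<partial>lborel)"
proof -
  have [measurable]: "ball (0::'a) 1 \<in> sets borel" by simp
  have N: "N >= 1" unfolding N_def by (simp add: Suc_leI)
  have bp: "ennreal a * ennreal b = ennreal (a * b)" if "a >= 0" for a b
    using that by (simp add: ennreal_mult')
  have "(\<integral>\<^sup>+r. ennreal (r ^ (N - 1)) * indicator {0<..} r *
      (\<integral>\<^sup>+x. f (r *\<^sub>R sgn x) * indicator (ball 0 1) x \<partial>lborel) \<partial>lborel)
    = (\<integral>\<^sup>+r. \<integral>\<^sup>+x. ennreal (r ^ (N - 1)) * indicator {0<..} r * f (r *\<^sub>R sgn x) * indicator (ball 0 1) x \<partial>(lborel::'a measure) \<partial>lborel)"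
    by (intro nn_integral_cong, subst nn_integral_cmult[symmetric]) (measurable, auto simp: mult.assoc intro!: nn_integral_cong)
  also have "\<dots> = (\<integral>\<^sup>+x. \<integral>\<^sup>+r. ennreal (r ^ (N - 1)) * indicator {0<..} r * f (r *\<^sub>R sgn x) * indicator (ball 0 1) x \<partial>lborel \<partial>(lborel::'a measure))"
    by (rule lborel_pair.Fubini'; measurable)
  also have "\<dots> = (\<integral>\<^sup>+x. \<integral>\<^sup>+r. ennreal (r ^ (N - 1)) * indicator {0<..} r * (ennreal (norm x ^ N) * f (r *\<^sub>R x) * indicator (ball 0 1) x) \<partial>lborel \<partial>(lborel::'a measure))"
  proof (rule nn_integral_cong_AE)
    show "AE x in lborel. (\<integral>\<^sup>+r. ennreal (r ^ (N - 1)) * indicator {0<..} r * f (r *\<^sub>R sgn x) * indicator (ball 0 1) x \<partial>lborel)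
      = (\<integral>\<^sup>+r. ennreal (r ^ (N - 1)) * indicator {0<..} r * (ennreal (norm x ^ N) * f (r *\<^sub>R x) * indicator (ball 0 1) x) \<partial>lborel)"
      using AE_lborel_singleton[of "0::'a"]
    proof eventually_elim
      fix x :: 'a assume "x ~= 0"
      then have nx: "norm x > 0" by simp
      have "(\<integral>\<^sup>+r. ennreal (r ^ (N - 1)) * indicator {0<..} r * f (r *\<^sub>R sgn x) * indicator (ball 0 1) x \<partial>lborel)
        = ennreal \<bar>norm x\<bar> * (\<integral>\<^sup>+r. ennreal ((0 + norm x * r) ^ (N - 1)) * indicator {0<..} (0 + norm x * r) * f ((0 + norm x * r) *\<^sub>R sgn x) * indicator (ball 0 1) x \<partial>lborel)"
        by (rule nn_integral_real_affine) (use nx in auto)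
      also have "\<dots> = (\<integral>\<^sup>+r. ennreal (norm x) * (ennreal ((norm x * r) ^ (N - 1)) * indicator {0<..} (norm x * r) * f ((norm x * r) *\<^sub>R sgn x) * indicator (ball 0 1) x) \<partial>lborel)"
        by (subst nn_integral_cmult) auto
      also have "\<dots> = (\<integral>\<^sup>+r. ennreal (r ^ (N - 1)) * indicator {0<..} r * (ennreal (norm x ^ N) * f (r *\<^sub>R x) * indicator (ball 0 1) x) \<partial>lborel)"
      proof (rule nn_integral_cong)
        fix r :: real
        have "norm x * norm x ^ (N - 1) = norm x ^ N" using N by (simp add: power_eq_if)
        then have "ennreal (norm x) * ennreal ((norm x * r) ^ (N - 1)) = ennreal (r ^ (N - 1)) * ennreal (norm x ^ N)" if "r > 0"
          using that nx by (simp add: bp power_mult_distrib algebra_simps)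
        moreover have "(norm x * r) *\<^sub>R sgn x = r *\<^sub>R x"
          using nx by (simp add: sgn_div_norm)
        moreover have "0 < norm x * r \<longleftrightarrow> 0 < r" using nx by (simp add: zero_less_mult_iff)
        ultimately show "ennreal (norm x) * (ennreal ((norm x * r) ^ (N - 1)) * indicator {0<..} (norm x * r) * f ((norm x * r) *\<^sub>R sgn x) * indicator (ball 0 1) x)
          = ennreal (r ^ (N - 1)) * indicator {0<..} r * (ennreal (norm x ^ N) * f (r *\<^sub>R x) * indicator (ball 0 1) x)"
          by (cases "r > 0") (auto simp: mult.assoc[symmetric] indicator_def)
      qed
      finally show "(\<integral>\<^sup>+r. ennreal (r ^ (N - 1)) * indicator {0<..} r * f (r *\<^sub>R sgn x) * indicator (ball 0 1) x \<partial>lborel)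
        = (\<integral>\<^sup>+r. ennreal (r ^ (N - 1)) * indicator {0<..} r * (ennreal (norm x ^ N) * f (r *\<^sub>R x) * indicator (ball 0 1) x) \<partial>lborel)" .
    qed
  qed
  also have "\<dots> = (\<integral>\<^sup>+r. \<integral>\<^sup>+x. ennreal (r ^ (N - 1)) * indicator {0<..} r * (ennreal (norm x ^ N) * f (r *\<^sub>R x) * indicator (ball 0 1) x) \<partial>(lborel::'a measure) \<partial>lborel)"
    by (rule lborel_pair.Fubini'[symmetric]) measurable
  also have "\<dots> = (\<integral>\<^sup>+r. \<integral>\<^sup>+x. ennreal (norm x ^ N) * f x * (ennreal (1 / r ^ (N + 1)) * (if norm x < r then 1 else 0)) \<partial>(lborel::'a measure) \<partial>lborel)"
  proof (rule nn_integral_cong)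
    fix r :: real
    show "(\<integral>\<^sup>+x. ennreal (r ^ (N - 1)) * indicator {0<..} r * (ennreal (norm x ^ N) * f (r *\<^sub>R x) * indicator (ball 0 1) x) \<partial>(lborel::'a measure))
      = (\<integral>\<^sup>+x. ennreal (norm x ^ N) * f x * (ennreal (1 / r ^ (N + 1)) * (if norm x < r then 1 else 0)) \<partial>lborel)"
    proof (cases "r > 0")
      case False
      then have "\<not> norm x < r" for x :: 'a by (smt (verit) norm_ge_zero)
      with False show ?thesis by simp
    next
      case True
      have "(\<integral>\<^sup>+x. ennreal (norm x ^ N) * f x * (ennreal (1 / r ^ (N + 1)) * (if norm x < r then 1 else 0)) \<partial>lborel)
        = ennreal (r ^ N) * (\<integral>\<^sup>+x. ennreal (norm (r *\<^sub>R x) ^ N) * f (r *\<^sub>R x) * (ennreal (1 / r ^ (N + 1)) * (if norm (r *\<^sub>R x) < r then 1 else 0)) \<partial>(lborel::'a measure))"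
        unfolding N_def by (rule nn_integral_scale[OF _ True]) measurable
      also have "\<dots> = (\<integral>\<^sup>+x. ennreal (r ^ N) * (ennreal (norm (r *\<^sub>R x) ^ N) * f (r *\<^sub>R x) * (ennreal (1 / r ^ (N + 1)) * (if norm (r *\<^sub>R x) < r then 1 else 0))) \<partial>(lborel::'a measure))"
        by (rule nn_integral_cmult[symmetric]; measurable)
      also have "\<dots> = (\<integral>\<^sup>+x. ennreal (r ^ (N - 1)) * indicator {0<..} r * (ennreal (norm x ^ N) * f (r *\<^sub>R x) * indicator (ball 0 1) x) \<partial>(lborel::'a measure))"
      proof (rule nn_integral_cong)
        fix x :: 'a
        have "r ^ N * (norm (r *\<^sub>R x) ^ N) * (1 / r ^ (N + 1)) = r ^ (N - 1) * norm x ^ N"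
          using True N by (simp add: power_mult_distrib field_simps power_eq_if[of r N])
        then have e: "ennreal (r ^ N) * ennreal (norm (r *\<^sub>R x) ^ N) * ennreal (1 / r ^ (N + 1)) = ennreal (r ^ (N - 1)) * ennreal (norm x ^ N)"
          by (subst bp, use True in simp, subst bp, use True in simp, subst bp, use True in simp, simp only:)
        have n: "norm (r *\<^sub>R x) < r \<longleftrightarrow> norm x < 1" using True by simp
        show "ennreal (r ^ N) * (ennreal (norm (r *\<^sub>R x) ^ N) * f (r *\<^sub>R x) * (ennreal (1 / r ^ (N + 1)) * (if norm (r *\<^sub>R x) < r then 1 else 0)))
          = ennreal (r ^ (N - 1)) * indicator {0<..} r * (ennreal (norm x ^ N) * f (r *\<^sub>R x) * indicator (ball 0 1) x)"
        proof -
          have "a * (b * F * (c * i)) = (a * b * c) * F * i" for a b c F i :: ennreal by (simp only: ac_simps)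
          then have "ennreal (r ^ N) * (ennreal (norm (r *\<^sub>R x) ^ N) * f (r *\<^sub>R x) * (ennreal (1 / r ^ (N + 1)) * (if norm (r *\<^sub>R x) < r then 1 else 0)))
            = (ennreal (r ^ (N - 1)) * ennreal (norm x ^ N)) * f (r *\<^sub>R x) * (if norm (r *\<^sub>R x) < r then 1 else 0)"
            using e by simp
          moreover have "(if norm (r *\<^sub>R x) < r then 1 else 0) = (indicator (ball 0 1) x :: ennreal)"
            using n by (auto simp: indicator_def dist_norm)
          ultimately show ?thesis using True by (simp add: mult.assoc)
        qed
      qed
      finally show ?thesis by simp
    qed
  qed
  also have "\<dots> = (\<integral>\<^sup>+x. \<integral>\<^sup>+r. ennreal (norm x ^ N) * f x * (ennreal (1 / r ^ (N + 1)) * (if norm x < r then 1 else 0)) \<partial>lborel \<partial>(lborel::'a measure))"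
    by (rule lborel_pair.Fubini'; measurable)
  also have "\<dots> = (\<integral>\<^sup>+x. ennreal (norm x ^ N) * f x * ennreal (1 / (real N * norm x ^ N)) \<partial>lborel)"
  proof (rule nn_integral_cong_AE)
    show "AE x in lborel. (\<integral>\<^sup>+r. ennreal (norm x ^ N) * f x * (ennreal (1 / r ^ (N + 1)) * (if norm x < r then 1 else 0)) \<partial>lborel)
       = ennreal (norm x ^ N) * f x * ennreal (1 / (real N * norm x ^ N))"
      using AE_lborel_singleton[of "0::'a"]
    proof eventually_elim
      fix x :: 'a assume "x ~= 0"
      then show "(\<integral>\<^sup>+r. ennreal (norm x ^ N) * f x * (ennreal (1 / r ^ (N + 1)) * (if norm x < r then 1 else 0)) \<partial>lborel)
        = ennreal (norm x ^ N) * f x * ennreal (1 / (real N * norm x ^ N))"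
        using nn_integral_power_tail[of "norm x" N] N
        by (subst nn_integral_cmult) (auto simp: indicator_def of_bool_def)
    qed
  qed
  also have "\<dots> = (\<integral>\<^sup>+x. ennreal (1 / real N) * f x \<partial>lborel)"
  proof (rule nn_integral_cong_AE)
    show "AE x in lborel. ennreal (norm x ^ N) * f x * ennreal (1 / (real N * norm x ^ N)) = ennreal (1 / real N) * f x"
      using AE_lborel_singleton[of "0::'a"]
    proof eventually_elim
      fix x :: 'a assume "x ~= 0"
      then have "ennreal (norm x ^ N) * ennreal (1 / (real N * norm x ^ N)) = ennreal (1 / real N)"
        using N by (simp add: bp)
      moreover have "ennreal (norm x ^ N) * f x * ennreal (1 / (real N * norm x ^ N))
          = (ennreal (norm x ^ N) * ennreal (1 / (real N * norm x ^ N))) * f x" by (simp only: ac_simps)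
      ultimately show "ennreal (norm x ^ N) * f x * ennreal (1 / (real N * norm x ^ N)) = ennreal (1 / real N) * f x"
        by simp
    qed
  qed
  also have "\<dots> = ennreal (1 / real N) * (\<integral>\<^sup>+x. f x \<partial>lborel)"
    by (rule nn_integral_cmult; measurable)
  finally have *: "(\<integral>\<^sup>+r. ennreal (r ^ (N - 1)) * indicator {0<..} r *
      (\<integral>\<^sup>+x. f (r *\<^sub>R sgn x) * indicator (ball 0 1) x \<partial>lborel) \<partial>lborel) = ennreal (1 / real N) * (\<integral>\<^sup>+x. f x \<partial>lborel)" .
  have "of_nat N * ennreal (1 / real N) = 1"
    using N bp[of "real N" "1 / real N"] by (simp add: ennreal_of_nat_eq_real_of_nat)
  then show ?thesis unfolding * by (simp add: mult.assoc[symmetric])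
qed

lemma nn_integral_polar_product:
  fixes g :: "'a::euclidean_space => ennreal" and f :: "real => ennreal"
  assumes [measurable]: "f \<in> borel_measurable borel" "g \<in> borel_measurable borel"
  shows "(\<integral>\<^sup>+x. f (norm x) * g (sgn x) \<partial>lborel) = of_nat DIM('a) *
    (\<integral>\<^sup>+r. ennreal (r ^ (DIM('a) - 1)) * indicator {0<..} r * f r \<partial>lborel) *
    (\<integral>\<^sup>+x. g (sgn x) * indicator (ball 0 1) x \<partial>lborel)"
proof -
  have [measurable]: "ball (0::'a) 1 \<in> sets borel" by simp
  let ?A = "%r. ennreal (r ^ (DIM('a) - 1)) * indicator {0<..} r"
  let ?I = "\<integral>\<^sup>+x. g (sgn x) * indicator (ball 0 1) x \<partial>lborel"
  have "(\<integral>\<^sup>+r. ?A r * (\<integral>\<^sup>+x. f (norm (r *\<^sub>R sgn x)) * g (sgn (r *\<^sub>R sgn x)) * indicator (ball 0 1) x \<partial>(lborel::'a measure)) \<partial>lborel)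
    = (\<integral>\<^sup>+r. (?A r * f r) * ?I \<partial>lborel)"
  proof (rule nn_integral_cong)
    fix r :: real
    show "?A r * (\<integral>\<^sup>+x. f (norm (r *\<^sub>R sgn x)) * g (sgn (r *\<^sub>R sgn x)) * indicator (ball 0 1) x \<partial>(lborel::'a measure)) = (?A r * f r) * ?I"
    proof (cases "r > 0")
      case True
      have "(\<integral>\<^sup>+x. f (norm (r *\<^sub>R sgn x)) * g (sgn (r *\<^sub>R sgn x)) * indicator (ball 0 1) x \<partial>(lborel::'a measure))
         = (\<integral>\<^sup>+x. f r * (g (sgn x) * indicator (ball 0 1) x) \<partial>lborel)"
      proof (rule nn_integral_cong_AE)
        show "AE x in lborel. f (norm (r *\<^sub>R sgn x)) * g (sgn (r *\<^sub>R sgn x)) * indicator (ball 0 1) x = f r * (g (sgn x) * indicator (ball (0::'a) 1) x)"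
          using AE_lborel_singleton[of "0::'a"]
          by eventually_elim (use True in \<open>auto simp: norm_sgn sgn_scaleR sgn_sgn_vector mult.assoc\<close>)
      qed
      also have "\<dots> = f r * ?I" by (rule nn_integral_cmult; measurable)
      finally show ?thesis by (simp add: mult.assoc)
    qed simp
  qed
  also have "\<dots> = (\<integral>\<^sup>+r. ?A r * f r \<partial>lborel) * ?I" by (rule nn_integral_multc; measurable)
  finally show ?thesis
    by (subst nn_integral_polar) (auto simp: mult.assoc)
qed

lemma integral_polar_product:
  fixes g :: "'a::euclidean_space => real" and f :: "real => real" and F C :: real
  assumes f[measurable]: "f \<in> borel_measurable borel" and f0: "!!r. f r >= 0"
    and fin: "(\<integral>\<^sup>+r. ennreal (r ^ (DIM('a) - 1)) * indicator {0<..} r * ennreal (f r) \<partial>lborel) = ennreal F" "F >= 0"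
    and g[measurable]: "g \<in> borel_measurable borel" and gb: "!!x. norm x = 1 ==> \<bar>g x\<bar> <= C"
  shows "integrable lborel (%x. f (norm x) * g (sgn x))" (is ?A)
    and "integrable lborel (%x. g (sgn x) * indicator (ball 0 1) x)" (is ?B)
    and "(\<integral>x. f (norm x) * g (sgn x) \<partial>lborel) = DIM('a) * F * (\<integral>x. g (sgn x) * indicator (ball 0 1) x \<partial>lborel)" (is ?C)
proof -
  have [measurable]: "ball (0::'a) 1 \<in> sets borel" by simp
  have fB: "emeasure lborel (ball (0::'a) 1) < \<infinity>" using emeasure_bounded_finite[of "ball (0::'a) 1"] by simp
  have B: "integrable lborel (%x. h (sgn x) * indicator (ball 0 1) x)"
    if [measurable]: "h \<in> borel_measurable borel" and hb: "!!x. norm x = 1 ==> \<bar>h x\<bar> <= C" for h :: "'a => real"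
  proof (rule Bochner_Integration.integrable_bound)
    show "integrable lborel (%x::'a. C * indicator (ball 0 1) x)"
      using fB by (intro integrable_mult_right integrable_real_indicator) auto
    show "AE x in lborel. norm (h (sgn x) * indicator (ball 0 1) x) <= norm (C * indicator (ball (0::'a) 1) x)"
      using AE_lborel_singleton[of "0::'a"]
      by eventually_elim (auto simp: indicator_def norm_sgn intro!: order_trans[OF hb])
  qed measurable
  have pos: "integrable lborel (%x. f (norm x) * h (sgn x)) &
      (\<integral>x. f (norm x) * h (sgn x) \<partial>lborel) = DIM('a) * F * (\<integral>x. h (sgn x) * indicator (ball 0 1) x \<partial>lborel)"
    if [measurable]: "h \<in> borel_measurable borel" and h0: "!!x. h x >= 0" and hb: "!!x. norm x = 1 ==> \<bar>h x\<bar> <= C" for h :: "'a => real"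
  proof -
    have m2: "(%r. ennreal (f r)) \<in> borel_measurable borel" "(%x. ennreal (h x)) \<in> borel_measurable borel"
      by measurable
    have "(\<integral>\<^sup>+x. ennreal (f (norm x) * h (sgn x)) \<partial>lborel) = (\<integral>\<^sup>+x. ennreal (f (norm x)) * ennreal (h (sgn x)) \<partial>lborel)"
      using f0 h0 by (simp add: ennreal_mult)
    also have "\<dots> = of_nat DIM('a) * ennreal F * (\<integral>\<^sup>+x. ennreal (h (sgn x)) * indicator (ball 0 1) x \<partial>lborel)"
      unfolding nn_integral_polar_product[OF m2] fin(1) ..
    also have "(\<integral>\<^sup>+x. ennreal (h (sgn x)) * indicator (ball 0 1) x \<partial>lborel) = (\<integral>\<^sup>+x. ennreal (h (sgn x) * indicator (ball 0 1) x) \<partial>lborel)"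
      by (intro nn_integral_cong) (auto simp: indicator_def)
    also have "\<dots> = ennreal (\<integral>x. h (sgn x) * indicator (ball 0 1) x \<partial>lborel)"
      by (rule nn_integral_eq_integral[OF B[OF that(1) hb]]) (use h0 in auto)
    finally have *: "(\<integral>\<^sup>+x. ennreal (f (norm x) * h (sgn x)) \<partial>lborel) = ennreal (DIM('a) * F * (\<integral>x. h (sgn x) * indicator (ball 0 1) x \<partial>lborel))"
      using fin(2) by (simp add: ennreal_mult' ennreal_of_nat_eq_real_of_nat)
    have **: "0 <= DIM('a) * F * (\<integral>x. h (sgn x) * indicator (ball 0 1) x \<partial>lborel)"
      using fin(2) h0 by (intro mult_nonneg_nonneg integral_nonneg_AE) auto
    show ?thesis
      using nn_integral_eq_integrable[of "%x. f (norm x) * h (sgn x)" lborel "DIM('a) * F * (\<integral>x. h (sgn x) * indicator (ball 0 1) x \<partial>lborel)"] * ** f0 h0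
      by auto
  qed
  have gb': "\<bar>max 0 (g x)\<bar> <= C" "\<bar>max 0 (- g x)\<bar> <= C" if "norm x = 1" for x
    using gb[OF that] by auto
  let ?p = "%x. max 0 (g x)" and ?m = "%x. max 0 (- g x)"
  have p: "integrable lborel (%x. f (norm x) * ?p (sgn x)) &
      (\<integral>x. f (norm x) * ?p (sgn x) \<partial>lborel) = DIM('a) * F * (\<integral>x. ?p (sgn x) * indicator (ball 0 1) x \<partial>lborel)"
    by (rule pos) (use gb' in auto)
  have m: "integrable lborel (%x. f (norm x) * ?m (sgn x)) &
      (\<integral>x. f (norm x) * ?m (sgn x) \<partial>lborel) = DIM('a) * F * (\<integral>x. ?m (sgn x) * indicator (ball 0 1) x \<partial>lborel)"
    by (rule pos) (use gb' in auto)
  have pB: "integrable lborel (%x. ?p (sgn x) * indicator (ball 0 1) x)"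
    by (rule B) (use gb' in auto)
  have mB: "integrable lborel (%x. ?m (sgn x) * indicator (ball 0 1) x)"
    by (rule B) (use gb' in auto)
  have e1: "(%x. f (norm x) * g (sgn x)) = (%x. f (norm x) * ?p (sgn x) - f (norm x) * ?m (sgn x))"
    by (auto simp: max_def algebra_simps)
  have e2: "(%x. g (sgn x) * indicator (ball 0 1) x) = (%x. ?p (sgn x) * indicator (ball 0 1) x - ?m (sgn x) * indicator (ball 0 1) x)"
    by (auto simp: max_def algebra_simps)
  show ?A unfolding e1 using p m by (intro Bochner_Integration.integrable_diff) auto
  show ?B by (rule B[OF g gb])
  show ?C unfolding e1 e2 using p m pB mB by (simp add: algebra_simps)
qed

section \<open>Radial and homogeneous functions\<close>

lemma laplacian_eqI:
  assumes "open S" "x \<in> S" "!!y. y \<in> S ==> (f has_derivative D y) (at y)"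
    and "!!i. i \<in> Basis ==> ((%y. D y i) has_derivative E i) (at x)"
  shows "laplacian f x = (\<Sum>i\<in>Basis. E i i)"
  unfolding laplacian_def
proof (rule sum.cong[OF refl])
  fix i :: 'a assume i: "i \<in> Basis"
  have "(dderiv [i] f has_derivative E i) (at x)"
    by (rule has_derivative_transform_within_open[OF assms(4)[OF i] assms(1,2)])
       (use dderiv1_eq[OF assms(3)] in simp)
  then show "dderiv [i, i] f x = E i i" by (metis dderiv.simps dderiv1_eq)
qed

lemma grad_sq_eqI: "(f has_derivative D) (at x) ==> grad_sq f x = (\<Sum>i\<in>Basis. (D i)\<^sup>2)"
  unfolding grad_sq_def by (intro sum.cong refl) (metis dderiv1_eq)

lemma grad_sq_nonneg: "grad_sq f x >= 0"
  unfolding grad_sq_def by (intro sum_nonneg) auto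

lemma laplacian_cong: "open S ==> x \<in> S ==> (!!y. y \<in> S ==> f y = g y) ==> laplacian f x = laplacian g x"
  unfolding laplacian_def by (intro sum.cong refl dderiv_cong_open[of S]) auto

lemma grad_sq_cong: "open S ==> x \<in> S ==> (!!y. y \<in> S ==> f y = g y) ==> grad_sq f x = grad_sq g x"
  unfolding grad_sq_def by (intro sum.cong refl arg_cong[where f="%x. x^2"] dderiv_cong_open[of S]) auto

lemma smooth_on_laplacian: "open S ==> smooth_on S f ==> smooth_on S (laplacian f)"
  unfolding laplacian_def[abs_def] by (intro smooth_on_sum smooth_on_D) auto

lemma smooth_on_grad_sq: "open S ==> smooth_on S f ==> smooth_on S (grad_sq f)"
  unfolding grad_sq_def[abs_def] by (intro smooth_on_sum smooth_on_power smooth_on_D) auto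

lemma dderiv_mult:
  assumes "open S" "x \<in> S" "smooth_on S f" "smooth_on S g"
  shows "dderiv [v] (%x. f x * g x) x = f x * dderiv [v] g x + dderiv [v] f x * g x"
  by (rule dderiv1_eq, rule has_derivative_mult; rule smooth_on_has_derivative[of S]) (use assms in auto)

lemma laplacian_mult:
  assumes S: "open S" "x \<in> S" "smooth_on S f" "smooth_on S g"
  shows "laplacian (%x. f x * g x) x =
    f x * laplacian g x + 2 * (\<Sum>i\<in>Basis. dderiv [i] f x * dderiv [i] g x) + g x * laplacian f x"
proof -
  have "laplacian (%x. f x * g x) x = (\<Sum>i\<in>Basis. (f x * dderiv [i,i] g x + dderiv [i] f x * dderiv [i] g x)
      + (dderiv [i] f x * dderiv [i] g x + dderiv [i,i] f x * g x))"
  proof (rule laplacian_eqI[OF S(1,2), where D="%y v. f y * dderiv [v] g y + dderiv [v] f y * g y"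
        and E="%i v. (f x * dderiv [v,i] g x + dderiv [v] f x * dderiv [i] g x)
      + (dderiv [i] f x * dderiv [v] g x + dderiv [v,i] f x * g x)"])
    fix y assume "y \<in> S"
    then show "((%x. f x * g x) has_derivative (%v. f y * dderiv [v] g y + dderiv [v] f y * g y)) (at y)"
      by (intro has_derivative_mult smooth_on_has_derivative[of S]) (use S in auto)
  next
    fix i :: 'a
    have "(dderiv [i] h has_derivative (%v. dderiv [v,i] h x)) (at x)" if "smooth_on S h" for h
      using smooth_on_has_derivative[OF smooth_on_D[OF that, of "[i]"] S(1,2)] by simp
    then show "((%y. f y * dderiv [i] g y + dderiv [i] f y * g y) has_derivative
       (%v. (f x * dderiv [v,i] g x + dderiv [v] f x * dderiv [i] g x)
      + (dderiv [i] f x * dderiv [v] g x + dderiv [v,i] f x * g x))) (at x)"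
      by (intro has_derivative_add has_derivative_mult smooth_on_has_derivative[of S]) (use S in auto)
  qed
  then show ?thesis
    by (simp add: laplacian_def sum.distrib sum_distrib_left algebra_simps del: dderiv.simps)
qed

lemma has_derivative_ln_norm:
  fixes x :: "'a::euclidean_space"
  assumes "x ~= 0"
  shows "((%x. ln (norm x)) has_derivative (%v. (x \<bullet> v) / (x \<bullet> x))) (at x)"
proof -
  have n: "(norm has_derivative (%v. v \<bullet> sgn x)) (at x)"
    by (rule has_derivative_norm[OF assms])
  have "((%x. ln (norm x)) has_derivative (%v. (v \<bullet> sgn x) * inverse (norm x))) (at x)"
    by (rule has_derivative_compose[OF n]) (use assms in \<open>auto intro!: derivative_eq_intros\<close>)
  then show ?thesis
    by (rule has_derivative_eq_rhs)
      (simp add: fun_eq_iff sgn_div_norm dot_square_norm power2_eq_square field_simps inner_commute)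
qed

lemma has_derivative_radial:
  fixes x :: "'a::euclidean_space"
  assumes "x ~= 0" "(h has_real_derivative h') (at (ln (norm x)))"
  shows "((%x. h (ln (norm x))) has_derivative (%v. h' * ((x \<bullet> v) / (x \<bullet> x)))) (at x)"
  using has_derivative_compose[OF has_derivative_ln_norm[OF assms(1)] assms(2)[unfolded has_field_derivative_def]] .

lemma sum_Basis_inner: "(\<Sum>i\<in>Basis. (x \<bullet> i) * (y \<bullet> i)) = x \<bullet> (y::'a::euclidean_space)"
  by (simp add: euclidean_inner[of x y])

lemma laplacian_radial:
  fixes x :: "'a::euclidean_space" and h h' h'' :: "real => real"
  assumes x: "x ~= 0" and h: "!!t. (h has_real_derivative h' t) (at t)" "!!t. (h' has_real_derivative h'' t) (at t)"
  shows "laplacian (%x::'a. h (ln (norm x))) x =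
    (h'' (ln (norm x)) + (real DIM('a) - 2) * h' (ln (norm x))) / (norm x)\<^sup>2"
proof -
  let ?l = "ln (norm x)"
  let ?E = "%i w. h' ?l * (((i \<bullet> w) * (x \<bullet> x) - (x \<bullet> i) * (2 * (x \<bullet> w))) / (x \<bullet> x)\<^sup>2)
    + h'' ?l * ((x \<bullet> w) / (x \<bullet> x)) * ((x \<bullet> i) / (x \<bullet> x))"
  have xx: "x \<bullet> x > 0" using x by simp
  have alg: "a * ((n * q - 2 * q) / q\<^sup>2) + b * q / q\<^sup>2 = (b + (n - 2) * a) / q" if "q > 0" for a b n q :: real
    using that by (simp add: power2_eq_square field_simps)
  have "laplacian (%x::'a. h (ln (norm x))) x = (\<Sum>i\<in>Basis. ?E i i)"
  proof (rule laplacian_eqI[of "UNIV - {0}" _ _ "%y v. h' (ln (norm y)) * ((y \<bullet> v) / (y \<bullet> y))" ?E])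
    fix i :: 'a
    have "((%y. (y \<bullet> i) / (y \<bullet> y)) has_derivative (%w. ((i \<bullet> w) * (x \<bullet> x) - (x \<bullet> i) * (2 * (x \<bullet> w))) / (x \<bullet> x)\<^sup>2)) (at x)"
      using xx by (auto intro!: derivative_eq_intros simp: fun_eq_iff power2_eq_square inner_commute algebra_simps)
    from has_derivative_mult[OF has_derivative_radial[OF x h(2)] this]
    show "((%y. h' (ln (norm y)) * ((y \<bullet> i) / (y \<bullet> y))) has_derivative ?E i) (at x)"
      by (rule has_derivative_eq_rhs) (simp add: fun_eq_iff)
  qed (use x has_derivative_radial[OF _ h(1)] in auto)
  also have "\<dots> = h' ?l * (\<Sum>i\<in>Basis. ((i \<bullet> i) * (x \<bullet> x) - 2 * ((x \<bullet> i) * (x \<bullet> i))) / (x \<bullet> x)\<^sup>2)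
    + h'' ?l * (\<Sum>i\<in>Basis. (x \<bullet> i) * (x \<bullet> i)) / (x \<bullet> x)\<^sup>2"
    by (simp add: sum.distrib sum_distrib_left sum_divide_distrib power2_eq_square algebra_simps)
  also have "(\<Sum>i\<in>Basis. ((i \<bullet> i) * (x \<bullet> x) - 2 * ((x \<bullet> i) * (x \<bullet> i))) / (x \<bullet> x)\<^sup>2)
    = (DIM('a) * (x \<bullet> x) - 2 * (x \<bullet> x)) / (x \<bullet> x)\<^sup>2"
    by (simp add: sum_divide_distrib[symmetric] sum_subtractf sum_distrib_left[symmetric] sum_Basis_inner)
  finally show ?thesis
    unfolding power2_norm_eq_inner sum_Basis_inner alg[OF xx] .
qed

lemma has_derivative_sgn:
  fixes x :: "'a::euclidean_space"
  assumes "x ~= 0"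
  shows "(sgn has_derivative (%v. inverse (norm x) *\<^sub>R (v - (sgn x \<bullet> v) *\<^sub>R sgn x))) (at x)"
proof -
  have n: "(norm has_derivative (%v. v \<bullet> sgn x)) (at x)"
    by (rule has_derivative_norm[OF assms])
  have "((%x. inverse (norm x) *\<^sub>R x) has_derivative
      (%v. inverse (norm x) *\<^sub>R v + (- (inverse (norm x) * (v \<bullet> sgn x) * inverse (norm x))) *\<^sub>R x)) (at x)"
    by (intro has_derivative_scaleR Deriv.has_derivative_inverse n has_derivative_ident) (use assms in auto)
  then show ?thesis unfolding sgn_div_norm[abs_def]
    by (rule has_derivative_eq_rhs) (simp add: fun_eq_iff sgn_div_norm inner_commute algebra_simps)
qed

lemma laplacian_compose_sgn:
  fixes x :: "'a::euclidean_space" and Z :: "'a => real" and DZ :: "'a => 'a => real" and D2 :: "'a => 'a => 'a => real"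
  assumes x: "x ~= 0" and Z: "!!y. (Z has_derivative DZ y) (at y)"
    and DZ: "!!v y. ((%y. DZ y v) has_derivative D2 y v) (at y)"
  shows "laplacian (%x. Z (sgn x)) x = ((\<Sum>i\<in>Basis. D2 (sgn x) i i) - (\<Sum>i\<in>Basis. (sgn x \<bullet> i) * D2 (sgn x) i (sgn x))
    - (real DIM('a) - 1) * DZ (sgn x) (sgn x)) / (norm x)\<^sup>2"
proof -
  define s where "s = sgn x"
  define n where "n = norm x"
  have n: "n > 0" using x by (simp add: n_def)
  have ss: "s \<bullet> s = 1" using x by (simp add: s_def dot_square_norm norm_sgn)
  define T where "T = (%v. inverse n *\<^sub>R (v - (s \<bullet> v) *\<^sub>R s))"
  have T: "(sgn has_derivative T) (at x)" using has_derivative_sgn[OF x] by (simp add: T_def s_def n_def)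
  define P where "P = (%y. \<Sum>j\<in>Basis. (sgn y \<bullet> j) * DZ (sgn y) j)"
  define DP where "DP = (%w. \<Sum>j\<in>Basis. (s \<bullet> j) * D2 s j (T w) + (T w \<bullet> j) * DZ s j)"
  have DPexp: "DZ y v = (\<Sum>j\<in>Basis. (v \<bullet> j) * DZ y j)" for y v
  proof -
    have "DZ y v = DZ y (\<Sum>j\<in>Basis. (v \<bullet> j) *\<^sub>R j)" by (simp add: euclidean_representation)
    also have "\<dots> = (\<Sum>j\<in>Basis. (v \<bullet> j) * DZ y j)"
      using has_derivative_linear[OF Z] by (simp add: linear_sum linear_cmul)
    finally show ?thesis .
  qed
  have DZs: "((%y. DZ (sgn y) j) has_derivative (%w. D2 s j (T w))) (at x)" for j
    unfolding s_def by (rule has_derivative_compose[OF T[unfolded s_def] DZ])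
  have sj: "((%y. sgn y \<bullet> j) has_derivative (%w. T w \<bullet> j)) (at x)" for j
    by (intro derivative_intros T)
  have P: "(P has_derivative DP) (at x)"
    unfolding P_def DP_def using has_derivative_sum[OF has_derivative_mult[OF sj DZs]] by (simp add: s_def)
  have Ts: "T s = 0" by (simp add: T_def ss)
  have lin2: "linear (D2 s j)" for j using has_derivative_linear[OF DZ] .
  have DPs: "DP s = 0" unfolding DP_def Ts using linear_0[OF lin2] by simp
  have rep: "(\<Sum>i\<in>Basis. (s \<bullet> i) *\<^sub>R i) = s" by (simp add: euclidean_representation)
  let ?D = "%y v. inverse (norm y) * (DZ (sgn y) v - (sgn y \<bullet> v) * P y)"
  let ?E = "%i w. inverse n * (D2 s i (T w) - ((s \<bullet> i) * DP w + (T w \<bullet> i) * P x))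
     + (- (inverse n * (w \<bullet> s) * inverse n)) * (DZ s i - (s \<bullet> i) * P x)"
  have "laplacian (%x. Z (sgn x)) x = (\<Sum>i\<in>Basis. ?E i i)"
  proof (rule laplacian_eqI[of "UNIV - {0}" _ _ ?D ?E])
    fix y :: 'a assume "y \<in> UNIV - {0}"
    then have y: "y ~= 0" by simp
    have "((%x. Z (sgn x)) has_derivative (%v. DZ (sgn y) (inverse (norm y) *\<^sub>R (v - (sgn y \<bullet> v) *\<^sub>R sgn y)))) (at y)"
      by (rule has_derivative_compose[OF has_derivative_sgn[OF y] Z])
    moreover have "DZ (sgn y) (inverse (norm y) *\<^sub>R (v - (sgn y \<bullet> v) *\<^sub>R sgn y)) = ?D y v" for v
      using has_derivative_linear[OF Z, of "sgn y"] DPexp[of "sgn y" "sgn y"]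
      by (simp add: linear_cmul linear_diff P_def)
    ultimately show "((%x. Z (sgn x)) has_derivative ?D y) (at y)" by simp
  next
    fix i :: 'a
    have n': "(norm has_derivative (%v. v \<bullet> s)) (at x)"
      using has_derivative_norm[OF x] by (simp add: s_def)
    have "((%y. inverse (norm y)) has_derivative (%w. - (inverse n * (w \<bullet> s) * inverse n))) (at x)"
      using Deriv.has_derivative_inverse[OF _ n'] x by (simp add: n_def)
    from has_derivative_mult[OF this has_derivative_diff[OF DZs[of i] has_derivative_mult[OF sj[of i] P]]]
    show "((%y. ?D y i) has_derivative ?E i) (at x)" by (simp add: n_def s_def)
  qed (use x in auto)
  also have "\<dots> = inverse n * ((\<Sum>i\<in>Basis. D2 s i (T i)) - (\<Sum>i\<in>Basis. (s \<bullet> i) * DP i) - (\<Sum>i\<in>Basis. T i \<bullet> i) * P x)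
     - inverse n * inverse n * ((\<Sum>i\<in>Basis. (s \<bullet> i) * DZ s i) - (\<Sum>i\<in>Basis. (s \<bullet> i) * (s \<bullet> i)) * P x)"
    by (simp add: sum.distrib sum_subtractf sum_distrib_left sum_distrib_right algebra_simps inner_commute[of _ s])
  also have "(\<Sum>i\<in>Basis. (s \<bullet> i) * DP i) = DP s"
  proof -
    have "DP s = DP (\<Sum>i\<in>Basis. (s \<bullet> i) *\<^sub>R i)" by (simp add: rep)
    also have "\<dots> = (\<Sum>i\<in>Basis. (s \<bullet> i) * DP i)"
      using has_derivative_linear[OF P] by (simp add: linear_sum linear_cmul)
    finally show ?thesis by simp
  qed
  also have "(\<Sum>i\<in>Basis. (s \<bullet> i) * DZ s i) = DZ s s" by (rule DPexp[symmetric])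
  also have "P x = DZ s s" unfolding P_def s_def[symmetric] by (rule DPexp[symmetric])
  also have "(\<Sum>i\<in>Basis. (s \<bullet> i) * (s \<bullet> i)) = 1" using ss by (simp add: sum_Basis_inner)
  also have "(\<Sum>i\<in>Basis. T i \<bullet> i) = inverse n * (real DIM('a) - 1)"
  proof -
    have "(\<Sum>i\<in>Basis. T i \<bullet> i) = (\<Sum>i\<in>Basis. inverse n * (1 - (s \<bullet> i) * (s \<bullet> i)))"
      unfolding T_def by (intro sum.cong) (auto simp: inner_diff_left)
    also have "\<dots> = inverse n * (real DIM('a) - 1)"
      by (simp add: sum_distrib_left[symmetric] sum_subtractf sum_Basis_inner ss)
    finally show ?thesis .
  qed
  also have "(\<Sum>i\<in>Basis. D2 s i (T i)) = inverse n * ((\<Sum>i\<in>Basis. D2 s i i) - (\<Sum>i\<in>Basis. (s \<bullet> i) * D2 s i s))"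
    unfolding T_def by (simp add: linear_cmul[OF lin2] linear_diff[OF lin2] sum_distrib_left[symmetric] sum_subtractf)
  finally show ?thesis
    unfolding s_def[symmetric] n_def[symmetric] using n by (simp add: DPs power2_eq_square divide_inverse algebra_simps)
qed

lemma homogeneous_derivative:
  fixes f :: "'a::euclidean_space => real"
  assumes hom: "!!x. f x = f (sgn x)" and x: "x ~= 0" and f: "(f has_derivative D) (at x)"
  shows homogeneous_radial_derivative: "D x = 0"
    and homogeneous_derivative_scale: "r > 0 ==> (f has_derivative (%v. D (inverse r *\<^sub>R v))) (at (r *\<^sub>R x))"
proof -
  have s: "f (r *\<^sub>R y) = f y" if "r > 0" for r y
    using hom[of "r *\<^sub>R y"] hom[of y] that by (simp add: sgn_scaleR)
  have "((%t. f (t *\<^sub>R x)) has_derivative (%h. D (h *\<^sub>R x))) (at 1)"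
    by (rule has_derivative_compose[where f="%t. t *\<^sub>R x" and g=f]) (auto intro!: derivative_eq_intros simp: f)
  moreover have "((%t. f (t *\<^sub>R x)) has_derivative (%h. 0)) (at 1)"
    by (rule has_derivative_transform_within_open[where f="%_. f x" and s="{0<..}"]) (auto simp: s)
  ultimately have "(%h. D (h *\<^sub>R x)) = (%h. 0)" by (rule has_derivative_unique)
  from fun_cong[OF this, of 1] show "D x = 0" by simp
  assume r: "r > 0"
  have "((%y. f (inverse r *\<^sub>R y)) has_derivative (%v. D (inverse r *\<^sub>R v))) (at (r *\<^sub>R x))"
    by (rule has_derivative_compose[where f="%y. inverse r *\<^sub>R y" and g=f])
       (use f r in \<open>auto intro!: derivative_eq_intros\<close>)
  then show "(f has_derivative (%v. D (inverse r *\<^sub>R v))) (at (r *\<^sub>R x))" using s r by simp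
qed

lemma homogeneous_grad_sq:
  fixes f :: "'a::euclidean_space => real"
  assumes hom: "!!x. f x = f (sgn x)" and x: "x ~= 0" and f: "smooth_on (UNIV - {0}) f"
  shows "(norm x)\<^sup>2 * grad_sq f x = grad_sq f (sgn x)"
proof -
  have D: "(f has_derivative (%v. dderiv [v] f x)) (at x)"
    by (rule smooth_on_has_derivative[OF f]) (use x in auto)
  have "(f has_derivative (%v. dderiv [inverse (inverse (norm x)) *\<^sub>R v] f x)) (at (inverse (norm x) *\<^sub>R x))"
    by (rule homogeneous_derivative_scale[OF hom x D]) (use x in auto)
  then have "grad_sq f (sgn x) = (\<Sum>i\<in>Basis. (dderiv [norm x *\<^sub>R i] f x)\<^sup>2)"
    using x by (subst grad_sq_eqI) (auto simp: sgn_div_norm)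
  also have "\<dots> = (\<Sum>i\<in>Basis. (norm x)\<^sup>2 * (dderiv [i] f x)\<^sup>2)"
    unfolding linear_cmul[OF has_derivative_linear[OF D]] by (simp add: power_mult_distrib)
  finally show ?thesis by (simp add: grad_sq_def sum_distrib_left)
qed

lemma homogeneous_laplacian:
  fixes f :: "'a::euclidean_space => real"
  assumes hom: "!!x. f x = f (sgn x)" and x: "x ~= 0" and f: "smooth_on (UNIV - {0}) f"
  shows "(norm x)\<^sup>2 * laplacian f x = laplacian f (sgn x)"
proof -
  define n where "n = norm x"
  have n: "n > 0" using x by (simp add: n_def)
  have sx: "sgn x ~= 0" using x by (simp add: sgn_zero_iff)
  let ?D = "%y v. n * dderiv [v] f (n *\<^sub>R y)"
  have "laplacian f (sgn x) = (\<Sum>i\<in>Basis. n * (n * dderiv [i,i] f x))"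
  proof (rule laplacian_eqI[of "UNIV - {0}" _ _ ?D "%i w. n * (n * dderiv [w,i] f x)"])
    fix y :: 'a assume "y \<in> UNIV - {0}"
    then have y: "n *\<^sub>R y ~= 0" "y ~= 0" using n by auto
    have D: "(f has_derivative (%v. dderiv [v] f (n *\<^sub>R y))) (at (n *\<^sub>R y))"
      by (rule smooth_on_has_derivative[OF f]) (use y in auto)
    have "(f has_derivative (%v. dderiv [inverse (inverse n) *\<^sub>R v] f (n *\<^sub>R y))) (at (inverse n *\<^sub>R n *\<^sub>R y))"
      by (rule homogeneous_derivative_scale[OF hom y(1) D]) (use n in auto)
    then show "(f has_derivative ?D y) (at y)"
      unfolding linear_cmul[OF has_derivative_linear[OF D]] using n by simp
  next
    fix i :: 'a
    have D: "(dderiv [i] f has_derivative (%v. dderiv [v,i] f x)) (at x)"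
      using smooth_on_has_derivative[OF smooth_on_D[OF f, of "[i]"], of x] x by (simp add: open_delete)
    have nx: "n *\<^sub>R sgn x = x" using x by (simp add: n_def sgn_div_norm)
    have "((%y. dderiv [i] f (n *\<^sub>R y)) has_derivative (%v. dderiv [n *\<^sub>R v, i] f x)) (at (sgn x))"
      by (rule has_derivative_compose[where f="%y. n *\<^sub>R y" and g="dderiv [i] f"])
         (use D nx in \<open>auto intro!: derivative_eq_intros simp del: dderiv.simps\<close>)
    then have "((%y. dderiv [i] f (n *\<^sub>R y)) has_derivative (%v. n * dderiv [v, i] f x)) (at (sgn x))"
      unfolding linear_cmul[OF has_derivative_linear[OF D]] by simp
    then show "((%y. ?D y i) has_derivative (%w. n * (n * dderiv [w,i] f x))) (at (sgn x))"
      by (rule has_derivative_mult_right)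
  qed (use sx in auto)
  then show ?thesis
    by (simp add: laplacian_def sum_distrib_left n_def power2_eq_square mult.assoc del: dderiv.simps)
qed

lemma sum_radial_homogeneous:
  fixes f :: "'a::euclidean_space => real"
  assumes hom: "!!x. f x = f (sgn x)" and x: "x ~= 0" and f: "smooth_on (UNIV - {0}) f"
    and h: "(h has_real_derivative h') (at (ln (norm x)))"
  shows "(\<Sum>i\<in>Basis. dderiv [i] (%x. h (ln (norm x))) x * dderiv [i] f x) = 0"
proof -
  have D: "(f has_derivative (%v. dderiv [v] f x)) (at x)"
    by (rule smooth_on_has_derivative[OF f]) (use x in auto)
  have "(\<Sum>i\<in>Basis. dderiv [i] (%x. h (ln (norm x))) x * dderiv [i] f x)
    = (\<Sum>i\<in>Basis. h' / (x \<bullet> x) * ((x \<bullet> i) * dderiv [i] f x))"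
    unfolding dderiv1_eq[OF has_derivative_radial[OF x h]] by (intro sum.cong) auto
  also have "\<dots> = h' / (x \<bullet> x) * (\<Sum>i\<in>Basis. (x \<bullet> i) * dderiv [i] f x)"
    by (rule sum_distrib_left[symmetric])
  also have "(\<Sum>i\<in>Basis. (x \<bullet> i) * dderiv [i] f x) = dderiv [\<Sum>i\<in>Basis. (x \<bullet> i) *\<^sub>R i] f x"
    unfolding linear_sum[OF has_derivative_linear[OF D]] linear_cmul[OF has_derivative_linear[OF D]] by simp
  also have "\<dots> = 0"
    using homogeneous_radial_derivative[OF hom x D] by (simp only: euclidean_representation)
  finally show ?thesis by simp
qed

lemma smooth_on_radial:
  assumes "smooth_on UNIV h"
  shows "smooth_on (UNIV - {0}) (%x::'a::euclidean_space. h (ln (norm x)))"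
proof (rule smooth_on_compose_real[OF _ _ _ assms])
  show "smooth_on (UNIV - {0}) (%x::'a. ln (norm x))"
    by (rule smooth_on_compose_real[OF _ smooth_on_norm _ smooth_on_ln]) auto
qed auto

lemma laplacian_separated:
  fixes f :: "'a::euclidean_space => real" and h h' h'' :: "real => real"
  assumes hom: "!!x. f x = f (sgn x)" and x: "x ~= 0" and f: "smooth_on (UNIV - {0}) f"
    and h: "!!t. (h has_real_derivative h' t) (at t)" "!!t. (h' has_real_derivative h'' t) (at t)"
    and hs: "smooth_on UNIV h"
  shows "laplacian (%x. h (ln (norm x)) * f x) x =
    ((h'' (ln (norm x)) + (real DIM('a) - 2) * h' (ln (norm x))) * f x + h (ln (norm x)) * laplacian f (sgn x)) / (norm x)\<^sup>2"
proof -
  have s: "smooth_on (UNIV - {0}) (%x::'a. h (ln (norm x)))" by (rule smooth_on_radial[OF hs])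
  have "laplacian (%x. h (ln (norm x)) * f x) x = h (ln (norm x)) * laplacian f x + f x * laplacian (%x. h (ln (norm x))) x"
    using laplacian_mult[OF _ _ s f, of x] x sum_radial_homogeneous[OF hom x f h(1)] by (simp add: open_delete)
  also have "laplacian f x = laplacian f (sgn x) / (norm x)\<^sup>2"
    using homogeneous_laplacian[OF hom x f] x by (simp add: field_simps)
  finally show ?thesis
    unfolding laplacian_radial[OF x h] by (simp add: add_divide_distrib diff_divide_distrib algebra_simps)
qed

section \<open>The Hardy constant of a cone\<close>

definition sphere_integral :: "('a::euclidean_space => real) => real" where
  "sphere_integral g = (\<integral>x. g (sgn x) * indicator (ball 0 1) x \<partial>lborel)"

definition admissible :: "'a::euclidean_space set => ('a => real) => bool" where
  "admissible \<Sigma> \<phi> \<longleftrightarrow> smooth_on (UNIV - {0}) (%y. \<phi> (sgn y)) &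
     closure {\<sigma> \<in> sphere 0 1. \<phi> \<sigma> ~= 0} \<subseteq> \<Sigma> & (\<exists>\<sigma>\<in>\<Sigma>. \<phi> \<sigma> ~= 0)"

lemma borel_measurable_off_zero:
  assumes "continuous_on (UNIV - {0}) (f :: 'a::euclidean_space => real)"
  shows "f \<in> borel_measurable borel"
  using borel_measurable_continuous_countable_exceptions[of "{0}" f] assms by (simp add: Compl_eq_Diff_UNIV)

lemma smooth_on_borel_measurable: "smooth_on (UNIV - {0}) f ==> f \<in> borel_measurable borel"
  by (intro borel_measurable_off_zero smooth_on_continuous)

lemma continuous_bounded_on_sphere:
  assumes "continuous_on (UNIV - {0}) (f :: 'a::euclidean_space => real)"
  obtains C where "!!x. norm x = 1 ==> \<bar>f x\<bar> <= C"
proof -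
  have "compact (f ` sphere 0 1)"
    by (rule compact_continuous_image) (auto intro: continuous_on_subset[OF assms])
  then have "bounded (f ` sphere 0 1)" by (rule compact_imp_bounded)
  then obtain C where "\<forall>y\<in>f ` sphere 0 1. norm y <= C" by (auto simp: bounded_iff)
  then show ?thesis by (intro that[of C]) auto
qed

lemma AE_open_nonempty:
  fixes U :: "'a::euclidean_space set"
  assumes "AE x in lborel. P x" "open U" "U ~= {}"
  shows "\<exists>x\<in>U. P x"
proof (rule ccontr)
  assume no: "\<not> ?thesis"
  have "AE x in lebesgue. P x" using assms(1) by (rule AE_completion)
  then obtain N where "N \<in> null_sets lebesgue" "{x. \<not> P x} \<subseteq> N"
    by (auto simp: eventually_ae_filter)
  then have "negligible U" using no by (intro negligible_subset[of N U]) (auto simp: negligible_iff_null_sets)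
  then show False using open_not_negligible assms by blast
qed

lemma sphere_integrable:
  fixes g :: "'a::euclidean_space => real"
  assumes g[measurable]: "g \<in> borel_measurable borel" and C: "!!x. norm x = 1 ==> \<bar>g x\<bar> <= C"
  shows "integrable lborel (%x. g (sgn x) * indicator (ball 0 1) x)"
  by (rule integral_polar_product(2)[of "%_. 0" 0 g C]) (use C in auto)

lemma sphere_integral_mono:
  assumes "g \<in> borel_measurable borel" "!!x. norm x = 1 ==> \<bar>g x\<bar> <= C"
    and "h \<in> borel_measurable borel" "!!x. norm x = 1 ==> \<bar>h x\<bar> <= D"
    and "!!x. norm x = 1 ==> g x <= h (x::'a::euclidean_space)"
  shows "sphere_integral g <= sphere_integral h"
  unfolding sphere_integral_def
proof (rule integral_mono_AE)
  show "AE x in lborel. g (sgn x) * indicator (ball 0 1) x <= h (sgn x) * indicator (ball (0::'a) 1) x"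
    using AE_lborel_singleton[of "0::'a"] by eventually_elim (auto simp: indicator_def assms(5) norm_sgn)
qed (use assms sphere_integrable in blast)+

lemma lebesgue_eq_sphere_integral:
  fixes g :: "'a::euclidean_space => real"
  assumes f: "f \<in> borel_measurable borel" and fg: "!!x. x ~= 0 ==> f x = g (sgn x)"
    and g: "g \<in> borel_measurable borel"
  shows "set_lebesgue_integral lebesgue (ball 0 1) f = sphere_integral g"
proof -
  have [measurable]: "ball (0::'a) 1 \<in> sets borel" by simp
  note [measurable] = f g
  have "set_lebesgue_integral lebesgue (ball 0 1) f = (\<integral>x. indicator (ball 0 1) x *\<^sub>R f x \<partial>lborel)"
    unfolding set_lebesgue_integral_def by (rule integral_completion) measurable
  also have "\<dots> = (\<integral>x. g (sgn x) * indicator (ball 0 1) x \<partial>lborel)"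
  proof (rule integral_cong_AE)
    show "AE x in lborel. indicator (ball 0 1) x *\<^sub>R f x = g (sgn x) * indicator (ball (0::'a) 1) x"
      using AE_lborel_singleton[of "0::'a"] by eventually_elim (auto simp: fg)
  qed measurable
  finally show ?thesis by (simp add: sphere_integral_def)
qed

context
  fixes \<Sigma> :: "'a::euclidean_space set" and \<phi> :: "'a => real"
  assumes adm: "smooth_on (UNIV - {0}) (%y. \<phi> (sgn y))"
begin

lemma hom_smooth: "smooth_on (UNIV - {0}) (grad_sq (%y. \<phi> (sgn y)))"
    "smooth_on (UNIV - {0}) (%y. (\<phi> (sgn y))\<^sup>2)"
  using smooth_on_grad_sq[OF _ adm] smooth_on_power[OF _ adm] by (auto simp: open_delete)

lemmas hom_measurable = smooth_on_borel_measurable[OF hom_smooth(1)] smooth_on_borel_measurable[OF hom_smooth(2)]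

lemma rayleigh_numerator:
  "set_lebesgue_integral lebesgue (ball 0 1) (%x. norm x ^ 2 * grad_sq (%y. \<phi> (sgn y)) x)
     = sphere_integral (grad_sq (%y. \<phi> (sgn y)))"
proof (rule lebesgue_eq_sphere_integral)
  note [measurable] = hom_measurable
  show "(%x. (norm x)\<^sup>2 * grad_sq (%y. \<phi> (sgn y)) x) \<in> borel_measurable borel" by measurable
  show "x ~= 0 ==> (norm x)\<^sup>2 * grad_sq (%y. \<phi> (sgn y)) x = grad_sq (%y. \<phi> (sgn y)) (sgn x)" for x
    by (rule homogeneous_grad_sq[OF _ _ adm]) (simp add: sgn_sgn_vector)
qed (rule hom_measurable)

lemma rayleigh_denominator:
  "set_lebesgue_integral lebesgue (ball 0 1) (%x. (\<phi> (sgn x))\<^sup>2) = sphere_integral (%x. (\<phi> (sgn x))\<^sup>2)"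
  by (rule lebesgue_eq_sphere_integral) (auto simp: sgn_sgn_vector hom_measurable)

lemma sphere_integral_square_pos:
  assumes s: "norm s = 1" "\<phi> s ~= 0"
  shows "sphere_integral (%x. (\<phi> (sgn x))\<^sup>2) > 0"
proof -
  let ?f = "%x. (\<phi> (sgn x))\<^sup>2"
  have cont: "continuous_on (UNIV - {0}) ?f" by (rule smooth_on_continuous[OF hom_smooth(2)])
  obtain C where C: "!!x. norm x = 1 ==> \<bar>?f x\<bar> <= C"
    using continuous_bounded_on_sphere[OF cont] by blast
  let ?F = "%x. ?f (sgn x) * indicator (ball 0 1) x"
  have int: "integrable lborel ?F"
    by (rule sphere_integrable[OF hom_measurable(2) C])
  define U where "U = (%x. \<phi> (sgn x)) -` (- {0}) \<inter> (UNIV - {0})"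
  have op: "open (U \<inter> ball 0 1)"
  proof (rule open_Int)
    have "open (UNIV - {0::'a})" by (simp add: open_delete)
    from iffD1[OF continuous_on_open_vimage[OF this] smooth_on_continuous[OF adm], rule_format, of "- {0}"]
    show "open U" unfolding U_def by (simp only: open_Compl closed_singleton)
  qed simp
  have ne: "(1/2) *\<^sub>R s \<in> U \<inter> ball 0 1"
    using s by (auto simp: U_def sgn_scaleR sgn_div_norm)
  have "(\<integral>x. ?F x \<partial>lborel) ~= 0"
  proof
    assume "(\<integral>x. ?F x \<partial>lborel) = 0"
    then have "AE x in lborel. ?F x = 0"
      using integral_nonneg_eq_0_iff_AE[OF int] by auto
    from AE_open_nonempty[OF this op] ne obtain x where "x \<in> U \<inter> ball 0 1" "?F x = 0" by blast
    then show False by (auto simp: U_def sgn_sgn_vector)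
  qed
  moreover have "(\<integral>x. ?F x \<partial>lborel) >= 0" by (rule integral_nonneg_AE) auto
  ultimately show ?thesis by (simp add: sphere_integral_def less_le)
qed

end

definition dirichlet :: "('a::euclidean_space => real) => real" where
  "dirichlet \<phi> = sphere_integral (grad_sq (%y. \<phi> (sgn y)))"

definition mass :: "('a::euclidean_space => real) => real" where
  "mass \<phi> = sphere_integral (%x. (\<phi> (sgn x))\<^sup>2)"

lemma dirichlet_nonneg: "dirichlet \<phi> >= 0" and mass_nonneg: "mass \<phi> >= 0"
  unfolding dirichlet_def mass_def sphere_integral_def
  by (auto intro!: integral_nonneg_AE simp: grad_sq_nonneg)

lemma sphere_domain_subset: "sphere_domain \<Sigma> ==> \<Sigma> \<subseteq> sphere 0 1"
  unfolding sphere_domain_def using openin_imp_subset by blast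

lemma mass_pos: "sphere_domain \<Sigma> ==> admissible \<Sigma> \<phi> ==> mass \<phi> > 0"
  unfolding mass_def admissible_def using sphere_domain_subset by (fastforce intro: sphere_integral_square_pos)

lemma lambda1_alt: "lambda1 \<Sigma> = Inf {dirichlet \<phi> / mass \<phi> | \<phi>. admissible \<Sigma> \<phi>}"
  unfolding lambda1_def dirichlet_def mass_def admissible_def
  by (rule arg_cong[where f=Inf]) (use rayleigh_numerator rayleigh_denominator in \<open>force\<close>)

lemma lambda1_bdd: "bdd_below {dirichlet \<phi> / mass \<phi> | \<phi>. admissible \<Sigma> \<phi>}"
  by (rule bdd_belowI[of _ 0]) (auto simp: dirichlet_nonneg mass_nonneg)

lemma lambda1_mass_le:
  assumes "sphere_domain \<Sigma>" "admissible \<Sigma> \<phi>"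
  shows "lambda1 \<Sigma> * mass \<phi> <= dirichlet \<phi>"
proof -
  have "lambda1 \<Sigma> <= dirichlet \<phi> / mass \<phi>"
    unfolding lambda1_alt by (rule cInf_lower[OF _ lambda1_bdd]) (use assms in auto)
  then show ?thesis using mass_pos[OF assms] by (simp add: field_simps)
qed

definition bump :: "real => real => real" where
  "bump e t = flat ((t - 1) / e\<^sup>2 + 1)"

lemma bump_smooth: "smooth_on UNIV (bump e)"
  unfolding bump_def[abs_def] divide_inverse
  by (rule smooth_on_compose_real[OF _ _ _ flat_smooth[of UNIV]])
     (auto intro!: smooth_on_add smooth_on_mult smooth_on_diff smooth_on_const smooth_on_ident)

lemma bump_nonneg: "bump e t >= 0" and bump_le_1: "bump e t <= 1"
  by (auto simp: bump_def flat_nonneg flat_le_1)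

lemma bump_zero: "e > 0 ==> t <= 1 - e\<^sup>2 ==> bump e t = 0"
  unfolding bump_def by (rule flat_zero) (simp add: field_simps)

lemma bump_nonzeroD: "e > 0 ==> bump e t ~= 0 ==> t > 1 - e\<^sup>2"
  by (metis bump_zero not_le)

lemma smooth_on_zonal:
  assumes "smooth_on UNIV g"
  shows "smooth_on (UNIV - {0}) (%y::'a::euclidean_space. g (s \<bullet> sgn y))"
  by (rule smooth_on_compose_sgn[where Z="%x. g (s \<bullet> x)"])
     (rule smooth_on_compose_real[OF _ _ _ assms]; simp add: smooth_on_inner)

lemma norm_diff_unit: "norm s = 1 ==> norm t = 1 ==> (norm (s - t))\<^sup>2 = 2 * (1 - s \<bullet> (t::'a::euclidean_space))"
  unfolding power2_norm_eq_inner inner_diff_left inner_diff_right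
  using dot_square_norm[of s] dot_square_norm[of t] by (simp add: inner_commute)

lemma cap_compact: "compact {t. norm t = 1 & s \<bullet> t >= (a::real)}" for s :: "'a::euclidean_space"
proof -
  have "{t. norm t = 1 & s \<bullet> t >= a} = sphere 0 1 \<inter> {t. s \<bullet> t >= a}" by auto
  then show ?thesis by (simp add: compact_Int_closed closed_halfspace_ge)
qed

lemma sphere_domain_cap:
  assumes "sphere_domain \<Sigma>" "s \<in> \<Sigma>"
  obtains e where "0 < e" "e < 1" "!!t. norm t = 1 ==> s \<bullet> t >= 1 - e\<^sup>2 ==> t \<in> \<Sigma>"
proof -
  obtain U where U: "open U" "\<Sigma> = sphere 0 1 \<inter> U"
    using assms(1) by (auto simp: sphere_domain_def openin_open)
  then obtain d where d: "d > 0" "ball s d \<subseteq> U" using assms(2) by (auto simp: open_contains_ball)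
  have ns: "norm s = 1" using assms(2) U by auto
  define e where "e = min (1/2) (d/2)"
  show ?thesis
  proof (rule that[of e])
    fix t :: 'a assume t: "norm t = 1" "s \<bullet> t >= 1 - e\<^sup>2"
    have "(norm (s - t))\<^sup>2 <= 2 * e\<^sup>2" using norm_diff_unit[OF ns t(1)] t(2) by simp
    also have "\<dots> < (2 * e)\<^sup>2" using d by (simp add: e_def power2_eq_square)
    finally have "norm (s - t) < 2 * e" by (rule power_less_imp_less_base) (use d in \<open>auto simp: e_def\<close>)
    also have "\<dots> <= d" by (simp add: e_def)
    finally show "t \<in> \<Sigma>" using U d t by (auto simp: dist_norm)
  qed (use d in \<open>auto simp: e_def\<close>)
qed

lemma admissible_exists:
  assumes "sphere_domain \<Sigma>"
  shows "\<exists>\<phi>. admissible \<Sigma> \<phi>"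
proof -
  obtain s where s: "s \<in> \<Sigma>" using assms by (auto simp: sphere_domain_def)
  then have ns: "norm s = 1" using sphere_domain_subset[OF assms] by auto
  obtain e where e: "0 < e" "e < 1" "!!t. norm t = 1 ==> s \<bullet> t >= 1 - e\<^sup>2 ==> t \<in> \<Sigma>"
    using sphere_domain_cap[OF assms s] by blast
  have "closure {\<sigma> \<in> sphere 0 1. bump e (s \<bullet> \<sigma>) ~= 0} \<subseteq> {t. norm t = 1 & s \<bullet> t >= 1 - e\<^sup>2}"
    by (rule closure_minimal) (use bump_nonzeroD[OF e(1)] cap_compact[THEN compact_imp_closed] in \<open>auto simp: less_imp_le\<close>)
  moreover have "bump e (s \<bullet> s) ~= 0"
    using ns flat_pos[of 1] by (simp add: bump_def dot_square_norm)
  ultimately have "admissible \<Sigma> (%x. bump e (s \<bullet> x))"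
    unfolding admissible_def using smooth_on_zonal[OF bump_smooth] e(3) s by blast
  then show ?thesis by blast
qed

lemma lambda1_nonneg: "sphere_domain \<Sigma> ==> lambda1 \<Sigma> >= 0"
  unfolding lambda1_alt using admissible_exists
  by (intro cInf_greatest) (auto simp: dirichlet_nonneg mass_nonneg)

lemma lambda1_lessD:
  assumes "sphere_domain \<Sigma>" "lambda1 \<Sigma> < c"
  obtains \<phi> where "admissible \<Sigma> \<phi>" "dirichlet \<phi> <= c * mass \<phi>" "mass \<phi> > 0"
proof -
  have "\<exists>y\<in>{dirichlet \<phi> / mass \<phi> | \<phi>. admissible \<Sigma> \<phi>}. y < c"
    using assms admissible_exists[OF assms(1)] unfolding lambda1_alt
    by (intro cInf_lessD) auto
  then obtain \<phi> where \<phi>: "admissible \<Sigma> \<phi>" "dirichlet \<phi> / mass \<phi> < c" by blast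
  then show ?thesis using mass_pos[OF assms(1) \<phi>(1)] by (intro that[of \<phi>]) (auto simp: field_simps)
qed

lemma smooth_on_extend_zero:
  fixes f :: "'a::euclidean_space => real"
  assumes f: "smooth_on (UNIV - {0}) f" and e: "e > 0" "!!x. norm x < e ==> f x = 0"
  shows "smooth_on UNIV f"
proof (rule smooth_on_local)
  fix x :: 'a
  show "\<exists>U. open U & x \<in> U & smooth_on U f"
  proof (cases "x = 0")
    case True
    have "smooth_on (ball 0 e) f"
      by (rule smooth_on_cong[of _ "%_. 0"]) (auto simp: smooth_on_const e)
    then show ?thesis using True e by (intro exI[of _ "ball 0 e"]) auto
  qed (use f in \<open>auto intro!: exI[of _ "UNIV - {0}"]\<close>)
qed

lemma integral_dderiv_zero:
  fixes f :: "'a::euclidean_space => real"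
  assumes "smooth_on UNIV f" "compact K" "!!x. x \<notin> K ==> f x = 0"
  shows "(\<integral>x. dderiv [v] f x \<partial>lborel) = 0"
  by (rule integral_derivative_zero[where D="%x v. dderiv [v] f x", OF _ _ assms(2,3)])
     (auto intro!: smooth_on_has_derivative[OF assms(1)] smooth_on_continuous smooth_on_D assms simp del: dderiv.simps)

lemma dderiv_zero: "dderiv vs (%_. 0) = (%_. 0)"
  by (induction vs) (auto simp: frechet_derivative_const)

definition annular :: "('a::euclidean_space => real) => bool" where
  "annular f \<longleftrightarrow> smooth_on UNIV f & (\<exists>e>0. \<exists>M. \<forall>x. norm x < e \<or> norm x > M --> f x = 0)"

lemma annular_smooth: "annular f ==> smooth_on UNIV f" by (simp add: annular_def)

lemma annularE:
  assumes "annular f"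
  obtains e M where "e > 0" "!!x. norm x < e \<or> norm x > M ==> f x = 0"
  using assms by (auto simp: annular_def)

lemma annularI:
  assumes "smooth_on (UNIV - {0}) f" "e > 0" "!!x. norm x < e \<or> norm x > M ==> f x = 0"
  shows "annular f"
  unfolding annular_def using smooth_on_extend_zero[OF assms(1,2)] assms by blast

lemma annular_mult:
  assumes f: "annular f" and g: "smooth_on (UNIV - {0}) g"
  shows "annular (%x. f x * g x)"
proof -
  obtain e M where e: "e > 0" "!!x. norm x < e \<or> norm x > M ==> f x = 0" using annularE[OF f] by blast
  have "smooth_on (UNIV - {0}) f" using annular_smooth[OF f] by (rule smooth_on_subset) auto
  then have "smooth_on (UNIV - {0}) (%x. f x * g x)" using g by (intro smooth_on_mult) (auto simp: open_delete)
  then show ?thesis by (rule annularI[OF _ e(1), where M=M]) (use e(2) in auto)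
qed

lemma annular_integrable: assumes "annular f" shows "integrable lborel f"
proof -
  obtain e M where e: "e > 0" "!!x. norm x < e \<or> norm x > M ==> f x = 0" using annularE[OF assms] by blast
  show ?thesis
    by (rule integrable_continuous_compact_support[of _ "cball 0 M"])
       (use smooth_on_continuous[OF annular_smooth[OF assms]] e in auto)
qed

lemma annular_dderiv: assumes "annular f" shows "annular (dderiv vs f)"
proof -
  obtain e M where e: "e > 0" "!!x. norm x < e \<or> norm x > M ==> f x = 0" using annularE[OF assms] by blast
  have op: "open (ball 0 e \<union> - cball (0::'a) M)" by auto
  show ?thesis
  proof (rule annularI[OF _ e(1)])
    show "smooth_on (UNIV - {0}) (dderiv vs f)"
      using smooth_on_D[OF annular_smooth[OF assms]] by (rule smooth_on_subset) auto
    show "dderiv vs f x = 0" if "norm x < e \<or> norm x > M" for x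
    proof -
      have "dderiv vs f x = dderiv vs (%_. 0) x"
        by (rule dderiv_cong_open[OF op]) (use that e(2) in auto)
      then show ?thesis by (simp add: dderiv_zero)
    qed
  qed
qed

lemma smooth_inverse_norm_sq: "smooth_on (UNIV - {0}) (%x::'a::euclidean_space. inverse ((norm x)\<^sup>2))"
  by (intro smooth_on_inverse smooth_on_power smooth_on_norm) (auto simp: open_delete)

lemma annular_divide_norm_sq: "annular f ==> annular (%x. f x / (norm x)\<^sup>2)"
  unfolding divide_inverse by (rule annular_mult[OF _ smooth_inverse_norm_sq])

lemma annular_add: "annular f ==> annular g ==> annular (%x. f x + g x)"
proof -
  assume f: "annular f" and g: "annular g"
  obtain e M where e: "e > 0" "!!x. norm x < e \<or> norm x > M ==> f x = 0" using annularE[OF f] by blast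
  obtain d L where d: "d > 0" "!!x. norm x < d \<or> norm x > L ==> g x = 0" using annularE[OF g] by blast
  show ?thesis unfolding annular_def
    using e d annular_smooth[OF f] annular_smooth[OF g]
    by (intro conjI smooth_on_add exI[of _ "min e d"] exI[of _ "max M L"]) auto
qed

lemma annular_zero: "annular (%_. 0)"
  by (rule annularI[of _ 1]) (auto simp: smooth_on_const)

lemma annular_sum: "finite I ==> (!!i. i \<in> I ==> annular (f i)) ==> annular (%x. \<Sum>i\<in>I. f i x)"
  by (induction I rule: finite_induct) (auto intro: annular_add annular_zero)

lemma dderiv_basis_expansion:
  assumes "open S" "x \<in> S" "smooth_on S f"
  shows "dderiv [v] f x = (\<Sum>i\<in>Basis. (v \<bullet> i) * dderiv [i] f x)"
proof -
  have D: "(f has_derivative (%v. dderiv [v] f x)) (at x)"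
    by (rule smooth_on_has_derivative[OF assms(3,1,2)])
  have "dderiv [v] f x = dderiv [\<Sum>i\<in>Basis. (v \<bullet> i) *\<^sub>R i] f x" by (simp only: euclidean_representation)
  also have "\<dots> = (\<Sum>i\<in>Basis. (v \<bullet> i) * dderiv [i] f x)"
    unfolding linear_sum[OF has_derivative_linear[OF D]] linear_cmul[OF has_derivative_linear[OF D]] by simp
  finally show ?thesis .
qed

lemma annular_radial_derivative: "annular f ==> annular (%x. dderiv [x] f x)"
proof -
  assume f: "annular f"
  have "annular (%x. \<Sum>i\<in>Basis. dderiv [i] f x * (i \<bullet> x))"
    by (intro annular_sum annular_mult annular_dderiv f smooth_on_inner) auto
  moreover have "(%x. \<Sum>i\<in>Basis. dderiv [i] f x * (i \<bullet> x)) = (%x. dderiv [x] f x)"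
  proof
    fix x
    show "(\<Sum>i\<in>Basis. dderiv [i] f x * (i \<bullet> x)) = dderiv [x] f x"
      unfolding dderiv_basis_expansion[OF open_UNIV UNIV_I annular_smooth[OF f], of x x]
      by (intro sum.cong) (simp_all add: inner_commute del: dderiv.simps)
  qed
  ultimately show ?thesis by (simp only:)
qed

lemma integral_radial_divergence:
  fixes F :: "'a::euclidean_space => real"
  assumes F: "annular F"
  shows "(\<integral>x. ((real DIM('a) - 2) * F x + dderiv [x] F x) / (norm x)\<^sup>2 \<partial>lborel) = 0"
proof -
  define f where "f = (%i x::'a. (F x / (norm x)\<^sup>2) * (i \<bullet> x))"
  have af: "annular (f i)" for i
    unfolding f_def by (intro annular_mult annular_divide_norm_sq F smooth_on_inner)
  have "(\<integral>x. dderiv [i] (f i) x \<partial>lborel) = 0" for i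
  proof -
    obtain e M where e: "e > 0" "!!x. norm x < e \<or> norm x > M ==> f i x = 0" using annularE[OF af] by blast
    show ?thesis by (rule integral_dderiv_zero[OF annular_smooth[OF af], of "cball 0 M"]) (use e in auto)
  qed
  then have "(\<integral>x. (\<Sum>i\<in>Basis. dderiv [i] (f i) x) \<partial>lborel) = 0"
    using annular_integrable[OF annular_dderiv[OF af]]
    by (subst Bochner_Integration.integral_sum) (auto simp del: dderiv.simps)
  moreover have "(\<Sum>i\<in>Basis. dderiv [i] (f i) x) = ((real DIM('a) - 2) * F x + dderiv [x] F x) / (norm x)\<^sup>2" for x
  proof (cases "x = 0")
    case True
    have "dderiv [i] (f i) 0 = 0" for i
      using annularE[OF annular_dderiv[OF af, of "[i]"]] by (metis norm_zero)
    then show ?thesis using True by (simp del: dderiv.simps)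
  next
    case False
    then have xx: "x \<bullet> x > 0" by simp
    have "dderiv [i] (f i) x = ((i \<bullet> i) * (x \<bullet> x) - 2 * ((x \<bullet> i) * (x \<bullet> i))) / (x \<bullet> x)\<^sup>2 * F x + (x \<bullet> i) * dderiv [i] F x / (x \<bullet> x)" for i
    proof -
      have "((%x. (x \<bullet> i) / (x \<bullet> x)) has_derivative (%w. ((i \<bullet> w) * (x \<bullet> x) - (x \<bullet> i) * (2 * (x \<bullet> w))) / (x \<bullet> x)\<^sup>2)) (at x)"
        using xx by (auto intro!: derivative_eq_intros simp: fun_eq_iff power2_eq_square inner_commute algebra_simps)
      moreover have "(F has_derivative (%v. dderiv [v] F x)) (at x)"
        by (rule smooth_on_has_derivative[OF annular_smooth[OF F]]) auto
      ultimately have "((%x. (x \<bullet> i) / (x \<bullet> x) * F x) has_derivative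
          (%w. (x \<bullet> i) / (x \<bullet> x) * dderiv [w] F x + ((i \<bullet> w) * (x \<bullet> x) - (x \<bullet> i) * (2 * (x \<bullet> w))) / (x \<bullet> x)\<^sup>2 * F x)) (at x)"
        by (rule has_derivative_mult)
      moreover have "(%x. (x \<bullet> i) / (x \<bullet> x) * F x) = f i"
        unfolding f_def power2_norm_eq_inner by (simp add: fun_eq_iff inner_commute)
      ultimately have "dderiv [i] (f i) x = (x \<bullet> i) / (x \<bullet> x) * dderiv [i] F x + ((i \<bullet> i) * (x \<bullet> x) - (x \<bullet> i) * (2 * (x \<bullet> i))) / (x \<bullet> x)\<^sup>2 * F x"
        using dderiv1_eq by fastforce
      then show ?thesis by (simp add: algebra_simps)
    qed
    then have "(\<Sum>i\<in>Basis. dderiv [i] (f i) x) = (\<Sum>i\<in>Basis. ((i \<bullet> i) * (x \<bullet> x) - 2 * ((x \<bullet> i) * (x \<bullet> i)))) / (x \<bullet> x)\<^sup>2 * F x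
        + (\<Sum>i\<in>Basis. (x \<bullet> i) * dderiv [i] F x) / (x \<bullet> x)"
      by (simp add: sum.distrib sum_divide_distrib sum_distrib_right del: dderiv.simps)
    also have "(\<Sum>i\<in>Basis. (x \<bullet> i) * dderiv [i] F x) = dderiv [x] F x"
      by (rule dderiv_basis_expansion[OF open_UNIV UNIV_I annular_smooth[OF F], symmetric])
    also have "(\<Sum>i\<in>Basis. ((i \<bullet> i) * (x \<bullet> x) - 2 * ((x \<bullet> i) * (x \<bullet> i)))) = (real DIM('a) - 2) * (x \<bullet> x)"
    proof -
      have "(\<Sum>i\<in>Basis. ((i \<bullet> i) * (x \<bullet> x) - 2 * ((x \<bullet> i) * (x \<bullet> i)))) = (\<Sum>i\<in>(Basis::'a set). (i \<bullet> i) * (x \<bullet> x)) - 2 * (\<Sum>i\<in>Basis. (x \<bullet> i) * (x \<bullet> i))"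
        by (simp only: sum_subtractf sum_distrib_left)
      then show ?thesis by (simp add: sum_Basis_inner algebra_simps)
    qed
    also have "(real DIM('a) - 2) * (x \<bullet> x) / (x \<bullet> x)\<^sup>2 * F x + dderiv [x] F x / (x \<bullet> x)
        = ((real DIM('a) - 2) * F x + dderiv [x] F x) / (x \<bullet> x)"
      using xx by (simp add: add_divide_distrib power2_eq_square del: dderiv.simps)
    finally show ?thesis by (simp only: power2_norm_eq_inner)
  qed
  ultimately show ?thesis by (simp only:)
qed

lemma hardy_radial:
  fixes v :: "'a::euclidean_space => real"
  assumes v: "annular v"
  shows "((real DIM('a) - 2) / 2)\<^sup>2 * (\<integral>x. (v x)\<^sup>2 / (norm x)\<^sup>2 \<partial>lborel)
    <= (\<integral>x. (dderiv [x] v x)\<^sup>2 / (norm x)\<^sup>2 \<partial>lborel)"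
proof -
  define n where "n = real DIM('a) - 2"
  have v2: "annular (%x. v x * v x)" by (rule annular_mult[OF v smooth_on_subset[OF annular_smooth[OF v]]]) auto
  define q where "q = (%x. dderiv [x] v x)"
  have qx: "dderiv [x] v x = q x" for x by (simp only: q_def)
  have aq: "annular q" unfolding q_def by (rule annular_radial_derivative[OF v])
  have q2: "annular (%x. q x * q x)" by (rule annular_mult[OF aq smooth_on_subset[OF annular_smooth[OF aq]]]) auto
  have vq: "annular (%x. v x * q x)" by (rule annular_mult[OF v smooth_on_subset[OF annular_smooth[OF aq]]]) auto
  note ints = annular_integrable[OF annular_divide_norm_sq[OF v2]]
    annular_integrable[OF annular_divide_norm_sq[OF vq]] annular_integrable[OF annular_divide_norm_sq[OF q2]]
  have "dderiv [x] (%x. v x * v x) x = 2 * (v x * q x)" for x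
    using dderiv_mult[OF open_UNIV UNIV_I annular_smooth[OF v] annular_smooth[OF v], of x x]
    unfolding q_def by (simp add: mult.commute del: dderiv.simps)
  then have "(\<integral>x. (n * (v x * v x) + 2 * (v x * q x)) / (norm x)\<^sup>2 \<partial>lborel) = 0"
    using integral_radial_divergence[OF v2] unfolding n_def by simp
  also have "(%x. (n * (v x * v x) + 2 * (v x * q x)) / (norm x)\<^sup>2)
      = (%x. n * (v x * v x / (norm x)\<^sup>2) + 2 * (v x * q x / (norm x)\<^sup>2))"
    by (simp add: add_divide_distrib)
  finally have *: "n * (\<integral>x. v x * v x / (norm x)\<^sup>2 \<partial>lborel) + 2 * (\<integral>x. v x * q x / (norm x)\<^sup>2 \<partial>lborel) = 0"
    using ints by (simp del: times_divide_eq_right)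
  have "0 <= (\<integral>x. (q x + n / 2 * v x)\<^sup>2 / (norm x)\<^sup>2 \<partial>lborel)"
    by (intro integral_nonneg_AE) auto
  also have "(%x. (q x + n / 2 * v x)\<^sup>2 / (norm x)\<^sup>2)
    = (%x. q x * q x / (norm x)\<^sup>2 + (n * (v x * q x / (norm x)\<^sup>2) + (n/2)\<^sup>2 * (v x * v x / (norm x)\<^sup>2)))"
  proof
    have "(Q + n / 2 * V)\<^sup>2 / m = Q * Q / m + (n * (V * Q / m) + (n/2)\<^sup>2 * (V * V / m))" for Q V m :: real
      by (simp add: power2_eq_square add_divide_distrib algebra_simps)
    then show "(q x + n / 2 * v x)\<^sup>2 / (norm x)\<^sup>2
      = q x * q x / (norm x)\<^sup>2 + (n * (v x * q x / (norm x)\<^sup>2) + (n/2)\<^sup>2 * (v x * v x / (norm x)\<^sup>2))" for x .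
  qed
  also have "(\<integral>x. \<dots> x \<partial>lborel) = (\<integral>x. q x * q x / (norm x)\<^sup>2 \<partial>lborel) + (n * (\<integral>x. v x * q x / (norm x)\<^sup>2 \<partial>lborel) + (n/2)\<^sup>2 * (\<integral>x. v x * v x / (norm x)\<^sup>2 \<partial>lborel))"
    using ints by (simp del: times_divide_eq_right)
  also have "n * (\<integral>x. v x * q x / (norm x)\<^sup>2 \<partial>lborel) = - 2 * (n/2)\<^sup>2 * (\<integral>x. v x * v x / (norm x)\<^sup>2 \<partial>lborel)"
  proof -
    have "(\<integral>x. v x * q x / (norm x)\<^sup>2 \<partial>lborel) = - (n / 2) * (\<integral>x. v x * v x / (norm x)\<^sup>2 \<partial>lborel)"
      using * by linarith
    moreover have "n * (- (n / 2) * a) = - 2 * (n/2)\<^sup>2 * a" for a :: real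
      by (simp add: power2_eq_square)
    ultimately show ?thesis by metis
  qed
  finally show ?thesis unfolding n_def[symmetric] qx by (simp add: power2_eq_square[of "_ :: real"])
qed

lemma nn_sphere_integral:
  fixes g :: "'a::euclidean_space => real"
  assumes "g \<in> borel_measurable borel" "!!x. norm x = 1 ==> \<bar>g x\<bar> <= C" "!!x. norm x = 1 ==> g x >= 0"
  shows "(\<integral>\<^sup>+x. ennreal (g (sgn x)) * indicator (ball 0 1) x \<partial>lborel) = ennreal (sphere_integral g)"
proof -
  have "(\<integral>\<^sup>+x. ennreal (g (sgn x)) * indicator (ball 0 1) x \<partial>lborel) = (\<integral>\<^sup>+x. ennreal (g (sgn x) * indicator (ball 0 1) x) \<partial>lborel)"
    by (intro nn_integral_cong) (auto simp: indicator_def)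
  also have "\<dots> = ennreal (sphere_integral g)"
    unfolding sphere_integral_def
  proof (rule nn_integral_eq_integral)
    show "AE x in lborel. 0 <= g (sgn x) * indicator (ball (0::'a) 1) x"
      using AE_lborel_singleton[of "0::'a"] by eventually_elim (auto simp: indicator_def assms(3) norm_sgn)
  qed (rule sphere_integrable[OF assms(1,2)])
  finally show ?thesis .
qed

lemma cone_of_sphere:
  assumes "sphere_domain \<Sigma>" "r > 0" "norm s = 1" "r *\<^sub>R s \<in> cone_of \<Sigma>"
  shows "s \<in> \<Sigma>"
proof -
  obtain r' s' where s': "r *\<^sub>R s = r' *\<^sub>R s'" "r' > 0" "s' \<in> \<Sigma>" using assms(4) by (auto simp: cone_of_def)
  then have "norm s' = 1" using sphere_domain_subset[OF assms(1)] by auto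
  then have "r = r'" using arg_cong[OF s'(1), of norm] assms(2,3) s'(2) by simp
  then show ?thesis using s' assms by simp
qed

lemma in_tsupport: "f x ~= 0 ==> x \<in> tsupport f"
  unfolding tsupport_def by (rule closure_subset[THEN subsetD]) simp

lemma test_fun_cone_annular:
  assumes "sphere_domain \<Sigma>" "test_fun (cone_of \<Sigma>) v"
  shows "annular v"
proof -
  have "0 \<notin> cone_of \<Sigma>" using sphere_domain_subset[OF assms(1)] by (auto simp: cone_of_def)
  then have "0 \<in> - tsupport v" "open (- tsupport v)"
    using assms(2) compact_imp_closed[of "tsupport v"] unfolding test_fun_def by auto
  then obtain e where e: "e > 0" "ball 0 e \<subseteq> - tsupport v" by (meson openE)
  obtain M where M: "!!x. x \<in> tsupport v ==> norm x <= M"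
    using assms(2) compact_imp_bounded[of "tsupport v"] unfolding test_fun_def bounded_iff by metis
  have "v x = 0" if "norm x < e \<or> norm x > M" for x
  proof (rule ccontr)
    assume "v x ~= 0"
    then have "x \<in> tsupport v" by (rule in_tsupport)
    then show False using that e(2) M[of x] by (auto simp: subset_iff)
  qed
  then show ?thesis
    using assms(2) e(1) unfolding annular_def test_fun_def by metis
qed

lemma hardy_cone:
  fixes v :: "'a::euclidean_space => real"
  assumes \<Sigma>: "sphere_domain \<Sigma>" and v: "test_fun (cone_of \<Sigma>) v"
  shows "(((real DIM('a) - 2) / 2)\<^sup>2 + lambda1 \<Sigma>) * (\<integral>x. (v x)\<^sup>2 / (norm x)\<^sup>2 \<partial>lborel) <= (\<integral>x. grad_sq v x \<partial>lborel)"
proof -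
  have av: "annular v" by (rule test_fun_cone_annular[OF \<Sigma> v])
  note sv = annular_smooth[OF av]
  define q where "q = (%x. dderiv [x] v x)"
  define T where "T = (%x. grad_sq v x - (q x)\<^sup>2 / (norm x)\<^sup>2)"
  have aq: "annular q" unfolding q_def by (rule annular_radial_derivative[OF av])
  have sq: "annular (%x. (f x)\<^sup>2)" if "annular f" for f :: "'a => real"
    unfolding power2_eq_square by (rule annular_mult[OF that smooth_on_subset[OF annular_smooth[OF that]]]) auto
  have ag: "annular (grad_sq v)"
    unfolding grad_sq_def[abs_def] by (intro annular_sum sq annular_dderiv av) auto
  note iq = annular_integrable[OF annular_divide_norm_sq[OF sq[OF aq]]]
  note iv = annular_integrable[OF annular_divide_norm_sq[OF sq[OF av]]]
  note ig = annular_integrable[OF ag]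
  have [measurable]: "ball (0::'a) 1 \<in> sets borel" by simp
  have iT: "integrable lborel T" unfolding T_def using iq ig by simp
  have [measurable]: "v \<in> borel_measurable borel" "T \<in> borel_measurable borel"
    using smooth_on_continuous[OF sv] iT by (auto intro: borel_measurable_continuous_onI)
  have Db: "(v has_derivative (%u. dderiv [u] v x)) (at x)" for x
    by (rule smooth_on_has_derivative[OF sv]) auto
  let ?\<phi> = "%r s. v (r *\<^sub>R s)"
  have s\<phi>: "smooth_on (UNIV - {0}) (%y. ?\<phi> r (sgn y))" for r
  proof (rule smooth_on_compose_sgn[where Z="?\<phi> r"], rule smooth_on_compose[OF _ _ _ sv])
    fix i :: 'a
    show "smooth_on UNIV (%x. (r *\<^sub>R x) \<bullet> i)"
      using smooth_on_mult[OF _ smooth_on_const[of UNIV r] smooth_on_inner[of UNIV i]] by (simp add: inner_commute)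
  qed auto
  have slice: "grad_sq (%y. ?\<phi> r (sgn y)) s = r\<^sup>2 * T (r *\<^sub>R s)" if r: "r > 0" and s: "norm s = 1" for r s
  proof -
    let ?y = "r *\<^sub>R s"
    have ss: "s \<bullet> s = 1" "sgn s = s" "s ~= 0" using s by (auto simp: dot_square_norm sgn_div_norm)
    note lin = has_derivative_linear[OF Db]
    have "((%y. ?\<phi> r (sgn y)) has_derivative (%u. dderiv [r *\<^sub>R (u - (s \<bullet> u) *\<^sub>R s)] v ?y)) (at s)"
    proof (rule has_derivative_compose[where f="%y. r *\<^sub>R sgn y" and g=v])
      show "((%y. r *\<^sub>R sgn y) has_derivative (%u. r *\<^sub>R (u - (s \<bullet> u) *\<^sub>R s))) (at s)"
        using has_derivative_scaleR_right[OF has_derivative_sgn[OF ss(3)], of r] ss s by simp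
      show "(v has_derivative (%u. dderiv [u] v ?y)) (at (r *\<^sub>R sgn s))" using Db[of ?y] ss by (simp only:)
    qed
    then have "grad_sq (%y. ?\<phi> r (sgn y)) s = (\<Sum>i\<in>Basis. (dderiv [r *\<^sub>R (i - (s \<bullet> i) *\<^sub>R s)] v ?y)\<^sup>2)"
      by (rule grad_sq_eqI)
    also have "\<dots> = (\<Sum>i\<in>Basis. r\<^sup>2 * ((dderiv [i] v ?y)\<^sup>2 - 2 * dderiv [s] v ?y * ((s \<bullet> i) * dderiv [i] v ?y) + (dderiv [s] v ?y)\<^sup>2 * ((s \<bullet> i) * (s \<bullet> i))))"
      unfolding linear_cmul[OF lin] linear_diff[OF lin]
      by (intro sum.cong refl) (simp add: power2_eq_square algebra_simps del: dderiv.simps)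
    also have "\<dots> = r\<^sup>2 * (grad_sq v ?y - 2 * dderiv [s] v ?y * (\<Sum>i\<in>Basis. (s \<bullet> i) * dderiv [i] v ?y) + (dderiv [s] v ?y)\<^sup>2 * (\<Sum>i\<in>Basis. (s \<bullet> i) * (s \<bullet> i)))"
      unfolding grad_sq_def by (simp only: sum_distrib_left[symmetric] sum.distrib sum_subtractf)
    also have "(\<Sum>i\<in>Basis. (s \<bullet> i) * dderiv [i] v ?y) = dderiv [s] v ?y"
      by (rule dderiv_basis_expansion[OF open_UNIV UNIV_I sv, symmetric])
    also have "(\<Sum>i\<in>Basis. (s \<bullet> i) * (s \<bullet> i)) = 1" using ss by (simp add: sum_Basis_inner)
    also have "dderiv [s] v ?y = q ?y / r"
    proof -
      have "q ?y = r * dderiv [s] v ?y" unfolding q_def linear_cmul[OF lin] by simp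
      then show ?thesis using r by simp
    qed
    finally show ?thesis using r s by (simp add: T_def power2_eq_square algebra_simps)
  qed
  have T0: "T x >= 0" for x
  proof (cases "x = 0")
    case True
    show ?thesis using True by (simp add: T_def grad_sq_nonneg)
  next
    case False
    have "(norm x)\<^sup>2 * T x = grad_sq (%y. ?\<phi> (norm x) (sgn y)) (sgn x)"
      using slice[of "norm x" "sgn x"] False by (simp add: norm_sgn) (simp add: sgn_div_norm)
    then have "(norm x)\<^sup>2 * T x >= 0" by (simp add: grad_sq_nonneg)
    then show ?thesis using False by (simp add: zero_le_mult_iff)
  qed
  let ?l = "lambda1 \<Sigma>"
  have l0: "?l >= 0" by (rule lambda1_nonneg[OF \<Sigma>])
  have sl: "?l * mass (?\<phi> r) <= dirichlet (?\<phi> r)" if r: "r > 0" for r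
  proof (cases "\<exists>\<sigma>\<in>\<Sigma>. ?\<phi> r \<sigma> ~= 0")
    case True
    have "closure {\<sigma> \<in> sphere 0 1. ?\<phi> r \<sigma> ~= 0} \<subseteq> sphere 0 1 \<inter> (%\<sigma>. r *\<^sub>R \<sigma>) -` tsupport v"
    proof (rule closure_minimal)
      show "closed (sphere 0 1 \<inter> (%\<sigma>. r *\<^sub>R \<sigma>) -` tsupport v)"
        by (intro closed_Int closed_vimage continuous_intros) (auto simp: tsupport_def)
      show "{\<sigma> \<in> sphere 0 1. ?\<phi> r \<sigma> ~= 0} \<subseteq> sphere 0 1 \<inter> (%\<sigma>. r *\<^sub>R \<sigma>) -` tsupport v"
        using in_tsupport[of v] by auto
    qed
    also have "\<dots> \<subseteq> \<Sigma>"
      using cone_of_sphere[OF \<Sigma> r] v by (auto simp: test_fun_def)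
    finally have "admissible \<Sigma> (?\<phi> r)" unfolding admissible_def using True s\<phi> by blast
    then show ?thesis by (rule lambda1_mass_le[OF \<Sigma>])
  next
    case False
    have "v (r *\<^sub>R sgn x) = 0" if "x ~= 0" for x
    proof (rule ccontr)
      assume nz: "v (r *\<^sub>R sgn x) ~= 0"
      then have "r *\<^sub>R sgn x \<in> cone_of \<Sigma>" using v in_tsupport[of v, OF nz] unfolding test_fun_def by blast
      then have "sgn x \<in> \<Sigma>" using cone_of_sphere[OF \<Sigma> r] that by (auto simp: norm_sgn)
      then show False using False nz by blast
    qed
    then have "mass (?\<phi> r) = 0"
      unfolding mass_def sphere_integral_def
      by (intro integral_eq_zero_AE) (use AE_lborel_singleton[of "0::'a"] in \<open>eventually_elim, auto simp: sgn_sgn_vector\<close>)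
    then show ?thesis using dirichlet_nonneg by simp
  qed
  have ineq: "ennreal ?l * (\<integral>\<^sup>+x. ennreal ((v (r *\<^sub>R sgn x))\<^sup>2 / (norm (r *\<^sub>R sgn x))\<^sup>2) * indicator (ball 0 1) x \<partial>lborel)
      <= (\<integral>\<^sup>+x. ennreal (T (r *\<^sub>R sgn x)) * indicator (ball 0 1) x \<partial>lborel)" if r: "r > 0" for r
  proof -
    note sm = hom_smooth[OF s\<phi>[of r]]
    note me = hom_measurable[OF s\<phi>[of r]]
    obtain C1 where C1: "!!x. norm x = 1 ==> \<bar>grad_sq (%y. ?\<phi> r (sgn y)) x\<bar> <= C1"
      using continuous_bounded_on_sphere[OF smooth_on_continuous[OF sm(1)]] by blast
    obtain C2 where C2: "!!x. norm x = 1 ==> \<bar>(?\<phi> r (sgn x))\<^sup>2\<bar> <= C2"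
      using continuous_bounded_on_sphere[OF smooth_on_continuous[OF sm(2)]] by blast
    have "ennreal (r\<^sup>2) * (\<integral>\<^sup>+x. ennreal (T (r *\<^sub>R sgn x)) * indicator (ball (0::'a) 1) x \<partial>lborel)
       = (\<integral>\<^sup>+x. ennreal (r\<^sup>2) * (ennreal (T (r *\<^sub>R sgn x)) * indicator (ball (0::'a) 1) x) \<partial>lborel)"
      by (rule nn_integral_cmult[symmetric]) measurable
    also have "\<dots> = (\<integral>\<^sup>+x. ennreal (grad_sq (%y. ?\<phi> r (sgn y)) (sgn x)) * indicator (ball (0::'a) 1) x \<partial>lborel)"
    proof (rule nn_integral_cong_AE)
      show "AE x in lborel. ennreal (r\<^sup>2) * (ennreal (T (r *\<^sub>R sgn x)) * indicator (ball (0::'a) 1) x)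
          = ennreal (grad_sq (%y. ?\<phi> r (sgn y)) (sgn x)) * indicator (ball 0 1) x"
        using AE_lborel_singleton[of "0::'a"]
        by eventually_elim (use r in \<open>simp add: slice norm_sgn ennreal_mult' mult.assoc\<close>)
    qed
    also have "\<dots> = ennreal (dirichlet (?\<phi> r))"
      unfolding dirichlet_def by (rule nn_sphere_integral[OF me(1) C1]) (auto simp: grad_sq_nonneg)
    finally have D: "ennreal (dirichlet (?\<phi> r)) = ennreal (r\<^sup>2) * (\<integral>\<^sup>+x. ennreal (T (r *\<^sub>R sgn x)) * indicator (ball (0::'a) 1) x \<partial>lborel)" ..
    have "ennreal (r\<^sup>2) * (\<integral>\<^sup>+x. ennreal ((v (r *\<^sub>R sgn x))\<^sup>2 / (norm (r *\<^sub>R sgn x))\<^sup>2) * indicator (ball (0::'a) 1) x \<partial>lborel)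
       = (\<integral>\<^sup>+x. ennreal (r\<^sup>2) * (ennreal ((v (r *\<^sub>R sgn x))\<^sup>2 / (norm (r *\<^sub>R sgn x))\<^sup>2) * indicator (ball (0::'a) 1) x) \<partial>lborel)"
      by (rule nn_integral_cmult[symmetric]) measurable
    also have "\<dots> = (\<integral>\<^sup>+x. ennreal ((?\<phi> r (sgn (sgn x)))\<^sup>2) * indicator (ball (0::'a) 1) x \<partial>lborel)"
    proof (rule nn_integral_cong_AE)
      show "AE x in lborel. ennreal (r\<^sup>2) * (ennreal ((v (r *\<^sub>R sgn x))\<^sup>2 / (norm (r *\<^sub>R sgn x))\<^sup>2) * indicator (ball (0::'a) 1) x)
          = ennreal ((?\<phi> r (sgn (sgn x)))\<^sup>2) * indicator (ball 0 1) x"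
        using AE_lborel_singleton[of "0::'a"]
      proof eventually_elim
        fix x :: 'a assume "x ~= 0"
        then have "ennreal (r\<^sup>2) * ennreal ((v (r *\<^sub>R sgn x))\<^sup>2 / (norm (r *\<^sub>R sgn x))\<^sup>2) = ennreal ((?\<phi> r (sgn (sgn x)))\<^sup>2)"
          using r by (simp add: norm_sgn sgn_sgn_vector flip: ennreal_mult')
        then show "ennreal (r\<^sup>2) * (ennreal ((v (r *\<^sub>R sgn x))\<^sup>2 / (norm (r *\<^sub>R sgn x))\<^sup>2) * indicator (ball (0::'a) 1) x)
          = ennreal ((?\<phi> r (sgn (sgn x)))\<^sup>2) * indicator (ball 0 1) x" by (simp only: mult.assoc[symmetric])
      qed
    qed
    also have "\<dots> = ennreal (mass (?\<phi> r))"
      unfolding mass_def by (rule nn_sphere_integral[OF me(2) C2]) auto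
    finally have M: "ennreal (r\<^sup>2) * (\<integral>\<^sup>+x. ennreal ((v (r *\<^sub>R sgn x))\<^sup>2 / (norm (r *\<^sub>R sgn x))\<^sup>2) * indicator (ball (0::'a) 1) x \<partial>lborel) = ennreal (mass (?\<phi> r))" .
    have "ennreal ?l * ennreal (mass (?\<phi> r)) <= ennreal (dirichlet (?\<phi> r))"
      using ennreal_leI[OF sl[OF r]] l0 by (simp add: ennreal_mult')
    then have "ennreal (r\<^sup>2) * (ennreal ?l * (\<integral>\<^sup>+x. ennreal ((v (r *\<^sub>R sgn x))\<^sup>2 / (norm (r *\<^sub>R sgn x))\<^sup>2) * indicator (ball (0::'a) 1) x \<partial>lborel))
      <= ennreal (r\<^sup>2) * (\<integral>\<^sup>+x. ennreal (T (r *\<^sub>R sgn x)) * indicator (ball (0::'a) 1) x \<partial>lborel)"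
      unfolding D M[symmetric] by (simp only: ac_simps)
    then show ?thesis
      by (rule ennreal_mult_le_mult_iff[THEN iffD1, rotated 2]) (use r in auto)
  qed
  define I1 where "I1 = (%r. \<integral>\<^sup>+x. ennreal ((v (r *\<^sub>R sgn x))\<^sup>2 / (norm (r *\<^sub>R sgn x))\<^sup>2) * indicator (ball (0::'a) 1) x \<partial>lborel)"
  define I2 where "I2 = (%r. \<integral>\<^sup>+x. ennreal (T (r *\<^sub>R sgn x)) * indicator (ball (0::'a) 1) x \<partial>lborel)"
  have [measurable]: "I1 \<in> borel_measurable borel" unfolding I1_def by measurable
  let ?B = "%r. ennreal (r ^ (DIM('a) - 1)) * indicator {0<..} r"
  have "ennreal (?l * (\<integral>x. (v x)\<^sup>2 / (norm x)\<^sup>2 \<partial>lborel)) = ennreal ?l * (\<integral>\<^sup>+x. ennreal ((v x)\<^sup>2 / (norm x)\<^sup>2) \<partial>lborel)"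
    using iv l0 by (subst nn_integral_eq_integral) (auto simp: ennreal_mult')
  also have "(\<integral>\<^sup>+x. ennreal ((v x)\<^sup>2 / (norm x)\<^sup>2) \<partial>lborel) = of_nat DIM('a) * (\<integral>\<^sup>+r. ?B r * I1 r \<partial>lborel)"
    unfolding I1_def by (rule nn_integral_polar) measurable
  also have "ennreal ?l * (of_nat DIM('a) * (\<integral>\<^sup>+r. ?B r * I1 r \<partial>lborel)) = of_nat DIM('a) * (ennreal ?l * (\<integral>\<^sup>+r. ?B r * I1 r \<partial>lborel))"
    by (rule mult.left_commute)
  also have "ennreal ?l * (\<integral>\<^sup>+r. ?B r * I1 r \<partial>lborel) = (\<integral>\<^sup>+r. ennreal ?l * (?B r * I1 r) \<partial>lborel)"
    by (rule nn_integral_cmult[symmetric]) measurable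
  also have "of_nat DIM('a) * \<dots> <= of_nat DIM('a) * (\<integral>\<^sup>+r. ?B r * I2 r \<partial>lborel)"
  proof (rule mult_left_mono, rule nn_integral_mono)
    fix r :: real
    show "ennreal ?l * (?B r * I1 r) <= ?B r * I2 r"
    proof (cases "r > 0")
      case True
      have "?B r * (ennreal ?l * I1 r) <= ?B r * I2 r"
        using ineq[OF True] unfolding I1_def I2_def by (rule mult_left_mono) simp
      then show ?thesis by (simp only: mult.left_commute)
    qed simp
  qed simp
  also have "of_nat DIM('a) * (\<integral>\<^sup>+r. ?B r * I2 r \<partial>lborel) = (\<integral>\<^sup>+x. ennreal (T x) \<partial>lborel)"
    unfolding I2_def by (rule nn_integral_polar[symmetric]) measurable
  also have "\<dots> = ennreal (\<integral>x. T x \<partial>lborel)"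
    by (rule nn_integral_eq_integral[OF iT]) (auto simp: T0)
  finally have "?l * (\<integral>x. (v x)\<^sup>2 / (norm x)\<^sup>2 \<partial>lborel) <= (\<integral>x. T x \<partial>lborel)"
    by (rule ennreal_le_iff[THEN iffD1, rotated]) (auto intro: integral_nonneg_AE simp: T0)
  moreover have "(\<integral>x. T x \<partial>lborel) = (\<integral>x. grad_sq v x \<partial>lborel) - (\<integral>x. (q x)\<^sup>2 / (norm x)\<^sup>2 \<partial>lborel)"
    unfolding T_def using iq ig by simp
  ultimately show ?thesis using hardy_radial[OF av] unfolding q_def by (simp add: algebra_simps del: dderiv.simps)
qed

definition separated :: "(real => real) => ('a => real) => 'a::euclidean_space => real" where
  "separated h \<phi> x = (if x = 0 then 0 else h (ln (norm x)) * \<phi> (sgn x))"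

lemma ln_norm_bounds:
  fixes x :: "'a::real_normed_vector"
  assumes "x ~= 0"
  shows "norm x < exp a \<longleftrightarrow> ln (norm x) < a" "norm x > exp b \<longleftrightarrow> ln (norm x) > b"
proof -
  have "norm x = exp (ln (norm x))" using assms by simp
  then show "norm x < exp a \<longleftrightarrow> ln (norm x) < a" "norm x > exp b \<longleftrightarrow> ln (norm x) > b"
    by (metis exp_less_cancel_iff)+
qed

context
  fixes h :: "real => real" and \<phi> :: "'a::euclidean_space => real" and a b :: real
  assumes h: "smooth_on UNIV h" "!!t. t < a \<or> t > b ==> h t = 0"
    and \<phi>: "smooth_on (UNIV - {0}) (%y. \<phi> (sgn y))"
begin

lemma separated_annular: "annular (separated h \<phi>)"
proof (rule annularI[of _ "exp a" "exp b"])
  have op: "open (UNIV - {0::'a})" by (simp add: open_delete)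
  show "smooth_on (UNIV - {0}) (separated h \<phi>)"
    by (rule smooth_on_cong[OF op _ smooth_on_mult[OF op smooth_on_radial[OF h(1)] \<phi>]])
       (auto simp: separated_def)
  show "separated h \<phi> x = 0" if "norm x < exp a \<or> norm x > exp b" for x
    using that ln_norm_bounds[of x] h(2)[of "ln (norm x)"] by (cases "x = 0") (auto simp: separated_def)
qed simp

lemma separated_tsupport:
  assumes C: "compact C" "{\<sigma> \<in> sphere 0 1. \<phi> \<sigma> ~= 0} \<subseteq> C"
  shows "compact (tsupport (separated h \<phi>))"
    and "tsupport (separated h \<phi>) \<subseteq> {r *\<^sub>R s | r s. exp a <= r & r <= exp b & s \<in> C}"
proof -
  let ?K = "(%(r, s). r *\<^sub>R s) ` ({exp a..exp b} \<times> C)"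
  have K: "compact ?K"
    by (intro compact_continuous_image compact_Times C) (auto simp: case_prod_unfold intro!: continuous_intros)
  have "{x. separated h \<phi> x ~= 0} \<subseteq> ?K"
  proof
    fix x assume "x \<in> {x. separated h \<phi> x ~= 0}"
    then have x: "x ~= 0" "h (ln (norm x)) ~= 0" "\<phi> (sgn x) ~= 0" by (auto simp: separated_def split: if_splits)
    then have "sgn x \<in> C" using C(2) by (auto simp: norm_sgn)
    moreover have "a <= ln (norm x)" "ln (norm x) <= b" using h(2) x(2) by force+
    then have "norm x \<in> {exp a..exp b}" using ln_norm_bounds[OF x(1)] by (auto simp: not_less[symmetric])
    moreover have "x = norm x *\<^sub>R sgn x" using x by (simp add: sgn_div_norm)
    ultimately show "x \<in> ?K" by (intro image_eqI[of _ _ "(norm x, sgn x)"]) auto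
  qed
  then have s: "tsupport (separated h \<phi>) \<subseteq> ?K"
    unfolding tsupport_def by (rule closure_minimal) (rule compact_imp_closed[OF K])
  then show "tsupport (separated h \<phi>) \<subseteq> {r *\<^sub>R s | r s. exp a <= r & r <= exp b & s \<in> C}" by (rule order_trans) (clarsimp, blast)
  show "compact (tsupport (separated h \<phi>))"
    using compact_Int_closed[OF K, of "tsupport (separated h \<phi>)"] s by (simp add: Int_absorb1 tsupport_def)
qed

lemma separated_test_fun:
  assumes C: "compact C" "{\<sigma> \<in> sphere 0 1. \<phi> \<sigma> ~= 0} \<subseteq> C"
    and "!!r s. exp a <= r ==> r <= exp b ==> s \<in> C ==> r *\<^sub>R s \<in> \<Omega>"
  shows "test_fun \<Omega> (separated h \<phi>)"
  unfolding test_fun_def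
  using annular_smooth[OF separated_annular] separated_tsupport[OF C] assms(3) by blast

lemma laplacian_separated':
  assumes x: "x ~= 0" and d: "!!t. (h has_real_derivative h' t) (at t)" "!!t. (h' has_real_derivative h'' t) (at t)"
  shows "laplacian (separated h \<phi>) x =
    ((h'' (ln (norm x)) + (real DIM('a) - 2) * h' (ln (norm x))) * \<phi> (sgn x)
      + h (ln (norm x)) * laplacian (%y. \<phi> (sgn y)) (sgn x)) / (norm x)\<^sup>2"
proof -
  have "laplacian (separated h \<phi>) x = laplacian (%x. h (ln (norm x)) * \<phi> (sgn x)) x"
    by (rule laplacian_cong[of "UNIV - {0}"]) (use x in \<open>auto simp: separated_def open_delete\<close>)
  also have "\<dots> = ((h'' (ln (norm x)) + (real DIM('a) - 2) * h' (ln (norm x))) * \<phi> (sgn x)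
      + h (ln (norm x)) * laplacian (%y. \<phi> (sgn y)) (sgn x)) / (norm x)\<^sup>2"
    by (rule laplacian_separated[where f="%y. \<phi> (sgn y)", OF _ x \<phi> d h(1)]) (simp add: sgn_sgn_vector)
  finally show ?thesis .
qed

lemma grad_sq_separated:
  assumes x: "x ~= 0" and d: "!!t. (h has_real_derivative h' t) (at t)"
  shows "grad_sq (separated h \<phi>) x =
    ((h' (ln (norm x)))\<^sup>2 * (\<phi> (sgn x))\<^sup>2 + (h (ln (norm x)))\<^sup>2 * grad_sq (%y. \<phi> (sgn y)) (sgn x)) / (norm x)\<^sup>2"
proof -
  let ?\<Psi> = "%y. \<phi> (sgn y)"
  have op: "open (UNIV - {0::'a})" by (simp add: open_delete)
  have D: "(?\<Psi> has_derivative (%v. dderiv [v] ?\<Psi> x)) (at x)"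
    by (rule smooth_on_has_derivative[OF \<phi> op]) (use x in auto)
  have xx: "x \<bullet> x > 0" using x by simp
  have "grad_sq (separated h \<phi>) x = grad_sq (%x. h (ln (norm x)) * \<phi> (sgn x)) x"
    by (rule grad_sq_cong[OF op]) (use x in \<open>auto simp: separated_def\<close>)
  also have "\<dots> = (\<Sum>i\<in>Basis. (h (ln (norm x)) * dderiv [i] ?\<Psi> x + h' (ln (norm x)) * ((x \<bullet> i) / (x \<bullet> x)) * ?\<Psi> x)\<^sup>2)"
    by (rule grad_sq_eqI) (rule has_derivative_mult[OF has_derivative_radial[OF x d] D])
  also have "\<dots> = (\<Sum>i\<in>Basis. (h (ln (norm x)))\<^sup>2 * (dderiv [i] ?\<Psi> x)\<^sup>2
       + (2 * h (ln (norm x)) * h' (ln (norm x)) * ?\<Psi> x / (x \<bullet> x)) * ((x \<bullet> i) * dderiv [i] ?\<Psi> x)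
       + ((h' (ln (norm x)))\<^sup>2 * (?\<Psi> x)\<^sup>2 / (x \<bullet> x)\<^sup>2) * ((x \<bullet> i) * (x \<bullet> i)))"
    by (intro sum.cong refl) (simp add: power2_eq_square algebra_simps del: dderiv.simps)
  also have "\<dots> = (h (ln (norm x)))\<^sup>2 * grad_sq ?\<Psi> x
       + (2 * h (ln (norm x)) * h' (ln (norm x)) * ?\<Psi> x / (x \<bullet> x)) * (\<Sum>i\<in>Basis. (x \<bullet> i) * dderiv [i] ?\<Psi> x)
       + ((h' (ln (norm x)))\<^sup>2 * (?\<Psi> x)\<^sup>2 / (x \<bullet> x)\<^sup>2) * (\<Sum>i\<in>Basis. (x \<bullet> i) * (x \<bullet> i))"
    unfolding grad_sq_def by (simp only: sum.distrib sum_distrib_left)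
  also have "(\<Sum>i\<in>Basis. (x \<bullet> i) * dderiv [i] ?\<Psi> x) = dderiv [x] ?\<Psi> x"
    by (rule dderiv_basis_expansion[OF op _ \<phi>, symmetric]) (use x in auto)
  also have "dderiv [x] ?\<Psi> x = 0"
    by (rule homogeneous_radial_derivative[where f="?\<Psi>", OF _ x D]) (simp add: sgn_sgn_vector)
  also have "(\<Sum>i\<in>Basis. (x \<bullet> i) * (x \<bullet> i)) = x \<bullet> x" by (rule sum_Basis_inner)
  also have "((h' (ln (norm x)))\<^sup>2 * (?\<Psi> x)\<^sup>2 / (x \<bullet> x)\<^sup>2) * (x \<bullet> x) = (h' (ln (norm x)))\<^sup>2 * (?\<Psi> x)\<^sup>2 / (norm x)\<^sup>2"
    unfolding power2_norm_eq_inner using xx by (simp add: power2_eq_square[of "x \<bullet> x"])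
  also have "grad_sq ?\<Psi> x = grad_sq ?\<Psi> (sgn x) / (norm x)\<^sup>2"
    using homogeneous_grad_sq[where f="?\<Psi>", OF _ x \<phi>] x by (simp add: sgn_sgn_vector field_simps)
  finally show ?thesis by (simp add: add_divide_distrib)
qed

end

lemma integral_pos_continuous:
  fixes f :: "'a::euclidean_space => real"
  assumes "continuous_on UNIV f" "!!x. f x >= 0" "integrable lborel f" "f x ~= 0"
  shows "(\<integral>x. f x \<partial>lborel) > 0"
proof -
  have "(\<integral>x. f x \<partial>lborel) ~= 0"
  proof
    assume "(\<integral>x. f x \<partial>lborel) = 0"
    then have "AE x in lborel. f x = 0" using integral_nonneg_eq_0_iff_AE[OF assms(3)] assms(2) by auto
    moreover have "open (f -` (- {0}))" by (rule open_vimage) (use assms(1) in auto)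
    ultimately obtain y where "y \<in> f -` (- {0})" "f y = 0" using AE_open_nonempty assms(4) by blast
    then show False by simp
  qed
  moreover have "(\<integral>x. f x \<partial>lborel) >= 0" by (rule integral_nonneg_AE) (use assms(2) in auto)
  ultimately show ?thesis by linarith
qed

lemma radial_factor:
  fixes h :: "real => real"
  assumes h: "continuous_on UNIV h" "!!t. t < a \<or> t > b ==> h t = 0" "!!t. h t >= 0"
  shows "\<exists>F\<ge>0. \<forall>(g :: 'a::euclidean_space => real) C. g \<in> borel_measurable borel --> (\<forall>x. norm x = 1 --> \<bar>g x\<bar> <= C) -->
       integrable lborel (%x. h (ln (norm x)) / (norm x)\<^sup>2 * g (sgn x)) &
       (\<integral>x. h (ln (norm x)) / (norm x)\<^sup>2 * g (sgn x) \<partial>lborel) = F * sphere_integral g"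
proof -
  define f where "f = (%r. if r <= 0 then 0 else h (ln r) / r\<^sup>2)"
  have [measurable]: "h \<in> borel_measurable borel" using h(1) by (rule borel_measurable_continuous_onI)
  have [measurable]: "f \<in> borel_measurable borel" unfolding f_def by measurable
  have f0: "f r >= 0" for r using h(3) by (simp add: f_def)
  have "compact (h ` {a..b})" by (intro compact_continuous_image continuous_on_subset[OF h(1)]) auto
  then obtain B where B: "!!t. t \<in> {a..b} ==> \<bar>h t\<bar> <= B" "B >= 0"
    using compact_imp_bounded[of "h ` {a..b}"] unfolding bounded_iff
    by (metis abs_ge_zero imageI norm_ge_zero order_trans real_norm_def linear)
  have hB: "h t <= B" for t
    using B(1)[of t] B(2) h(2)[of t] by (cases "t \<in> {a..b}") (auto simp: abs_le_iff)
  define M where "M = (exp b) ^ (DIM('a) - 1) * (B / (exp a)\<^sup>2)"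
  have le: "ennreal (r ^ (DIM('a) - 1)) * indicator {0<..} r * ennreal (f r) <= ennreal M * indicator {exp a..exp b} r" for r
  proof (cases "r \<in> {exp a..exp b}")
    case True
    have r: "r > 0" using True less_le_trans[OF exp_gt_zero] by auto
    have "r ^ (DIM('a) - 1) * f r <= M"
      unfolding M_def using True r hB B(2) h(3) by (intro mult_mono power_mono) (auto simp: f_def intro!: frac_le power_mono)
    then show ?thesis using True r f0 by (simp add: ennreal_leI flip: ennreal_mult)
  next
    case False
    have "f r = 0"
    proof (cases "r <= 0")
      case False
      have "r < exp a \<or> exp b < r" using \<open>r \<notin> {exp a..exp b}\<close> by auto
      then have "ln r < a \<or> ln r > b" using False ln_norm_bounds[of r] by auto
      then show ?thesis using h(2) by (simp add: f_def)
    qed (simp add: f_def)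
    then show ?thesis by simp
  qed
  define I where "I = (\<integral>\<^sup>+r. ennreal (r ^ (DIM('a) - 1)) * indicator {0<..} r * ennreal (f r) \<partial>lborel)"
  have "I <= (\<integral>\<^sup>+r. ennreal M * indicator {exp a..exp b} r \<partial>lborel)"
    unfolding I_def by (intro nn_integral_mono le)
  also have "\<dots> < \<infinity>"
    by (subst nn_integral_cmult_indicator) (auto simp: emeasure_lborel_Icc_eq intro!: ennreal_mult_less_top[THEN iffD2])
  finally have fin: "I = ennreal (enn2real I)" by (simp add: less_top)
  show ?thesis
  proof (intro exI[of _ "DIM('a) * enn2real I"] conjI allI impI)
    fix g :: "'a => real" and C assume g0: "g \<in> borel_measurable borel" "\<forall>x. norm x = 1 --> \<bar>g x\<bar> <= C"
    then have g: "g \<in> borel_measurable borel" "!!x. norm x = 1 ==> \<bar>g x\<bar> <= C" by auto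
    have ff: "f (norm x) = h (ln (norm x)) / (norm x)\<^sup>2" for x :: 'a by (auto simp: f_def)
    have fm: "f \<in> borel_measurable borel" by measurable
    have fin': "(\<integral>\<^sup>+r. ennreal (r ^ (DIM('a) - 1)) * indicator {0<..} r * ennreal (f r) \<partial>lborel) = ennreal (enn2real I)"
      using fin unfolding I_def .
    from integral_polar_product[OF fm f0 fin' enn2real_nonneg g]
    show "integrable lborel (%x. h (ln (norm x)) / (norm x)\<^sup>2 * g (sgn x))"
      "(\<integral>x. h (ln (norm x)) / (norm x)\<^sup>2 * g (sgn x) \<partial>lborel) = real DIM('a) * enn2real I * sphere_integral g"
      unfolding ff sphere_integral_def by simp_all
  qed simp
qed

lemma hump_estimate:
  assumes "(L::real) > 0"
  defines "s \<equiv> %t. 4 * t * (L - t) / L\<^sup>2"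
  obtains X' X'' where "!!t. ((%t. flat (s t)) has_real_derivative X' t) (at t)"
    "!!t. (X' has_real_derivative X'' t) (at t)" "!!t. X'' t >= - (108 / L\<^sup>2) * flat (s t)"
proof -
  define s' where "s' = (%t. 4 * (L - 2 * t) / L\<^sup>2)"
  define F1 where "F1 = (%t. flat t * (inverse t)\<^sup>2)"
  define F2 where "F2 = (%t. flat t * ((inverse t)^4 - 2 * (inverse t)^3))"
  have s: "(s has_real_derivative s' t) (at t)" for t
    unfolding s_def s'_def using assms by (auto intro!: derivative_eq_intros simp: field_simps)
  have s': "(s' has_real_derivative - 8 / L\<^sup>2) (at t)" for t
    unfolding s'_def using assms by (auto intro!: derivative_eq_intros simp: field_simps)
  have d1: "((%t. flat (s t)) has_real_derivative F1 (s t) * s' t) (at t)" for t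
    unfolding F1_def by (rule DERIV_chain2[OF flat_deriv s])
  have d2: "((%t. F1 (s t) * s' t) has_real_derivative F2 (s t) * s' t * s' t + (- 8 / L\<^sup>2) * F1 (s t)) (at t)" for t
    unfolding F1_def F2_def by (rule DERIV_mult[OF DERIV_chain2[OF flat_deriv2 s] s'])
  have sq: "s' t * s' t = 16 * (1 - s t) / L\<^sup>2" for t
    unfolding s_def s'_def using assms by (simp add: field_simps power2_eq_square)
  show ?thesis
  proof (rule that[OF d1 d2])
    fix t
    show "F2 (s t) * s' t * s' t + (- 8 / L\<^sup>2) * F1 (s t) >= - (108 / L\<^sup>2) * flat (s t)"
    proof (cases "s t > 0")
      case False
      then show ?thesis by (simp add: F1_def F2_def flat_zero)
    next
      case True
      define z where "z = inverse (s t)"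
      have z: "s t * z = 1" using True by (simp add: z_def)
      have "16 * (1 - s t) * (z^4 - 2 * z^3) - 8 * z\<^sup>2 = z\<^sup>2 * (16 * z\<^sup>2 - 48 * z + 24)"
      proof -
        have sz: "s t * z^4 = z^3" "s t * z^3 = z^2"
          using z by (simp_all add: power4_eq_xxxx power3_eq_cube power2_eq_square mult.assoc[symmetric])
        have "16 * (1 - s t) * (z^4 - 2 * z^3) - 8 * z\<^sup>2
          = 16 * z^4 - 32 * z^3 - 16 * (s t * z^4) + 32 * (s t * z^3) - 8 * z\<^sup>2" by (simp add: algebra_simps)
        then show ?thesis unfolding sz by (simp add: algebra_simps power4_eq_xxxx power3_eq_cube power2_eq_square)
      qed
      also have "\<dots> >= - 108"
      proof (cases "z <= 3")
        case True
        have "16 * z\<^sup>2 - 48 * z + 24 = 16 * (z - 3/2)\<^sup>2 - 12" by (simp add: power2_eq_square algebra_simps)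
        then have a: "16 * z\<^sup>2 - 48 * z + 24 >= - 12" by simp
        have "z >= 0" using \<open>s t > 0\<close> by (simp add: z_def)
        then have "z\<^sup>2 <= 3\<^sup>2" using True by (intro power_mono)
        then have "z\<^sup>2 * (- 12) >= - 108" by simp
        moreover have "z\<^sup>2 * (16 * z\<^sup>2 - 48 * z + 24) >= z\<^sup>2 * (- 12)" by (rule mult_left_mono[OF a]) simp
        ultimately show ?thesis by linarith
      next
        case False
        then have "z * (z - 3) >= 0" by (intro mult_nonneg_nonneg) auto
        then have "z * z >= 3 * z" unfolding right_diff_distrib by linarith
        then have "16 * z\<^sup>2 - 48 * z + 24 >= 0" unfolding power2_eq_square by linarith
        then have "z\<^sup>2 * (16 * z\<^sup>2 - 48 * z + 24) >= 0" by simp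
        then show ?thesis by linarith
      qed
      finally have A: "- 108 <= 16 * (1 - s t) * (z^4 - 2 * z^3) - 8 * z\<^sup>2" .
      have "F2 (s t) * s' t * s' t + (- 8 / L\<^sup>2) * F1 (s t) = flat (s t) / L\<^sup>2 * (16 * (1 - s t) * (z^4 - 2 * z^3) - 8 * z\<^sup>2)"
        unfolding F1_def F2_def z_def[symmetric] mult.assoc[of _ "s' t" "s' t"] sq
        by (simp add: add_divide_distrib diff_divide_distrib algebra_simps)
      also have "\<dots> >= flat (s t) / L\<^sup>2 * (- 108)"
        by (rule mult_left_mono[OF A]) (simp add: flat_nonneg)
      finally show ?thesis by (simp add: field_simps)
    qed
  qed
qed

lemma hardy_lebesgue:
  assumes "annular v"
  shows "(\<integral>x. grad_sq v x \<partial>lebesgue) = (\<integral>x. grad_sq v x \<partial>lborel)"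
    "(\<integral>x. v x ^ 2 / norm x ^ 2 \<partial>lebesgue) = (\<integral>x. (v x)\<^sup>2 / (norm x)\<^sup>2 \<partial>lborel)"
proof -
  have s: "smooth_on UNIV v" by (rule annular_smooth[OF assms])
  have [measurable]: "v \<in> borel_measurable borel" "grad_sq v \<in> borel_measurable borel"
    using smooth_on_continuous[OF s] smooth_on_continuous[OF smooth_on_grad_sq[OF _ s]]
    by (auto intro: borel_measurable_continuous_onI)
  show "(\<integral>x. grad_sq v x \<partial>lebesgue) = (\<integral>x. grad_sq v x \<partial>lborel)"
    "(\<integral>x. v x ^ 2 / norm x ^ 2 \<partial>lebesgue) = (\<integral>x. (v x)\<^sup>2 / (norm x)\<^sup>2 \<partial>lborel)"
    by (rule integral_completion, measurable)+
qed

lemma annular_square_integral_pos: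
  assumes v: "annular v" "v x ~= 0"
  shows "(\<integral>x. (v x)\<^sup>2 / (norm x)\<^sup>2 \<partial>lborel) > 0"
proof -
  have "annular (%x. v x * v x / (norm x)\<^sup>2)"
    by (intro annular_divide_norm_sq annular_mult v smooth_on_subset[OF annular_smooth[OF v(1)]]) auto
  then have a: "annular (%x. (v x)\<^sup>2 / (norm x)\<^sup>2)" by (simp add: power2_eq_square)
  obtain e M where e: "e > 0" "!!x. norm x < e \<or> norm x > M ==> v x = 0" using annularE[OF v(1)] by blast
  then have "x ~= 0" using v(2) by auto
  then show ?thesis
    using v(2) by (intro integral_pos_continuous[where x=x] smooth_on_continuous annular_smooth[OF a] annular_integrable[OF a]) auto
qed

lemma hardy_upper_test:
  fixes \<Sigma> :: "'a::euclidean_space set"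
  assumes \<Sigma>: "sphere_domain \<Sigma>" and \<phi>: "admissible \<Sigma> \<phi>" and L: "L > 0"
  obtains v where "test_fun (cone_of \<Sigma>) v" "\<exists>x. v x ~= 0"
    "(\<integral>x. grad_sq v x \<partial>lborel) <= (((real DIM('a) - 2) / 2)\<^sup>2 + 108 / L\<^sup>2 + dirichlet \<phi> / mass \<phi>) * (\<integral>x. (v x)\<^sup>2 / (norm x)\<^sup>2 \<partial>lborel)"
proof -
  define m where "m = (real DIM('a) - 2) / 2"
  define s where "s = (%t. 4 * t * (L - t) / L\<^sup>2)"
  define X where "X = (%t. flat (s t))"
  obtain X' X'' where X': "!!t. (X has_real_derivative X' t) (at t)" and X'': "!!t. (X' has_real_derivative X'' t) (at t)"
    and Xge: "!!t. X'' t >= - (108 / L\<^sup>2) * X t"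
  proof (rule hump_estimate[OF L], goal_cases)
    case (1 Y Y')
    show ?case by (rule 1(1)[of Y Y']) (use 1(2-) in \<open>simp_all add: X_def s_def\<close>)
  qed
  have Xs: "smooth_on UNIV X"
    unfolding X_def s_def divide_inverse
    by (rule smooth_on_compose_real[OF _ _ _ flat_smooth[of UNIV]])
       (auto intro!: smooth_on_add smooth_on_mult smooth_on_diff smooth_on_const smooth_on_ident)
  have Xz: "X t = 0" if "t < 0 \<or> t > L" for t
  proof -
    have "t * (L - t) <= 0" using that L by (auto simp: mult_le_0_iff)
    then show ?thesis unfolding X_def s_def by (intro flat_zero) (simp add: divide_nonpos_nonneg mult.assoc)
  qed
  define h where "h = (%t. exp (- m * t) * X t)"
  define h' where "h' = (%t. exp (- m * t) * (X' t - m * X t))"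
  define h'' where "h'' = (%t. exp (- m * t) * (X'' t - 2 * m * X' t + m\<^sup>2 * X t))"
  have es: "smooth_on UNIV (%t. exp (- m * t))"
    by (rule smooth_on_compose_real[OF _ _ _ smooth_on_exp[of UNIV]])
       (auto intro!: smooth_on_minus smooth_on_mult smooth_on_const smooth_on_ident)
  have hs: "smooth_on UNIV h" unfolding h_def by (intro smooth_on_mult es Xs) auto
  have h1: "(h has_real_derivative h' t) (at t)" for t
    unfolding h_def h'_def by (auto intro!: derivative_eq_intros X' simp: algebra_simps)
  have h2: "(h' has_real_derivative h'' t) (at t)" for t
    unfolding h'_def h''_def by (auto intro!: derivative_eq_intros X' X'' simp: algebra_simps power2_eq_square)
  have hz: "h t = 0" if "t < 0 \<or> t > L" for t using Xz[OF that] by (simp add: h_def)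
  let ?\<Psi> = "%y. \<phi> (sgn y)"
  have s\<Psi>: "smooth_on (UNIV - {0}) ?\<Psi>" using \<phi> by (simp add: admissible_def)
  define C where "C = closure {\<sigma> \<in> sphere 0 1. \<phi> \<sigma> ~= 0}"
  have C: "compact C" "{\<sigma> \<in> sphere 0 1. \<phi> \<sigma> ~= 0} \<subseteq> C" "C \<subseteq> \<Sigma>"
  proof -
    have "bounded {\<sigma> \<in> sphere (0::'a) 1. \<phi> \<sigma> ~= 0}" by (rule bounded_subset[of "sphere 0 1"]) auto
    then show "compact C" by (simp add: C_def)
    show "{\<sigma> \<in> sphere 0 1. \<phi> \<sigma> ~= 0} \<subseteq> C" unfolding C_def by (rule closure_subset)
    show "C \<subseteq> \<Sigma>" using \<phi> by (simp add: C_def admissible_def)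
  qed
  define v where "v = separated h \<phi>"
  have tv: "test_fun (cone_of \<Sigma>) v"
    unfolding v_def
  proof (rule separated_test_fun[OF hs hz s\<Psi> C(1,2)])
    fix r :: real and s :: 'a assume "exp 0 <= r" "s \<in> C"
    then show "r *\<^sub>R s \<in> cone_of \<Sigma>" using C(3) unfolding cone_of_def by (auto intro!: exI[of _ r] exI[of _ s])
  qed auto
  have av: "annular v" unfolding v_def by (rule separated_annular[OF hs hz s\<Psi>])
  obtain \<sigma> where \<sigma>: "\<sigma> \<in> \<Sigma>" "\<phi> \<sigma> ~= 0" using \<phi> by (auto simp: admissible_def)
  then have n\<sigma>: "norm \<sigma> = 1" using sphere_domain_subset[OF \<Sigma>] by auto
  have "s (L / 2) = 1" using L by (simp add: s_def power2_eq_square)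
  then have "v (exp (L / 2) *\<^sub>R \<sigma>) ~= 0"
    using n\<sigma> \<sigma>(2) flat_pos[of 1] by (auto simp: v_def separated_def h_def X_def sgn_scaleR) (auto simp: sgn_div_norm)
  then have nz: "\<exists>x. v x ~= 0" by blast
  then have Apos: "(\<integral>x. (v x)\<^sup>2 / (norm x)\<^sup>2 \<partial>lborel) > 0"
    using annular_square_integral_pos[OF av] by blast
  have h'z: "h' t = 0" if "t < 0 \<or> t > L" for t
  proof -
    have "open ({..<0} \<union> {L<..})" by auto
    have "(h has_real_derivative 0) (at t)"
      by (rule has_field_derivative_transform_within_open[OF DERIV_const \<open>open _\<close>]) (use that hz in auto)
    then show ?thesis using DERIV_unique[OF h1] by blast
  qed
  have h's: "smooth_on UNIV h'"
  proof -
    have "h' = dderiv [1] h"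
      using dderiv1_eq[OF h1[unfolded has_field_derivative_def], of 1] by (intro ext) (simp del: dderiv.simps)
    then show ?thesis using smooth_on_D[OF hs, of "[1]"] by metis
  qed
  \<comment> \<open>The radial divergence identity replaces the integration by parts in the one-dimensional radial variable.\<close>
  define k where "k = (%t. h t * h' t)"
  have ks: "smooth_on UNIV k" unfolding k_def by (intro smooth_on_mult hs h's) auto
  have kz: "k t = 0" if "t < 0 \<or> t > L" for t using hz[OF that] by (simp add: k_def)
  have k1: "(k has_real_derivative (h' t)\<^sup>2 + h t * h'' t) (at t)" for t
    unfolding k_def by (auto intro!: derivative_eq_intros h1 h2 simp: power2_eq_square)
  have s\<Psi>2: "smooth_on (UNIV - {0}) (%y. (\<phi> (sgn y))\<^sup>2)" by (rule hom_smooth(2)[OF s\<Psi>])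
  define F where "F = separated k (%y. (\<phi> y)\<^sup>2)"
  have aF: "annular F" unfolding F_def by (rule separated_annular[OF ks kz s\<Psi>2])
  have dF: "dderiv [x] F x = ((h' (ln (norm x)))\<^sup>2 + h (ln (norm x)) * h'' (ln (norm x))) * (\<phi> (sgn x))\<^sup>2" if x: "x ~= 0" for x
  proof -
    have op: "open (UNIV - {0::'a})" by (simp add: open_delete)
    have D: "((%y. (\<phi> (sgn y))\<^sup>2) has_derivative (%v. dderiv [v] (%y. (\<phi> (sgn y))\<^sup>2) x)) (at x)"
      by (rule smooth_on_has_derivative[OF s\<Psi>2 op]) (use x in auto)
    have "dderiv [x] F x = dderiv [x] (%x. k (ln (norm x)) * (\<phi> (sgn x))\<^sup>2) x"
      by (rule dderiv_cong_open[OF op]) (use x in \<open>auto simp: F_def separated_def\<close>)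
    also have "\<dots> = k (ln (norm x)) * dderiv [x] (%y. (\<phi> (sgn y))\<^sup>2) x
        + ((h' (ln (norm x)))\<^sup>2 + h (ln (norm x)) * h'' (ln (norm x))) * ((x \<bullet> x) / (x \<bullet> x)) * (\<phi> (sgn x))\<^sup>2"
      by (rule dderiv1_eq) (rule has_derivative_mult[OF has_derivative_radial[OF x k1] D])
    also have "dderiv [x] (%y. (\<phi> (sgn y))\<^sup>2) x = 0"
      by (rule homogeneous_radial_derivative[where f="%y. (\<phi> (sgn y))\<^sup>2", OF _ x D]) (simp add: sgn_sgn_vector)
    finally show ?thesis using x by simp
  qed
  define P where "P = (%x. (h' (ln (norm x)))\<^sup>2 / (norm x)\<^sup>2 * (\<phi> (sgn x))\<^sup>2)"
  define A where "A = (%x. (h (ln (norm x)))\<^sup>2 / (norm x)\<^sup>2 * (\<phi> (sgn x))\<^sup>2)"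
  define G where "G = (%x. (h (ln (norm x)))\<^sup>2 / (norm x)\<^sup>2 * grad_sq ?\<Psi> (sgn x))"
  note sm = hom_smooth[OF s\<Psi>] and me = hom_measurable[OF s\<Psi>]
  obtain C1 where C1: "!!x. norm x = 1 ==> \<bar>grad_sq ?\<Psi> x\<bar> <= C1"
    using continuous_bounded_on_sphere[OF smooth_on_continuous[OF sm(1)]] by blast
  obtain C2 where C2: "!!x. norm x = 1 ==> \<bar>(?\<Psi> x)\<^sup>2\<bar> <= C2"
    using continuous_bounded_on_sphere[OF smooth_on_continuous[OF sm(2)]] by blast
  have cF0: "continuous_on UNIV (%t. (h t)\<^sup>2)" "!!t. t < 0 \<or> t > L ==> (h t)\<^sup>2 = 0"
    using hz by (auto intro!: continuous_intros smooth_on_continuous[OF hs])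
  have cF1: "continuous_on UNIV (%t. (h' t)\<^sup>2)" "!!t. t < 0 \<or> t > L ==> (h' t)\<^sup>2 = 0"
    using h'z by (auto intro!: continuous_intros smooth_on_continuous[OF h's])
  have "\<exists>F\<ge>0. \<forall>(g :: 'a => real) C. g \<in> borel_measurable borel --> (\<forall>x. norm x = 1 --> \<bar>g x\<bar> <= C) -->
       integrable lborel (%x. (h (ln (norm x)))\<^sup>2 / (norm x)\<^sup>2 * g (sgn x)) &
       (\<integral>x. (h (ln (norm x)))\<^sup>2 / (norm x)\<^sup>2 * g (sgn x) \<partial>lborel) = F * sphere_integral g"
    by (rule radial_factor[of "%t. (h t)\<^sup>2" 0 L], rule cF0(1), erule cF0(2), rule zero_le_power2)
  then obtain F0 where F00: "F0 >= 0"
    "\<forall>(g :: 'a => real) C. g \<in> borel_measurable borel --> (\<forall>x. norm x = 1 --> \<bar>g x\<bar> <= C) -->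
       integrable lborel (%x. (h (ln (norm x)))\<^sup>2 / (norm x)\<^sup>2 * g (sgn x)) &
       (\<integral>x. (h (ln (norm x)))\<^sup>2 / (norm x)\<^sup>2 * g (sgn x) \<partial>lborel) = F0 * sphere_integral g"
    by (elim exE conjE)
  note F0 = F00(1) F00(2)[rule_format]
  have "\<exists>F\<ge>0. \<forall>(g :: 'a => real) C. g \<in> borel_measurable borel --> (\<forall>x. norm x = 1 --> \<bar>g x\<bar> <= C) -->
       integrable lborel (%x. (h' (ln (norm x)))\<^sup>2 / (norm x)\<^sup>2 * g (sgn x)) &
       (\<integral>x. (h' (ln (norm x)))\<^sup>2 / (norm x)\<^sup>2 * g (sgn x) \<partial>lborel) = F * sphere_integral g"
    by (rule radial_factor[of "%t. (h' t)\<^sup>2" 0 L], rule cF1(1), erule cF1(2), rule zero_le_power2)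
  then obtain F1 where F10: "F1 >= 0"
    "\<forall>(g :: 'a => real) C. g \<in> borel_measurable borel --> (\<forall>x. norm x = 1 --> \<bar>g x\<bar> <= C) -->
       integrable lborel (%x. (h' (ln (norm x)))\<^sup>2 / (norm x)\<^sup>2 * g (sgn x)) &
       (\<integral>x. (h' (ln (norm x)))\<^sup>2 / (norm x)\<^sup>2 * g (sgn x) \<partial>lborel) = F1 * sphere_integral g"
    by (elim exE conjE)
  note F1 = F10(1) F10(2)[rule_format]
  have iA: "integrable lborel A" "(\<integral>x. A x \<partial>lborel) = F0 * mass \<phi>"
    using F0(2)[OF me(2) C2] by (auto simp: A_def mass_def sgn_sgn_vector)
  have iG: "integrable lborel G" "(\<integral>x. G x \<partial>lborel) = F0 * dirichlet \<phi>"
    using F0(2)[OF me(1) C1] by (auto simp: G_def dirichlet_def sgn_sgn_vector)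
  have iP: "integrable lborel P"
    using F1(2)[OF me(2) C2] by (auto simp: P_def sgn_sgn_vector)
  have vA: "(v x)\<^sup>2 / (norm x)\<^sup>2 = A x" for x
    by (cases "x = 0") (auto simp: v_def separated_def A_def power_mult_distrib)
  have "(\<integral>x. grad_sq v x \<partial>lborel) = (\<integral>x. P x + G x \<partial>lborel)"
  proof (rule integral_cong_AE)
    show "AE x in lborel. grad_sq v x = P x + G x"
      using AE_lborel_singleton[of "0::'a"]
      by eventually_elim (simp add: v_def grad_sq_separated[OF hs hz s\<Psi> _ h1] P_def G_def add_divide_distrib)
    show "grad_sq v \<in> borel_measurable lborel"
      using smooth_on_continuous[OF smooth_on_grad_sq[OF _ annular_smooth[OF av]]] by (auto intro: borel_measurable_continuous_onI)
  qed (use iP iG in auto)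
  also have "\<dots> = (\<integral>x. P x \<partial>lborel) + F0 * dirichlet \<phi>" using iP iG by simp
  also have "(\<integral>x. P x \<partial>lborel) <= (m\<^sup>2 + 108 / L\<^sup>2) * (\<integral>x. A x \<partial>lborel)"
  proof -
    let ?d = "%x. ((real DIM('a) - 2) * F x + dderiv [x] F x) / (norm x)\<^sup>2"
    have id: "integrable lborel ?d"
    proof -
      have "annular (%x. F x * (real DIM('a) - 2))" by (rule annular_mult[OF aF smooth_on_const])
      then have "annular (%x. F x * (real DIM('a) - 2) + dderiv [x] F x)"
        by (intro annular_add annular_radial_derivative[OF aF])
      from annular_integrable[OF annular_divide_norm_sq[OF this]] show ?thesis by (simp only: mult.commute)
    qed
    have "AE x in lborel. P x <= (m\<^sup>2 + 108 / L\<^sup>2) * A x + ?d x"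
      using AE_lborel_singleton[of "0::'a"]
    proof eventually_elim
      fix x :: 'a assume x: "x ~= 0"
      let ?l = "ln (norm x)"
      have "(real DIM('a) - 2) * k ?l + h ?l * h'' ?l = (exp (- m * ?l))\<^sup>2 * X ?l * (X'' ?l - m\<^sup>2 * X ?l)"
        unfolding k_def h_def h'_def h''_def m_def by (simp add: power2_eq_square field_simps)
      also have "\<dots> >= (exp (- m * ?l))\<^sup>2 * X ?l * (- (108 / L\<^sup>2) * X ?l - m\<^sup>2 * X ?l)"
        using Xge[of ?l] by (intro mult_left_mono) (auto simp: X_def flat_nonneg)
      also have "(exp (- m * ?l))\<^sup>2 * X ?l * (- (108 / L\<^sup>2) * X ?l - m\<^sup>2 * X ?l) = - (m\<^sup>2 + 108 / L\<^sup>2) * (h ?l)\<^sup>2"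
        unfolding h_def by (simp add: power2_eq_square algebra_simps)
      finally have ge: "0 <= (m\<^sup>2 + 108 / L\<^sup>2) * (h ?l)\<^sup>2 + ((real DIM('a) - 2) * k ?l + h ?l * h'' ?l)" by (simp add: algebra_simps)
      have "(m\<^sup>2 + 108 / L\<^sup>2) * A x + ?d x - P x
        = ((m\<^sup>2 + 108 / L\<^sup>2) * (h ?l)\<^sup>2 + ((real DIM('a) - 2) * k ?l + h ?l * h'' ?l)) * ((\<phi> (sgn x))\<^sup>2 / (norm x)\<^sup>2)"
        unfolding dF[OF x] using x by (simp add: A_def P_def F_def separated_def add_divide_distrib diff_divide_distrib algebra_simps)
      also have "\<dots> >= 0" using ge by (intro mult_nonneg_nonneg) auto
      finally show "P x <= (m\<^sup>2 + 108 / L\<^sup>2) * A x + ?d x" by simp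
    qed
    then have "(\<integral>x. P x \<partial>lborel) <= (\<integral>x. (m\<^sup>2 + 108 / L\<^sup>2) * A x + ?d x \<partial>lborel)"
      by (intro integral_mono_AE iP Bochner_Integration.integrable_add integrable_mult_right iA(1) id)
    also have "\<dots> = (m\<^sup>2 + 108 / L\<^sup>2) * (\<integral>x. A x \<partial>lborel) + (\<integral>x. ?d x \<partial>lborel)"
      by (subst Bochner_Integration.integral_add) (use iA id in auto)
    finally show ?thesis using integral_radial_divergence[OF aF] by simp
  qed
  also have "F0 * dirichlet \<phi> = (dirichlet \<phi> / mass \<phi>) * (\<integral>x. A x \<partial>lborel)"
    using iA mass_pos[OF \<Sigma> \<phi>] by simp
  finally have "(\<integral>x. grad_sq v x \<partial>lborel) <= (m\<^sup>2 + 108 / L\<^sup>2 + dirichlet \<phi> / mass \<phi>) * (\<integral>x. (v x)\<^sup>2 / (norm x)\<^sup>2 \<partial>lborel)"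
    unfolding vA by (simp add: algebra_simps)
  then show ?thesis using that[OF tv nz] by (simp add: m_def)
qed

theorem hardy_const_eq:
  fixes \<Sigma> :: "'a::euclidean_space set"
  assumes \<Sigma>: "sphere_domain \<Sigma>"
  shows "hardy_const \<Sigma> = ((real DIM('a) - 2) / 2)\<^sup>2 + lambda1 \<Sigma>"
proof (rule antisym)
  let ?S = "{(\<integral>x. grad_sq u x \<partial>lebesgue) / (\<integral>x. u x ^ 2 / norm x ^ 2 \<partial>lebesgue) | u.
       test_fun (cone_of \<Sigma>) u & (\<exists>x. u x ~= 0)}"
  have bdd: "bdd_below ?S"
    by (rule bdd_belowI[of _ 0]) (auto intro!: divide_nonneg_nonneg integral_nonneg_AE simp: grad_sq_nonneg)
  show "hardy_const \<Sigma> <= ((real DIM('a) - 2) / 2)\<^sup>2 + lambda1 \<Sigma>"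
  proof (rule field_le_epsilon)
    fix e :: real assume e: "e > 0"
    obtain \<phi> where \<phi>: "admissible \<Sigma> \<phi>" "dirichlet \<phi> <= (lambda1 \<Sigma> + e / 2) * mass \<phi>" "mass \<phi> > 0"
      using lambda1_lessD[OF \<Sigma>, of "lambda1 \<Sigma> + e / 2"] e by auto
    define L where "L = sqrt (216 / e)"
    have L: "L > 0" "108 / L\<^sup>2 = e / 2" using e by (auto simp: L_def)
    obtain v where v: "test_fun (cone_of \<Sigma>) v" "\<exists>x. v x ~= 0"
      "(\<integral>x. grad_sq v x \<partial>lborel) <= (((real DIM('a) - 2) / 2)\<^sup>2 + 108 / L\<^sup>2 + dirichlet \<phi> / mass \<phi>) * (\<integral>x. (v x)\<^sup>2 / (norm x)\<^sup>2 \<partial>lborel)"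
      using hardy_upper_test[OF \<Sigma> \<phi>(1) L(1)] by blast
    have av: "annular v" by (rule test_fun_cone_annular[OF \<Sigma> v(1)])
    have pos: "(\<integral>x. (v x)\<^sup>2 / (norm x)\<^sup>2 \<partial>lborel) > 0"
      using annular_square_integral_pos[OF av] v(2) by blast
    have "hardy_const \<Sigma> <= (\<integral>x. grad_sq v x \<partial>lebesgue) / (\<integral>x. v x ^ 2 / norm x ^ 2 \<partial>lebesgue)"
      unfolding hardy_const_def by (rule cInf_lower[OF _ bdd]) (use v in auto)
    also have "\<dots> <= ((real DIM('a) - 2) / 2)\<^sup>2 + 108 / L\<^sup>2 + dirichlet \<phi> / mass \<phi>"
      unfolding hardy_lebesgue[OF av] using v(3) pos by (simp add: divide_le_eq)
    also have "dirichlet \<phi> / mass \<phi> <= lambda1 \<Sigma> + e / 2" using \<phi> by (simp add: divide_le_eq)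
    finally show "hardy_const \<Sigma> <= ((real DIM('a) - 2) / 2)\<^sup>2 + lambda1 \<Sigma> + e" using L by simp
  qed
  obtain \<phi> where "admissible \<Sigma> \<phi>" using admissible_exists[OF \<Sigma>] by blast
  then obtain v where "test_fun (cone_of \<Sigma>) v" "\<exists>x. v x ~= 0" using hardy_upper_test[OF \<Sigma> _ zero_less_one] by blast
  then have ne: "?S ~= {}" by blast
  show "((real DIM('a) - 2) / 2)\<^sup>2 + lambda1 \<Sigma> <= hardy_const \<Sigma>"
    unfolding hardy_const_def
  proof (rule cInf_greatest[OF ne])
    fix y assume "y \<in> ?S"
    then obtain u where u: "test_fun (cone_of \<Sigma>) u" "\<exists>x. u x ~= 0"
      "y = (\<integral>x. grad_sq u x \<partial>lebesgue) / (\<integral>x. u x ^ 2 / norm x ^ 2 \<partial>lebesgue)" by blast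
    have au: "annular u" by (rule test_fun_cone_annular[OF \<Sigma> u(1)])
    have pos: "(\<integral>x. (u x)\<^sup>2 / (norm x)\<^sup>2 \<partial>lborel) > 0"
      using annular_square_integral_pos[OF au] u(2) by blast
    show "((real DIM('a) - 2) / 2)\<^sup>2 + lambda1 \<Sigma> <= y"
      unfolding u(3) hardy_lebesgue[OF au] using hardy_cone[OF \<Sigma> u(1)] pos by (simp add: le_divide_eq)
  qed
qed

section \<open>The strong minimum principle\<close>

lemma real_antiderivative:
  fixes G :: "real => real"
  assumes "continuous_on UNIV G"
  obtains F where "!!x. (F has_real_derivative G x) (at x)"
proof -
  have "\<exists>F. \<forall>x::real. - \<infinity> < ereal x --> ereal x < \<infinity> --> (F has_vector_derivative G x) (at x)"
    by (rule einterval_antiderivative) (use assms in \<open>auto simp: continuous_on_eq_continuous_at\<close>)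
  then show ?thesis using that by (auto simp: has_real_derivative_iff_has_vector_derivative)
qed

definition step :: "real => real" where
  "step s = flat (s - 1/4) * inverse (flat (s - 1/4) + flat (1 - s))"

lemma step_denominator: "flat (s - 1/4) + flat (1 - s) > 0"
proof (cases "s < 1")
  case True then show ?thesis using flat_pos[of "1 - s"] flat_nonneg[of "s - 1/4"] by linarith
next
  case False then show ?thesis using flat_pos[of "s - 1/4"] flat_nonneg[of "1 - s"] by linarith
qed

lemma smooth_on_flat_affine:
  shows "smooth_on UNIV (%s. flat (s - a))" "smooth_on UNIV (%s. flat (a - s))"
  by (rule smooth_on_compose_real[OF _ _ _ flat_smooth[of UNIV]];
      auto intro!: smooth_on_diff smooth_on_const smooth_on_ident)+

lemma step_smooth: "smooth_on UNIV step"
  unfolding step_def[abs_def] using step_denominator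
  by (intro smooth_on_mult smooth_on_inverse smooth_on_add smooth_on_flat_affine) auto

lemma step_bounds: "0 <= step s" "step s <= 1"
  using step_denominator[of s] flat_nonneg[of "s - 1/4"] flat_nonneg[of "1 - s"]
  by (auto simp: step_def divide_inverse[symmetric])

lemma step_0: "s <= 1/4 ==> step s = 0" and step_1: "s >= 1 ==> step s = 1"
  using flat_pos[of "s - 1/4"] by (auto simp: step_def flat_zero)

lemma step_deriv:
  obtains S' B where "!!s. (step has_real_derivative S' s) (at s)" "!!s. S' s <= B" "B > 0"
    "!!s. s < 1/4 \<or> s > 1 ==> S' s = 0"
proof -
  define S' where "S' = dderiv [1] step"
  have S': "(step has_real_derivative S' s) (at s)" for s
  proof -
    have D: "(step has_derivative (%v. dderiv [v] step s)) (at s)"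
      by (rule smooth_on_has_derivative[OF step_smooth]) auto
    have "dderiv [v] step s = S' s * v" for v
    proof -
      have "dderiv [v *\<^sub>R 1] step s = v *\<^sub>R dderiv [1] step s"
        by (rule linear_cmul[OF has_derivative_linear[OF D]])
      then show ?thesis unfolding S'_def real_scaleR_def mult_1_right by (metis mult.commute)
    qed
    then have "(%v. dderiv [v] step s) = (*) (S' s)" by (intro ext)
    with D show ?thesis unfolding has_field_derivative_def by metis
  qed
  have S'0: "S' s = 0" if "s < 1/4 \<or> s > 1" for s
  proof -
    have "(step has_real_derivative 0) (at s)"
    proof (cases "s < 1/4")
      case True
      show ?thesis
        by (rule has_field_derivative_transform_within_open[OF DERIV_const, of "{..<1/4}" s 0]) (use True step_0 in auto)
    next
      case False
      then have "s > 1" using that by auto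
      show ?thesis
        by (rule has_field_derivative_transform_within_open[OF DERIV_const, of "{1<..}" s 1]) (use \<open>s > 1\<close> step_1 in auto)
    qed
    then show ?thesis using DERIV_unique[OF S'] by blast
  qed
  have "continuous_on UNIV S'" unfolding S'_def by (rule smooth_on_continuous[OF smooth_on_D[OF step_smooth]])
  then have "compact (S' ` {1/4..1})" by (intro compact_continuous_image) (auto intro: continuous_on_subset)
  then have "bounded (S' ` {1/4..1})" by (rule compact_imp_bounded)
  then obtain B where "\<forall>y\<in>S' ` {1/4..1}. norm y <= B" unfolding bounded_iff by blast
  then have B: "\<bar>S' s\<bar> <= B" if "s \<in> {1/4..1}" for s using that by simp
  have "S' s <= \<bar>B\<bar> + 1" for s
    using B[of s] S'0[of s] by (cases "s \<in> {1/4..1}") auto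
  then show ?thesis using that[of S' "\<bar>B\<bar> + 1"] S' S'0 by auto
qed

lemma laplacian_norm_sq:
  fixes x0 x :: "'a::euclidean_space" and f f' f'' :: "real => real"
  assumes f: "!!z. (f has_real_derivative f' z) (at z)" "!!z. (f' has_real_derivative f'' z) (at z)"
  shows "laplacian (%x. f ((norm (x - x0))\<^sup>2)) x = 4 * (norm (x - x0))\<^sup>2 * f'' ((norm (x - x0))\<^sup>2) + 2 * DIM('a) * f' ((norm (x - x0))\<^sup>2)"
proof -
  let ?z = "%x. (x - x0) \<bullet> (x - x0)"
  have dz: "(?z has_derivative (%v. 2 * ((x - x0) \<bullet> v))) (at x)" for x
    by (auto intro!: derivative_eq_intros simp: inner_commute)
  have d1: "((%x. g (?z x)) has_derivative (%v. g' * (2 * ((x - x0) \<bullet> v)))) (at x)"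
    if "(g has_real_derivative g') (at (?z x))" for g g' x
    using has_derivative_compose[OF dz that[unfolded has_field_derivative_def]] .
  let ?E = "%i w. f' (?z x) * (2 * (w \<bullet> i)) + (f'' (?z x) * (2 * ((x - x0) \<bullet> w))) * (2 * ((x - x0) \<bullet> i))"
  have "laplacian (%x. f (?z x)) x = (\<Sum>i\<in>Basis. ?E i i)"
  proof (rule laplacian_eqI[of UNIV x _ "%y v. f' (?z y) * (2 * ((y - x0) \<bullet> v))" ?E])
    fix i :: 'a
    have "((%y. 2 * ((y - x0) \<bullet> i)) has_derivative (%w. 2 * (w \<bullet> i))) (at x)"
      by (auto intro!: derivative_eq_intros)
    from has_derivative_mult[OF d1[OF f(2)] this]
    show "((%y. f' (?z y) * (2 * ((y - x0) \<bullet> i))) has_derivative ?E i) (at x)" .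
  qed (use d1[OF f(1)] in auto)
  also have "\<dots> = (\<Sum>i\<in>(Basis::'a set). 2 * f' (?z x) + 4 * f'' (?z x) * (((x - x0) \<bullet> i) * ((x - x0) \<bullet> i)))"
    by (intro sum.cong refl) simp
  also have "\<dots> = (\<Sum>i\<in>(Basis::'a set). 2 * f' (?z x)) + 4 * f'' (?z x) * (\<Sum>i\<in>Basis. ((x - x0) \<bullet> i) * ((x - x0) \<bullet> i))"
    by (simp only: sum.distrib sum_distrib_left)
  finally show ?thesis by (simp add: power2_norm_eq_inner sum_Basis_inner)
qed

lemma fundamental_bump:
  fixes N :: nat and r e :: real
  assumes N: "N >= 2" and e: "0 < e" "e < r" and S': "!!s. (step has_real_derivative S' s) (at s)"
    "!!s. s < 1/4 \<or> s > 1 ==> S' s = 0"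
  shows "\<exists>(f :: real => real) (f' :: real => real) (f'' :: real => real). smooth_on UNIV f & (\<forall>z. f z >= 0) & (\<forall>z\<ge>r\<^sup>2. f z = 0) &
    (\<forall>z. (f has_real_derivative f' z) (at z)) & (\<forall>z. (f' has_real_derivative f'' z) (at z)) &
    (\<forall>z>0. - (4 * z * f'' z + 2 * N * f' z) =
       4 * z powr (1 - N / 2) * (S' (z / e\<^sup>2) / e\<^sup>2 * flat (r\<^sup>2 - z) - step (z / e\<^sup>2) * (flat (r\<^sup>2 - z) * (inverse (r\<^sup>2 - z))\<^sup>2))) &
    f' 0 = 0"
proof -
  define G where "G = (%z. if z <= 0 then 0 else z powr (- (N / 2)) * (step (z / e\<^sup>2) * flat (r\<^sup>2 - z)))"
  define G' where "G' = (%z. if z <= 0 then 0 else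
    (- (N/2)) * z powr (- (N / 2) - 1) * (step (z / e\<^sup>2) * flat (r\<^sup>2 - z)) +
    z powr (- (N/2)) * (S' (z / e\<^sup>2) / e\<^sup>2 * flat (r\<^sup>2 - z) - step (z / e\<^sup>2) * (flat (r\<^sup>2 - z) * (inverse (r\<^sup>2 - z))\<^sup>2)))"
  have Gz: "G z = 0" if "z < e\<^sup>2 / 4" for z
    using that e step_0[of "z / e\<^sup>2"] by (simp add: G_def field_simps)
  have ss: "smooth_on UNIV (%z. step (z / e\<^sup>2))"
    unfolding divide_inverse
    by (rule smooth_on_compose_real[OF _ _ _ step_smooth]) (auto intro!: smooth_on_mult smooth_on_ident smooth_on_const)
  have Gs: "smooth_on UNIV G"
  proof (rule smooth_on_local)
    fix z :: real
    show "\<exists>U. open U & z \<in> U & smooth_on U G"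
    proof (cases "z > 0")
      case True
      have "smooth_on {0<..} (%z. z powr (- (N / 2)) * (step (z / e\<^sup>2) * flat (r\<^sup>2 - z)))"
        by (intro smooth_on_mult smooth_on_powr smooth_on_subset[OF ss] smooth_on_subset[OF smooth_on_flat_affine(2)]) auto
      then have "smooth_on {0<..} G" by (rule smooth_on_cong[rotated 2]) (auto simp: G_def)
      then show ?thesis using True by (intro exI[of _ "{0<..}"]) auto
    next
      case False
      have "smooth_on {..<e\<^sup>2/4} G"
        by (rule smooth_on_cong[OF _ _ smooth_on_const[of _ 0]]) (auto simp: Gz)
      moreover have "z < e\<^sup>2 / 4" using False e by (smt (verit) divide_pos_pos zero_less_power)
      ultimately show ?thesis by (intro exI[of _ "{..<e\<^sup>2/4}"]) auto
    qed
  qed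
  have dG: "(G has_real_derivative G' z) (at z)" for z
  proof (cases "z > 0")
    case True
    have d1: "((%z. z powr (- (N/2))) has_real_derivative (- (N/2)) * z powr (- (N/2) - 1)) (at z)"
      by (rule has_real_derivative_powr[OF True])
    have d2: "((%z. step (z / e\<^sup>2)) has_real_derivative S' (z / e\<^sup>2) * (1 / e\<^sup>2)) (at z)"
      by (rule DERIV_chain2[OF S'(1) DERIV_cdivide[OF DERIV_ident]])
    have d3: "((%z. flat (r\<^sup>2 - z)) has_real_derivative (flat (r\<^sup>2 - z) * (inverse (r\<^sup>2 - z))\<^sup>2) * (- 1)) (at z)"
      by (rule DERIV_chain2[OF flat_deriv]) (auto intro!: derivative_eq_intros)
    have "((%z. z powr (- (N / 2)) * (step (z / e\<^sup>2) * flat (r\<^sup>2 - z))) has_real_derivative G' z) (at z)"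
      by (rule DERIV_cong[OF DERIV_mult[OF d1 DERIV_mult[OF d2 d3]]]) (use True in \<open>simp add: G'_def algebra_simps\<close>)
    then show ?thesis
      by (rule has_field_derivative_transform_within_open[of _ _ _ "{0<..}"]) (use True in \<open>auto simp: G_def\<close>)
  next
    case False
    then have "z < e\<^sup>2 / 4" using e by (smt (verit) divide_pos_pos zero_less_power)
    then have "(G has_real_derivative 0) (at z)"
      by (intro has_field_derivative_transform_within_open[OF DERIV_const, of "{..<e\<^sup>2/4}" z 0]) (auto simp: Gz)
    then show ?thesis using False by (simp add: G'_def)
  qed
  obtain F where F: "!!z. (F has_real_derivative G z) (at z)"
    using real_antiderivative[OF smooth_on_continuous[OF Gs]] by blast
  have G0: "G z >= 0" for z using step_bounds flat_nonneg by (simp add: G_def)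
  have mono: "F y <= F z" if "y <= z" for y z
    by (rule DERIV_nonneg_imp_nondecreasing[OF that]) (use F G0 in blast)
  have const: "F z = F (r\<^sup>2)" if "z >= r\<^sup>2" for z
  proof (cases "z = r\<^sup>2")
    case False
    then have "z > r\<^sup>2" using that by simp
    then obtain y where y: "r\<^sup>2 < y" "F z - F (r\<^sup>2) = (z - r\<^sup>2) * G y" using MVT2[of "r\<^sup>2" z F G] F by blast
    then have "G y = 0" by (simp add: G_def flat_zero)
    then show ?thesis using y by simp
  qed simp
  have Fs: "smooth_on UNIV F" by (rule smooth_on_if_real_derivative_smooth[OF _ F Gs]) auto
  show ?thesis
  proof (rule exI[of _ "%z. F (r\<^sup>2) - F z"], rule exI[of _ "%z. - G z"], rule exI[of _ "%z. - G' z"], intro conjI allI impI)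
    show "smooth_on UNIV (%z. F (r\<^sup>2) - F z)" by (intro smooth_on_diff smooth_on_const Fs) auto
    show "F (r\<^sup>2) - F z >= 0" for z using mono[of z "r\<^sup>2"] const[of z] by (cases "z <= r\<^sup>2") auto
    show "F (r\<^sup>2) - F z = 0" if "z >= r\<^sup>2" for z using const[OF that] by simp
    show "((%z. F (r\<^sup>2) - F z) has_real_derivative - G z) (at z)" for z
      using F by (auto intro!: derivative_eq_intros)
    show "((%z. - G z) has_real_derivative - G' z) (at z)" for z
      using dG by (auto intro!: derivative_eq_intros)
    show "- G 0 = 0" by (simp add: G_def)
    fix z :: real assume z: "z > 0"
    have p: "z powr (- (N / 2) - 1) * z = z powr (- (N/2))" "z powr (- (N/2)) * z = z powr (1 - N/2)"
      using z powr_add[of z "- (N / 2) - 1" 1] powr_add[of z "- (N / 2)" 1] by simp_all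
    define Q where "Q = S' (z / e\<^sup>2) / e\<^sup>2 * flat (r\<^sup>2 - z) - step (z / e\<^sup>2) * (flat (r\<^sup>2 - z) * (inverse (r\<^sup>2 - z))\<^sup>2)"
    have "- (4 * z * (- G' z) + 2 * N * (- G z)) = 4 * (z * G' z) + 2 * N * G z" by simp
    also have "z * G' z = (- (N/2)) * (z powr (- (N / 2) - 1) * z) * (step (z / e\<^sup>2) * flat (r\<^sup>2 - z)) + (z powr (- (N/2)) * z) * Q"
      unfolding G'_def Q_def using z by (simp add: algebra_simps)
    also have "\<dots> = - (N / 2) * G z + z powr (1 - N/2) * Q" unfolding p G_def using z by simp
    finally show "- (4 * z * (- G' z) + 2 * N * (- G z)) = 4 * z powr (1 - N / 2) *
       (S' (z / e\<^sup>2) / e\<^sup>2 * flat (r\<^sup>2 - z) - step (z / e\<^sup>2) * (flat (r\<^sup>2 - z) * (inverse (r\<^sup>2 - z))\<^sup>2))"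
      unfolding Q_def[symmetric] by (simp add: algebra_simps)
  qed
qed


lemma laplacian_test_fun:
  assumes "test_fun \<Omega> \<phi>"
  obtains C where "laplacian \<phi> \<in> borel_measurable lebesgue" "!!x. \<bar>laplacian \<phi> x\<bar> <= C"
    "!!x. x \<notin> tsupport \<phi> ==> laplacian \<phi> x = 0"
proof -
  have s: "smooth_on UNIV \<phi>" and K: "compact (tsupport \<phi>)" using assms by (auto simp: test_fun_def)
  have cont: "continuous_on UNIV (laplacian \<phi>)" by (rule smooth_on_continuous[OF smooth_on_laplacian[OF _ s]]) simp
  have z: "laplacian \<phi> x = 0" if "x \<notin> tsupport \<phi>" for x
  proof -
    have "laplacian \<phi> x = laplacian (%_. 0) x"
    proof (rule laplacian_cong[of "- tsupport \<phi>"])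
      show "open (- tsupport \<phi>)" using K by (auto intro: compact_imp_closed)
      show "\<phi> y = 0" if "y \<in> - tsupport \<phi>" for y using that in_tsupport[of \<phi> y] by blast
    qed (use that in simp)
    then show ?thesis by (simp add: laplacian_def dderiv_zero del: dderiv.simps)
  qed
  have "bounded (laplacian \<phi> ` tsupport \<phi>)"
    by (intro compact_imp_bounded compact_continuous_image K continuous_on_subset[OF cont]) auto
  then obtain B where "\<forall>y\<in>laplacian \<phi> ` tsupport \<phi>. norm y <= B" unfolding bounded_iff by blast
  then have "\<bar>laplacian \<phi> x\<bar> <= max B 0" for x using z[of x] by (cases "x \<in> tsupport \<phi>") (auto simp: le_max_iff_disj)
  moreover have "laplacian \<phi> \<in> borel_measurable lborel" using borel_measurable_continuous_onI[OF cont] by simp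
  then have "laplacian \<phi> \<in> borel_measurable lebesgue" by (rule measurable_completion)
  ultimately show ?thesis using that z by blast
qed

locale superharmonic =
  fixes \<Omega> :: "'a::euclidean_space set" and w :: "'a => real"
  assumes dim: "DIM('a) >= 2" and open_\<Omega>: "open \<Omega>"
    and w_meas [measurable]: "w \<in> borel_measurable lebesgue"
    and w_nonneg: "w x >= 0" and w_zero: "x \<notin> \<Omega> ==> w x = 0"
    and w_loc: "compact K ==> K \<subseteq> \<Omega> ==> integrable lebesgue (%x. w x * indicator K x)"
    and w_super: "test_fun \<Omega> \<phi> ==> (!!x. \<phi> x >= 0) ==> 0 <= (\<integral>x. w x * - laplacian \<phi> x \<partial>lebesgue)"
begin

lemma w_integrable:
  assumes "compact K" "K \<subseteq> \<Omega>" and [measurable]: "g \<in> borel_measurable lebesgue"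
    and "!!x. \<bar>g x\<bar> <= C" "!!x. x \<notin> K ==> g x = 0"
  shows "integrable lebesgue (%x. w x * g x)"
proof (rule Bochner_Integration.integrable_bound)
  show "integrable lebesgue (%x. C * (w x * indicator K x))" using w_loc[OF assms(1,2)] by simp
  show "AE x in lebesgue. norm (w x * g x) <= norm (C * (w x * indicator K x))"
  proof (intro AE_I2)
    fix x
    have "C >= 0" using assms(4)[of x] by linarith
    then show "norm (w x * g x) <= norm (C * (w x * indicator K x))"
      using assms(4,5)[of x] w_nonneg[of x] by (cases "x \<in> K") (auto simp: abs_mult mult.commute[of C] intro!: mult_left_mono)
  qed
qed measurable

lemma w_integrable_subset:
  assumes "compact K" "K \<subseteq> \<Omega>" "A \<subseteq> K" "A \<in> sets lebesgue"
  shows "integrable lebesgue (%x. w x * indicator A x)"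
  by (rule w_integrable[OF assms(1,2), of _ 1]) (use assms in \<open>auto simp: indicator_def\<close>)

lemma w_laplacian_integrable:
  assumes "test_fun \<Omega> \<phi>"
  shows "integrable lebesgue (%x. w x * laplacian \<phi> x)"
proof -
  obtain C where C: "laplacian \<phi> \<in> borel_measurable lebesgue" "!!x. \<bar>laplacian \<phi> x\<bar> <= C"
    "!!x. x \<notin> tsupport \<phi> ==> laplacian \<phi> x = 0" using laplacian_test_fun[OF assms] by blast
  show ?thesis
    by (rule w_integrable[OF _ _ C]) (use assms in \<open>auto simp: test_fun_def\<close>)
qed

lemma annulus_le_ball:
  assumes r: "r > 0"
  obtains C where "C > 0" "!!x0 e. 0 < e ==> e < r ==> cball x0 r \<subseteq> \<Omega> ==>
    (\<integral>x. w x * indicator {x. e < dist x0 x & dist x0 x <= 3/4 * r} x \<partial>lebesgue)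
      <= C / e ^ DIM('a) * (\<integral>x. w x * indicator (cball x0 e) x \<partial>lebesgue)"
proof -
  define N where "N = DIM('a)"
  have N: "N >= 2" using dim by (simp add: N_def)
  obtain S' B where S': "!!s. (step has_real_derivative S' s) (at s)" "!!s. S' s <= B" "B > 0"
    "!!s. s < 1/4 \<or> s > 1 ==> S' s = 0" using step_deriv by blast
  define c0 where "c0 = 4 * (r\<^sup>2) powr (1 - N/2) * (flat (7/16 * r\<^sup>2) * (inverse (r\<^sup>2))\<^sup>2)"
  define C1 where "C1 = 4 * (1/4) powr (1 - N/2) * B"
  have c0: "c0 > 0" using r flat_pos[of "7/16 * r\<^sup>2"] by (simp add: c0_def)
  have C1: "C1 > 0" using S' by (simp add: C1_def)
  show ?thesis
  proof (rule that[of "C1 / c0"])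
    show "C1 / c0 > 0" using c0 C1 by simp
    fix x0 e assume e: "0 < e" "e < r" and sub: "cball x0 r \<subseteq> \<Omega>"
    have "\<exists>(f :: real => real) (f' :: real => real) (f'' :: real => real). smooth_on UNIV f & (\<forall>z. f z >= 0) & (\<forall>z\<ge>r\<^sup>2. f z = 0) &
    (\<forall>z. (f has_real_derivative f' z) (at z)) & (\<forall>z. (f' has_real_derivative f'' z) (at z)) &
    (\<forall>z>0. - (4 * z * f'' z + 2 * N * f' z) =
       4 * z powr (1 - N / 2) * (S' (z / e\<^sup>2) / e\<^sup>2 * flat (r\<^sup>2 - z) - step (z / e\<^sup>2) * (flat (r\<^sup>2 - z) * (inverse (r\<^sup>2 - z))\<^sup>2))) &
    f' 0 = 0"
      by (rule fundamental_bump[OF N e, of S'], rule S'(1), erule S'(4))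
    then obtain f f' f'' :: "real => real" where f0: "smooth_on UNIV f & (\<forall>z. f z >= 0) & (\<forall>z\<ge>r\<^sup>2. f z = 0) &
    (\<forall>z. (f has_real_derivative f' z) (at z)) & (\<forall>z. (f' has_real_derivative f'' z) (at z)) &
    (\<forall>z>0. - (4 * z * f'' z + 2 * N * f' z) =
       4 * z powr (1 - N / 2) * (S' (z / e\<^sup>2) / e\<^sup>2 * flat (r\<^sup>2 - z) - step (z / e\<^sup>2) * (flat (r\<^sup>2 - z) * (inverse (r\<^sup>2 - z))\<^sup>2))) &
    f' 0 = 0"
      by (elim exE)
    note f = f0[THEN conjunct1] f0[THEN conjunct2, THEN conjunct1, rule_format]
      f0[THEN conjunct2, THEN conjunct2, THEN conjunct1, rule_format]
      f0[THEN conjunct2, THEN conjunct2, THEN conjunct2, THEN conjunct1, rule_format]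
      f0[THEN conjunct2, THEN conjunct2, THEN conjunct2, THEN conjunct2, THEN conjunct1, rule_format]
      f0[THEN conjunct2, THEN conjunct2, THEN conjunct2, THEN conjunct2, THEN conjunct2, THEN conjunct1, rule_format]
      f0[THEN conjunct2, THEN conjunct2, THEN conjunct2, THEN conjunct2, THEN conjunct2, THEN conjunct2]
    define \<phi> where "\<phi> = (%x. f ((norm (x - x0))\<^sup>2))"
    have dx: "norm (x - x0) = dist x0 x" for x by (simp add: dist_norm norm_minus_commute)
    have lap: "- laplacian \<phi> x = - (4 * (dist x0 x)\<^sup>2 * f'' ((dist x0 x)\<^sup>2) + 2 * N * f' ((dist x0 x)\<^sup>2))" for x
      unfolding \<phi>_def by (subst laplacian_norm_sq[OF f(4,5)]) (simp add: dx N_def)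
    have \<phi>s: "smooth_on UNIV \<phi>"
      unfolding \<phi>_def
    proof (rule smooth_on_compose_real[OF _ _ _ f(1)])
      have "smooth_on UNIV (%x. \<Sum>i\<in>Basis. (i \<bullet> x - i \<bullet> x0)\<^sup>2)"
        by (intro smooth_on_sum smooth_on_power smooth_on_diff smooth_on_inner smooth_on_const) auto
      then show "smooth_on UNIV (%x. (norm (x - x0))\<^sup>2)"
      proof (rule smooth_on_cong[rotated 2])
        show "(\<Sum>i\<in>Basis. (i \<bullet> x - i \<bullet> x0)\<^sup>2) = (norm (x - x0))\<^sup>2" for x
          unfolding power2_norm_eq_inner euclidean_inner[of "x - x0" "x - x0"]
          by (intro sum.cong) (simp_all add: power2_eq_square inner_diff_right inner_commute)
      qed simp
    qed auto
    have \<phi>z: "\<phi> x = 0" if "x \<notin> cball x0 r" for x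
      using that f(3)[of "(norm (x - x0))\<^sup>2"] r by (auto simp: \<phi>_def dx abs_le_square_iff[symmetric])
    have ts: "tsupport \<phi> \<subseteq> cball x0 r"
      unfolding tsupport_def by (rule closure_minimal) (use \<phi>z in blast, simp)
    have tf: "test_fun \<Omega> \<phi>"
      unfolding test_fun_def using \<phi>s ts sub compact_Int_closed[OF compact_cball[of x0 r], of "tsupport \<phi>"]
      by (auto simp: Int_absorb1 tsupport_def)
    define A where "A = {x. e < dist x0 x & dist x0 x <= 3/4 * r}"
    have Am: "A \<in> sets lebesgue"
    proof -
      have "A = cball x0 (3/4 * r) - cball x0 e" by (auto simp: A_def)
      then show ?thesis by simp
    qed
    have le: "- laplacian \<phi> x <= C1 / e ^ N * indicator (cball x0 e) x - c0 * indicator A x" for x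
    proof (cases "x = x0")
      case True
      have "- laplacian \<phi> x = 0" unfolding lap using True f(7) by simp
      then show ?thesis using True e C1 by (simp add: A_def)
    next
      case False
      define z where "z = (dist x0 x)\<^sup>2"
      have z: "z > 0" using False by (simp add: z_def)
      have L: "- laplacian \<phi> x = 4 * z powr (1 - N / 2) * (S' (z / e\<^sup>2) / e\<^sup>2 * flat (r\<^sup>2 - z) - step (z / e\<^sup>2) * (flat (r\<^sup>2 - z) * (inverse (r\<^sup>2 - z))\<^sup>2))"
        unfolding lap z_def[symmetric] by (rule f(6)[OF z])
      have st: "step (z / e\<^sup>2) * (flat (r\<^sup>2 - z) * (inverse (r\<^sup>2 - z))\<^sup>2) >= 0"
        using step_bounds flat_nonneg by simp
      show ?thesis
      proof (cases "x \<in> cball x0 e")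
        case True
        then have "x \<notin> A" by (simp add: A_def)
        have "- laplacian \<phi> x <= 4 * z powr (1 - N / 2) * (S' (z / e\<^sup>2) / e\<^sup>2 * flat (r\<^sup>2 - z))"
          unfolding L using st by (intro mult_left_mono) auto
        also have "\<dots> <= C1 / e ^ N"
        proof (cases "z / e\<^sup>2 < 1/4")
          case True
          then show ?thesis using S'(4) C1 e by simp
        next
          case False
          then have "z >= e\<^sup>2 / 4" using e by (simp add: field_simps)
          then have "z powr (1 - N/2) <= (e\<^sup>2 / 4) powr (1 - N/2)"
            using e N by (intro powr_mono2') auto
          also have "\<dots> = (1/4) powr (1 - N/2) * (e\<^sup>2) powr (1 - N/2)"
            using e by (simp add: powr_mult[symmetric])
          also have "(e\<^sup>2) powr (1 - N/2) = e\<^sup>2 / e ^ N"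
          proof -
            have "(e\<^sup>2) powr (1 - N/2) = (e powr 2) powr (1 - N/2)" using e by (simp add: powr_numeral)
            also have "\<dots> = e powr (2 - real N)" by (simp add: powr_powr algebra_simps)
            also have "\<dots> = e\<^sup>2 / e ^ N" using e by (simp add: powr_diff powr_realpow powr_numeral)
            finally show ?thesis .
          qed
          finally have p: "z powr (1 - N/2) <= (1/4) powr (1 - N/2) * (e\<^sup>2 / e ^ N)" .
          have "S' (z / e\<^sup>2) / e\<^sup>2 * flat (r\<^sup>2 - z) <= B / e\<^sup>2 * 1"
          proof (cases "S' (z / e\<^sup>2) >= 0")
            case True
            then show ?thesis using S'(2,3) e flat_le_1 flat_nonneg by (intro mult_mono divide_right_mono) auto
          next
            case False
            then have "S' (z / e\<^sup>2) / e\<^sup>2 * flat (r\<^sup>2 - z) <= 0"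
              using flat_nonneg e by (intro mult_nonpos_nonneg divide_nonpos_nonneg) auto
            also have "0 <= B / e\<^sup>2 * 1" using S'(3) by simp
            finally show ?thesis .
          qed
          then have "4 * z powr (1 - N / 2) * (S' (z / e\<^sup>2) / e\<^sup>2 * flat (r\<^sup>2 - z)) <= 4 * z powr (1 - N / 2) * (B / e\<^sup>2 * 1)"
            by (intro mult_left_mono) auto
          also have "\<dots> <= 4 * ((1/4) powr (1 - N/2) * (e\<^sup>2 / e ^ N)) * (B / e\<^sup>2 * 1)"
            using p S'(3) by (intro mult_right_mono mult_left_mono) auto
          also have "\<dots> = C1 / e ^ N" unfolding C1_def using e by (simp add: field_simps)
          finally show ?thesis .
        qed
        finally show ?thesis using True \<open>x \<notin> A\<close> by simp
      next
        case False
        then have "z / e\<^sup>2 > 1" using e by (simp add: z_def power_strict_mono)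
        then have L2: "- laplacian \<phi> x = - (4 * z powr (1 - N / 2) * (flat (r\<^sup>2 - z) * (inverse (r\<^sup>2 - z))\<^sup>2))"
          unfolding L using S'(4) step_1 by simp
        show ?thesis
        proof (cases "x \<in> A")
          case False
          have "- laplacian \<phi> x <= 0" unfolding L2 using flat_nonneg by simp
          then show ?thesis using False \<open>x \<notin> cball x0 e\<close> by simp
        next
          case True
          then have "dist x0 x <= 3/4 * r" by (simp add: A_def)
          then have "z <= (3/4 * r)\<^sup>2" unfolding z_def by (intro power_mono) auto
          then have zr: "z <= 9/16 * r\<^sup>2" by (simp add: power2_eq_square)
          have r2: "r\<^sup>2 > 0" using r by simp
          have "(r\<^sup>2) powr (1 - N/2) <= z powr (1 - N/2)"
            using z zr r2 N by (intro powr_mono2') (auto)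
          then have "4 * (r\<^sup>2) powr (1 - N/2) <= 4 * z powr (1 - N/2)" by simp
          moreover have "flat (7/16 * r\<^sup>2) * (inverse (r\<^sup>2))\<^sup>2 <= flat (r\<^sup>2 - z) * (inverse (r\<^sup>2 - z))\<^sup>2"
            using z zr r2 by (intro mult_mono flat_mono power_mono le_imp_inverse_le) (auto simp: flat_nonneg)
          ultimately have "c0 <= 4 * z powr (1 - N / 2) * (flat (r\<^sup>2 - z) * (inverse (r\<^sup>2 - z))\<^sup>2)"
            unfolding c0_def by (rule mult_mono) (simp_all add: flat_nonneg)
          then show ?thesis using True \<open>x \<notin> cball x0 e\<close> unfolding L2 by simp
        qed
      qed
    qed
    have ib: "integrable lebesgue (%x. w x * indicator (cball x0 e) x)"
      by (rule w_integrable_subset[OF compact_cball sub]) (use e in auto)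
    have ia: "integrable lebesgue (%x. w x * indicator A x)"
      by (rule w_integrable_subset[OF compact_cball sub]) (use e r Am in \<open>auto simp: A_def\<close>)
    have "0 <= (\<integral>x. w x * - laplacian \<phi> x \<partial>lebesgue)"
      by (rule w_super[OF tf]) (simp add: \<phi>_def f(2))
    also have "\<dots> <= (\<integral>x. C1 / e ^ N * (w x * indicator (cball x0 e) x) - c0 * (w x * indicator A x) \<partial>lebesgue)"
    proof (rule integral_mono)
      show "integrable lebesgue (%x. w x * - laplacian \<phi> x)" using w_laplacian_integrable[OF tf] by simp
      show "w x * - laplacian \<phi> x <= C1 / e ^ N * (w x * indicator (cball x0 e) x) - c0 * (w x * indicator A x)" for x
        using mult_left_mono[OF le[of x] w_nonneg[of x]] by (simp add: algebra_simps)
    qed (use ia ib in simp)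
    also have "\<dots> = C1 / e ^ N * (\<integral>x. w x * indicator (cball x0 e) x \<partial>lebesgue) - c0 * (\<integral>x. w x * indicator A x \<partial>lebesgue)"
      using ia ib by simp
    finally have "c0 * (\<integral>x. w x * indicator A x \<partial>lebesgue) <= C1 / e ^ N * (\<integral>x. w x * indicator (cball x0 e) x \<partial>lebesgue)" by simp
    then have "(\<integral>x. w x * indicator A x \<partial>lebesgue) <= (C1 / e ^ N * (\<integral>x. w x * indicator (cball x0 e) x \<partial>lebesgue)) / c0"
      by (simp only: pos_le_divide_eq[OF c0] mult.commute)
    also have "\<dots> = C1 / c0 / e ^ N * (\<integral>x. w x * indicator (cball x0 e) x \<partial>lebesgue)"
      by (simp add: divide_inverse ac_simps)
    finally show "(\<integral>x. w x * indicator {x. e < dist x0 x & dist x0 x <= 3/4 * r} x \<partial>lebesgue)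
      <= C1 / c0 / e ^ DIM('a) * (\<integral>x. w x * indicator (cball x0 e) x \<partial>lebesgue)"
      unfolding A_def N_def .
  qed
qed

lemma integral_zero_AE:
  assumes "integrable lebesgue (%x. w x * indicator A x)" "(\<integral>x. w x * indicator A x \<partial>lebesgue) <= 0"
  shows "AE x in lebesgue. x \<in> A --> w x = 0"
proof -
  have "(\<integral>x. w x * indicator A x \<partial>lebesgue) >= 0" by (rule integral_nonneg_AE) (simp add: w_nonneg)
  then have "(\<integral>x. w x * indicator A x \<partial>lebesgue) = 0" using assms(2) by linarith
  then have "AE x in lebesgue. w x * indicator A x = 0"
    by (subst (asm) integral_nonneg_eq_0_iff_AE[OF assms(1)]) (simp_all add: w_nonneg)
  then show ?thesis by eventually_elim (auto simp: indicator_def split: if_splits)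
qed

lemma zero_or_positive_on_balls:
  assumes conn: "connected \<Omega>" and nz: "\<not> (AE x in lebesgue. w x = 0)"
    and x: "x \<in> \<Omega>" and r: "r > 0"
  shows "\<not> (AE y in lebesgue. y \<in> ball x r --> w y = 0)"
proof
  assume bad: "AE y in lebesgue. y \<in> ball x r --> w y = 0"
  define Z where "Z = {x \<in> \<Omega>. \<exists>r>0. AE y in lebesgue. y \<in> ball x r --> w y = 0}"
  have opZ: "open Z"
    unfolding open_contains_ball
  proof
    fix x assume "x \<in> Z"
    then obtain r where r: "x \<in> \<Omega>" "r > 0" "AE y in lebesgue. y \<in> ball x r --> w y = 0" by (auto simp: Z_def)
    obtain d where d: "d > 0" "ball x d \<subseteq> \<Omega>" using open_\<Omega> r(1) by (meson openE)
    have "y \<in> Z" if y: "y \<in> ball x (min d (r/2))" for y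
    proof -
      have "AE v in lebesgue. v \<in> ball y (r/2) --> w v = 0"
        using r(3)
      proof eventually_elim
        case (elim v)
        have "dist x v <= dist x y + dist y v" by (rule dist_triangle)
        then show ?case using elim y by auto
      qed
      then show ?thesis unfolding Z_def using y d r(2) by (auto intro!: exI[of _ "r/2"])
    qed
    then show "\<exists>e>0. ball x e \<subseteq> Z" using d(1) r(2) by (intro exI[of _ "min d (r/2)"]) auto
  qed
  have "open (\<Omega> - Z)"
    unfolding open_contains_ball
  proof
    fix x assume x: "x \<in> \<Omega> - Z"
    obtain d where d: "d > 0" "ball x d \<subseteq> \<Omega>" using open_\<Omega> x by (meson DiffD1 openE)
    define r where "r = d / 4"
    have r: "r > 0" using d by (simp add: r_def)
    obtain C where C: "C > 0" "!!x0 e. 0 < e ==> e < r ==> cball x0 r \<subseteq> \<Omega> ==>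
      (\<integral>x. w x * indicator {x. e < dist x0 x & dist x0 x <= 3/4 * r} x \<partial>lebesgue)
        <= C / e ^ DIM('a) * (\<integral>x. w x * indicator (cball x0 e) x \<partial>lebesgue)"
      using annulus_le_ball[OF r] by blast
    have "x1 \<notin> Z" if x1: "x1 \<in> ball x (r/4)" for x1
    proof
      assume "x1 \<in> Z"
      then obtain \<rho> where \<rho>: "\<rho> > 0" "AE y in lebesgue. y \<in> ball x1 \<rho> --> w y = 0" by (auto simp: Z_def)
      define e where "e = min (\<rho> / 2) (r / 2)"
      have e: "0 < e" "e < r" "e < \<rho>" using r \<rho> by (auto simp: e_def)
      have sub: "cball x1 r \<subseteq> \<Omega>"
      proof
        fix v assume "v \<in> cball x1 r"
        then have "dist x v < d" using x1 r dist_triangle[of x v x1] by (auto simp: r_def)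
        then show "v \<in> \<Omega>" using d(2) by auto
      qed
      let ?A = "{x. e < dist x1 x & dist x1 x <= 3/4 * r}"
      have z: "AE y in lebesgue. y \<in> cball x1 e --> w y = 0"
        using \<rho>(2) by eventually_elim (use e in auto)
      have "(\<integral>x. w x * indicator (cball x1 e) x \<partial>lebesgue) = 0"
        by (rule integral_eq_zero_AE) (use z in \<open>eventually_elim, auto simp: indicator_def\<close>)
      then have le: "(\<integral>x. w x * indicator ?A x \<partial>lebesgue) <= 0" using C(2)[OF e(1,2) sub] by simp
      have "?A = cball x1 (3/4 * r) - cball x1 e" by auto
      then have "?A \<in> sets lebesgue" by simp
      then have "AE x in lebesgue. x \<in> ?A --> w x = 0"
        by (intro integral_zero_AE[OF w_integrable_subset[OF compact_cball sub] le]) (use r in auto)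
      with z have "AE y in lebesgue. y \<in> ball x (r/2) --> w y = 0"
      proof eventually_elim
        case (elim y)
        have "dist x1 y <= dist x1 x + dist x y" by (rule dist_triangle)
        then show ?case using elim x1 by (auto simp: dist_commute)
      qed
      then have "x \<in> Z" using x r unfolding Z_def by (auto intro!: exI[of _ "r/2"])
      then show False using x by blast
    qed
    then have "ball x (min (r/4) d) \<subseteq> \<Omega> - Z" using d by auto
    then show "\<exists>e>0. ball x e \<subseteq> \<Omega> - Z" using r d by (intro exI[of _ "min (r/4) d"]) auto
  qed
  moreover have "Z ~= {}" using x r bad by (auto simp: Z_def)
  ultimately have "\<Omega> - Z = {}"
    using connectedD[OF conn opZ, of "\<Omega> - Z"] by (auto simp: Z_def)
  then have all: "!!x. x \<in> \<Omega> ==> \<exists>r>0. AE y in lebesgue. y \<in> ball x r --> w y = 0" by (auto simp: Z_def)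
  define F where "F = {ball x r | x r. x \<in> \<Omega> & r > 0 & (AE y in lebesgue. y \<in> ball x r --> w y = 0)}"
  obtain F' where F': "F' \<subseteq> F" "countable F'" "\<Union>F' = \<Union>F"
    using Lindelof[of F] by (auto simp: F_def)
  have "AE y in lebesgue. \<forall>B\<in>F'. y \<in> B --> w y = 0"
    using F' by (subst AE_ball_countable) (auto simp: F_def)
  then have "AE y in lebesgue. w y = 0"
  proof eventually_elim
    case (elim y)
    show ?case
    proof (cases "y \<in> \<Omega>")
      case True
      then obtain r where "r > 0" "AE v in lebesgue. v \<in> ball y r --> w v = 0" using all by blast
      then have "y \<in> \<Union>F" unfolding F_def using True centre_in_ball by blast
      then show ?thesis using elim F'(3) by blast
    qed (rule w_zero)
  qed
  then show False using nz by blast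
qed

lemma ball_mass_lower_bound:
  assumes conn: "connected \<Omega>" and nz: "\<not> (AE x in lebesgue. w x = 0)"
    and K: "compact K" "K \<subseteq> \<Omega>"
  obtains c r where "c > 0" "r > 0"
    "!!x e. x \<in> K ==> 0 < e ==> e < r ==> c * e ^ DIM('a) <= (\<integral>y. w y * indicator (cball x e) y \<partial>lebesgue)"
proof -
  obtain d where d: "d > 0" "!!x. x \<in> K ==> cball x d \<subseteq> \<Omega>"
  proof (cases "\<Omega> = UNIV")
    case False
    obtain d where "d > 0" "\<forall>x\<in>K. \<forall>y\<in>- \<Omega>. d <= dist x y"
      using separate_compact_closed[of K "- \<Omega>"] K open_\<Omega> by auto
    then show ?thesis by (intro that[of "d/2"]) (force simp: subset_iff)+
  qed (use that[of 1] in auto)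
  obtain e0 :: 'a where e0: "norm e0 = 1" using norm_Basis SOME_Basis by blast
  define \<delta> where "\<delta> = d / 100"
  have \<delta>: "\<delta> > 0" using d by (simp add: \<delta>_def)
  obtain C where C: "C > 0" "!!x0 e. 0 < e ==> e < d ==> cball x0 d \<subseteq> \<Omega> ==>
      (\<integral>x. w x * indicator {x. e < dist x0 x & dist x0 x <= 3/4 * d} x \<partial>lebesgue)
        <= C / e ^ DIM('a) * (\<integral>x. w x * indicator (cball x0 e) x \<partial>lebesgue)"
    using annulus_le_ball[OF d(1)] by blast
  obtain T where T: "T \<subseteq> K" "finite T" "K \<subseteq> (\<Union>z\<in>T. ball z \<delta>)"
    using compactE_image[OF K(1), of K "%z. ball z \<delta>"] \<delta> by (metis UN_I centre_in_ball open_ball subsetI)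
  let ?B = "%z. ball (z + (d/2) *\<^sub>R e0) \<delta>"
  define m where "m = Min (insert 1 ((%z. \<integral>x. w x * indicator (?B z) x \<partial>lebesgue) ` T))"
  have sub: "?B z \<subseteq> cball z d" for z
  proof
    fix v assume "v \<in> ?B z"
    then have "dist (z + (d/2) *\<^sub>R e0) v < \<delta>" by simp
    moreover have "dist z (z + (d/2) *\<^sub>R e0) = d/2" using d e0 by (simp add: dist_norm)
    ultimately show "v \<in> cball z d" using dist_triangle[of z v "z + (d/2) *\<^sub>R e0"] d(1) by (simp add: \<delta>_def)
  qed
  have int: "integrable lebesgue (%x. w x * indicator (?B z) x)" if "z \<in> T" for z
    by (rule w_integrable_subset[OF compact_cball _ sub[of z]]) (use d(2)[of z] T(1) that in auto)
  have "(\<integral>x. w x * indicator (?B z) x \<partial>lebesgue) > 0" if z: "z \<in> T" for z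
  proof (rule ccontr)
    assume "\<not> ?thesis"
    then have "AE x in lebesgue. x \<in> ?B z --> w x = 0" by (intro integral_zero_AE int z) auto
    moreover have "z + (d/2) *\<^sub>R e0 \<in> \<Omega>" using sub[of z] d(2)[of z] T(1) z \<delta> by (meson centre_in_ball subsetD)
    ultimately show False using zero_or_positive_on_balls[OF conn nz _ \<delta>] by blast
  qed
  then have m: "m > 0" unfolding m_def using T(2) by (subst Min_gr_iff) auto
  show ?thesis
  proof (rule that[of "m / C" "d / 4"])
    fix x e assume x: "x \<in> K" and e: "0 < e" "e < d / 4"
    obtain z where z: "z \<in> T" "dist z x < \<delta>" using T(3) x by auto
    let ?A = "{y. e < dist x y & dist x y <= 3/4 * d}"
    have BA: "?B z \<subseteq> ?A"
    proof
      fix v assume "v \<in> ?B z"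
      then have a: "dist (z + (d/2) *\<^sub>R e0) v < \<delta>" by simp
      have b: "dist z (z + (d/2) *\<^sub>R e0) = d/2" using d e0 by (simp add: dist_norm)
      have "dist z v <= d/2 + \<delta>" using dist_triangle[of z v "z + (d/2) *\<^sub>R e0"] a b by simp
      moreover have "d/2 <= dist z v + \<delta>"
        using dist_triangle[of z "z + (d/2) *\<^sub>R e0" v] a b by (simp add: dist_commute)
      moreover have "dist x v <= dist z x + dist z v" "dist z v <= dist z x + dist x v"
        using dist_triangle[of x v z] dist_triangle[of z v x] by (simp_all add: dist_commute)
      ultimately show "v \<in> ?A" using z(2) e \<delta> d(1) by (auto simp: \<delta>_def)
    qed
    have "?A = cball x (3/4 * d) - cball x e" by auto
    then have "?A \<in> sets lebesgue" by simp
    then have iA: "integrable lebesgue (%y. w y * indicator ?A y)"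
      by (intro w_integrable_subset[OF compact_cball d(2)[OF x]]) (use d in auto)
    have "m <= (\<integral>y. w y * indicator (?B z) y \<partial>lebesgue)" unfolding m_def using T(2) z(1) by (intro Min_le) auto
    also have "\<dots> <= (\<integral>y. w y * indicator ?A y \<partial>lebesgue)"
      by (rule integral_mono[OF int[OF z(1)] iA]) (use BA w_nonneg in \<open>auto simp: indicator_def\<close>)
    also have "\<dots> <= C / e ^ DIM('a) * (\<integral>y. w y * indicator (cball x e) y \<partial>lebesgue)"
      by (rule C(2)[OF e(1) _ d(2)[OF x]]) (use e d in auto)
    finally show "m / C * e ^ DIM('a) <= (\<integral>y. w y * indicator (cball x e) y \<partial>lebesgue)"
      using C(1) e by (simp add: field_simps)
  qed (use m C d in auto)
qed

end

section \<open>Functions of small Rayleigh quotient do not concentrate\<close>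

lemma square_increment_le:
  fixes k k' :: "real => real"
  assumes d: "!!t. t \<in> {0..1} ==> (k has_real_derivative k' t) (at t)" and c: "continuous_on {0..1} k'"
  shows "ennreal ((k 1 - k 0)\<^sup>2) <= (\<integral>\<^sup>+t. ennreal ((k' t)\<^sup>2) * indicator {0..1} t \<partial>lborel)"
proof -
  have i1: "integrable lborel (%t. k' t * indicator {0..1} t)"
    using borel_integrable_compact[of "{0..1::real}" k'] c by (simp add: mult.commute)
  have i2: "integrable lborel (%t. (k' t)\<^sup>2 * indicator {0..1} t)"
    using borel_integrable_compact[of "{0..1::real}" "%t. (k' t)\<^sup>2"] c by (simp add: mult.commute continuous_on_power)
  have i0: "integrable lborel (%t::real. indicator {0..1} t :: real)" by simp
  define a where "a = k 1 - k 0"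
  have "(\<integral>t. indicator {0..1} t *\<^sub>R k' t \<partial>lborel) = k 1 - k 0"
  proof (rule integral_FTC_Icc)
    show "(k has_vector_derivative k' x) (at x within {0..1})" if "0 <= x" "x <= 1" for x
      using d[of x] that by (auto simp: has_real_derivative_iff_has_vector_derivative intro: has_vector_derivative_at_within)
  qed (use c in auto)
  then have F: "(\<integral>t. k' t * indicator {0..1} t \<partial>lborel) = a" by (simp add: a_def mult.commute)
  have "0 <= (\<integral>t. (k' t - a)\<^sup>2 * indicator {0..1} t \<partial>lborel)" by (rule integral_nonneg_AE) auto
  also have "(%t. (k' t - a)\<^sup>2 * indicator {0..1} t) = (%t. (k' t)\<^sup>2 * indicator {0..1} t - 2 * a * (k' t * indicator {0..1} t) + a\<^sup>2 * indicator {0..1} t)"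
    by (auto simp: fun_eq_iff power2_eq_square algebra_simps)
  also have "(\<integral>t. \<dots> t \<partial>lborel) = (\<integral>t. (k' t)\<^sup>2 * indicator {0..1} t \<partial>lborel) - 2 * a * a + a\<^sup>2"
    using i0 i1 i2 F by simp
  finally have "a\<^sup>2 <= (\<integral>t. (k' t)\<^sup>2 * indicator {0..1} t \<partial>lborel)" by (simp add: power2_eq_square)
  also have "ennreal \<dots> = (\<integral>\<^sup>+t. ennreal ((k' t)\<^sup>2 * indicator {0..1} t) \<partial>lborel)"
    by (rule nn_integral_eq_integral[OF i2, symmetric]) auto
  also have "\<dots> = (\<integral>\<^sup>+t. ennreal ((k' t)\<^sup>2) * indicator {0..1} t \<partial>lborel)"
    by (intro nn_integral_cong) (auto simp: indicator_def)
  finally show ?thesis by (simp add: a_def ennreal_leI)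
qed

lemma square_difference_le:
  fixes \<Psi> :: "'a::euclidean_space => real"
  assumes \<Psi>: "smooth_on (UNIV - {0}) \<Psi>" and seg: "!!t. t \<in> {0..1} ==> x + t *\<^sub>R z ~= 0"
  shows "ennreal ((\<Psi> (x + z) - \<Psi> x)\<^sup>2) <= (\<integral>\<^sup>+t. ennreal ((norm z)\<^sup>2 * grad_sq \<Psi> (x + t *\<^sub>R z)) * indicator {0..1} t \<partial>lborel)"
proof -
  have op: "open (UNIV - {0::'a})" by (simp add: open_delete)
  define k' where "k' = (%t. dderiv [z] \<Psi> (x + t *\<^sub>R z))"
  have d: "((%t. \<Psi> (x + t *\<^sub>R z)) has_real_derivative k' t) (at t)" if "t \<in> {0..1}" for t
  proof -
    have D: "(\<Psi> has_derivative (%v. dderiv [v] \<Psi> (x + t *\<^sub>R z))) (at (x + t *\<^sub>R z))"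
      by (rule smooth_on_has_derivative[OF \<Psi> op]) (use seg that in auto)
    have "((%t. \<Psi> (x + t *\<^sub>R z)) has_derivative (%h. dderiv [h *\<^sub>R z] \<Psi> (x + t *\<^sub>R z))) (at t)"
      by (rule has_derivative_compose[where f="%t. x + t *\<^sub>R z" and g=\<Psi>, OF _ D]) (auto intro!: derivative_eq_intros)
    then show ?thesis
      unfolding linear_cmul[OF has_derivative_linear[OF D]] has_field_derivative_def k'_def
      by (simp add: mult.commute[of _ "frechet_derivative _ _ _"])
  qed
  have c: "continuous_on {0..1} k'"
    unfolding k'_def
    by (rule continuous_on_compose2[OF smooth_on_continuous[OF smooth_on_D[OF \<Psi>]]])
       (use seg in \<open>auto intro!: continuous_intros\<close>)
  have "ennreal ((\<Psi> (x + z) - \<Psi> x)\<^sup>2) <= (\<integral>\<^sup>+t. ennreal ((k' t)\<^sup>2) * indicator {0..1} t \<partial>lborel)"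
    using square_increment_le[of "%t. \<Psi> (x + t *\<^sub>R z)", OF d c] by simp
  also have "\<dots> <= (\<integral>\<^sup>+t. ennreal ((norm z)\<^sup>2 * grad_sq \<Psi> (x + t *\<^sub>R z)) * indicator {0..1} t \<partial>lborel)"
  proof (rule nn_integral_mono)
    fix t :: real
    have "(k' t)\<^sup>2 <= (norm z)\<^sup>2 * grad_sq \<Psi> (x + t *\<^sub>R z)" if "t \<in> {0..1}"
    proof -
      have "(k' t)\<^sup>2 = (\<Sum>i\<in>Basis. (z \<bullet> i) * dderiv [i] \<Psi> (x + t *\<^sub>R z))\<^sup>2"
        unfolding k'_def by (subst dderiv_basis_expansion[OF op _ \<Psi>]) (use seg that in auto)
      also have "\<dots> <= (\<Sum>i\<in>Basis. (z \<bullet> i)\<^sup>2) * (\<Sum>i\<in>Basis. (dderiv [i] \<Psi> (x + t *\<^sub>R z))\<^sup>2)"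
        by (rule Cauchy_Schwarz_ineq_sum)
      also have "(\<Sum>i\<in>Basis. (z \<bullet> i)\<^sup>2) = (norm z)\<^sup>2"
      proof -
        have "(\<Sum>i\<in>Basis. (z \<bullet> i)\<^sup>2) = (\<Sum>i\<in>Basis. (z \<bullet> i) * (z \<bullet> i))" by (simp only: power2_eq_square)
        also have "\<dots> = (norm z)\<^sup>2" unfolding sum_Basis_inner by (rule power2_norm_eq_inner[symmetric])
        finally show ?thesis .
      qed
      finally show ?thesis by (simp add: grad_sq_def)
    qed
    then show "ennreal ((k' t)\<^sup>2) * indicator {0..1} t <= ennreal ((norm z)\<^sup>2 * grad_sq \<Psi> (x + t *\<^sub>R z)) * indicator {0..1} t"
      by (auto simp: indicator_def intro!: ennreal_leI)
  qed
  finally show ?thesis .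
qed

definition shell :: "real => real => 'a::euclidean_space set" where
  "shell a b = {x. a < norm x & norm x < b}"

lemma shell_measurable [measurable]: "shell a b \<in> sets borel"
  unfolding shell_def by measurable

lemma shell_factor:
  assumes "0 < a" "a < b"
  shows "\<exists>c>0. \<forall>g :: 'a::euclidean_space => ennreal. g \<in> borel_measurable borel -->
    (\<integral>\<^sup>+x. indicator (shell a b) x * g (sgn x) \<partial>lborel) = ennreal c * (\<integral>\<^sup>+x. g (sgn x) * indicator (ball 0 1) x \<partial>lborel)"
proof -
  define I where "I = of_nat DIM('a) * (\<integral>\<^sup>+r. ennreal (r ^ (DIM('a) - 1)) * indicator {0<..} r * indicator {a<..<b} r \<partial>lborel)"
  have eq: "(\<integral>\<^sup>+x. indicator (shell a b) x * g (sgn x) \<partial>lborel) = I * (\<integral>\<^sup>+x. g (sgn x) * indicator (ball 0 1) x \<partial>lborel)"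
    if [measurable]: "g \<in> borel_measurable borel" for g :: "'a => ennreal"
  proof -
    have "(\<integral>\<^sup>+x. indicator (shell a b) x * g (sgn x) \<partial>lborel) = (\<integral>\<^sup>+x. indicator {a<..<b} (norm x) * g (sgn x) \<partial>lborel)"
      by (intro nn_integral_cong) (auto simp: shell_def indicator_def)
    also have "\<dots> = I * (\<integral>\<^sup>+x. g (sgn x) * indicator (ball 0 1) x \<partial>lborel)"
      unfolding I_def by (rule nn_integral_polar_product) measurable
    finally show ?thesis .
  qed
  have fin: "I < \<infinity>"
  proof -
    have "(\<integral>\<^sup>+r. ennreal (r ^ (DIM('a) - 1)) * indicator {0<..} r * indicator {a<..<b} r \<partial>lborel)
      <= (\<integral>\<^sup>+r. ennreal (b ^ (DIM('a) - 1)) * indicator {a<..<b} r \<partial>lborel)"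
      using assms by (intro nn_integral_mono) (auto simp: indicator_def intro!: ennreal_leI power_mono)
    also have "\<dots> < \<infinity>"
      using assms by (subst nn_integral_cmult_indicator) (auto intro!: ennreal_mult_less_top[THEN iffD2])
    finally show ?thesis unfolding I_def by (auto simp: ennreal_mult_less_top ennreal_of_nat_eq_real_of_nat)
  qed
  have "I ~= 0"
  proof
    assume "I = 0"
    then have "emeasure lborel (shell a b :: 'a set) = 0"
      using eq[of "%_. 1"] by simp
    then have "AE x in lborel. x \<notin> (shell a b :: 'a set)" by (simp add: AE_iff_measurable[OF _ refl])
    moreover have "open (shell a b :: 'a set)" unfolding shell_def by (intro open_Collect_conj open_Collect_less continuous_intros)
    moreover obtain e :: 'a where "norm e = 1" using norm_Basis SOME_Basis by blast
    then have "((a + b) / 2) *\<^sub>R e \<in> shell a b" using assms by (auto simp: shell_def)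
    ultimately show False using AE_open_nonempty by blast
  qed
  then have "enn2real I > 0" using fin by (simp add: enn2real_positive_iff zero_less_iff_neq_zero)
  moreover have "I = ennreal (enn2real I)" using fin by (simp add: less_top)
  ultimately show ?thesis using eq by (intro exI[of _ "enn2real I"]) simp
qed

lemma ennreal_two': "b >= 0 ==> ennreal (2 * b) = 2 * ennreal b"
  by (subst ennreal_mult') auto

lemma ennreal_two: "b >= 0 ==> c >= 0 ==> ennreal (2 * b + 2 * c) = 2 * ennreal b + 2 * ennreal c"
  by (subst ennreal_plus) (auto simp: ennreal_two')

lemma ennreal_mult3: "a >= 0 ==> b >= 0 ==> c >= 0 ==> ennreal (a * (b * c)) = ennreal a * (ennreal b * ennreal c)"
  by (simp add: ennreal_mult)

lemma mass_equiintegrable: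
  assumes \<Lambda>: "\<Lambda> >= 0"
  obtains \<delta> where "\<delta> > 0" "!!\<phi> B. smooth_on (UNIV - {0}) (%y::'a::euclidean_space. \<phi> (sgn y)) ==> dirichlet \<phi> <= \<Lambda> * mass \<phi> ==>
     B \<in> sets borel ==> (\<integral>\<^sup>+x. indicator B (sgn x) * indicator (ball 0 1) x \<partial>lborel) <= ennreal \<delta> ==>
     (\<integral>\<^sup>+x. ennreal ((\<phi> (sgn x))\<^sup>2) * indicator B (sgn x) * indicator (ball 0 1) x \<partial>lborel) <= ennreal (mass \<phi> / 2)"
proof -
  have "\<exists>c>0. \<forall>g :: 'a => ennreal. g \<in> borel_measurable borel -->
    (\<integral>\<^sup>+x. indicator (shell (1/2) 1) x * g (sgn x) \<partial>lborel) = ennreal c * (\<integral>\<^sup>+x. g (sgn x) * indicator (ball 0 1) x \<partial>lborel)"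
    by (rule shell_factor) auto
  then obtain c1 where c10: "c1 > 0" "\<forall>g :: 'a => ennreal. g \<in> borel_measurable borel -->
    (\<integral>\<^sup>+x. indicator (shell (1/2) 1) x * g (sgn x) \<partial>lborel) = ennreal c1 * (\<integral>\<^sup>+x. g (sgn x) * indicator (ball 0 1) x \<partial>lborel)"
    by (elim exE conjE)
  note c1 = c10(1) c10(2)[rule_format]
  have "\<exists>c>0. \<forall>g :: 'a => ennreal. g \<in> borel_measurable borel -->
    (\<integral>\<^sup>+x. indicator (shell (1/4) (5/4)) x * g (sgn x) \<partial>lborel) = ennreal c * (\<integral>\<^sup>+x. g (sgn x) * indicator (ball 0 1) x \<partial>lborel)"
    by (rule shell_factor) auto
  then obtain c2 where c20: "c2 > 0" "\<forall>g :: 'a => ennreal. g \<in> borel_measurable borel -->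
    (\<integral>\<^sup>+x. indicator (shell (1/4) (5/4)) x * g (sgn x) \<partial>lborel) = ennreal c2 * (\<integral>\<^sup>+x. g (sgn x) * indicator (ball 0 1) x \<partial>lborel)"
    by (elim exE conjE)
  note c2 = c20(1) c20(2)[rule_format]
  define h where "h = min (1/4) (sqrt (c1 / (128 * c2 * (\<Lambda> + 1))))"
  have h: "0 < h" "h <= 1/4" using c1 c2 \<Lambda> by (auto simp: h_def)
  have h2: "32 * h\<^sup>2 * c2 * \<Lambda> <= c1 / 4"
  proof -
    have pos: "128 * c2 * (\<Lambda> + 1) > 0" using c2(1) \<Lambda> by simp
    have "h\<^sup>2 <= (sqrt (c1 / (128 * c2 * (\<Lambda> + 1))))\<^sup>2" using h by (intro power_mono) (auto simp: h_def)
    also have "\<dots> = c1 / (128 * c2 * (\<Lambda> + 1))" using c1(1) pos by simp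
    finally have "h\<^sup>2 * (128 * c2 * (\<Lambda> + 1)) <= c1" by (simp only: pos_le_divide_eq[OF pos])
    then have "32 * h\<^sup>2 * c2 * (\<Lambda> + 1) <= c1 / 4" by simp
    moreover have "32 * h\<^sup>2 * c2 * \<Lambda> <= 32 * h\<^sup>2 * c2 * (\<Lambda> + 1)" using c2 by (intro mult_left_mono) auto
    ultimately show ?thesis by linarith
  qed
  define V where "V = unit_ball_vol DIM('a) * h ^ DIM('a)"
  have Vfin: "emeasure lborel (cball (0::'a) h) = ennreal V"
    unfolding V_def by (rule emeasure_cball) (use h in simp)
  have V: "V > 0" using h by (simp add: V_def)
  define \<delta> where "\<delta> = V / (8 * c2)"
  show ?thesis
  proof (rule that[of \<delta>])
    show "\<delta> > 0" using V c2 by (simp add: \<delta>_def)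
    fix \<phi> :: "'a => real" and B :: "'a set"
    assume sm: "smooth_on (UNIV - {0}) (%y. \<phi> (sgn y))" and le: "dirichlet \<phi> <= \<Lambda> * mass \<phi>" and B[measurable]: "B \<in> sets borel"
      and small: "(\<integral>\<^sup>+x. indicator B (sgn x) * indicator (ball 0 1) x \<partial>lborel) <= ennreal \<delta>"
    define \<Psi> where "\<Psi> = (%y. \<phi> (sgn y))"
    have \<Psi>a: "\<phi> (sgn y) = \<Psi> y" for y by (simp add: \<Psi>_def)
    have hs: "\<Psi> (sgn x) = \<Psi> x" for x by (simp add: \<Psi>_def sgn_sgn_vector)
    note sm' = sm[unfolded \<Psi>a]
    have dir: "dirichlet \<phi> = sphere_integral (grad_sq \<Psi>)" unfolding dirichlet_def \<Psi>a ..
    have mas: "mass \<phi> = sphere_integral (%x. (\<Psi> x)\<^sup>2)" unfolding mass_def \<Psi>a ..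
    have [measurable]: "cball (0::'a) h \<in> sets borel" by simp
    define G where "G = (%x. if x = 0 then 0 else grad_sq \<Psi> x)"
    note sm2 = hom_smooth[OF sm, unfolded \<Psi>a] and me = hom_measurable[OF sm, unfolded \<Psi>a]
    note [measurable] = me smooth_on_borel_measurable[OF sm']
    have [measurable]: "G \<in> borel_measurable borel" unfolding G_def by measurable
    have G0: "G x >= 0" for x by (simp add: G_def grad_sq_nonneg)
    obtain C1 where C1: "!!x. norm x = 1 ==> \<bar>grad_sq \<Psi> x\<bar> <= C1"
      using continuous_bounded_on_sphere[OF smooth_on_continuous[OF sm2(1)]] by blast
    obtain C2 where C2: "!!x. norm x = 1 ==> \<bar>(\<Psi> x)\<^sup>2\<bar> <= C2"
      using continuous_bounded_on_sphere[OF smooth_on_continuous[OF sm2(2)]] by blast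
    have SM: "(\<integral>\<^sup>+x. ennreal ((\<Psi> (sgn x))\<^sup>2) * indicator (ball 0 1) x \<partial>lborel) = ennreal (mass \<phi>)"
      unfolding mas by (rule nn_sphere_integral[OF me(2) C2]) auto
    have SD: "(\<integral>\<^sup>+x. ennreal (grad_sq \<Psi> (sgn x)) * indicator (ball 0 1) x \<partial>lborel) = ennreal (dirichlet \<phi>)"
      unfolding dir by (rule nn_sphere_integral[OF me(1) C1]) (auto simp: grad_sq_nonneg)
    let ?S1 = "shell (1/2) 1 :: 'a set" and ?S2 = "shell (1/4) (5/4) :: 'a set"
    have M2: "(\<integral>\<^sup>+x. indicator ?S2 x * ennreal ((\<Psi> x)\<^sup>2) \<partial>lborel) = ennreal (c2 * mass \<phi>)"
      using c2(2)[of "%x. ennreal ((\<Psi> x)\<^sup>2)"] SM c2(1) by (simp add: hs ennreal_mult')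
    have D2: "(\<integral>\<^sup>+x. indicator ?S2 x * ennreal (G x) \<partial>lborel) <= ennreal (16 * c2 * dirichlet \<phi>)"
    proof -
      have "(\<integral>\<^sup>+x. indicator ?S2 x * ennreal (G x) \<partial>lborel) <= (\<integral>\<^sup>+x. 16 * (indicator ?S2 x * ennreal (grad_sq \<Psi> (sgn x))) \<partial>lborel)"
      proof (rule nn_integral_mono)
        fix x :: 'a
        show "indicator ?S2 x * ennreal (G x) <= 16 * (indicator ?S2 x * ennreal (grad_sq \<Psi> (sgn x)))"
        proof (cases "x \<in> ?S2")
          case True
          then have n: "norm x > 1/4" by (simp add: shell_def)
          then have x: "x ~= 0" by auto
          have "(norm x)\<^sup>2 * grad_sq \<Psi> x = grad_sq \<Psi> (sgn x)"
            by (rule homogeneous_grad_sq[OF _ x sm']) (simp add: hs)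
          moreover have "(1/4)\<^sup>2 * grad_sq \<Psi> x <= (norm x)\<^sup>2 * grad_sq \<Psi> x"
            using n by (intro mult_right_mono power_mono) (auto simp: grad_sq_nonneg)
          ultimately have "G x <= 16 * grad_sq \<Psi> (sgn x)" using x by (simp add: G_def power2_eq_square)
          then show ?thesis using True ennreal_leI[of "G x" "16 * grad_sq \<Psi> (sgn x)"] by (simp add: ennreal_mult' ennreal_numeral)
        qed simp
      qed
      also have "\<dots> = 16 * (ennreal c2 * ennreal (dirichlet \<phi>))"
        using c2(2)[of "%x. ennreal (grad_sq \<Psi> x)"] SD by (subst nn_integral_cmult) auto
      also have "\<dots> = ennreal (16 * c2 * dirichlet \<phi>)"
        using c2(1) by (simp add: ennreal_mult' ennreal_numeral mult.assoc dirichlet_nonneg)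
      finally show ?thesis .
    qed
    let ?A = "%x. indicator ?S1 x * indicator B (sgn x) :: ennreal"
    let ?Z = "%z. indicator (cball (0::'a) h) z :: ennreal"
    define I where "I = (\<integral>\<^sup>+x. ?A x * ennreal ((\<Psi> x)\<^sup>2) \<partial>lborel)"
    have I_eq: "I = ennreal c1 * (\<integral>\<^sup>+x. ennreal ((\<Psi> x)\<^sup>2) * indicator B (sgn x) * indicator (ball 0 1) x \<partial>lborel)"
      unfolding I_def using c1(2)[of "%x. ennreal ((\<Psi> x)\<^sup>2) * indicator B x"] by (simp add: hs ac_simps)
    have A_eq: "(\<integral>\<^sup>+x. ?A x \<partial>lborel) <= ennreal (c1 * \<delta>)"
      using c1(2)[of "indicator B"] mult_left_mono[OF small, of "ennreal c1"] c1(1) by (simp add: ennreal_mult')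
    have S12: "x + v \<in> ?S2" if "x \<in> ?S1" "norm v <= h" for x v
      using that h norm_triangle_ineq[of x v] norm_diff_ineq[of x v] by (auto simp: shell_def)
    have pt: "?Z z * (?A x * ennreal ((\<Psi> x)\<^sup>2)) \<le>
        2 * (?Z z * (\<integral>\<^sup>+t. ennreal (h\<^sup>2) * (indicator {0..1} t * (indicator ?S1 x * ennreal (G (x + t *\<^sub>R z)))) \<partial>lborel))
        + 2 * (?A x * (?Z z * (indicator ?S2 (x + z) * ennreal ((\<Psi> (x + z))\<^sup>2))))" for x z :: 'a
    proof (cases "z \<in> cball 0 h & x \<in> ?S1 & sgn x \<in> B")
      case True
      then have z: "norm z <= h" by simp
      have seg: "x + t *\<^sub>R z \<in> ?S2" if "t \<in> {0..1}" for t
      proof (rule S12)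
        have "norm (t *\<^sub>R z) <= 1 * norm z" using that mult_left_le_one_le[of "norm z" t] by simp
        then show "norm (t *\<^sub>R z) <= h" using z by simp
      qed (use True in simp)
      have nz: "x + t *\<^sub>R z ~= 0" if "t \<in> {0..1}" for t using seg[OF that] by (auto simp: shell_def)
      have "(\<Psi> x)\<^sup>2 <= 2 * (\<Psi> (x + z) - \<Psi> x)\<^sup>2 + 2 * (\<Psi> (x + z))\<^sup>2"
        using zero_le_power2[of "\<Psi> x - 2 * \<Psi> (x + z)"] by (simp add: power2_eq_square algebra_simps)
      then have "ennreal ((\<Psi> x)\<^sup>2) <= 2 * ennreal ((\<Psi> (x + z) - \<Psi> x)\<^sup>2) + 2 * ennreal ((\<Psi> (x + z))\<^sup>2)"
        by (subst ennreal_two[symmetric], simp, simp, rule ennreal_leI)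
      also have "ennreal ((\<Psi> (x + z) - \<Psi> x)\<^sup>2) <= (\<integral>\<^sup>+t. ennreal ((norm z)\<^sup>2 * grad_sq \<Psi> (x + t *\<^sub>R z)) * indicator {0..1} t \<partial>lborel)"
        by (rule square_difference_le[OF sm' nz])
      also have "\<dots> <= (\<integral>\<^sup>+t. ennreal (h\<^sup>2) * (indicator {0..1} t * (indicator ?S1 x * ennreal (G (x + t *\<^sub>R z)))) \<partial>lborel)"
      proof (rule nn_integral_mono)
        fix t :: real
        have "(norm z)\<^sup>2 * grad_sq \<Psi> (x + t *\<^sub>R z) <= h\<^sup>2 * G (x + t *\<^sub>R z)" if "t \<in> {0..1}"
          using nz[OF that] z by (auto simp: G_def grad_sq_nonneg intro!: mult_right_mono power_mono)
        then show "ennreal ((norm z)\<^sup>2 * grad_sq \<Psi> (x + t *\<^sub>R z)) * indicator {0..1} t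
          <= ennreal (h\<^sup>2) * (indicator {0..1} t * (indicator ?S1 x * ennreal (G (x + t *\<^sub>R z))))"
          using True by (auto simp: indicator_def ennreal_leI simp flip: ennreal_mult')
      qed
      finally show ?thesis using True seg[of 1] by (simp add: mult_left_mono)
    qed auto
    have Zint: "(\<integral>\<^sup>+z. ?Z z * c \<partial>lborel) = ennreal V * c" for c
      by (subst nn_integral_multc) (simp_all add: Vfin)
    have in0: "(\<integral>\<^sup>+x. ?Z z * (?A x * ennreal ((\<Psi> x)\<^sup>2)) \<partial>lborel) = ?Z z * I" for z
      unfolding I_def by (rule nn_integral_cmult) measurable
    define F1 where "F1 = (%(z::'a) (x::'a). 2 * (?Z z * (\<integral>\<^sup>+t. ennreal (h\<^sup>2) * (indicator {0..1} t * (indicator ?S1 x * ennreal (G (x + t *\<^sub>R z)))) \<partial>lborel)))"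
    define F2 where "F2 = (%(z::'a) (x::'a). 2 * (?A x * (?Z z * (indicator ?S2 (x + z) * ennreal ((\<Psi> (x + z))\<^sup>2)))))"
    have in1: "(\<integral>\<^sup>+x. F1 z x + F2 z x \<partial>lborel) = (\<integral>\<^sup>+x. F1 z x \<partial>lborel) + (\<integral>\<^sup>+x. F2 z x \<partial>lborel)" for z
      unfolding F1_def F2_def by (rule nn_integral_add; measurable)
    have in2: "(\<integral>\<^sup>+z. (\<integral>\<^sup>+x. F1 z x \<partial>lborel) + (\<integral>\<^sup>+x. F2 z x \<partial>lborel) \<partial>lborel)
        = (\<integral>\<^sup>+z. (\<integral>\<^sup>+x. F1 z x \<partial>lborel) \<partial>lborel) + (\<integral>\<^sup>+z. (\<integral>\<^sup>+x. F2 z x \<partial>lborel) \<partial>lborel)"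
      unfolding F1_def F2_def by (rule nn_integral_add; measurable)
    have "ennreal V * I = (\<integral>\<^sup>+z. \<integral>\<^sup>+x. ?Z z * (?A x * ennreal ((\<Psi> x)\<^sup>2)) \<partial>lborel \<partial>lborel)"
      unfolding in0 by (rule Zint[symmetric])
    also have "\<dots> <= (\<integral>\<^sup>+z. \<integral>\<^sup>+x. 2 * (?Z z * (\<integral>\<^sup>+t. ennreal (h\<^sup>2) * (indicator {0..1} t * (indicator ?S1 x * ennreal (G (x + t *\<^sub>R z)))) \<partial>lborel))
        + 2 * (?A x * (?Z z * (indicator ?S2 (x + z) * ennreal ((\<Psi> (x + z))\<^sup>2)))) \<partial>lborel \<partial>lborel)"
      by (intro nn_integral_mono pt)
    also have "\<dots> = (\<integral>\<^sup>+z. \<integral>\<^sup>+x. 2 * (?Z z * (\<integral>\<^sup>+t. ennreal (h\<^sup>2) * (indicator {0..1} t * (indicator ?S1 x * ennreal (G (x + t *\<^sub>R z)))) \<partial>lborel)) \<partial>lborel \<partial>lborel)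
        + (\<integral>\<^sup>+z. \<integral>\<^sup>+x. 2 * (?A x * (?Z z * (indicator ?S2 (x + z) * ennreal ((\<Psi> (x + z))\<^sup>2)))) \<partial>lborel \<partial>lborel)"
      using in2 unfolding in1[symmetric] unfolding F1_def F2_def .
    finally have X0: "ennreal V * I <= (\<integral>\<^sup>+z. \<integral>\<^sup>+x. 2 * (?Z z * (\<integral>\<^sup>+t. ennreal (h\<^sup>2) * (indicator {0..1} t * (indicator ?S1 x * ennreal (G (x + t *\<^sub>R z)))) \<partial>lborel)) \<partial>lborel \<partial>lborel)
        + (\<integral>\<^sup>+z. \<integral>\<^sup>+x. 2 * (?A x * (?Z z * (indicator ?S2 (x + z) * ennreal ((\<Psi> (x + z))\<^sup>2)))) \<partial>lborel \<partial>lborel)" .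
    have "(\<integral>\<^sup>+z. \<integral>\<^sup>+x. 2 * (?Z z * (\<integral>\<^sup>+t. ennreal (h\<^sup>2) * (indicator {0..1} t * (indicator ?S1 x * ennreal (G (x + t *\<^sub>R z)))) \<partial>lborel)) \<partial>lborel \<partial>lborel)
        <= (\<integral>\<^sup>+z. ?Z z * ennreal (2 * h\<^sup>2 * (16 * c2 * dirichlet \<phi>)) \<partial>(lborel::'a measure))"
    proof (rule nn_integral_mono)
      fix z :: 'a
      show "(\<integral>\<^sup>+x. 2 * (?Z z * (\<integral>\<^sup>+t. ennreal (h\<^sup>2) * (indicator {0..1} t * (indicator ?S1 x * ennreal (G (x + t *\<^sub>R z)))) \<partial>lborel)) \<partial>lborel)
        <= ?Z z * ennreal (2 * h\<^sup>2 * (16 * c2 * dirichlet \<phi>))"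
      proof (cases "norm z <= h")
        case True
        have "(\<integral>\<^sup>+x. (\<integral>\<^sup>+t. ennreal (h\<^sup>2) * (indicator {0..1} t * (indicator ?S1 x * ennreal (G (x + t *\<^sub>R z)))) \<partial>lborel) \<partial>lborel)
          = (\<integral>\<^sup>+t. (\<integral>\<^sup>+x. ennreal (h\<^sup>2) * (indicator {0..1} t * (indicator ?S1 x * ennreal (G (x + t *\<^sub>R z)))) \<partial>lborel) \<partial>lborel)"
          by (rule lborel_pair.Fubini') measurable
        also have "\<dots> = (\<integral>\<^sup>+t. ennreal (h\<^sup>2) * (indicator {0..1} t * (\<integral>\<^sup>+x. indicator ?S1 x * ennreal (G (x + t *\<^sub>R z)) \<partial>lborel)) \<partial>lborel)"
          by (intro nn_integral_cong) (simp add: nn_integral_cmult)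
        also have "\<dots> <= (\<integral>\<^sup>+(t::real). ennreal (h\<^sup>2) * (indicator {0..1} t * ennreal (16 * c2 * dirichlet \<phi>)) \<partial>lborel)"
        proof (rule nn_integral_mono)
          fix t :: real
          have "(\<integral>\<^sup>+x. indicator ?S1 x * ennreal (G (x + t *\<^sub>R z)) \<partial>lborel) <= ennreal (16 * c2 * dirichlet \<phi>)" if "t \<in> {0..1}"
          proof -
            have "norm (t *\<^sub>R z) <= 1 * norm z" using that mult_left_le_one_le[of "norm z" t] by simp
            then have tz: "norm (t *\<^sub>R z) <= h" using True by simp
            have "(\<integral>\<^sup>+x. indicator ?S1 x * ennreal (G (x + t *\<^sub>R z)) \<partial>lborel) <= (\<integral>\<^sup>+x. indicator ?S2 (x + t *\<^sub>R z) * ennreal (G (x + t *\<^sub>R z)) \<partial>lborel)"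
              using S12[OF _ tz] by (intro nn_integral_mono mult_right_mono) (auto simp: indicator_def)
            also have "\<dots> = (\<integral>\<^sup>+x. indicator ?S2 x * ennreal (G x) \<partial>lborel)"
              by (rule nn_integral_translation[of "%x. indicator ?S2 x * ennreal (G x)"]) measurable
            finally show ?thesis using D2 by (rule order_trans)
          qed
          then show "ennreal (h\<^sup>2) * (indicator {0..1} t * (\<integral>\<^sup>+x. indicator ?S1 x * ennreal (G (x + t *\<^sub>R z)) \<partial>lborel))
             <= ennreal (h\<^sup>2) * (indicator {0..1} t * ennreal (16 * c2 * dirichlet \<phi>))"
            by (auto simp: indicator_def intro!: mult_left_mono)
        qed
        also have "\<dots> = ennreal (h\<^sup>2) * ennreal (16 * c2 * dirichlet \<phi>)"
          by (simp add: nn_integral_cmult nn_integral_multc)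
        finally have "2 * (\<integral>\<^sup>+x. (\<integral>\<^sup>+t. ennreal (h\<^sup>2) * (indicator {0..1} t * (indicator ?S1 x * ennreal (G (x + t *\<^sub>R z)))) \<partial>lborel) \<partial>lborel)
           <= 2 * (ennreal (h\<^sup>2) * ennreal (16 * c2 * dirichlet \<phi>))" by (rule mult_left_mono) simp
        also have "\<dots> = ennreal (2 * h\<^sup>2 * (16 * c2 * dirichlet \<phi>))"
          using c2(1) dirichlet_nonneg[of \<phi>] ennreal_two'[of "h\<^sup>2 * (16 * c2 * dirichlet \<phi>)"]
          by (simp add: ennreal_mult mult.assoc)
        finally show ?thesis using True by (simp add: nn_integral_cmult)
      qed simp
    qed
    also have "\<dots> = ennreal V * ennreal (2 * h\<^sup>2 * (16 * c2 * dirichlet \<phi>))"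
      by (rule Zint)
    finally have X1: "(\<integral>\<^sup>+z. \<integral>\<^sup>+x. 2 * (?Z z * (\<integral>\<^sup>+t. ennreal (h\<^sup>2) * (indicator {0..1} t * (indicator ?S1 x * ennreal (G (x + t *\<^sub>R z)))) \<partial>lborel)) \<partial>lborel \<partial>lborel)
       <= ennreal V * ennreal (2 * h\<^sup>2 * (16 * c2 * dirichlet \<phi>))" .
    have "(\<integral>\<^sup>+z. \<integral>\<^sup>+x. 2 * (?A x * (?Z z * (indicator ?S2 (x + z) * ennreal ((\<Psi> (x + z))\<^sup>2)))) \<partial>lborel \<partial>lborel)
       = (\<integral>\<^sup>+x. \<integral>\<^sup>+z. 2 * (?A x * (?Z z * (indicator ?S2 (x + z) * ennreal ((\<Psi> (x + z))\<^sup>2)))) \<partial>lborel \<partial>lborel)"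
      by (rule lborel_pair.Fubini') measurable
    also have "\<dots> <= (\<integral>\<^sup>+x. ?A x * ennreal (2 * (c2 * mass \<phi>)) \<partial>lborel)"
    proof (rule nn_integral_mono)
      fix x :: 'a
      have "(\<integral>\<^sup>+z. ?Z z * (indicator ?S2 (x + z) * ennreal ((\<Psi> (x + z))\<^sup>2)) \<partial>lborel) <= (\<integral>\<^sup>+z. indicator ?S2 (z + x) * ennreal ((\<Psi> (z + x))\<^sup>2) \<partial>lborel)"
        by (intro nn_integral_mono) (auto simp: indicator_def add.commute)
      also have "\<dots> = (\<integral>\<^sup>+x. indicator ?S2 x * ennreal ((\<Psi> x)\<^sup>2) \<partial>lborel)"
        by (rule nn_integral_translation[of "%x. indicator ?S2 x * ennreal ((\<Psi> x)\<^sup>2)"]) measurable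
      finally have "2 * (?A x * (\<integral>\<^sup>+z. ?Z z * (indicator ?S2 (x + z) * ennreal ((\<Psi> (x + z))\<^sup>2)) \<partial>lborel)) <= 2 * (?A x * ennreal (c2 * mass \<phi>))"
        unfolding M2 by (intro mult_left_mono) auto
      also have "\<dots> = ?A x * ennreal (2 * (c2 * mass \<phi>))"
        using c2(1) mass_nonneg[of \<phi>] ennreal_two'[of "c2 * mass \<phi>"] by (simp only: ac_simps mult_nonneg_nonneg less_imp_le)
      finally show "(\<integral>\<^sup>+z. 2 * (?A x * (?Z z * (indicator ?S2 (x + z) * ennreal ((\<Psi> (x + z))\<^sup>2)))) \<partial>lborel) <= ?A x * ennreal (2 * (c2 * mass \<phi>))"
        by (simp add: nn_integral_cmult)
    qed
    also have "\<dots> = (\<integral>\<^sup>+x. ?A x \<partial>lborel) * ennreal (2 * (c2 * mass \<phi>))" by (rule nn_integral_multc) measurable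
    also have "\<dots> <= ennreal (c1 * \<delta>) * ennreal (2 * (c2 * mass \<phi>))" by (rule mult_right_mono[OF A_eq]) simp
    finally have X2: "(\<integral>\<^sup>+z. \<integral>\<^sup>+x. 2 * (?A x * (?Z z * (indicator ?S2 (x + z) * ennreal ((\<Psi> (x + z))\<^sup>2)))) \<partial>lborel \<partial>lborel)
       <= ennreal (c1 * \<delta>) * ennreal (2 * (c2 * mass \<phi>))" .
    note X0
    also note add_mono[OF X1 X2]
    also have "ennreal V * ennreal (2 * h\<^sup>2 * (16 * c2 * dirichlet \<phi>)) + ennreal (c1 * \<delta>) * ennreal (2 * (c2 * mass \<phi>)) = ennreal (V * (2 * h\<^sup>2 * (16 * c2 * dirichlet \<phi>)) + c1 * \<delta> * (2 * (c2 * mass \<phi>)))"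
      using V c1(1) c2(1) mass_nonneg[of \<phi>] dirichlet_nonneg[of \<phi>] by (simp add: \<delta>_def flip: ennreal_mult' ennreal_plus)
    also have "\<dots> <= ennreal (V * (c1 * (mass \<phi> / 2)))"
    proof (rule ennreal_leI)
      have "V * (2 * h\<^sup>2 * (16 * c2 * dirichlet \<phi>)) = V * (32 * h\<^sup>2 * c2 * dirichlet \<phi>)" by simp
      also have "\<dots> <= V * (32 * h\<^sup>2 * c2 * (\<Lambda> * mass \<phi>))" using V c2(1) le by (intro mult_left_mono) auto
      also have "\<dots> = V * ((32 * h\<^sup>2 * c2 * \<Lambda>) * mass \<phi>)" by simp
      also have "\<dots> <= V * ((c1 / 4) * mass \<phi>)" using V h2 mass_nonneg by (intro mult_left_mono mult_right_mono) auto
      finally have a: "V * (2 * h\<^sup>2 * (16 * c2 * dirichlet \<phi>)) <= V * ((c1 / 4) * mass \<phi>)" .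
      have b: "c1 * \<delta> * (2 * (c2 * mass \<phi>)) = V * ((c1 / 4) * mass \<phi>)" using c2(1) by (simp add: \<delta>_def)
      show "V * (2 * h\<^sup>2 * (16 * c2 * dirichlet \<phi>)) + c1 * \<delta> * (2 * (c2 * mass \<phi>)) <= V * (c1 * (mass \<phi> / 2))"
        using a unfolding b by (simp add: algebra_simps)
    qed
    also have "\<dots> = ennreal V * (ennreal c1 * ennreal (mass \<phi> / 2))"
      using V c1(1) by (intro ennreal_mult3) (auto simp: mass_nonneg)
    finally have "ennreal V * (ennreal c1 * (\<integral>\<^sup>+x. ennreal ((\<Psi> x)\<^sup>2) * indicator B (sgn x) * indicator (ball 0 1) x \<partial>lborel))
       <= ennreal V * (ennreal c1 * ennreal (mass \<phi> / 2))"
      unfolding I_eq .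
    then show "(\<integral>\<^sup>+x. ennreal ((\<phi> (sgn x))\<^sup>2) * indicator B (sgn x) * indicator (ball 0 1) x \<partial>lborel) <= ennreal (mass \<phi> / 2)"
      unfolding \<Psi>a
      using V c1(1) by (subst (asm) ennreal_mult_le_mult_iff; simp)+
  qed
qed

section \<open>Weights for the logarithmic radial variable\<close>

lemma flat_power_decay:
  assumes "a > 0" "y > 0"
  shows "flat y powr a * (inverse y)\<^sup>2 <= 2 / a\<^sup>2"
proof -
  let ?u = "inverse y"
  have u: "?u > 0" using assms by simp
  have e: "exp (a * ?u) >= (a * ?u)\<^sup>2 / 2"
  proof -
    have z: "a * ?u >= 0" using assms u by simp
    show ?thesis using exp_lower_Taylor_quadratic[OF z] z by linarith
  qed
  have "flat y powr a = exp (- (a * ?u))" using assms by (simp add: flat_def powr_def)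
  then have "flat y powr a * ?u\<^sup>2 = ?u\<^sup>2 / exp (a * ?u)" by (simp add: exp_minus divide_inverse mult.commute)
  also have "\<dots> <= ?u\<^sup>2 / ((a * ?u)\<^sup>2 / 2)" using e assms u by (intro divide_left_mono) auto
  also have "\<dots> = 2 / a\<^sup>2" using assms u by (simp add: power_mult_distrib)
  finally show ?thesis .
qed

lemma cutoff_young:
  assumes p: "p > 1" and W: "W >= 0" and y: "y > 0"
  defines "a \<equiv> 1 - 1 / p"
  shows "W * (flat y * (inverse y)\<^sup>2) <= (2 / a\<^sup>2) * (W powr p * flat y + 1)"
proof -
  have a: "a > 0" using p by (simp add: a_def)
  have f: "flat y > 0" using y by (rule flat_pos)
  let ?V = "W * flat y powr (1 / p)"
  have V0: "?V >= 0" using W by simp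
  have Vp: "?V powr p = W powr p * flat y" using W f p by (simp add: powr_mult powr_powr)
  have V: "?V <= W powr p * flat y + 1"
  proof (cases "?V <= 1")
    case True
    have "W powr p * flat y >= 0" using f by simp
    then show ?thesis using True by linarith
  next
    case False
    then have "?V powr 1 <= ?V powr p" using p by (intro powr_mono) auto
    then show ?thesis unfolding Vp using V0 by simp
  qed
  have "flat y = flat y powr (1 / p) * flat y powr a" using f by (simp add: a_def flip: powr_add)
  then have "W * (flat y * (inverse y)\<^sup>2) = ?V * (flat y powr a * (inverse y)\<^sup>2)" by (metis mult.assoc)
  also have "\<dots> <= (W powr p * flat y + 1) * (2 / a\<^sup>2)"
    using V V0 flat_power_decay[OF a y] by (intro mult_mono) auto
  finally show ?thesis by (simp add: mult.commute)
qed

lemma weight_exists: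
  assumes \<kappa>: "(\<kappa>::real) >= 0" and p: "p > 1"
  shows "\<exists>b>0. \<exists>m>0. \<forall>q. 0 < q & q <= 1/16 --> (\<forall>\<tau>>0. \<exists>(\<eta>::real => real) (\<eta>'::real => real) (\<eta>''::real => real) T.
     smooth_on UNIV \<eta> & (\<forall>t. (\<eta> has_real_derivative \<eta>' t) (at t)) & (\<forall>t. (\<eta>' has_real_derivative \<eta>'' t) (at t)) &
     (\<forall>t. \<eta> t >= 0) & T > 0 & (\<forall>t. t < 0 \<or> t > T --> \<eta> t = 0) & (\<forall>t\<in>{1..2}. \<eta> t >= m) &
     (\<forall>t. (q\<^sup>2 + \<kappa> * q) * \<eta> t <= 2 * q / (1 + q\<^sup>2 * t\<^sup>2)) &
     (\<forall>t W. W >= 0 --> W * (\<eta>'' t + 2 * \<kappa> * \<eta>' t) + \<tau> * (W powr p * \<eta> t)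
        >= - 64 * (q\<^sup>2 + \<kappa> * q) * (W * \<eta> t) + b * (indicator {1..2} t * W) - \<tau> * (1 / q / (1 + q\<^sup>2 * t\<^sup>2))))"
proof -
  define E where "E = (%t. flat t * exp (- \<kappa> * t))"
  have Es: "smooth_on UNIV E"
    unfolding E_def
    by (intro smooth_on_mult flat_smooth smooth_on_compose_real[OF _ _ _ smooth_on_exp[of UNIV]] smooth_on_const smooth_on_ident) auto
  have dE: "(E has_real_derivative E t * ((inverse t)\<^sup>2 - \<kappa>)) (at t)" for t
    unfolding E_def by (auto intro!: derivative_eq_intros flat_deriv simp: algebra_simps)
  have E0: "E t >= 0" for t by (simp add: E_def flat_nonneg)
  obtain F where F: "!!t. (F has_real_derivative E t) (at t)"
    using real_antiderivative[OF smooth_on_continuous[OF Es]] by blast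
  define X where "X = (%t. F t - F 0)"
  have dX: "(X has_real_derivative E t) (at t)" for t
    unfolding X_def using F by (auto intro!: derivative_eq_intros)
  have Xs: "smooth_on UNIV X" by (rule smooth_on_if_real_derivative_smooth[OF _ dX Es]) auto
  have X00: "X 0 = 0" by (simp add: X_def)
  have Xmono: "X s <= X t" if "s <= t" for s t
    by (rule DERIV_nonneg_imp_nondecreasing[OF that]) (use dX E0 in blast)
  have Xneg: "X t = 0" if "t <= 0" for t
  proof (cases "t = 0")
    case False
    then obtain z where "z < 0" "X 0 - X t = (0 - t) * E z" using MVT2[of t 0 X E] dX \<open>t <= 0\<close> by auto
    then show ?thesis using X00 by (simp add: E_def flat_zero)
  qed (simp add: X00)
  have X0: "X t >= 0" for t using Xmono[of 0 t] Xneg[of t] X00 by (cases "t >= 0") auto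
  have Xle: "X t <= t" if "t >= 0" for t
  proof (cases "t = 0")
    case False
    then obtain z where z: "0 < z" "X t - X 0 = (t - 0) * E z" using MVT2[of 0 t X E] dX \<open>t >= 0\<close> by auto
    have "E z <= 1 * 1" unfolding E_def using \<kappa> z flat_le_1 by (intro mult_mono) auto
    then have "t * E z <= t * 1" using that by (intro mult_left_mono) auto
    then show ?thesis using z X00 by simp
  qed (simp add: X00)
  have \<kappa>X: "\<kappa> * X t <= 1" if "t >= 0" for t
  proof -
    have "\<kappa> * X t + exp (- \<kappa> * t) <= \<kappa> * X 0 + exp (- \<kappa> * 0)"
    proof (rule DERIV_nonpos_imp_nonincreasing[OF that])
      fix s :: real
      have "((%t. \<kappa> * X t + exp (- \<kappa> * t)) has_real_derivative \<kappa> * E s + exp (- \<kappa> * s) * (- \<kappa>)) (at s)"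
        by (auto intro!: derivative_eq_intros dX)
      moreover have "\<kappa> * E s + exp (- \<kappa> * s) * (- \<kappa>) = - (\<kappa> * exp (- \<kappa> * s) * (1 - flat s))"
        by (simp add: E_def algebra_simps)
      moreover have "\<dots> <= 0" using \<kappa> flat_le_1 by simp
      ultimately show "\<exists>y. ((%t. \<kappa> * X t + exp (- \<kappa> * t)) has_real_derivative y) (at s) & y <= 0" by metis
    qed
    moreover have "exp (- \<kappa> * t) > 0" by simp
    moreover have "\<kappa> * X 0 + exp (- \<kappa> * 0) = 1" using X00 by simp
    ultimately show ?thesis by linarith
  qed
  have Xge: "t * E t <= 6 * X t" if t: "t >= 2" for t
  proof -
    obtain z where z: "1 < z" "z < t" "X t - X 1 = (t - 1) * E z" using MVT2[of 1 t X E] dX t by auto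
    have "flat 1 * exp (- \<kappa> * t) <= E z"
      unfolding E_def using z \<kappa> by (intro mult_mono flat_mono) (auto simp: flat_nonneg mult_left_mono)
    moreover have "(1/3::real) <= flat 1" using exp_le by (simp add: flat_def exp_minus field_simps)
    then have "(1/3) * exp (- \<kappa> * t) <= flat 1 * exp (- \<kappa> * t)" by (intro mult_right_mono) auto
    moreover have "E t <= 1 * exp (- \<kappa> * t)" unfolding E_def using flat_le_1 by (intro mult_right_mono) auto
    ultimately have "E t <= 3 * E z" by linarith
    then have "t * E t <= t * (3 * E z)" using t by (intro mult_left_mono) auto
    also have "\<dots> <= (2 * (t - 1)) * (3 * E z)" using t E0[of z] by (intro mult_right_mono) auto
    also have "\<dots> = 6 * (X t - X 1)" using z by simp
    also have "\<dots> <= 6 * X t" using X0[of 1] by simp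
    finally show ?thesis .
  qed
  have X1: "X 1 > 0"
  proof -
    obtain z where z: "1/2 < z" "X 1 - X (1/2) = (1 - 1/2) * E z" using MVT2[of "1/2" 1 X E] dX by auto
    have "E z > 0" using z by (simp add: E_def flat_pos)
    then show ?thesis using z X0[of "1/2"] by simp
  qed
  define b where "b = flat (1/2) * flat 1 * exp (- \<kappa> * 2) / 16"
  define m where "m = X 1 * flat (1/2) / 2"
  have fh: "flat (1/2) > 0" "flat 1 > 0" by (simp_all add: flat_pos)
  show ?thesis
  proof (rule exI[of _ b], rule conjI, simp add: b_def fh, rule exI[of _ m], rule conjI, simp add: m_def fh X1, intro allI impI)
    fix q \<tau> :: real assume q: "0 < q & q <= 1/16" and \<tau>: "\<tau> > 0"
    then have q0: "q > 0" "q <= 1/16" by auto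
    define h where "h = (%t. inverse (1 + q\<^sup>2 * t\<^sup>2))"
    define g where "g = (%t. (h t)\<^sup>2)"
    define g' where "g' = (%t. - 4 * q\<^sup>2 * t * (h t) ^ 3)"
    define g'' where "g'' = (%t. - 4 * q\<^sup>2 * (h t) ^ 3 + 24 * q ^ 4 * t\<^sup>2 * (h t) ^ 4)"
    have den: "1 + q\<^sup>2 * t\<^sup>2 >= 1" for t by simp
    have den0: "1 + q\<^sup>2 * t\<^sup>2 > 0" for t using den[of t] by linarith
    have h0: "h t > 0" "h t <= 1" for t using den[of t] den0[of t] by (auto simp: h_def inverse_le_1_iff)
    have dh: "(h has_real_derivative - 2 * q\<^sup>2 * t * (h t)\<^sup>2) (at t)" for t
      unfolding h_def using den0[of t]
      by (auto intro!: derivative_eq_intros simp: power2_eq_square field_simps)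
    have dg: "(g has_real_derivative g' t) (at t)" for t
      unfolding g_def g'_def by (auto intro!: derivative_eq_intros dh simp: power2_eq_square power3_eq_cube)
    have dg': "(g' has_real_derivative g'' t) (at t)" for t
      unfolding g'_def g''_def
      by (auto intro!: derivative_eq_intros dh simp: power2_eq_square power3_eq_cube power4_eq_xxxx algebra_simps)
    have hs: "smooth_on UNIV h"
      unfolding h_def using den0
      by (intro smooth_on_inverse smooth_on_add smooth_on_const smooth_on_mult smooth_on_power smooth_on_ident) auto
    have gs: "smooth_on UNIV g" unfolding g_def by (intro smooth_on_power hs) auto
    have g0: "g t > 0" "g t <= h t" for t
      using h0[of t] by (auto simp: g_def power2_eq_square mult_left_le)
    have qth: "q * t * h t <= 1/2" for t
    proof -
      have "2 * (q * t) <= 1 + q\<^sup>2 * t\<^sup>2" using zero_le_power2[of "1 - q * t"] by (simp add: power2_eq_square algebra_simps)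
      then show ?thesis using den0[of t] by (simp add: h_def field_simps)
    qed
    have g'1: "g' t >= - 4 * q\<^sup>2 * t * g t" "g' t <= 0" if "t >= 0" for t
    proof -
      have "h t ^ 3 <= (h t)\<^sup>2" using h0[of t] by (intro power_decreasing) auto
      then have "4 * q\<^sup>2 * t * h t ^ 3 <= 4 * q\<^sup>2 * t * (h t)\<^sup>2" using that by (intro mult_left_mono) auto
      then show "g' t >= - 4 * q\<^sup>2 * t * g t" by (simp add: g'_def g_def)
      show "g' t <= 0" unfolding g'_def using that h0[of t] by simp
    qed
    have g'2: "g' t >= - 2 * q * g t" for t
    proof -
      have "4 * q\<^sup>2 * t * h t ^ 3 = (4 * q * g t) * (q * t * h t)" by (simp add: g_def power2_eq_square power3_eq_cube)
      also have "\<dots> <= (4 * q * g t) * (1/2)" using q0 g0[of t] by (intro mult_left_mono qth) auto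
      finally show ?thesis by (simp add: g'_def)
    qed
    have g''1: "g'' t >= - 4 * q\<^sup>2 * g t" for t
    proof -
      have "h t ^ 3 <= (h t)\<^sup>2" using h0[of t] by (intro power_decreasing) auto
      then have "4 * q\<^sup>2 * h t ^ 3 <= 4 * q\<^sup>2 * g t" unfolding g_def by (intro mult_left_mono) auto
      moreover have "24 * q ^ 4 * t\<^sup>2 * h t ^ 4 >= 0" using h0[of t] by simp
      ultimately show ?thesis unfolding g''_def by linarith
    qed
    define a where "a = 1 - 1 / p"
    have a: "a > 0" using p by (simp add: a_def)
    define c where "c = (6 + 2 * \<kappa>) * (2 / a\<^sup>2)"
    have c: "c > 0" using \<kappa> a by (simp add: c_def)
    define T where "T = max (max 128 (8 / q)) (c / \<tau>)"
    have T: "T >= 128" "T >= 8 / q" "T >= c / \<tau>" by (auto simp: T_def)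
    then have T0: "T > 0" by linarith
    have Tq: "8 / T <= q" using T(2) T0 q0 by (simp add: field_simps)
    have T\<tau>: "c / T <= \<tau>" using T(3) T0 \<tau> by (simp add: field_simps)
    have T8: "8 / T <= 1/16" using T(1) T0 by (simp add: field_simps)
    define y where "y = (%t. 1 - t / T)"
    define x where "x = (%t. flat (y t))"
    define x' where "x' = (%t. - (1/T) * (flat (y t) * (inverse (y t))\<^sup>2))"
    define x'' where "x'' = (%t. (1/T\<^sup>2) * (flat (y t) * ((inverse (y t))^4 - 2 * (inverse (y t))^3)))"
    have dy: "(y has_real_derivative - (1/T)) (at t)" for t
      unfolding y_def using T0 by (auto intro!: derivative_eq_intros)
    have dx: "(x has_real_derivative x' t) (at t)" for t
      unfolding x_def x'_def by (rule DERIV_cong[OF DERIV_chain2[OF flat_deriv dy]]) simp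
    have dx': "(x' has_real_derivative x'' t) (at t)" for t
      unfolding x'_def x''_def
      by (rule DERIV_cong[OF DERIV_cmult[OF DERIV_chain2[OF flat_deriv2 dy]]]) (simp add: power2_eq_square)
    have xs: "smooth_on UNIV x"
      unfolding x_def y_def divide_inverse
      by (intro smooth_on_compose_real[OF _ _ _ flat_smooth[of UNIV]] smooth_on_diff smooth_on_mult smooth_on_const smooth_on_ident) auto
    have x0: "x t >= 0" "x t <= 1" for t by (auto simp: x_def flat_nonneg flat_le_1)
    have x'0: "x' t <= 0" for t unfolding x'_def using T0 by (simp add: flat_nonneg)
    have x''0: "x'' t >= - q\<^sup>2 * x t" for t
    proof -
      have "u ^ 4 - 2 * u ^ 3 >= - 2" for u :: real
      proof -
        have "u ^ 4 - 2 * u ^ 3 + 2 = (u\<^sup>2 - u - 3/4)\<^sup>2 + (u - 3/2)\<^sup>2 / 2 + 5/16"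
          by (simp add: power2_eq_square power3_eq_cube power4_eq_xxxx field_simps)
        moreover have "(u\<^sup>2 - u - 3/4)\<^sup>2 + (u - 3/2)\<^sup>2 / 2 >= 0" by simp
        ultimately show ?thesis by linarith
      qed
      then have "x'' t >= (1/T\<^sup>2) * (flat (y t) * (- 2))"
        unfolding x''_def by (intro mult_left_mono) (auto simp: flat_nonneg)
      moreover have "2 / T\<^sup>2 <= q\<^sup>2"
      proof -
        have "2 / T\<^sup>2 <= (8 / T)\<^sup>2" by (simp add: power_divide divide_right_mono)
        also have "\<dots> <= q\<^sup>2" using Tq T0 by (intro power_mono) auto
        finally show ?thesis .
      qed
      then have "2 / T\<^sup>2 * flat (y t) <= q\<^sup>2 * flat (y t)" by (intro mult_right_mono flat_nonneg)
      ultimately show ?thesis by (simp add: x_def)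
    qed
    define \<eta> where "\<eta> = (%t. X t * (g t * x t))"
    define G' where "G' = (%t. g' t * x t + g t * x' t)"
    define G'' where "G'' = (%t. g'' t * x t + 2 * g' t * x' t + g t * x'' t)"
    define \<eta>' where "\<eta>' = (%t. E t * (g t * x t) + X t * G' t)"
    define \<eta>'' where "\<eta>'' = (%t. E t * ((inverse t)\<^sup>2 - \<kappa>) * (g t * x t) + 2 * E t * G' t + X t * G'' t)"
    have d\<eta>: "(\<eta> has_real_derivative \<eta>' t) (at t)" for t
      unfolding \<eta>_def \<eta>'_def G'_def by (auto intro!: derivative_eq_intros dX dg dx simp: algebra_simps)
    have dG': "(G' has_real_derivative G'' t) (at t)" for t
      unfolding G'_def G''_def by (auto intro!: derivative_eq_intros dg dg' dx dx' simp: algebra_simps)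
    have dgx: "((%t. g t * x t) has_real_derivative G' t) (at t)" for t
      unfolding G'_def by (auto intro!: derivative_eq_intros dg dx simp: algebra_simps)
    have d\<eta>': "(\<eta>' has_real_derivative \<eta>'' t) (at t)" for t
      unfolding \<eta>'_def \<eta>''_def
      by (rule DERIV_cong[OF DERIV_add[OF DERIV_mult[OF dE dgx] DERIV_mult[OF dX dG']]]) (simp add: algebra_simps)
    have \<eta>s: "smooth_on UNIV \<eta>" unfolding \<eta>_def by (intro smooth_on_mult Xs gs xs) auto
    have \<eta>0: "\<eta> t >= 0" for t unfolding \<eta>_def using X0[of t] g0[of t] x0[of t] by simp
    have \<eta>z: "\<eta> t = 0" if "t < 0 \<or> t > T" for t
    proof (cases "t < 0")
      case True then show ?thesis using Xneg by (simp add: \<eta>_def)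
    next
      case False
      then have "y t <= 0" using that T0 by (simp add: y_def field_simps)
      then show ?thesis by (simp add: \<eta>_def x_def flat_zero)
    qed
    have y12: "y t >= 1/2" if "t <= 2" for t
      using that T(1) T0 by (simp add: y_def field_simps)
    have g12: "g t >= 1/2" if "0 <= t" "t <= 2" for t
    proof -
      have "q\<^sup>2 * t\<^sup>2 <= (1/16)\<^sup>2 * 2\<^sup>2" using q0 that by (intro mult_mono power_mono) auto
      then have "1 + q\<^sup>2 * t\<^sup>2 <= 65/64" by (simp add: power2_eq_square)
      then have "h t >= 64/65" using den0[of t] by (simp add: h_def field_simps)
      then have "(h t)\<^sup>2 >= (64/65)\<^sup>2" by (intro power_mono) auto
      then show ?thesis by (simp add: g_def power2_eq_square)
    qed
    have \<eta>m: "\<eta> t >= m" if "t \<in> {1..2}" for t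
    proof -
      have "X 1 * ((1/2) * flat (1/2)) <= X t * (g t * x t)"
        unfolding x_def using that Xmono[of 1 t] g12[of t] y12[of t] X0[of t] g0[of t] fh
        by (intro mult_mono flat_mono) (auto simp: flat_nonneg)
      then show ?thesis by (simp add: m_def \<eta>_def)
    qed
    have Xg: "q * X t * g t <= (1/2) * h t" "\<kappa> * X t * g t <= h t" "X t * g t >= 0" for t
    proof -
      show "X t * g t >= 0" using X0[of t] g0[of t] by simp
      show "q * X t * g t <= (1/2) * h t"
      proof (cases "t >= 0")
        case True
        have "q * X t * g t <= q * t * g t" using Xle[OF True] q0 g0[of t] by (intro mult_right_mono mult_left_mono) auto
        also have "\<dots> = (q * t * h t) * h t" by (simp add: g_def power2_eq_square)
        also have "\<dots> <= (1/2) * h t" using h0[of t] by (intro mult_right_mono qth) auto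
        finally show ?thesis .
      qed (use Xneg[of t] h0[of t] in simp)
      show "\<kappa> * X t * g t <= h t"
      proof (cases "t >= 0")
        case True
        have "\<kappa> * X t * g t <= 1 * h t" using \<kappa>X[OF True] g0[of t] by (intro mult_mono) auto
        then show ?thesis by simp
      qed (use Xneg[of t] h0[of t] in simp)
    qed
    have \<eta>Q: "(q\<^sup>2 + \<kappa> * q) * \<eta> t <= 2 * q / (1 + q\<^sup>2 * t\<^sup>2)" for t
    proof -
      have "\<eta> t <= X t * g t" unfolding \<eta>_def using Xg(3)[of t] x0[of t] by (simp add: mult.assoc[symmetric] mult_left_le)
      then have "(q\<^sup>2 + \<kappa> * q) * \<eta> t <= (q\<^sup>2 + \<kappa> * q) * (X t * g t)" using q0 \<kappa> by (intro mult_left_mono) auto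
      also have "\<dots> = q * (q * X t * g t) + q * (\<kappa> * X t * g t)" by (simp add: power2_eq_square algebra_simps)
      also have "\<dots> <= q * ((1/2) * h t) + q * h t" using q0 Xg[of t] by (intro add_mono mult_left_mono) auto
      also have "\<dots> <= 2 * q * h t" using q0 h0[of t] by simp
      finally show ?thesis by (simp add: h_def divide_inverse)
    qed
    have key: "W * (\<eta>'' t + 2 * \<kappa> * \<eta>' t) + \<tau> * (W powr p * \<eta> t)
        >= - 64 * (q\<^sup>2 + \<kappa> * q) * (W * \<eta> t) + b * (indicator {1..2} t * W) - \<tau> * (1 / q / (1 + q\<^sup>2 * t\<^sup>2))"
      if W: "W >= 0" for t W
    proof (cases "t <= 0")
      case True
      then have "E t = 0" "X t = 0" using Xneg by (auto simp: E_def flat_zero)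
      then have "\<eta>'' t = 0" "\<eta>' t = 0" "\<eta> t = 0" by (auto simp: \<eta>_def \<eta>'_def \<eta>''_def)
      then show ?thesis using True q0 \<tau> den0[of t] by (auto simp: indicator_def)
    next
      case False
      then have t: "t > 0" by simp
      define P where "P = g t * x t"
      have P0: "P >= 0" using g0[of t] x0[of t] by (simp add: P_def)
      have XP: "X t * P >= 0" using X0[of t] P0 by simp
      have \<eta>P: "\<eta> t = X t * P" by (simp add: \<eta>_def P_def)
      have expand: "\<eta>'' t + 2 * \<kappa> * \<eta>' t = E t * P * ((inverse t)\<^sup>2 + \<kappa>) + 2 * E t * (g' t * x t) + 2 * E t * (g t * x' t)
          + 2 * \<kappa> * X t * (g' t * x t) + 2 * \<kappa> * X t * (g t * x' t) + X t * (g'' t * x t) + 2 * X t * (g' t * x' t) + X t * (g t * x'' t)"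
        unfolding \<eta>''_def \<eta>'_def G'_def G''_def P_def by (simp add: algebra_simps)
      have B1: "2 * E t * (g' t * x t) >= - 8 * q\<^sup>2 * (t * E t) * P"
      proof -
        have "(- 4 * q\<^sup>2 * t * g t) * x t <= g' t * x t" using g'1(1)[of t] t x0[of t] by (intro mult_right_mono) auto
        then have "(2 * E t) * ((- 4 * q\<^sup>2 * t * g t) * x t) <= (2 * E t) * (g' t * x t)" using E0[of t] by (intro mult_left_mono) auto
        then show ?thesis by (simp add: P_def algebra_simps)
      qed
      have C1: "2 * \<kappa> * X t * (g' t * x t) >= - 4 * (\<kappa> * q) * (X t * P)"
      proof -
        have "(- 2 * q * g t) * x t <= g' t * x t" using g'2[of t] x0[of t] by (intro mult_right_mono) auto
        then have "(2 * \<kappa> * X t) * ((- 2 * q * g t) * x t) <= (2 * \<kappa> * X t) * (g' t * x t)" using X0[of t] \<kappa> by (intro mult_left_mono) auto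
        then show ?thesis by (simp add: P_def algebra_simps)
      qed
      have D1: "X t * (g'' t * x t) >= - 4 * q\<^sup>2 * (X t * P)"
      proof -
        have "(- 4 * q\<^sup>2 * g t) * x t <= g'' t * x t" using g''1[of t] x0[of t] by (intro mult_right_mono) auto
        then have "X t * ((- 4 * q\<^sup>2 * g t) * x t) <= X t * (g'' t * x t)" using X0[of t] by (intro mult_left_mono) auto
        then show ?thesis by (simp add: P_def algebra_simps)
      qed
      have D2: "2 * X t * (g' t * x' t) >= 0"
        using X0[of t] mult_nonpos_nonpos[OF g'1(2) x'0, of t t] t by simp
      have D3: "X t * (g t * x'' t) >= - q\<^sup>2 * (X t * P)"
      proof -
        have "g t * (- q\<^sup>2 * x t) <= g t * x'' t" using x''0[of t] g0[of t] by (intro mult_left_mono) auto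
        then have "X t * (g t * (- q\<^sup>2 * x t)) <= X t * (g t * x'' t)" by (rule mult_left_mono[OF _ X0])
        then show ?thesis by (simp add: P_def algebra_simps)
      qed
      have W\<eta>: "\<tau> * (W powr p * \<eta> t) >= 0" using \<tau> \<eta>0[of t] by simp
      have tail: "\<tau> * (1 / q / (1 + q\<^sup>2 * t\<^sup>2)) >= 0" using \<tau> q0 den0[of t] by simp
      have kq: "\<kappa> * q * (X t * P) >= 0" "q\<^sup>2 * (X t * P) >= 0" using \<kappa> q0 XP by auto
      show ?thesis
      proof (cases "t <= 2")
        case True
        have x'le: "x' t >= - (4 / T) * x t"
        proof -
          have "inverse (y t) <= inverse (1/2)" using y12[OF True] by (intro le_imp_inverse_le) auto
          then have "(inverse (y t))\<^sup>2 <= 2\<^sup>2" using y12[OF True] by (intro power_mono) auto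
          then have "flat (y t) * (inverse (y t))\<^sup>2 <= flat (y t) * 4" by (intro mult_left_mono flat_nonneg) auto
          then have "(1/T) * (flat (y t) * (inverse (y t))\<^sup>2) <= (1/T) * (flat (y t) * 4)" by (rule mult_left_mono) (use T0 in auto)
          then show ?thesis by (simp add: x'_def x_def mult.commute)
        qed
        have gx': "g t * x' t >= - (4 / T) * P"
        proof -
          have "g t * (- (4 / T) * x t) <= g t * x' t" using x'le g0[of t] by (intro mult_left_mono) auto
          then show ?thesis by (simp add: P_def algebra_simps)
        qed
        have B2: "2 * E t * (g t * x' t) >= - (1/16) * (E t * P)"
        proof -
          have "(2 * E t) * (- (4 / T) * P) <= (2 * E t) * (g t * x' t)" using gx' E0[of t] by (intro mult_left_mono) auto
          moreover have "(8 / T) * (E t * P) <= (1/16) * (E t * P)" using T8 E0[of t] P0 by (intro mult_right_mono) auto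
          ultimately show ?thesis by (simp add: algebra_simps)
        qed
        have C2: "2 * \<kappa> * X t * (g t * x' t) >= - (\<kappa> * q) * (X t * P)"
        proof -
          have "(2 * \<kappa> * X t) * (- (4 / T) * P) <= (2 * \<kappa> * X t) * (g t * x' t)" using gx' X0[of t] \<kappa> by (intro mult_left_mono) auto
          moreover have "(8 / T) * (\<kappa> * (X t * P)) <= q * (\<kappa> * (X t * P))" using Tq \<kappa> XP by (intro mult_right_mono) auto
          ultimately show ?thesis by (simp add: algebra_simps)
        qed
        have A: "E t * P * ((inverse t)\<^sup>2 + \<kappa>) >= (1/4) * (E t * P)"
        proof -
          have "inverse t >= inverse 2" using t True by (intro le_imp_inverse_le) auto
          then have "(inverse t)\<^sup>2 >= (inverse 2)\<^sup>2" using t by (intro power_mono) auto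
          then have "(inverse t)\<^sup>2 + \<kappa> >= 1/4" using \<kappa> by (simp add: power2_eq_square)
          then have "(E t * P) * (1/4) <= (E t * P) * ((inverse t)\<^sup>2 + \<kappa>)" using E0[of t] P0 by (intro mult_left_mono) auto
          then show ?thesis by (simp add: mult.commute)
        qed
        have B1': "8 * q\<^sup>2 * (t * E t) * P <= (1/16) * (E t * P)"
        proof -
          have "q\<^sup>2 <= (1/16)\<^sup>2" using q0 by (intro power_mono) auto
          then have "8 * q\<^sup>2 * t <= 8 * (1/16)\<^sup>2 * 2" using t True by (intro mult_mono) auto
          then have "(8 * q\<^sup>2 * t) * (E t * P) <= (1/16) * (E t * P)" using E0[of t] P0 by (intro mult_right_mono) (auto simp: power2_eq_square)
          then show ?thesis by (simp add: algebra_simps)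
        qed
        have src: "(1/8) * (E t * P) >= b * indicator {1..2} t"
        proof (cases "t \<in> {1..2}")
          case True
          have "flat 1 * exp (- \<kappa> * 2) <= E t" unfolding E_def using True \<kappa> by (intro mult_mono flat_mono) (auto simp: flat_nonneg mult_left_mono)
          moreover have "(1/2) * flat (1/2) <= P" unfolding P_def x_def using True g12[of t] y12[of t] g0[of t] by (intro mult_mono flat_mono) (auto simp: flat_nonneg)
          ultimately have "(flat 1 * exp (- \<kappa> * 2)) * ((1/2) * flat (1/2)) <= E t * P" using E0[of t] fh by (intro mult_mono) auto
          then show ?thesis using True by (simp add: b_def mult_ac)
        next
          case False
          then show ?thesis using E0[of t] P0 by simp
        qed
        have "\<eta>'' t + 2 * \<kappa> * \<eta>' t >= b * indicator {1..2} t - 64 * (q\<^sup>2 + \<kappa> * q) * (X t * P)"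
          using expand A B1 B1' B2 C1 C2 D1 D2 D3 src kq by (simp add: algebra_simps)
        then have "W * (\<eta>'' t + 2 * \<kappa> * \<eta>' t) >= W * (b * indicator {1..2} t - 64 * (q\<^sup>2 + \<kappa> * q) * (X t * P))"
          using W by (intro mult_left_mono) auto
        then show ?thesis using W\<eta> tail by (simp add: \<eta>P algebra_simps)
      next
        case False
        then have t2: "t >= 2" by simp
        define D where "D = X t * g t * (flat (y t) * (inverse (y t))\<^sup>2)"
        have D0: "D >= 0" unfolding D_def using Xg(3)[of t] by (simp add: flat_nonneg)
        have EX: "E t <= 3 * X t" using Xge[OF t2] t2 E0[of t] mult_right_mono[of 2 t "E t"] by simp
        have A: "E t * P * ((inverse t)\<^sup>2 + \<kappa>) >= 0" using E0[of t] P0 \<kappa> by simp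
        have B1': "8 * q\<^sup>2 * (t * E t) * P <= 48 * q\<^sup>2 * (X t * P)"
        proof -
          have "(8 * q\<^sup>2) * (t * E t) * P <= (8 * q\<^sup>2) * (6 * X t) * P" using Xge[OF t2] P0 by (intro mult_right_mono mult_left_mono) auto
          then show ?thesis by (simp add: algebra_simps)
        qed
        have gx': "g t * x' t = - (1/T) * (g t * (flat (y t) * (inverse (y t))\<^sup>2))" by (simp add: x'_def)
        have B2: "2 * E t * (g t * x' t) >= - (6 / T) * D"
        proof -
          have "E t * (g t * (flat (y t) * (inverse (y t))\<^sup>2)) <= (3 * X t) * (g t * (flat (y t) * (inverse (y t))\<^sup>2))"
            using EX g0[of t] by (intro mult_right_mono) (auto simp: flat_nonneg)
          then have "(2 / T) * (E t * (g t * (flat (y t) * (inverse (y t))\<^sup>2))) <= (2 / T) * ((3 * X t) * (g t * (flat (y t) * (inverse (y t))\<^sup>2)))"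
            using T0 by (intro mult_left_mono) auto
          then show ?thesis unfolding gx' D_def by (simp add: algebra_simps)
        qed
        have C2: "2 * \<kappa> * X t * (g t * x' t) = - (2 * \<kappa> / T) * D" unfolding gx' D_def by simp
        have "\<eta>'' t + 2 * \<kappa> * \<eta>' t >= - ((6 + 2 * \<kappa>) / T) * D - 64 * (q\<^sup>2 + \<kappa> * q) * (X t * P)"
          using expand A B1 B1' B2 C1 C2 D1 D2 D3 kq by (simp add: algebra_simps add_divide_distrib)
        then have "W * (\<eta>'' t + 2 * \<kappa> * \<eta>' t) >= W * (- ((6 + 2 * \<kappa>) / T) * D - 64 * (q\<^sup>2 + \<kappa> * q) * (X t * P))"
          using W by (intro mult_left_mono) auto
        moreover have "((6 + 2 * \<kappa>) / T) * (W * D) <= \<tau> * (W powr p * (X t * P)) + \<tau> * (1 / q / (1 + q\<^sup>2 * t\<^sup>2))"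
        proof (cases "y t > 0")
          case False
          then have "D = 0" by (simp add: D_def flat_zero)
          then show ?thesis using tail W\<eta> by (simp add: \<eta>P)
        next
          case True
          have "W * D = (X t * g t) * (W * (flat (y t) * (inverse (y t))\<^sup>2))" by (simp add: D_def)
          also have "\<dots> <= (X t * g t) * ((2 / a\<^sup>2) * (W powr p * flat (y t) + 1))"
            unfolding a_def by (intro mult_left_mono cutoff_young p W True Xg(3))
          also have "\<dots> = (2 / a\<^sup>2) * (W powr p * (X t * P) + X t * g t)" by (simp only: P_def x_def) algebra
          finally have "((6 + 2 * \<kappa>) / T) * (W * D) <= ((6 + 2 * \<kappa>) / T) * ((2 / a\<^sup>2) * (W powr p * (X t * P) + X t * g t))"
            using \<kappa> T0 by (intro mult_left_mono) auto
          also have "\<dots> = (c / T) * (W powr p * (X t * P) + X t * g t)" by (simp only: c_def divide_inverse mult_ac)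
          also have "\<dots> <= \<tau> * (W powr p * (X t * P) + X t * g t)"
            using T\<tau> XP Xg(3)[of t] by (intro mult_right_mono add_nonneg_nonneg) auto
          also have "\<dots> = \<tau> * (W powr p * (X t * P)) + \<tau> * (X t * g t)" by (simp add: algebra_simps)
          also have "\<tau> * (X t * g t) <= \<tau> * (1 / q / (1 + q\<^sup>2 * t\<^sup>2))"
          proof (rule mult_left_mono)
            have "q * (X t * g t) <= h t" using Xg(1)[of t] h0[of t] by simp
            then have "X t * g t <= h t / q" using q0 by (simp add: pos_le_divide_eq mult.commute)
            then show "X t * g t <= 1 / q / (1 + q\<^sup>2 * t\<^sup>2)" by (simp add: h_def divide_inverse mult.commute)
          qed (use \<tau> in simp)
          finally show ?thesis by simp
        qed
        moreover have "indicator {1..2} t * W = 0 \<or> t = 2" using t2 by (auto simp: indicator_def)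
        ultimately show ?thesis using False by (simp add: \<eta>P algebra_simps)
      qed
    qed
    show "\<exists>(\<eta>::real => real) (\<eta>'::real => real) (\<eta>''::real => real) T.
     smooth_on UNIV \<eta> & (\<forall>t. (\<eta> has_real_derivative \<eta>' t) (at t)) & (\<forall>t. (\<eta>' has_real_derivative \<eta>'' t) (at t)) &
     (\<forall>t. \<eta> t >= 0) & T > 0 & (\<forall>t. t < 0 \<or> t > T --> \<eta> t = 0) & (\<forall>t\<in>{1..2}. \<eta> t >= m) &
     (\<forall>t. (q\<^sup>2 + \<kappa> * q) * \<eta> t <= 2 * q / (1 + q\<^sup>2 * t\<^sup>2)) &
     (\<forall>t W. W >= 0 --> W * (\<eta>'' t + 2 * \<kappa> * \<eta>' t) + \<tau> * (W powr p * \<eta> t)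
        >= - 64 * (q\<^sup>2 + \<kappa> * q) * (W * \<eta> t) + b * (indicator {1..2} t * W) - \<tau> * (1 / q / (1 + q\<^sup>2 * t\<^sup>2)))"
      by (rule exI[of _ \<eta>], rule exI[of _ \<eta>'], rule exI[of _ \<eta>''], rule exI[of _ T], intro conjI allI impI ballI)
         (assumption | rule \<eta>s d\<eta> d\<eta>' \<eta>0 T0 \<eta>z \<eta>m \<eta>Q key)+
  qed
qed

section \<open>Spherical caps\<close>

lemma cap_mass_le:
  obtains C where "C > 0" "!!(s::'a::euclidean_space) e. norm s = 1 ==> 0 < e ==> e <= 1 ==>
    emeasure lborel {x \<in> ball 0 1. norm (s - sgn x) <= e} <= ennreal (C * e ^ (DIM('a) - 1))"
proof -
  define N where "N = DIM('a)"
  have N: "N >= 1" by (simp add: N_def Suc_leI)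
  define C where "C = 3 * (unit_ball_vol N * 2 ^ N)"
  show ?thesis
  proof (rule that[of C])
    show "C > 0" by (simp add: C_def)
    fix s :: 'a and e :: real assume s: "norm s = 1" and e: "0 < e" "e <= 1"
    define n where "n = nat \<lceil>1 / e\<rceil>"
    have n1: "real n >= 1 / e" unfolding n_def by linarith
    have n2: "real n <= 1 / e + 1" proof -
      have "1 / e >= 0" using e by simp
      then show ?thesis unfolding n_def by linarith
    qed
    have "{x \<in> ball 0 1. norm (s - sgn x) <= e} \<subseteq> (\<Union>j\<in>{..n}. cball ((real j * e) *\<^sub>R s) (2 * e))"
    proof
      fix x assume "x \<in> {x \<in> ball 0 1. norm (s - sgn x) <= e}"
      then have x: "norm x < 1" "norm (s - sgn x) <= e" by auto
      define j where "j = nat \<lfloor>norm x / e\<rfloor>"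
      have j1: "real j * e <= norm x"
      proof -
        have "real j <= norm x / e" unfolding j_def using e by simp
        then show ?thesis using e by (simp add: field_simps)
      qed
      have j2: "norm x <= (real j + 1) * e"
      proof -
        have "norm x / e <= real j + 1" unfolding j_def using e by linarith
        then show ?thesis using e by (simp add: field_simps)
      qed
      have "real j <= 1 / e" using j1 x e by (simp add: field_simps)
      then have jn: "j <= n" using n1 by linarith
      have "x = norm x *\<^sub>R sgn x" by (cases "x = 0") (simp_all add: sgn_div_norm)
      then have "(real j * e) *\<^sub>R s - x = norm x *\<^sub>R (s - sgn x) + (real j * e - norm x) *\<^sub>R s"
        by (simp add: scaleR_diff_left scaleR_diff_right)
      then have "norm ((real j * e) *\<^sub>R s - x) <= norm (norm x *\<^sub>R (s - sgn x)) + norm ((real j * e - norm x) *\<^sub>R s)"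
        by (metis norm_triangle_ineq)
      also have "norm (norm x *\<^sub>R (s - sgn x)) <= 1 * e"
        unfolding norm_scaleR using x by (intro mult_mono) auto
      also have "norm ((real j * e - norm x) *\<^sub>R s) <= e" using s j1 j2 unfolding norm_scaleR by (simp add: algebra_simps)
      finally have "x \<in> cball ((real j * e) *\<^sub>R s) (2 * e)" by (simp add: dist_norm)
      then show "x \<in> (\<Union>j\<in>{..n}. cball ((real j * e) *\<^sub>R s) (2 * e))" using jn by blast
    qed
    then have "emeasure lborel {x \<in> ball 0 1. norm (s - sgn x) <= e} <= emeasure lborel (\<Union>j\<in>{..n}. cball ((real j * e) *\<^sub>R s) (2 * e))"
      by (rule emeasure_mono) auto
    also have "\<dots> <= (\<Sum>j\<in>{..n}. emeasure lborel (cball ((real j * e) *\<^sub>R s) (2 * e)))"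
      by (rule emeasure_subadditive_finite) auto
    also have "\<dots> = (\<Sum>j\<in>{..n}. ennreal (unit_ball_vol N * (2 * e) ^ N))"
      using e by (simp add: emeasure_cball N_def)
    also have "\<dots> = ennreal (real (n + 1) * (unit_ball_vol N * (2 * e) ^ N))"
      by (simp add: ennreal_mult' ennreal_of_nat_eq_real_of_nat flip: of_nat_Suc)
    also have "\<dots> <= ennreal (C * e ^ (N - 1))"
    proof (rule ennreal_leI)
      have "real (n + 1) * e <= (1 / e + 2) * e" using n2 e by (intro mult_right_mono) auto
      also have "\<dots> <= 3" using e by (simp add: field_simps)
      finally have a: "real (n + 1) * e <= 3" .
      have "e ^ N = e * e ^ (N - 1)" using N by (simp add: power_eq_if)
      then have "real (n + 1) * (unit_ball_vol N * (2 * e) ^ N) = (real (n + 1) * e) * (unit_ball_vol N * 2 ^ N * e ^ (N - 1))"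
        by (simp add: power_mult_distrib)
      also have "\<dots> <= 3 * (unit_ball_vol N * 2 ^ N * e ^ (N - 1))"
        using a e by (intro mult_right_mono) auto
      finally show "real (n + 1) * (unit_ball_vol N * (2 * e) ^ N) <= C * e ^ (N - 1)" by (simp add: C_def)
    qed
    finally show "emeasure lborel {x \<in> ball 0 1. norm (s - sgn x) <= e} <= ennreal (C * e ^ (DIM('a) - 1))"
      by (simp add: N_def)
  qed
qed

lemma bump_measurable [measurable]: "bump e \<in> borel_measurable borel"
  by (rule borel_measurable_continuous_onI, rule smooth_on_continuous, rule bump_smooth)

lemma bump_support:
  assumes "norm s = 1" "norm t = 1" "e > 0" "bump e (s \<bullet> t) ~= 0"
  shows "norm (s - (t::'a::euclidean_space)) <= 2 * e"
proof (rule power2_le_imp_le)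
  have "(norm (s - t))\<^sup>2 <= 2 * e\<^sup>2" using norm_diff_unit[OF assms(1,2)] bump_nonzeroD[OF assms(3,4)] by simp
  also have "\<dots> <= (2 * e)\<^sup>2" by (simp add: power2_eq_square)
  finally show "(norm (s - t))\<^sup>2 <= (2 * e)\<^sup>2" .
qed (use assms in auto)

lemma bump_lower:
  assumes "norm s = 1" "norm t = 1" "e > 0" "norm (s - t) <= e"
  shows "bump e (s \<bullet> (t::'a::euclidean_space)) >= flat (1/2)"
proof -
  have "2 * (1 - s \<bullet> t) <= e\<^sup>2"
    using norm_diff_unit[OF assms(1,2)] power_mono[OF assms(4), of 2] by simp
  then have "(s \<bullet> t - 1) / e\<^sup>2 + 1 >= 1/2" using assms(3) by (simp add: field_simps)
  then show ?thesis unfolding bump_def by (rule flat_mono)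
qed

lemma bump_mass_le:
  obtains C where "C > 0" "!!(s::'a::euclidean_space) e. norm s = 1 ==> 0 < e ==> e <= 1/2 ==>
    (\<integral>\<^sup>+x. ennreal (bump e (s \<bullet> sgn x)) * indicator (ball 0 1) x \<partial>lborel) <= ennreal (C * e ^ (DIM('a) - 1))"
proof -
  obtain C where C: "C > 0" "!!(s::'a) e. norm s = 1 ==> 0 < e ==> e <= 1 ==>
    emeasure lborel {x \<in> ball 0 1. norm (s - sgn x) <= e} <= ennreal (C * e ^ (DIM('a) - 1))"
    using cap_mass_le[where 'a='a] by blast
  show ?thesis
  proof (rule that[of "C * 2 ^ (DIM('a) - 1)"])
    show "C * 2 ^ (DIM('a) - 1) > 0" using C by simp
    fix s :: 'a and e :: real assume s: "norm s = 1" and e: "0 < e" "e <= 1/2"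
    let ?A = "{x \<in> ball 0 1. norm (s - sgn x) <= 2 * e}"
    have [measurable]: "ball (0::'a) 1 \<in> sets borel" by simp
    have A: "?A \<in> sets borel" by measurable
    have "(\<integral>\<^sup>+x. ennreal (bump e (s \<bullet> sgn x)) * indicator (ball 0 1) x \<partial>lborel) <= (\<integral>\<^sup>+x. indicator ?A x \<partial>lborel)"
    proof (rule nn_integral_mono_AE)
      show "AE x in lborel. ennreal (bump e (s \<bullet> sgn x)) * indicator (ball 0 1) x <= indicator ?A x"
        using AE_lborel_singleton[of "0::'a"]
      proof eventually_elim
        fix x :: 'a assume x: "x ~= 0"
        show "ennreal (bump e (s \<bullet> sgn x)) * indicator (ball 0 1) x <= indicator ?A x"
        proof (cases "bump e (s \<bullet> sgn x) = 0 \<or> x \<notin> ball 0 1")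
          case False
          then have "x \<in> ?A" using bump_support[OF s _ e(1), of "sgn x"] x by (auto simp: norm_sgn)
          then show ?thesis using bump_le_1[of e "s \<bullet> sgn x"] by (simp add: indicator_def)
        qed auto
      qed
    qed
    also have "\<dots> = emeasure lborel ?A" using A by (simp add: nn_integral_indicator)
    also have "\<dots> <= ennreal (C * (2 * e) ^ (DIM('a) - 1))" by (rule C(2)[OF s]) (use e in auto)
    finally show "(\<integral>\<^sup>+x. ennreal (bump e (s \<bullet> sgn x)) * indicator (ball 0 1) x \<partial>lborel) <= ennreal (C * 2 ^ (DIM('a) - 1) * e ^ (DIM('a) - 1))"
      by (simp add: power_mult_distrib mult.assoc)
  qed
qed

context superharmonic
begin

lemma cap_lower:
  assumes conn: "connected \<Omega>" and nz: "\<not> (AE x in lebesgue. w x = 0)"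
    and K: "compact K" "K \<subseteq> sphere 0 1" and r: "0 < r1" "r1 < r2"
    and sub: "!!\<rho> s. r1 <= \<rho> ==> \<rho> <= r2 ==> s \<in> K ==> \<rho> *\<^sub>R s \<in> \<Omega>"
  shows "\<exists>c>0. \<exists>e1>0. \<forall>s\<in>K. \<forall>e. 0 < e & e < e1 &
     integrable lebesgue (%y. w y * (indicator {y. r1 <= norm y & norm y <= r2} y * bump e (s \<bullet> sgn y))) -->
     c * e ^ (DIM('a) - 1) <= (\<integral>y. w y * (indicator {y. r1 <= norm y & norm y <= r2} y * bump e (s \<bullet> sgn y)) \<partial>lebesgue)"
proof -
  define N where "N = DIM('a)"
  have N: "N >= 2" using dim by (simp add: N_def)
  define K' where "K' = (%(\<rho>, s). \<rho> *\<^sub>R s) ` ({r1..r2} \<times> K)"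
  have K': "compact K'" "K' \<subseteq> \<Omega>"
    unfolding K'_def using sub
    by (auto intro!: compact_continuous_image compact_Times K continuous_intros simp: case_prod_unfold)
  obtain c r where c: "c > 0" "r > 0"
    "!!x e. x \<in> K' ==> 0 < e ==> e < r ==> c * e ^ N <= (\<integral>y. w y * indicator (cball x e) y \<partial>lebesgue)"
    unfolding N_def using ball_mass_lower_bound[OF conn nz K'] by blast
  obtain d where d: "d > 0" "!!x. x \<in> K' ==> cball x d \<subseteq> \<Omega>"
  proof (cases "\<Omega> = UNIV")
    case False
    obtain d where "d > 0" "\<forall>x\<in>K'. \<forall>y\<in>- \<Omega>. d <= dist x y"
      using separate_compact_closed[of K' "- \<Omega>"] K' open_\<Omega> by auto
    then show ?thesis by (intro that[of "d/2"]) (force simp: subset_iff)+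
  qed (use that[of 1] in auto)
  define e1 where "e1 = min (min r d) ((r2 - r1) / 6) * 2 / r1"
  define c' where "c' = flat (1/2) * c * ((r2 - r1) / 6) * (r1 / 2) ^ (N - 1)"
  have "c' > 0 & e1 > 0 & (\<forall>s\<in>K. \<forall>e. 0 < e & e < e1 &
     integrable lebesgue (%y. w y * (indicator {y. r1 <= norm y & norm y <= r2} y * bump e (s \<bullet> sgn y))) -->
     c' * e ^ (DIM('a) - 1) <= (\<integral>y. w y * (indicator {y. r1 <= norm y & norm y <= r2} y * bump e (s \<bullet> sgn y)) \<partial>lebesgue))"
  proof (intro conjI ballI allI impI)
    show "c' > 0" using c r by (simp add: c'_def flat_pos)
    show "e1 > 0" using c d r by (simp add: e1_def)
    fix s :: 'a and e :: real
    let ?f = "%y. indicator {y. r1 <= norm y & norm y <= r2} y * bump e (s \<bullet> sgn y)"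
    assume s: "s \<in> K" and e': "0 < e & e < e1 & integrable lebesgue (%y. w y * ?f y)"
    then have e: "0 < e" "e < e1" and int: "integrable lebesgue (%y. w y * ?f y)" by auto
    have ns: "norm s = 1" using s K by auto
    define \<epsilon> where "\<epsilon> = e * r1 / 2"
    have "\<epsilon> < min (min r d) ((r2 - r1) / 6)" using e r by (simp only: \<epsilon>_def e1_def pos_less_divide_eq)
    then have \<epsilon>: "0 < \<epsilon>" "\<epsilon> < r" "\<epsilon> < d" "\<epsilon> < (r2 - r1) / 6"
      using e r unfolding \<epsilon>_def by (simp_all only: min_less_iff_conj) simp_all
    define n where "n = nat \<lfloor>(r2 - r1) / (3 * \<epsilon>)\<rfloor>"
    have q: "(r2 - r1) / (3 * \<epsilon>) >= 2" using \<epsilon> by (simp add: field_simps)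
    have n1: "real n <= (r2 - r1) / (3 * \<epsilon>)" unfolding n_def using q by linarith
    have n2: "real n >= (r2 - r1) / (6 * \<epsilon>)"
    proof -
      have "real n >= (r2 - r1) / (3 * \<epsilon>) - 1" unfolding n_def by linarith
      moreover have "(r2 - r1) / (6 * \<epsilon>) = (r2 - r1) / (3 * \<epsilon>) / 2" by simp
      ultimately show ?thesis using q by linarith
    qed
    define \<rho> where "\<rho> = (%j::nat. r1 + \<epsilon> + 3 * real j * \<epsilon>)"
    let ?B = "%j. cball (\<rho> j *\<^sub>R s) \<epsilon>"
    have \<rho>: "r1 + \<epsilon> <= \<rho> j" "\<rho> j + \<epsilon> <= r2" if "j < n" for j
    proof -
      show "r1 + \<epsilon> <= \<rho> j" using \<epsilon> by (simp add: \<rho>_def)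
      have "real (Suc j) <= real n" using that by simp
      also have "\<dots> <= (r2 - r1) / (3 * \<epsilon>)" by (rule n1)
      finally have "real (Suc j) * (3 * \<epsilon>) <= r2 - r1" using \<epsilon> by (simp add: field_simps)
      then show "\<rho> j + \<epsilon> <= r2" using \<epsilon> by (simp add: \<rho>_def algebra_simps)
    qed
    have inK: "\<rho> j *\<^sub>R s \<in> K'" if "j < n" for j
      unfolding K'_def using \<rho>[OF that] \<epsilon> s by (intro image_eqI[of _ _ "(\<rho> j, s)"]) auto
    have disj: "i = j" if "y \<in> ?B i" "y \<in> ?B j" for i j y
    proof (rule ccontr)
      assume "i ~= j"
      then have "\<bar>real i - real j\<bar> >= 1" by linarith
      then have "3 * \<epsilon> * 1 <= 3 * \<epsilon> * \<bar>real i - real j\<bar>" using \<epsilon> by (intro mult_left_mono) auto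
      also have "\<dots> = \<bar>\<rho> i - \<rho> j\<bar>"
      proof -
        have "\<rho> i - \<rho> j = 3 * \<epsilon> * (real i - real j)" by (simp add: \<rho>_def algebra_simps)
        then show ?thesis using \<epsilon> by (simp add: abs_mult)
      qed
      also have "\<dots> = dist (\<rho> i *\<^sub>R s) (\<rho> j *\<^sub>R s)"
        using ns by (simp add: dist_norm flip: scaleR_diff_left)
      also have "\<dots> <= 2 * \<epsilon>" using that dist_triangle2[of "\<rho> i *\<^sub>R s" "\<rho> j *\<^sub>R s" y] by simp
      finally show False using \<epsilon> by simp
    qed
    have low: "?f y >= flat (1/2)" if "j < n" "y \<in> ?B j" for j y
    proof -
      have dy: "norm (y - \<rho> j *\<^sub>R s) <= \<epsilon>" using that(2) by (simp add: dist_norm norm_minus_commute)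
      have \<rho>0: "\<rho> j > 0" using \<rho>(1)[OF that(1)] r \<epsilon> by linarith
      have n\<rho>: "norm (\<rho> j *\<^sub>R s) = \<rho> j" using ns \<rho>0 by simp
      have ny: "\<bar>norm y - \<rho> j\<bar> <= \<epsilon>" using norm_triangle_ineq3[of y "\<rho> j *\<^sub>R s"] dy unfolding n\<rho> by linarith
      then have nr: "r1 <= norm y" "norm y <= r2" using \<rho>[OF that(1)] by linarith+
      then have y0: "y ~= 0" using r by auto
      have "norm y *\<^sub>R (s - sgn y) = (norm y - \<rho> j) *\<^sub>R s - (y - \<rho> j *\<^sub>R s)"
        using y0 by (simp add: sgn_div_norm algebra_simps)
      then have "norm y * norm (s - sgn y) <= norm ((norm y - \<rho> j) *\<^sub>R s) + norm (y - \<rho> j *\<^sub>R s)"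
        by (metis norm_scaleR abs_norm_cancel norm_triangle_ineq4)
      also have "\<dots> <= 2 * \<epsilon>" using ny dy ns by simp
      finally have "norm y * norm (s - sgn y) <= r1 * e" by (simp add: \<epsilon>_def mult.commute)
      also have "\<dots> <= norm y * e" using nr e by (intro mult_right_mono) auto
      finally have "norm (s - sgn y) <= e" using y0 by simp
      then have "bump e (s \<bullet> sgn y) >= flat (1/2)" using bump_lower[OF ns _ e(1)] y0 by (simp add: norm_sgn)
      then show ?thesis using nr by simp
    qed
    define F where "F = (%j y. w y * indicator (?B j) y)"
    have iB: "integrable lebesgue (F j)" if "j < n" for j
      unfolding F_def
    proof (rule w_integrable_subset[OF compact_cball d(2)[OF inK[OF that]]])
      show "?B j \<subseteq> cball (\<rho> j *\<^sub>R s) d" using \<epsilon> by auto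
    qed simp
    have "c' * e ^ (N - 1) = flat (1/2) * (c * ((r2 - r1) / 6) * \<epsilon> ^ (N - 1))"
      unfolding c'_def \<epsilon>_def by (simp add: power_mult_distrib power_divide)
    also have "\<dots> <= flat (1/2) * (real n * (c * \<epsilon> ^ N))"
    proof (rule mult_left_mono)
      have "\<epsilon> ^ N = \<epsilon> * \<epsilon> ^ (N - 1)" using N by (simp add: power_eq_if)
      then have "real n * (c * \<epsilon> ^ N) = (real n * \<epsilon>) * (c * \<epsilon> ^ (N - 1))" by (simp only: mult_ac)
      moreover have "(r2 - r1) / 6 <= real n * \<epsilon>" using n2 \<epsilon> by (simp add: field_simps)
      then have "(r2 - r1) / 6 * (c * \<epsilon> ^ (N - 1)) <= (real n * \<epsilon>) * (c * \<epsilon> ^ (N - 1))"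
        using c \<epsilon> by (intro mult_right_mono) auto
      ultimately show "c * ((r2 - r1) / 6) * \<epsilon> ^ (N - 1) <= real n * (c * \<epsilon> ^ N)" by (simp only: mult_ac)
    qed (simp add: flat_nonneg)
    also have "real n * (c * \<epsilon> ^ N) = (\<Sum>j<n. c * \<epsilon> ^ N)" by simp
    also have "flat (1/2) * \<dots> <= flat (1/2) * (\<Sum>j<n. \<integral>y. F j y \<partial>lebesgue)"
      by (intro mult_left_mono sum_mono) (auto simp: F_def flat_nonneg intro!: c(3) inK \<epsilon>)
    also have "\<dots> = (\<integral>y. flat (1/2) * (\<Sum>j<n. F j y) \<partial>lebesgue)"
      using iB by simp
    also have "\<dots> <= (\<integral>y. w y * ?f y \<partial>lebesgue)"
    proof (rule integral_mono[OF _ int])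
      show "integrable lebesgue (%y. flat (1/2) * (\<Sum>j<n. F j y))" by (intro integrable_mult_right Bochner_Integration.integrable_sum iB) auto
      fix y
      show "flat (1/2) * (\<Sum>j<n. F j y) <= w y * ?f y"
      proof (cases "\<exists>j<n. y \<in> ?B j")
        case True
        then obtain j where j: "j < n" "y \<in> ?B j" by blast
        have "(\<Sum>i<n. F i y) = (\<Sum>i<n. if i = j then w y else 0)"
          by (intro sum.cong refl) (use j disj in \<open>auto simp: F_def indicator_def\<close>)
        also have "\<dots> = w y" using j by simp
        finally show ?thesis using mult_left_mono[OF low[OF j] w_nonneg[of y]] by (simp add: mult.commute)
      next
        case False
        then have "(\<Sum>i<n. F i y) = 0" by (intro sum.neutral) (auto simp: F_def)
        then show ?thesis using w_nonneg[of y] bump_nonneg by simp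
      qed
    qed
    finally show "c' * e ^ (DIM('a) - 1) <= (\<integral>y. w y * ?f y \<partial>lebesgue)" by (simp add: N_def)
  qed
  then show ?thesis by blast
qed

end

section \<open>Integral inequality for positive supersolutions on the sphere\<close>

text \<open>Multiplying the inequality for \<open>Y\<close> by \<open>\<psi>\<^sup>2 / Y\<close> and integrating by parts completes a square
  (Allegretto--Piepenbrink, Agmon).\<close>

lemma allegretto_piepenbrink:
  fixes Y \<phi> :: "'a::euclidean_space => real"
  assumes Y: "smooth_on (UNIV - {0}) Y" "!!x. Y x = Y (sgn x)"
    and \<phi>: "smooth_on (UNIV - {0}) (%x. \<phi> (sgn x))"
    and pos: "!!s. norm s = 1 ==> s \<in> closure {s \<in> sphere 0 1. \<phi> s ~= 0} ==> Y s > 0"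
  shows "smooth_on (UNIV - {0}) (%s. (\<phi> (sgn s))\<^sup>2 * (- laplacian Y s) / Y s)"
    and "sphere_integral (%s. (\<phi> (sgn s))\<^sup>2 * (- laplacian Y s) / Y s) <= dirichlet \<phi>"
proof -
  define \<Psi> where "\<Psi> = (%x. \<phi> (sgn x))"
  have s\<Psi>: "smooth_on (UNIV - {0}) \<Psi>" using \<phi> by (simp add: \<Psi>_def)
  have h\<Psi>: "\<Psi> x = \<Psi> (sgn x)" for x by (simp add: \<Psi>_def sgn_sgn_vector)
  have op: "open (UNIV - {0::'a})" by (simp add: open_delete)
  define h where "h = (%t. flat t * flat (1 - t))"
  have hs: "smooth_on UNIV h"
    unfolding h_def by (intro smooth_on_mult flat_smooth smooth_on_flat_affine) auto
  have hz: "h t = 0" if "t < 0 \<or> t > 1" for t using that by (auto simp: h_def flat_zero)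
  have h0: "h t >= 0" for t by (simp add: h_def flat_nonneg)
  have h1: "(h has_real_derivative flat t * (- (flat (1 - t) * (inverse (1 - t))\<^sup>2)) + flat t * (inverse t)\<^sup>2 * flat (1 - t)) (at t)" for t
  proof -
    have "((%t. flat (1 - t)) has_real_derivative (flat (1 - t) * (inverse (1 - t))\<^sup>2) * (- 1)) (at t)"
      by (rule DERIV_chain2[OF flat_deriv]) (auto intro!: derivative_eq_intros)
    then show ?thesis unfolding h_def by (rule DERIV_cong[OF DERIV_mult[OF flat_deriv]]) simp
  qed
  define \<xi> where "\<xi> = (%x::'a. h (ln (norm x)))"
  have s\<xi>: "smooth_on (UNIV - {0}) \<xi>" unfolding \<xi>_def by (rule smooth_on_radial[OF hs])
  have \<xi>z: "\<xi> x = 0" if "norm x < 1 \<or> norm x > exp 1" for x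
    using that ln_norm_bounds[of x 0] ln_norm_bounds[of x 1] hz[of "ln (norm x)"]
    by (cases "x = 0") (auto simp: \<xi>_def h_def flat_zero)
  have \<xi>0: "\<xi> x >= 0" for x by (simp add: \<xi>_def h0)
  define S where "S = closure {s \<in> sphere 0 1. \<phi> s ~= 0}"
  have S\<Psi>: "\<exists>U. open U & x \<in> U & U \<subseteq> UNIV - {0} & (\<forall>y\<in>U. \<Psi> y = 0)" if x: "x ~= 0" "sgn x \<notin> S" for x
  proof -
    define U where "U = sgn -` (- S) \<inter> (UNIV - {0::'a})"
    have oS: "open (- S)" unfolding S_def by (rule open_Compl) simp
    have "continuous_on (UNIV - {0::'a}) sgn" by (intro continuous_on_sgn continuous_on_id) auto
    then have "open U" unfolding U_def using iffD1[OF continuous_on_open_vimage[OF op], rule_format, of sgn "- S"] oS by blast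
    moreover have "\<Psi> y = 0" if "y \<in> U" for y
    proof (rule ccontr)
      assume "\<Psi> y ~= 0"
      then have "sgn y \<in> {s \<in> sphere 0 1. \<phi> s ~= 0}" using that by (auto simp: \<Psi>_def U_def norm_sgn)
      then have "sgn y \<in> S" unfolding S_def by (rule subsetD[OF closure_subset])
      then show False using that by (simp add: U_def)
    qed
    ultimately show ?thesis using x by (intro exI[of _ U]) (auto simp: U_def)
  qed
  have Ypos: "Y x > 0" if "x ~= 0" "sgn x \<in> S" for x
    using pos[of "sgn x"] that Y(2)[of x] by (simp add: S_def norm_sgn)
  define F where "F = (%i x. \<xi> x * ((\<Psi> x)\<^sup>2 * (dderiv [i] Y x * inverse (Y x))))"
  define Div where "Div = (%x. \<xi> x * (grad_sq \<Psi> x - (\<Psi> x)\<^sup>2 * (- laplacian Y x) / Y x))"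
  have sF: "smooth_on (UNIV - {0}) (F i)" for i
  proof (rule smooth_on_local)
    fix x :: 'a assume "x \<in> UNIV - {0}"
    then have x: "x ~= 0" by simp
    show "\<exists>U. open U & x \<in> U & smooth_on U (F i)"
    proof (cases "Y x > 0")
      case True
      define U where "U = Y -` {0<..} \<inter> (UNIV - {0})"
      have oU: "open U" unfolding U_def
        using iffD1[OF continuous_on_open_vimage[OF op] smooth_on_continuous[OF Y(1)], rule_format, of "{0<..}"] by simp
      have sub: "U \<subseteq> UNIV - {0}" by (auto simp: U_def)
      have "smooth_on U (F i)"
        unfolding F_def
        by (intro smooth_on_mult smooth_on_inverse smooth_on_power oU smooth_on_subset[OF _ sub] s\<xi> s\<Psi> smooth_on_D Y(1)) (auto simp: U_def)
      then show ?thesis using oU x True by (intro exI[of _ U]) (auto simp: U_def)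
    next
      case False
      then have "sgn x \<notin> S" using Ypos[OF x] by blast
      then obtain U where U: "open U" "x \<in> U" "\<forall>y\<in>U. \<Psi> y = 0" using S\<Psi>[OF x] by blast
      have "smooth_on U (F i)"
        by (rule smooth_on_cong[OF U(1) _ smooth_on_const[of _ 0]]) (use U in \<open>simp add: F_def\<close>)
      then show ?thesis using U by blast
    qed
  qed
  have aF: "annular (F i)" for i
    by (rule annularI[OF sF, of 1 "exp 1"]) (use \<xi>z in \<open>auto simp: F_def\<close>)
  have int0: "(\<integral>x. dderiv [i] (F i) x \<partial>lborel) = 0" for i
  proof -
    obtain e M where e: "e > 0" "!!x. norm x < e \<or> norm x > M ==> F i x = 0" using annularE[OF aF] by blast
    show ?thesis by (rule integral_dderiv_zero[OF annular_smooth[OF aF], of "cball 0 M"]) (use e in auto)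
  qed
  have div_le: "(\<Sum>i\<in>Basis. dderiv [i] (F i) x) <= Div x" if x: "x ~= 0" for x
  proof (cases "Y x > 0")
    case False
    then have "sgn x \<notin> S" using Ypos[OF x] by blast
    then obtain U where U: "open U" "x \<in> U" "\<forall>y\<in>U. \<Psi> y = 0" using S\<Psi>[OF x] by blast
    have "dderiv [i] (F i) x = dderiv [i] (%_. 0) x" for i
      by (rule dderiv_cong_open[OF U(1) _ U(2)]) (use U in \<open>simp add: F_def\<close>)
    then have "(\<Sum>i\<in>Basis. dderiv [i] (F i) x) = 0" by (simp only: dderiv_zero) simp
    moreover have "Div x >= 0" using U \<xi>0[of x] grad_sq_nonneg[of \<Psi> x] by (simp add: Div_def)
    ultimately show ?thesis by linarith
  next
    case True
    have dY: "(Y has_derivative (%v. dderiv [v] Y x)) (at x)"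
      by (rule smooth_on_has_derivative[OF Y(1) op]) (use x in auto)
    have d\<Psi>: "(\<Psi> has_derivative (%v. dderiv [v] \<Psi> x)) (at x)"
      by (rule smooth_on_has_derivative[OF s\<Psi> op]) (use x in auto)
    have d\<xi>: "(\<xi> has_derivative (%v. dderiv [v] \<xi> x)) (at x)"
      by (rule smooth_on_has_derivative[OF s\<xi> op]) (use x in auto)
    have dF: "dderiv [i] (F i) x = dderiv [i] \<xi> x * dderiv [i] Y x * ((\<Psi> x)\<^sup>2 / Y x)
       + \<xi> x * (2 * \<Psi> x * dderiv [i] \<Psi> x * dderiv [i] Y x / Y x + (\<Psi> x)\<^sup>2 * dderiv [i,i] Y x / Y x - (\<Psi> x * dderiv [i] Y x / Y x)\<^sup>2)" for i
    proof -
      have dYi: "(dderiv [i] Y has_derivative (%v. dderiv [v,i] Y x)) (at x)"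
        using smooth_on_has_derivative[OF smooth_on_D[OF Y(1), of "[i]"] op, of x] x by simp
      have "(F i has_derivative (%v. \<xi> x * ((\<Psi> x)\<^sup>2 * (dderiv [i] Y x * (- (inverse (Y x) * dderiv [v] Y x * inverse (Y x))) + dderiv [v,i] Y x * inverse (Y x))
          + (2 * dderiv [v] \<Psi> x * \<Psi> x) * (dderiv [i] Y x * inverse (Y x)))
          + dderiv [v] \<xi> x * ((\<Psi> x)\<^sup>2 * (dderiv [i] Y x * inverse (Y x))))) (at x)"
        unfolding F_def
      proof (intro has_derivative_mult d\<xi> dYi Deriv.has_derivative_inverse dY)
        show "((%x. (\<Psi> x)\<^sup>2) has_derivative (%v. 2 * dderiv [v] \<Psi> x * \<Psi> x)) (at x)"
          unfolding power2_eq_square using has_derivative_mult[OF d\<Psi> d\<Psi>]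
          by (rule has_derivative_eq_rhs) (simp add: fun_eq_iff)
      qed (use True in simp)
      then have "dderiv [i] (F i) x = \<xi> x * ((\<Psi> x)\<^sup>2 * (dderiv [i] Y x * (- (inverse (Y x) * dderiv [i] Y x * inverse (Y x))) + dderiv [i,i] Y x * inverse (Y x))
          + (2 * dderiv [i] \<Psi> x * \<Psi> x) * (dderiv [i] Y x * inverse (Y x)))
          + dderiv [i] \<xi> x * ((\<Psi> x)\<^sup>2 * (dderiv [i] Y x * inverse (Y x)))"
        by (rule dderiv1_eq)
      moreover have "(a' * (P * P) * (b * (- (j * b * j)) + d * j) + a' * (2 * c * P) * (b * j)) + e * (P * P * (b * j))
          = e * b * (P * P * j) + a' * (2 * P * c * b * j + P * P * d * j - (P * b * j) * (P * b * j))" for a' P b j d c e :: real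
        by (simp add: algebra_simps)
      ultimately show ?thesis by (simp only: divide_inverse power2_eq_square distrib_left mult.assoc)
    qed
    have le: "2 * \<Psi> x * a * b / Y x + (\<Psi> x)\<^sup>2 * c / Y x - (\<Psi> x * b / Y x)\<^sup>2 <= a\<^sup>2 + (\<Psi> x)\<^sup>2 / Y x * c" for a b c
      using zero_le_power2[of "a - \<Psi> x * b / Y x"] by (simp add: power2_diff algebra_simps)
    have "(\<Sum>i\<in>Basis. dderiv [i] (F i) x) <= (\<Sum>i\<in>Basis. dderiv [i] \<xi> x * dderiv [i] Y x * ((\<Psi> x)\<^sup>2 / Y x)
       + \<xi> x * ((dderiv [i] \<Psi> x)\<^sup>2 + (\<Psi> x)\<^sup>2 / Y x * dderiv [i,i] Y x))"
      unfolding dF by (intro sum_mono add_left_mono mult_left_mono le \<xi>0)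
    also have "\<dots> = (\<Sum>i\<in>Basis. dderiv [i] \<xi> x * dderiv [i] Y x) * ((\<Psi> x)\<^sup>2 / Y x)
       + \<xi> x * (grad_sq \<Psi> x + (\<Psi> x)\<^sup>2 / Y x * laplacian Y x)"
      unfolding grad_sq_def laplacian_def by (simp only: sum.distrib distrib_left sum_distrib_left sum_distrib_right)
    also have "(\<Sum>i\<in>Basis. dderiv [i] \<xi> x * dderiv [i] Y x) = 0"
      unfolding \<xi>_def by (rule sum_radial_homogeneous[OF Y(2) x Y(1) h1])
    finally show ?thesis by (simp add: Div_def algebra_simps)
  qed
  define P where "P = (%s. (\<Psi> s)\<^sup>2 * (- laplacian Y s) / Y s)"
  have sP: "smooth_on (UNIV - {0}) P"
  proof (rule smooth_on_local)
    fix x :: 'a assume "x \<in> UNIV - {0}"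
    then have x: "x ~= 0" by simp
    show "\<exists>U. open U & x \<in> U & smooth_on U P"
    proof (cases "Y x > 0")
      case True
      define U where "U = Y -` {0<..} \<inter> (UNIV - {0})"
      have oU: "open U" unfolding U_def
        using iffD1[OF continuous_on_open_vimage[OF op] smooth_on_continuous[OF Y(1)], rule_format, of "{0<..}"] by simp
      have sub: "U \<subseteq> UNIV - {0}" by (auto simp: U_def)
      have "smooth_on U P"
        unfolding P_def divide_inverse
        by (intro smooth_on_mult smooth_on_inverse smooth_on_power smooth_on_minus oU smooth_on_subset[OF _ sub] s\<Psi> smooth_on_laplacian Y(1) op) (auto simp: U_def)
      then show ?thesis using oU x True by (intro exI[of _ U]) (auto simp: U_def)
    next
      case False
      then have "sgn x \<notin> S" using Ypos[OF x] by blast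
      then obtain U where U: "open U" "x \<in> U" "\<forall>y\<in>U. \<Psi> y = 0" using S\<Psi>[OF x] by blast
      have "smooth_on U P"
        by (rule smooth_on_cong[OF U(1) _ smooth_on_const[of _ 0]]) (use U in \<open>simp add: P_def\<close>)
      then show ?thesis using U by blast
    qed
  qed
  have sG: "smooth_on (UNIV - {0}) (grad_sq \<Psi>)" by (rule smooth_on_grad_sq[OF op s\<Psi>])
  obtain C1 where C1: "!!x. norm x = 1 ==> \<bar>grad_sq \<Psi> x\<bar> <= C1"
    using continuous_bounded_on_sphere[OF smooth_on_continuous[OF sG]] by blast
  obtain C2 where C2: "!!x. norm x = 1 ==> \<bar>P x\<bar> <= C2"
    using continuous_bounded_on_sphere[OF smooth_on_continuous[OF sP]] by blast
  note mG = smooth_on_borel_measurable[OF sG] and mP = smooth_on_borel_measurable[OF sP]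
  have "\<exists>F\<ge>0. \<forall>(g :: 'a => real) C. g \<in> borel_measurable borel --> (\<forall>x. norm x = 1 --> \<bar>g x\<bar> <= C) -->
       integrable lborel (%x. h (ln (norm x)) / (norm x)\<^sup>2 * g (sgn x)) &
       (\<integral>x. h (ln (norm x)) / (norm x)\<^sup>2 * g (sgn x) \<partial>lborel) = F * sphere_integral g"
    by (rule radial_factor[of h 0 1], rule smooth_on_continuous[OF hs], erule hz, rule h0)
  then obtain F0 where F00: "F0 >= 0" "\<forall>(g :: 'a => real) C. g \<in> borel_measurable borel --> (\<forall>x. norm x = 1 --> \<bar>g x\<bar> <= C) -->
       integrable lborel (%x. h (ln (norm x)) / (norm x)\<^sup>2 * g (sgn x)) &
       (\<integral>x. h (ln (norm x)) / (norm x)\<^sup>2 * g (sgn x) \<partial>lborel) = F0 * sphere_integral g"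
    by (elim exE conjE)
  note F0 = F00(2)[rule_format]
  have DivE: "Div x = h (ln (norm x)) / (norm x)\<^sup>2 * grad_sq \<Psi> (sgn x) - h (ln (norm x)) / (norm x)\<^sup>2 * P (sgn x)" if x: "x ~= 0" for x
  proof -
    have "grad_sq \<Psi> x = grad_sq \<Psi> (sgn x) / (norm x)\<^sup>2" "laplacian Y x = laplacian Y (sgn x) / (norm x)\<^sup>2"
      using homogeneous_grad_sq[OF h\<Psi> x s\<Psi>] homogeneous_laplacian[OF Y(2) x Y(1)] x by (simp_all add: field_simps)
    then show ?thesis
      unfolding Div_def P_def \<xi>_def using Y(2)[of x] h\<Psi>[of x] by (simp add: algebra_simps)
  qed
  have iD: "integrable lborel (%x. h (ln (norm x)) / (norm x)\<^sup>2 * grad_sq \<Psi> (sgn x))"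
     "integrable lborel (%x. h (ln (norm x)) / (norm x)\<^sup>2 * P (sgn x))"
    using F0[OF mG C1] F0[OF mP C2] by blast+
  have "0 = (\<integral>x. (\<Sum>i\<in>Basis. dderiv [i] (F i) x) \<partial>lborel)"
    using annular_integrable[OF annular_dderiv[OF aF]] int0
    by (subst Bochner_Integration.integral_sum) (auto simp del: dderiv.simps)
  also have "\<dots> <= (\<integral>x. h (ln (norm x)) / (norm x)\<^sup>2 * grad_sq \<Psi> (sgn x) - h (ln (norm x)) / (norm x)\<^sup>2 * P (sgn x) \<partial>lborel)"
  proof (rule integral_mono_AE)
    show "integrable lborel (%x. \<Sum>i\<in>Basis. dderiv [i] (F i) x)"
      by (intro Bochner_Integration.integrable_sum annular_integrable annular_dderiv aF)
    show "AE x in lborel. (\<Sum>i\<in>Basis. dderiv [i] (F i) x) <= h (ln (norm x)) / (norm x)\<^sup>2 * grad_sq \<Psi> (sgn x) - h (ln (norm x)) / (norm x)\<^sup>2 * P (sgn x)"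
      using AE_lborel_singleton[of "0::'a"] by eventually_elim (use div_le DivE in metis)
  qed (use iD in simp)
  also have "\<dots> = F0 * sphere_integral (grad_sq \<Psi>) - F0 * sphere_integral P"
    using iD F0[OF mG C1] F0[OF mP C2] by simp
  finally have le: "F0 * sphere_integral P <= F0 * sphere_integral (grad_sq \<Psi>)" by simp
  have F0pos: "F0 > 0"
  proof -
    have "F0 ~= 0"
    proof
      assume "F0 = 0"
      then have "(\<integral>x. h (ln (norm x)) / (norm x)\<^sup>2 * (%_. 1) (sgn x) \<partial>(lborel::'a measure)) = 0"
        using F0[of "%_. 1" 1] by simp
      moreover have "annular (separated h (%_::'a. 1))" by (rule separated_annular[OF hs hz smooth_on_const])
      then have a2: "annular (%x::'a. separated h (%_. 1) x / (norm x)\<^sup>2)" by (rule annular_divide_norm_sq)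
      obtain e :: 'a where e: "norm e = 1" using norm_Basis SOME_Basis by blast
      have "(\<integral>x. separated h (%_. 1) x / (norm x)\<^sup>2 \<partial>(lborel::'a measure)) > 0"
      proof (rule integral_pos_continuous[where x="exp (1/2) *\<^sub>R e"])
        show "separated h (%_. 1) x / (norm x)\<^sup>2 >= 0" for x :: 'a by (simp add: separated_def h0)
        show "separated h (%_. 1) (exp (1/2) *\<^sub>R e) / (norm (exp (1/2) *\<^sub>R e))\<^sup>2 ~= 0"
          using e flat_pos[of "1/2"] by (auto simp: separated_def h_def)
      qed (use smooth_on_continuous[OF annular_smooth[OF a2]] annular_integrable[OF a2] in auto)
      moreover have "separated h (%_. 1) x / (norm x)\<^sup>2 = h (ln (norm x)) / (norm x)\<^sup>2 * (%_. 1) (sgn x)" for x :: 'a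
        by (simp add: separated_def)
      ultimately show False by simp
    qed
    then show ?thesis using F00(1) by simp
  qed
  have "sphere_integral P <= sphere_integral (grad_sq \<Psi>)" using le F0pos by simp
  then show "sphere_integral (%s. (\<phi> (sgn s))\<^sup>2 * (- laplacian Y s) / Y s) <= dirichlet \<phi>"
    by (simp add: P_def \<Psi>_def dirichlet_def)
  show "smooth_on (UNIV - {0}) (%s. (\<phi> (sgn s))\<^sup>2 * (- laplacian Y s) / Y s)"
    using sP by (simp add: P_def \<Psi>_def)
qed

section \<open>Zonal potentials\<close>

lemma integrable_continuous_on_compact:
  fixes f g :: "'a::euclidean_space => real"
  assumes "integrable lebesgue (%x. f x * indicator K x)" "compact K" "continuous_on K g"
  shows "integrable lebesgue (%x. f x * (g x * indicator K x))"
proof -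
  obtain B where B: "!!x. x \<in> K ==> \<bar>g x\<bar> <= B"
    using compact_imp_bounded[OF compact_continuous_image[OF assms(3,2)]] by (auto simp: bounded_iff)
  have "(%x. g x * indicator K x) \<in> borel_measurable borel"
    using borel_measurable_continuous_on_indicator[OF _ assms(3)] compact_imp_closed[OF assms(2)]
    by (simp add: mult.commute)
  then have m: "(%x. g x * indicator K x) \<in> borel_measurable lebesgue" by (simp add: measurable_completion)
  have "integrable lebesgue (%x. (f x * indicator K x) * (g x * indicator K x))"
  proof (rule Bochner_Integration.integrable_bound)
    show "integrable lebesgue (%x. B * (f x * indicator K x))" using assms(1) by simp
    show "(%x. (f x * indicator K x) * (g x * indicator K x)) \<in> borel_measurable lebesgue"
      using borel_measurable_integrable[OF assms(1)] m by (rule borel_measurable_times)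
    show "AE x in lebesgue. norm ((f x * indicator K x) * (g x * indicator K x)) <= norm (B * (f x * indicator K x))"
    proof (rule AE_I2)
      fix x show "norm ((f x * indicator K x) * (g x * indicator K x)) <= norm (B * (f x * indicator K x))"
      proof (cases "x \<in> K")
        case True
        then have "\<bar>g x\<bar> <= \<bar>B\<bar>" using B by fastforce
        then have "\<bar>f x\<bar> * \<bar>g x\<bar> <= \<bar>f x\<bar> * \<bar>B\<bar>" by (intro mult_left_mono) auto
        then show ?thesis using True by (simp add: abs_mult mult.commute)
      qed simp
    qed
  qed
  moreover have "(f x * indicator K x) * (g x * indicator K x) = f x * (g x * indicator K x)" for x
    by (simp add: indicator_def)
  ultimately show ?thesis by simp
qed

lemma integrable_times_zonal:
  fixes v :: "'a::euclidean_space => real"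
  assumes v: "integrable lebesgue v" and G: "continuous_on UNIV G"
  shows "integrable lebesgue (%y. v y * G (x \<bullet> sgn y))"
proof -
  have "bounded (G ` {- norm x..norm x})"
    by (intro compact_imp_bounded compact_continuous_image continuous_on_subset[OF G]) auto
  then obtain B where B': "\<forall>t\<in>{- norm x..norm x}. \<bar>G t\<bar> <= B" by (auto simp: bounded_iff)
  note B = B'[rule_format]
  have GB: "\<bar>G (x \<bullet> sgn y)\<bar> <= B" for y
  proof (rule B)
    have "\<bar>x \<bullet> sgn y\<bar> <= norm x * norm (sgn y)" by (rule Cauchy_Schwarz_ineq2)
    also have "\<dots> <= norm x * 1" by (intro mult_left_mono) (auto simp: norm_sgn)
    finally show "x \<bullet> sgn y \<in> {- norm x..norm x}" by auto
  qed
  have [measurable]: "G \<in> borel_measurable borel" by (rule borel_measurable_continuous_onI[OF G])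
  have "(%y::'a. G (x \<bullet> sgn y)) \<in> borel_measurable borel" by measurable
  then have m: "(%y. G (x \<bullet> sgn y)) \<in> borel_measurable lebesgue" by (simp add: measurable_completion)
  show ?thesis
  proof (rule Bochner_Integration.integrable_bound)
    show "integrable lebesgue (%y. B * v y)" using v by simp
    show "(%y. v y * G (x \<bullet> sgn y)) \<in> borel_measurable lebesgue"
      using borel_measurable_integrable[OF v] m by (rule borel_measurable_times)
    show "AE y in lebesgue. norm (v y * G (x \<bullet> sgn y)) <= norm (B * v y)"
    proof (rule AE_I2)
      fix y
      have "\<bar>v y\<bar> * \<bar>G (x \<bullet> sgn y)\<bar> <= \<bar>v y\<bar> * \<bar>B\<bar>" using GB[of y] by (intro mult_left_mono) auto
      then show "norm (v y * G (x \<bullet> sgn y)) <= norm (B * v y)" by (simp add: abs_mult mult.commute)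
    qed
  qed
qed

lemma first_order_remainder:
  fixes G G' G'' :: "real => real"
  assumes G: "!!t. (G has_real_derivative G' t) (at t)" "!!t. (G' has_real_derivative G'' t) (at t)"
    and B: "!!t. t \<in> {- r..r} ==> \<bar>G'' t\<bar> <= B" and st: "s \<in> {- r..r}" "t \<in> {- r..r}"
  shows "\<bar>G t - G s - (t - s) * G' s\<bar> <= B * (t - s)\<^sup>2"
proof -
  let ?I = "closed_segment s t"
  have sub: "?I \<subseteq> {- r..r}" using st by (intro closed_segment_subset) auto
  have G'b: "norm (G' z - G' s) <= B * \<bar>t - s\<bar>" if "z \<in> ?I" for z
  proof -
    have "norm (G' z - G' s) <= B * norm (z - s)"
      by (rule field_differentiable_bound[of ?I G' G''])
         (use that sub B in \<open>auto intro: has_field_derivative_at_within G(2)\<close>)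
    also have "\<dots> <= B * \<bar>t - s\<bar>"
    proof (rule mult_left_mono)
      show "norm (z - s) <= \<bar>t - s\<bar>" using that by (auto simp: closed_segment_eq_real_ivl split: if_splits)
      show "B >= 0" using B[OF st(1)] by linarith
    qed
    finally show ?thesis .
  qed
  have "norm ((G t - t * G' s) - (G s - s * G' s)) <= (B * \<bar>t - s\<bar>) * norm (t - s)"
  proof (rule field_differentiable_bound[of ?I "%z. G z - z * G' s" "%z. G' z - G' s"])
    show "((%z. G z - z * G' s) has_field_derivative G' z - G' s) (at z within ?I)" for z
      by (rule has_field_derivative_at_within, rule DERIV_cong[OF DERIV_diff[OF G(1) DERIV_cmult_right[OF DERIV_ident]]]) simp
  qed (use G'b in auto)
  moreover have e1: "(G t - t * G' s) - (G s - s * G' s) = G t - G s - (t - s) * G' s" by (simp add: algebra_simps)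
  moreover have e2: "(B * \<bar>t - s\<bar>) * norm (t - s) = B * (t - s)\<^sup>2" by (simp add: power2_eq_square mult.assoc)
  ultimately show ?thesis by (simp only: real_norm_def)
qed

lemma zonal_potential_has_derivative:
  fixes v :: "'a::euclidean_space => real"
  assumes v: "integrable lebesgue v"
    and G: "!!t. (G has_real_derivative G' t) (at t)" "!!t. (G' has_real_derivative G'' t) (at t)" "continuous_on UNIV G''"
  shows "((%x. \<integral>y. v y * G (x \<bullet> sgn y) \<partial>lebesgue) has_derivative
    (%h. \<integral>y. (v y * (h \<bullet> sgn y)) * G' (x \<bullet> sgn y) \<partial>lebesgue)) (at x)"
proof -
  have cG: "continuous_on UNIV G" "continuous_on UNIV G'"
    using G(1,2) by (auto intro!: continuous_at_imp_continuous_on DERIV_isCont)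
  have vh: "integrable lebesgue (%y. v y * (h \<bullet> sgn y))" for h
    using integrable_times_zonal[OF v continuous_on_id, of h] by simp
  let ?D = "%h. \<integral>y. (v y * (h \<bullet> sgn y)) * G' (x \<bullet> sgn y) \<partial>lebesgue"
  have iD: "integrable lebesgue (%y. (v y * (h \<bullet> sgn y)) * G' (x \<bullet> sgn y))" for h
    by (rule integrable_times_zonal[OF vh cG(2)])
  have iG: "integrable lebesgue (%y. v y * G (z \<bullet> sgn y))" for z
    by (rule integrable_times_zonal[OF v cG(1)])
  have lin: "linear ?D"
  proof (rule linearI)
    fix h k
    have "(v y * ((h + k) \<bullet> sgn y)) * G' (x \<bullet> sgn y) = (v y * (h \<bullet> sgn y)) * G' (x \<bullet> sgn y) + (v y * (k \<bullet> sgn y)) * G' (x \<bullet> sgn y)" for y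
      by (simp add: inner_add_left algebra_simps)
    then show "?D (h + k) = ?D h + ?D k" using Bochner_Integration.integral_add[OF iD iD, of h k] by simp
  next
    fix c :: real and h
    have "(v y * ((c *\<^sub>R h) \<bullet> sgn y)) * G' (x \<bullet> sgn y) = c * ((v y * (h \<bullet> sgn y)) * G' (x \<bullet> sgn y))" for y
      by simp
    then show "?D (c *\<^sub>R h) = c *\<^sub>R ?D h" by (simp only: integral_mult_right_zero real_scaleR_def)
  qed
  define r where "r = norm x + 1"
  have "bounded (G'' ` {- r..r})"
    by (intro compact_imp_bounded compact_continuous_image continuous_on_subset[OF G(3)]) auto
  then obtain B where B': "\<forall>t\<in>{- r..r}. \<bar>G'' t\<bar> <= B" by (auto simp: bounded_iff)
  note B = B'[rule_format]
  define I where "I = (\<integral>y. \<bar>v y\<bar> \<partial>lebesgue)"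
  have bnd: "z \<bullet> sgn y \<in> {- r..r}" if "norm z <= r" for z y :: 'a
  proof -
    have "\<bar>z \<bullet> sgn y\<bar> <= norm z * norm (sgn y)" by (rule Cauchy_Schwarz_ineq2)
    also have "\<dots> <= norm z * 1" by (intro mult_left_mono) (auto simp: norm_sgn)
    finally show ?thesis using that by auto
  qed
  have B0: "B >= 0" using B[OF bnd[of x 0]] by (simp add: r_def)
  have est: "\<bar>(\<integral>y. v y * G (z \<bullet> sgn y) \<partial>lebesgue) - (\<integral>y. v y * G (x \<bullet> sgn y) \<partial>lebesgue) - ?D (z - x)\<bar> <= B * I * (norm (z - x))\<^sup>2"
    if z: "norm z <= r" for z
  proof -
    have "(\<integral>y. v y * G (z \<bullet> sgn y) \<partial>lebesgue) - (\<integral>y. v y * G (x \<bullet> sgn y) \<partial>lebesgue) - ?D (z - x)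
        = (\<integral>y. v y * G (z \<bullet> sgn y) - v y * G (x \<bullet> sgn y) - (v y * ((z - x) \<bullet> sgn y)) * G' (x \<bullet> sgn y) \<partial>lebesgue)"
      using iG iD by simp
    also have "\<bar>\<dots>\<bar> <= (\<integral>y. \<bar>v y\<bar> * (B * (norm (z - x))\<^sup>2) \<partial>lebesgue)"
    proof (rule integral_abs_bound[THEN order_trans], rule integral_mono)
      show "integrable lebesgue (%y. \<bar>v y * G (z \<bullet> sgn y) - v y * G (x \<bullet> sgn y) - (v y * ((z - x) \<bullet> sgn y)) * G' (x \<bullet> sgn y)\<bar>)"
        by (intro integrable_abs Bochner_Integration.integrable_diff iG iD)
      show "integrable lebesgue (%y. \<bar>v y\<bar> * (B * (norm (z - x))\<^sup>2))" using v by (intro integrable_mult_left integrable_abs)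
      fix y
      have "\<bar>z \<bullet> sgn y - x \<bullet> sgn y\<bar> <= norm (z - x)"
      proof -
        have "\<bar>(z - x) \<bullet> sgn y\<bar> <= norm (z - x) * norm (sgn y)" by (rule Cauchy_Schwarz_ineq2)
        also have "\<dots> <= norm (z - x) * 1" by (intro mult_left_mono) (auto simp: norm_sgn)
        finally show ?thesis by (simp add: inner_diff_left)
      qed
      then have "(z \<bullet> sgn y - x \<bullet> sgn y)\<^sup>2 <= (norm (z - x))\<^sup>2" by (metis abs_ge_zero power2_abs power_mono)
      then have "B * (z \<bullet> sgn y - x \<bullet> sgn y)\<^sup>2 <= B * (norm (z - x))\<^sup>2" by (rule mult_left_mono[OF _ B0])
      with first_order_remainder[OF G(1,2) B bnd bnd, of x z y y] z
      have "\<bar>G (z \<bullet> sgn y) - G (x \<bullet> sgn y) - (z \<bullet> sgn y - x \<bullet> sgn y) * G' (x \<bullet> sgn y)\<bar> <= B * (norm (z - x))\<^sup>2"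
        by (simp add: r_def)
      then have "\<bar>v y\<bar> * \<bar>G (z \<bullet> sgn y) - G (x \<bullet> sgn y) - (z \<bullet> sgn y - x \<bullet> sgn y) * G' (x \<bullet> sgn y)\<bar> <= \<bar>v y\<bar> * (B * (norm (z - x))\<^sup>2)"
        by (intro mult_left_mono) auto
      moreover have "v y * G (z \<bullet> sgn y) - v y * G (x \<bullet> sgn y) - (v y * ((z - x) \<bullet> sgn y)) * G' (x \<bullet> sgn y)
          = v y * (G (z \<bullet> sgn y) - G (x \<bullet> sgn y) - (z \<bullet> sgn y - x \<bullet> sgn y) * G' (x \<bullet> sgn y))"
        by (simp add: inner_diff_left algebra_simps)
      ultimately show "\<bar>v y * G (z \<bullet> sgn y) - v y * G (x \<bullet> sgn y) - (v y * ((z - x) \<bullet> sgn y)) * G' (x \<bullet> sgn y)\<bar> <= \<bar>v y\<bar> * (B * (norm (z - x))\<^sup>2)"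
        by (simp only: abs_mult)
    qed
    also have "\<dots> = B * I * (norm (z - x))\<^sup>2" by (simp add: I_def)
    finally show ?thesis .
  qed
  show ?thesis
  proof (rule has_derivativeI_sandwich[where e=1 and H="%z. B * I * norm (z - x)"])
    show "bounded_linear ?D" using lin by (simp add: linear_conv_bounded_linear)
    fix z assume z: "z ~= x" "dist z x < 1"
    have "norm z <= r" using norm_triangle_ineq2[of z x] z(2) by (simp add: r_def dist_norm)
    from est[OF this] show "norm ((\<integral>y. v y * G (z \<bullet> sgn y) \<partial>lebesgue) - (\<integral>y. v y * G (x \<bullet> sgn y) \<partial>lebesgue) - ?D (z - x)) / norm (z - x) <= B * I * norm (z - x)"
      using z(1) by (simp add: divide_le_eq power2_eq_square mult.assoc)
  next
    have "((%z. B * I * norm (z - x)) \<longlongrightarrow> B * I * norm (x - x)) (at x)" by (intro tendsto_intros)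
    then show "((%z. B * I * norm (z - x)) \<longlongrightarrow> 0) (at x)" by simp
  qed simp
qed

lemma smooth_on_has_real_derivative:
  assumes "smooth_on UNIV (H :: real => real)"
  shows "(H has_real_derivative dderiv [1] H t) (at t)"
proof -
    have d: "(H has_derivative (%v. dderiv [v] H t)) (at t)" by (rule smooth_on_has_derivative[OF assms]) auto
    then have "linear (%v. dderiv [v] H t)" by (rule has_derivative_linear)
    then have "dderiv [v] H t = dderiv [1] H t * v" for v
      using linear_scale[of "%v. dderiv [v] H t" v 1] by (simp del: dderiv.simps)
    then have "(%v. dderiv [v] H t) = (*) (dderiv [1] H t)" by (rule ext)
    then show ?thesis using d unfolding has_field_derivative_def by metis
qed

lemma zonal_potential_smooth:
  fixes v :: "'a::euclidean_space => real"
  assumes v: "integrable lebesgue v" and G: "smooth_on UNIV G"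
  shows "smooth_on UNIV (%x. \<integral>y. v y * G (x \<bullet> sgn y) \<partial>lebesgue)"
proof (rule smooth_on_family[where F="{%x. \<integral>y. v y * G (x \<bullet> sgn y) \<partial>lebesgue | v G. integrable lebesgue v & smooth_on UNIV G}"])
  fix f :: "'a => real" assume "f \<in> {%x. \<integral>y. v y * G (x \<bullet> sgn y) \<partial>lebesgue | v G. integrable lebesgue v & smooth_on UNIV G}"
  then obtain v G where f: "f = (%x. \<integral>y. v y * G (x \<bullet> sgn y) \<partial>lebesgue)" and v: "integrable lebesgue v" and G: "smooth_on UNIV G" by blast
  note D = smooth_on_has_real_derivative
  note s1 = smooth_on_D[OF G, of "[1]"]
  note der = zonal_potential_has_derivative[OF v D[OF G] D[OF s1] smooth_on_continuous[OF smooth_on_D[OF s1]]]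
  show "\<exists>D. (\<forall>x\<in>UNIV. (f has_derivative D x) (at x)) & (\<forall>u. (%x. D x u) \<in> {%x. \<integral>y. v y * G (x \<bullet> sgn y) \<partial>lebesgue | v G. integrable lebesgue v & smooth_on UNIV G})"
  proof (rule exI[of _ "%x h. \<integral>y. (v y * (h \<bullet> sgn y)) * dderiv [1] G (x \<bullet> sgn y) \<partial>lebesgue"], intro conjI ballI allI)
    show "(f has_derivative (%h. \<integral>y. (v y * (h \<bullet> sgn y)) * dderiv [1] G (x \<bullet> sgn y) \<partial>lebesgue)) (at x)" for x
      unfolding f by (rule der)
    fix u
    have "integrable lebesgue (%y. v y * (u \<bullet> sgn y))"
      using integrable_times_zonal[OF v continuous_on_id, of u] by simp
    then show "(%x. \<integral>y. (v y * (u \<bullet> sgn y)) * dderiv [1] G (x \<bullet> sgn y) \<partial>lebesgue) \<in> {%x. \<integral>y. v y * G (x \<bullet> sgn y) \<partial>lebesgue | v G. integrable lebesgue v & smooth_on UNIV G}"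
      by (intro CollectI exI[of _ "%y. v y * (u \<bullet> sgn y)"] exI[of _ "dderiv [1] G"] conjI refl s1)
  qed
qed (use v G in auto)

definition zonal_lap :: "nat => (real => real) => (real => real) => real => real" where
  "zonal_lap n G' G'' t = (1 - t\<^sup>2) * G'' t - (real n - 1) * t * G' t"

lemma laplacian_zonal:
  fixes s :: "'a::euclidean_space"
  assumes x: "x ~= 0" and s: "norm s = 1"
    and G: "!!t. (G has_real_derivative G' t) (at t)" "!!t. (G' has_real_derivative G'' t) (at t)"
  shows "laplacian (%x. G (s \<bullet> sgn x)) x = zonal_lap DIM('a) G' G'' (s \<bullet> sgn x) / (norm x)\<^sup>2"
proof -
  have "laplacian (%x. (%z. G (s \<bullet> z)) (sgn x)) x = ((\<Sum>i\<in>Basis. (s \<bullet> i) * ((s \<bullet> i) * G'' (s \<bullet> sgn x))) - (\<Sum>i\<in>Basis. (sgn x \<bullet> i) * ((s \<bullet> i) * ((s \<bullet> sgn x) * G'' (s \<bullet> sgn x))))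
     - (real DIM('a) - 1) * ((s \<bullet> sgn x) * G' (s \<bullet> sgn x))) / (norm x)\<^sup>2"
  proof (rule laplacian_compose_sgn[OF x, where DZ="%y v. (s \<bullet> v) * G' (s \<bullet> y)" and ?D2.0="%y v h. (s \<bullet> v) * ((s \<bullet> h) * G'' (s \<bullet> y))"])
    have d: "((%z. s \<bullet> z) has_derivative (%h. s \<bullet> h)) (at y)" for y
      by (intro bounded_linear_imp_has_derivative bounded_linear_inner_right)
    have c: "((%z. H (s \<bullet> z)) has_derivative (%h. (s \<bullet> h) * H' (s \<bullet> y))) (at y)"
      if "!!t. (H has_real_derivative H' t) (at t)" for H H' y
      using has_derivative_compose[OF d that[unfolded has_field_derivative_def], of y] by (simp add: mult.commute)
    show "((%z. G (s \<bullet> z)) has_derivative (%v. (s \<bullet> v) * G' (s \<bullet> y))) (at y)" for y by (rule c[OF G(1)])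
    show "((%y. (s \<bullet> v) * G' (s \<bullet> y)) has_derivative (%h. (s \<bullet> v) * ((s \<bullet> h) * G'' (s \<bullet> y)))) (at y)" for v y
      by (rule has_derivative_mult_right[OF c[OF G(2)]])
  qed
  moreover have e1: "(\<Sum>i\<in>Basis. (s \<bullet> i) * ((s \<bullet> i) * c)) = c" for c
    using euclidean_inner[of s s] s by (simp add: mult.assoc[symmetric] flip: sum_distrib_right power2_norm_eq_inner)
  moreover have e2: "(\<Sum>i\<in>Basis. (sgn x \<bullet> i) * ((s \<bullet> i) * c)) = (s \<bullet> sgn x) * c" for c
    using euclidean_inner[of "sgn x" s] by (simp add: mult.assoc[symmetric] inner_commute flip: sum_distrib_right)
  ultimately show ?thesis unfolding e1 e2 by (simp add: zonal_lap_def power2_eq_square algebra_simps)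
qed

lemma laplacian_zonal_potential:
  fixes v :: "'a::euclidean_space => real"
  assumes v: "integrable lebesgue v" and v0: "v 0 = 0" and s: "norm s = 1"
    and G: "!!t. (G has_real_derivative G' t) (at t)" "!!t. (G' has_real_derivative G'' t) (at t)" "!!t. (G'' has_real_derivative G3 t) (at t)" "continuous_on UNIV G3"
  shows "laplacian (%x. \<integral>y. v y * G (sgn x \<bullet> sgn y) \<partial>lebesgue) s = (\<integral>y. v y * zonal_lap DIM('a) G' G'' (s \<bullet> sgn y) \<partial>lebesgue)"
proof -
  have cG: "continuous_on UNIV G'" "continuous_on UNIV G''"
    using G(2,3) by (auto intro!: continuous_at_imp_continuous_on DERIV_isCont)
  have vh: "integrable lebesgue (%y. v y * (h \<bullet> sgn y))" if "integrable lebesgue v" for h v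
    using integrable_times_zonal[OF that continuous_on_id, of h] by simp
  have s1: "sgn s = s" using s by (simp add: sgn_div_norm)
  have s0: "s ~= 0" using s by auto
  have "laplacian (%x. (%z. \<integral>y. v y * G (z \<bullet> sgn y) \<partial>lebesgue) (sgn x)) s
     = ((\<Sum>i\<in>Basis. \<integral>y. (v y * (i \<bullet> sgn y) * (i \<bullet> sgn y)) * G'' (sgn s \<bullet> sgn y) \<partial>lebesgue)
       - (\<Sum>i\<in>Basis. (sgn s \<bullet> i) * (\<integral>y. (v y * (i \<bullet> sgn y) * (sgn s \<bullet> sgn y)) * G'' (sgn s \<bullet> sgn y) \<partial>lebesgue))
     - (real DIM('a) - 1) * (\<integral>y. (v y * (sgn s \<bullet> sgn y)) * G' (sgn s \<bullet> sgn y) \<partial>lebesgue)) / (norm s)\<^sup>2"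
    by (rule laplacian_compose_sgn[OF s0, where DZ="%x h. \<integral>y. (v y * (h \<bullet> sgn y)) * G' (x \<bullet> sgn y) \<partial>lebesgue" and ?D2.0="%x u h. \<integral>y. (v y * (u \<bullet> sgn y) * (h \<bullet> sgn y)) * G'' (x \<bullet> sgn y) \<partial>lebesgue"])
       (rule zonal_potential_has_derivative[OF v G(1,2) cG(2)], rule zonal_potential_has_derivative[OF vh[OF v] G(2,3,4)])
  also have "\<dots> = (\<Sum>i\<in>Basis. \<integral>y. (v y * (i \<bullet> sgn y) * (i \<bullet> sgn y)) * G'' (s \<bullet> sgn y) \<partial>lebesgue)
       - (\<Sum>i\<in>Basis. (s \<bullet> i) * (\<integral>y. (v y * (i \<bullet> sgn y) * (s \<bullet> sgn y)) * G'' (s \<bullet> sgn y) \<partial>lebesgue))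
     - (real DIM('a) - 1) * (\<integral>y. (v y * (s \<bullet> sgn y)) * G' (s \<bullet> sgn y) \<partial>lebesgue)"
    by (simp add: s s1)
  also have "\<dots> = (\<integral>y. (\<Sum>i\<in>Basis. (v y * (i \<bullet> sgn y) * (i \<bullet> sgn y)) * G'' (s \<bullet> sgn y))
       - (\<Sum>i\<in>Basis. (s \<bullet> i) * ((v y * (i \<bullet> sgn y) * (s \<bullet> sgn y)) * G'' (s \<bullet> sgn y)))
       - (real DIM('a) - 1) * ((v y * (s \<bullet> sgn y)) * G' (s \<bullet> sgn y)) \<partial>lebesgue)"
  proof -
    have i1: "integrable lebesgue (%y. (v y * (a \<bullet> sgn y) * (b \<bullet> sgn y)) * G'' (s \<bullet> sgn y))" for a b
      by (intro integrable_times_zonal[OF vh[OF vh[OF v]] cG(2)])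
    have i2: "integrable lebesgue (%y. (v y * (s \<bullet> sgn y)) * G' (s \<bullet> sgn y))"
      by (intro integrable_times_zonal[OF vh[OF v] cG(1)])
    show ?thesis
      by (subst Bochner_Integration.integral_diff, (intro Bochner_Integration.integrable_diff Bochner_Integration.integrable_sum integrable_mult_right i1 i2)+,
          subst Bochner_Integration.integral_diff, (intro Bochner_Integration.integrable_sum integrable_mult_right i1)+,
          subst Bochner_Integration.integral_sum, rule i1,
          subst Bochner_Integration.integral_sum, intro integrable_mult_right i1, simp only: integral_mult_right_zero)
  qed
  also have "\<dots> = (\<integral>y. v y * zonal_lap DIM('a) G' G'' (s \<bullet> sgn y) \<partial>lebesgue)"
  proof (rule Bochner_Integration.integral_cong[OF refl])
    fix y :: 'a
    show "(\<Sum>i\<in>Basis. (v y * (i \<bullet> sgn y) * (i \<bullet> sgn y)) * G'' (s \<bullet> sgn y))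
       - (\<Sum>i\<in>Basis. (s \<bullet> i) * ((v y * (i \<bullet> sgn y) * (s \<bullet> sgn y)) * G'' (s \<bullet> sgn y)))
       - (real DIM('a) - 1) * ((v y * (s \<bullet> sgn y)) * G' (s \<bullet> sgn y)) = v y * zonal_lap DIM('a) G' G'' (s \<bullet> sgn y)"
    proof (cases "y = 0")
      case False
      have e1: "(\<Sum>i\<in>Basis. (v y * (i \<bullet> sgn y) * (i \<bullet> sgn y)) * G'' (s \<bullet> sgn y)) = v y * (sgn y \<bullet> sgn y) * G'' (s \<bullet> sgn y)"
        unfolding euclidean_inner[of "sgn y" "sgn y"] sum_distrib_left sum_distrib_right by (simp add: inner_commute mult_ac)
      have e2: "(\<Sum>i\<in>Basis. (s \<bullet> i) * ((v y * (i \<bullet> sgn y) * (s \<bullet> sgn y)) * G'' (s \<bullet> sgn y))) = v y * (s \<bullet> sgn y) * (s \<bullet> sgn y) * G'' (s \<bullet> sgn y)"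
      proof -
        have "(\<Sum>i\<in>Basis. (s \<bullet> i) * ((v y * (i \<bullet> sgn y) * (s \<bullet> sgn y)) * G'' (s \<bullet> sgn y)))
          = (\<Sum>i\<in>Basis. (s \<bullet> i) * (sgn y \<bullet> i)) * (v y * (s \<bullet> sgn y) * G'' (s \<bullet> sgn y))"
          unfolding sum_distrib_right by (rule sum.cong) (simp_all add: inner_commute mult_ac)
        then show ?thesis by (simp flip: euclidean_inner add: mult_ac)
      qed
      have "sgn y \<bullet> sgn y = 1" using False by (simp add: norm_sgn flip: power2_norm_eq_inner)
      then show ?thesis unfolding e1 e2 by (simp add: zonal_lap_def power2_eq_square algebra_simps)
    qed (simp add: v0)
  qed
  finally show ?thesis by simp
qed

lemma powr_tangent:
  assumes "(p::real) > 1" "x >= 0" "s >= 0"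
  shows "x powr p >= p * s powr (p - 1) * x - (p - 1) * s powr p"
proof (cases "x = 0 \<or> s = 0")
  case False
  then have "(x powr p) powr (1/p) * (s powr p) powr ((p - 1)/p) <= (1/p) * x powr p + ((p - 1)/p) * s powr p"
    using assms by (intro Youngs_inequality_0) (auto simp: field_simps)
  moreover have "(x powr p) powr (1/p) = x" "(s powr p) powr ((p - 1)/p) = s powr (p - 1)"
    using assms by (auto simp: powr_powr)
  ultimately have "p * (x * s powr (p - 1)) <= p * ((1/p) * x powr p + ((p - 1)/p) * s powr p)"
    using assms by (intro mult_left_mono) auto
  also have "\<dots> = x powr p + (p - 1) * s powr p" using assms by (simp add: field_simps)
  finally show ?thesis by (simp add: algebra_simps)
qed (use assms in auto)

lemma nn_integral_log_cauchy:
  assumes q: "q > 0"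
  shows "(\<integral>\<^sup>+(r::real). ennreal (1 / r / (1 + q\<^sup>2 * (a - ln r)\<^sup>2)) * indicator {0<..} r \<partial>lborel) = ennreal (pi / q)"
proof -
  let ?f = "%r::real. 1 / r / (1 + q\<^sup>2 * (a - ln r)\<^sup>2)"
  let ?F = "%r. arctan (q * (ln r - a)) / q"
  have den: "1 + q\<^sup>2 * x\<^sup>2 > 0" for x by (rule add_pos_nonneg) auto
  have l1: "(?F \<longlongrightarrow> - (pi/2) / q) (at_right 0)"
  proof -
    have "filterlim (%r. ln r - a) at_bot (at_right 0)"
      unfolding filterlim_at_bot
    proof
      fix Z show "\<forall>\<^sub>F r in at_right 0. ln r - a <= Z"
        using ln_at_0[unfolded filterlim_at_bot, rule_format, of "Z + a"] by eventually_elim simp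
    qed
    then have "filterlim (%r. q * (ln r - a)) at_bot (at_right 0)"
      by (rule filterlim_tendsto_pos_mult_at_bot[OF tendsto_const q])
    from filterlim_compose[OF tendsto_arctan_at_bot this] show ?thesis using q by (intro tendsto_divide tendsto_const) auto
  qed
  have l2: "(?F \<longlongrightarrow> (pi/2) / q) at_top"
  proof -
    have "filterlim (%r. ln r - a) at_top at_top"
      unfolding filterlim_at_top
    proof
      fix Z show "\<forall>\<^sub>F r in at_top. Z <= ln r - a"
        using ln_at_top[unfolded filterlim_at_top, rule_format, of "Z + a"] by eventually_elim simp
    qed
    then have "filterlim (%r. q * (ln r - a)) at_top at_top"
      by (rule filterlim_tendsto_pos_mult_at_top[OF tendsto_const q])
    from filterlim_compose[OF tendsto_arctan_at_top this] show ?thesis using q by (intro tendsto_divide tendsto_const) auto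
  qed
  have D: "(?F has_real_derivative ?f x) (at x)" if "x > 0" for x
  proof -
    have "((%r. q * (ln r - a)) has_real_derivative q * (1 / x)) (at x)"
      using that by (auto intro!: derivative_eq_intros)
    from DERIV_cdivide[OF DERIV_chain2[OF DERIV_arctan this], of q]
    have "(?F has_real_derivative inverse (1 + (q * (ln x - a))\<^sup>2) * (q * (1 / x)) / q) (at x)" .
    moreover have "(q * (ln x - a))\<^sup>2 = q\<^sup>2 * (a - ln x)\<^sup>2" by (simp add: power_mult_distrib power2_commute)
    moreover have "inverse Z * (q * (1 / x)) / q = 1 / x / Z" for Z using q by (simp add: divide_simps)
    ultimately show ?thesis by (simp only:)
  qed
  have c: "isCont ?f x" if "x > 0" for x
    using that den[of "a - ln x"] by (intro continuous_intros) auto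
  have F1: "DERIV ?F x :> ?f x" if "0 < ereal x" "ereal x < \<infinity>" for x using that by (intro D) simp
  have F2: "isCont ?f x" if "0 < ereal x" "ereal x < \<infinity>" for x using that by (intro c) simp
  have F3: "AE x in lborel. 0 < ereal x --> ereal x < \<infinity> --> 0 <= ?f x"
  proof (intro AE_I2 impI)
    fix x :: real assume "0 < ereal x"
    then show "0 <= ?f x" using den[of "a - ln x"] by (intro divide_nonneg_nonneg less_imp_le[OF den]) auto
  qed
  have F4: "((?F \<circ> real_of_ereal) \<longlongrightarrow> - (pi / 2) / q) (at_right 0)"
    unfolding zero_ereal_def ereal_tendsto_simps using l1 by simp
  have F5: "((?F \<circ> real_of_ereal) \<longlongrightarrow> pi / 2 / q) (at_left \<infinity>)"
    unfolding ereal_tendsto_simps using l2 by simp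
  have zi: "(0::ereal) < \<infinity>" by simp
  note si = interval_integral_FTC_nonneg[of 0 "\<infinity>" ?F ?f, OF zi F1 F2 F3 F4 F5]
  have e: "einterval 0 \<infinity> = {0<..}" by (auto simp: einterval_def)
  have "(\<integral>\<^sup>+r. ennreal (?f r) * indicator {0<..} r \<partial>lborel) = (\<integral>\<^sup>+r. ennreal (indicator {0<..} r * ?f r) \<partial>lborel)"
    by (intro nn_integral_cong) (auto simp: indicator_def)
  also have "\<dots> = ennreal (\<integral>r. indicator {0<..} r * ?f r \<partial>lborel)"
    using si(1) den unfolding set_integrable_def e
    by (intro nn_integral_eq_integral) (auto simp: indicator_def less_imp_le)
  also have "(\<integral>r. indicator {0<..} r * ?f r \<partial>lborel) = pi / q"
    using si(2) unfolding interval_lebesgue_integral_def set_lebesgue_integral_def e by simp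
  finally show ?thesis .
qed

lemma compact_exhaustion_measure:
  fixes \<Sigma> :: "'a::euclidean_space set"
  assumes \<Sigma>: "sphere_domain \<Sigma>" and \<delta>: "\<delta> > 0"
  obtains K where "compact K" "K \<subseteq> \<Sigma>" "\<Sigma> - K \<in> sets borel"
    "(\<integral>\<^sup>+x. indicator (\<Sigma> - K) (sgn x) * indicator (ball 0 1) x \<partial>lborel) <= ennreal \<delta>"
proof -
  obtain U where U: "open U" "\<Sigma> = sphere 0 1 \<inter> U"
    using \<Sigma> unfolding sphere_domain_def openin_open by blast
  obtain C where C: "!!n::nat. compact (C n)" "!!n. C n \<subseteq> U" "!!n. C n \<subseteq> interior (C (Suc n))" "\<Union>(range C) = U"
    using open_Union_compact_subsets[OF U(1)] by metis
  define A where "A n = {x \<in> ball 0 1. sgn x \<in> \<Sigma> - C n}" for n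
  have [measurable]: "\<Sigma> \<in> sets borel" "C n \<in> sets borel" "ball (0::'a) 1 \<in> sets borel" for n
    using U C(1)[of n] by (auto simp: compact_imp_closed)
  have mA: "A n \<in> sets lborel" for n unfolding A_def by measurable
  have "decseq A"
  proof (rule decseq_SucI)
    show "A (Suc n) \<subseteq> A n" for n using C(3)[of n] interior_subset[of "C (Suc n)"] by (auto simp: A_def)
  qed
  moreover have "emeasure lborel (A n) ~= \<infinity>" for n
  proof -
    have "emeasure lborel (A n) <= emeasure lborel (ball (0::'a) 1)" by (intro emeasure_mono) (auto simp: A_def)
    also have "\<dots> < \<infinity>" using emeasure_lborel_ball_finite by simp
    finally show ?thesis by simp
  qed
  ultimately have "(%n. emeasure lborel (A n)) \<longlonglongrightarrow> emeasure lborel (\<Inter>n. A n)"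
    using mA by (intro Lim_emeasure_decseq) auto
  moreover have "(\<Inter>n. A n) = {}" using U C(4) by (auto simp: A_def)
  ultimately have "(%n. emeasure lborel (A n)) \<longlonglongrightarrow> 0" by simp
  then have "eventually (%n. emeasure lborel (A n) < ennreal \<delta>) sequentially"
    by (rule order_tendstoD) (use \<delta> in simp)
  then obtain n where n: "emeasure lborel (A n) < ennreal \<delta>" by (auto simp: eventually_sequentially)
  show ?thesis
  proof (rule that[of "sphere 0 1 \<inter> C n"])
    show "compact (sphere 0 1 \<inter> C n)" using C(1) by (intro closed_Int_compact) auto
    show "sphere 0 1 \<inter> C n \<subseteq> \<Sigma>" using C(2) U by auto
    have eq: "\<Sigma> - sphere 0 1 \<inter> C n = \<Sigma> - C n" using U by auto
    show "\<Sigma> - sphere 0 1 \<inter> C n \<in> sets borel" unfolding eq by measurable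
    have "(\<integral>\<^sup>+x. indicator (\<Sigma> - sphere 0 1 \<inter> C n) (sgn x) * indicator (ball 0 1) x \<partial>lborel) = (\<integral>\<^sup>+x. indicator (A n) x \<partial>lborel)"
      unfolding eq by (intro nn_integral_cong) (auto simp: A_def indicator_def)
    then show "(\<integral>\<^sup>+x. indicator (\<Sigma> - sphere 0 1 \<inter> C n) (sgn x) * indicator (ball 0 1) x \<partial>lborel) <= ennreal \<delta>"
      using n mA by simp
  qed
qed

lemma compact_sphere_neighbourhood:
  fixes \<Sigma> K :: "'a::euclidean_space set"
  assumes \<Sigma>: "sphere_domain \<Sigma>" and K: "compact K" "K \<subseteq> \<Sigma>"
  obtains L d where "compact L" "L \<subseteq> \<Sigma>" "d > 0" "!!s t. s \<in> K ==> norm t = 1 ==> norm (s - t) <= d ==> t \<in> L"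
proof -
  obtain U where U: "open U" "\<Sigma> = sphere 0 1 \<inter> U"
    using \<Sigma> unfolding sphere_domain_def openin_open by blast
  obtain d where d: "d > 0" "(\<Union>x\<in>K. cball x d) \<subseteq> U"
    using compact_subset_open_imp_cball_epsilon_subset[OF K(1) U(1)] K U by auto
  let ?L = "sphere 0 1 \<inter> {x + y | x y. x \<in> K & y \<in> cball 0 d}"
  show ?thesis
  proof (rule that[of ?L d])
    show "compact ?L" by (intro closed_Int_compact compact_sums K) auto
    show "?L \<subseteq> \<Sigma>"
    proof
      fix z assume "z \<in> ?L"
      then obtain x y where z: "z = x + y" "x \<in> K" "norm y <= d" "norm z = 1" by auto
      then have "z \<in> cball x d" by (simp add: dist_norm)
      then have "z \<in> U" using d(2) z(2) by blast
      then show "z \<in> \<Sigma>" using U z by simp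
    qed
    fix s t :: 'a assume "s \<in> K" "norm t = 1" "norm (s - t) <= d"
    then have "t \<in> {x + y | x y. x \<in> K & y \<in> cball 0 d}"
      by (intro CollectI exI[of _ s] exI[of _ "t - s"]) (simp add: norm_minus_commute)
    then show "t \<in> ?L" using \<open>norm t = 1\<close> by simp
  qed (rule d)
qed

section \<open>Supersolutions in truncated cones\<close>

lemma bump_derivatives:
  assumes e: "e > 0"
  shows "\<exists>G' G'' G3. (\<forall>t. (bump e has_real_derivative G' t) (at t)) & (\<forall>t. (G' has_real_derivative G'' t) (at t)) &
    (\<forall>t. (G'' has_real_derivative G3 t) (at t)) & continuous_on UNIV G3 & (\<forall>t. bump e t = 0 --> G' t = 0 & G'' t = 0)"
proof -
  let ?u = "%t::real. (t - 1) / e\<^sup>2 + 1"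
  have du: "(?u has_real_derivative 1 / e\<^sup>2) (at t)" for t
    by (rule DERIV_cong[OF DERIV_add[OF DERIV_cdivide[OF DERIV_diff[OF DERIV_ident DERIV_const]] DERIV_const]]) simp
  define G' where "G' = (%t. (flat (?u t) * (inverse (?u t))\<^sup>2) * (1 / e\<^sup>2))"
  define G'' where "G'' = (%t. (flat (?u t) * ((inverse (?u t))^4 - 2 * (inverse (?u t))^3)) * (1 / e\<^sup>2) * (1 / e\<^sup>2))"
  have d1: "(bump e has_real_derivative G' t) (at t)" for t
    unfolding bump_def[abs_def] G'_def by (rule DERIV_chain2[OF flat_deriv du])
  have d2: "(G' has_real_derivative G'' t) (at t)" for t
    unfolding G'_def G''_def by (rule DERIV_cmult_right[OF DERIV_chain2[OF flat_deriv2 du]])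
  have eq: "dderiv [1] H = H'" if "!!t. (H has_real_derivative H' t) (at t)" for H H' :: "real => real"
  proof
    fix t show "dderiv [1] H t = H' t"
      using dderiv1_eq[OF that[unfolded has_field_derivative_def], of 1 t] by (simp del: dderiv.simps)
  qed
  have s1: "smooth_on UNIV G'" using smooth_on_D[OF bump_smooth, of "[1]" e] unfolding eq[OF d1] .
  have s2: "smooth_on UNIV G''" using smooth_on_D[OF s1, of "[1]"] unfolding eq[OF d2] .
  have "\<forall>t. bump e t = 0 --> G' t = 0 & G'' t = 0" by (simp add: bump_def G'_def G''_def)
  then show ?thesis
    using d1 d2 smooth_on_has_real_derivative[OF s2] smooth_on_continuous[OF smooth_on_D[OF s2, of "[1]"]] by blast
qed

lemma trunc_cone_iff:
  assumes "sphere_domain \<Sigma>"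
  shows "x \<in> trunc_cone \<Sigma> R \<longleftrightarrow> x ~= 0 & norm x < R & sgn x \<in> \<Sigma>"
proof
  assume "x \<in> trunc_cone \<Sigma> R"
  then obtain r s where s: "x = r *\<^sub>R s" "0 < r" "r < R" "s \<in> \<Sigma>" by (auto simp: trunc_cone_def)
  then have n: "norm s = 1" using sphere_domain_subset[OF assms] by auto
  then have "sgn x = s" "s ~= 0" using s by (auto simp: sgn_scaleR sgn_div_norm)
  then show "x ~= 0 & norm x < R & sgn x \<in> \<Sigma>" using s n by simp
next
  assume x: "x ~= 0 & norm x < R & sgn x \<in> \<Sigma>"
  then have "x = norm x *\<^sub>R sgn x" by (simp add: sgn_div_norm)
  then show "x \<in> trunc_cone \<Sigma> R" unfolding trunc_cone_def using x by (intro CollectI exI[of _ "norm x"] exI[of _ "sgn x"]) auto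
qed

lemma trunc_cone_open:
  assumes "sphere_domain (\<Sigma> :: 'a::euclidean_space set)"
  shows "open (trunc_cone \<Sigma> R)"
proof -
  obtain U where U: "open U" "\<Sigma> = sphere 0 1 \<inter> U"
    using assms unfolding sphere_domain_def openin_open by blast
  have c: "continuous_on (UNIV - {0::'a}) sgn" by (intro continuous_on_sgn continuous_on_id) auto
  have "open (sgn -` U \<inter> (UNIV - {0::'a}))"
    using iffD1[OF continuous_on_open_vimage[OF open_delete[OF open_UNIV]], rule_format, OF c U(1)] .
  then have "open ((sgn -` U \<inter> (UNIV - {0})) \<inter> ball 0 R)" by auto
  also have "(sgn -` U \<inter> (UNIV - {0})) \<inter> ball 0 R = trunc_cone \<Sigma> R"
    by (rule set_eqI, simp only: Int_iff trunc_cone_iff[OF assms]) (auto simp: U(2) norm_sgn)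
  finally show ?thesis .
qed

lemma trunc_cone_connected:
  assumes "sphere_domain (\<Sigma> :: 'a::euclidean_space set)"
  shows "connected (trunc_cone \<Sigma> R)"
proof -
  have "trunc_cone \<Sigma> R = (%(r, s). r *\<^sub>R s) ` ({0<..<R} \<times> \<Sigma>)" by (force simp: trunc_cone_def)
  moreover have "connected ((%(r, s). r *\<^sub>R s) ` ({0<..<R} \<times> \<Sigma>))"
    using assms unfolding sphere_domain_def case_prod_unfold
    by (intro connected_continuous_image connected_Times continuous_intros) auto
  ultimately show ?thesis by simp
qed

lemma log_cauchy_kernel:
  assumes q: "q > 0" and N: "DIM('a) >= 1"
  shows "(\<integral>\<^sup>+(y::'a::euclidean_space). ennreal (norm y powr (- real DIM('a)) / (1 + q\<^sup>2 * (a - ln (norm y))\<^sup>2) * bump e (s \<bullet> sgn y)) \<partial>lborel)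
   = ennreal (real DIM('a) * (pi / q)) * (\<integral>\<^sup>+x. ennreal (bump e (s \<bullet> sgn x)) * indicator (ball 0 1) x \<partial>lborel)"
proof -
  let ?N = "DIM('a)"
  let ?f = "%r::real. ennreal (r powr (- real ?N) / (1 + q\<^sup>2 * (a - ln r)\<^sup>2))"
  have den: "1 + q\<^sup>2 * x\<^sup>2 >= 0" for x :: real by simp
  have "(\<integral>\<^sup>+(y::'a). ennreal (norm y powr (- real ?N) / (1 + q\<^sup>2 * (a - ln (norm y))\<^sup>2) * bump e (s \<bullet> sgn y)) \<partial>lborel)
     = (\<integral>\<^sup>+(y::'a). ?f (norm y) * ennreal (bump e (s \<bullet> sgn y)) \<partial>lborel)"
    by (intro nn_integral_cong ennreal_mult divide_nonneg_nonneg den bump_nonneg) auto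
  also have "\<dots> = of_nat ?N * (\<integral>\<^sup>+r. ennreal (r ^ (?N - 1)) * indicator {0<..} r * ?f r \<partial>lborel) *
     (\<integral>\<^sup>+x. ennreal (bump e (s \<bullet> sgn x)) * indicator (ball 0 1) x \<partial>lborel)"
    by (rule nn_integral_polar_product[of ?f "%x. ennreal (bump e (s \<bullet> x))"]) measurable
  also have "(\<integral>\<^sup>+r. ennreal (r ^ (?N - 1)) * indicator {0<..} r * ?f r \<partial>lborel)
     = (\<integral>\<^sup>+r. ennreal (1 / r / (1 + q\<^sup>2 * (a - ln r)\<^sup>2)) * indicator {0<..} r \<partial>lborel)"
  proof (rule nn_integral_cong)
    fix r :: real
    show "ennreal (r ^ (?N - 1)) * indicator {0<..} r * ?f r = ennreal (1 / r / (1 + q\<^sup>2 * (a - ln r)\<^sup>2)) * indicator {0<..} r"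
    proof (cases "r > 0")
      case True
      have "r ^ (?N - 1) * r powr (- real ?N) = 1 / r"
        using True N by (simp add: powr_minus powr_realpow divide_inverse power_diff)
      then have "r ^ (?N - 1) * (r powr (- real ?N) / (1 + q\<^sup>2 * (a - ln r)\<^sup>2)) = 1 / r / (1 + q\<^sup>2 * (a - ln r)\<^sup>2)"
        by (simp only: times_divide_eq_right)
      then show ?thesis using True by (simp add: ennreal_mult'[symmetric])
    qed simp
  qed
  also have "\<dots> = ennreal (pi / q)" by (rule nn_integral_log_cauchy[OF q])
  also have "of_nat ?N * ennreal (pi / q) = ennreal (real ?N * (pi / q))"
    using q by (simp add: ennreal_mult'[symmetric] ennreal_of_nat_eq_real_of_nat)
  finally show ?thesis .
qed

locale hardy_supersolution = superharmonic "trunc_cone \<Sigma> R" w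
  for \<Sigma> :: "'a::euclidean_space set" and R :: real and w :: "'a => real" +
  fixes p \<kappa> lam :: real
  assumes N3: "DIM('a) >= 3" and \<Sigma>: "sphere_domain \<Sigma>" and R: "R > 0" and p: "p > 1" and \<kappa>: "\<kappa> >= 0"
    and crit: "((real DIM('a) - 2) / 2 - \<kappa>) * (p - 1) >= 2"
    and wp_loc: "compact K ==> K \<subseteq> trunc_cone \<Sigma> R ==> integrable lebesgue (%x. w x powr p * indicator K x)"
    and super: "test_fun (trunc_cone \<Sigma> R) \<phi> ==> (!!x. \<phi> x >= 0) ==> (\<integral>x. w x powr p * \<phi> x \<partial>lebesgue)
      <= (\<integral>x. w x * (- laplacian \<phi> x - (lam + ((real DIM('a) - 2) / 2)\<^sup>2 - \<kappa>\<^sup>2) / (norm x)\<^sup>2 * \<phi> x) \<partial>lebesgue)"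
begin

definition \<alpha> :: real where "\<alpha> = (real DIM('a) - 2) / 2 - \<kappa>"
definition tt :: "'a => real" where "tt y = ln (R / 2) - ln (norm y)"
definition sector :: "real => real => 'a set => 'a set" where
  "sector a b L = {y. R / 2 * exp (- b) <= norm y & norm y <= R / 2 * exp (- a) & sgn y \<in> L}"

lemma sector_iff: "y ~= 0 ==> y \<in> sector a b L \<longleftrightarrow> a <= tt y & tt y <= b & sgn y \<in> L"
proof -
  assume y: "y ~= 0"
  have "R / 2 * exp (- b) <= norm y \<longleftrightarrow> ln (R / 2 * exp (- b)) <= ln (norm y)"
    using R y by (subst ln_le_cancel_iff) auto
  moreover have "norm y <= R / 2 * exp (- a) \<longleftrightarrow> ln (norm y) <= ln (R / 2 * exp (- a))"
    using R y by (subst ln_le_cancel_iff) auto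
  moreover have "ln (R / 2 * exp (- c)) = ln (R / 2) - c" for c using R by (subst ln_mult) auto
  ultimately show ?thesis unfolding sector_def tt_def by auto
qed

lemma sector_pos: "y \<in> sector a b L ==> norm y > 0"
proof -
  assume "y \<in> sector a b L"
  moreover have "R / 2 * exp (- b) > 0" using R by simp
  ultimately show ?thesis unfolding sector_def by (auto simp del: zero_less_norm_iff)
qed

lemma sector_compact:
  assumes "compact L" "L \<subseteq> \<Sigma>" "a >= 0"
  shows "compact (sector a b L)" "sector a b L \<subseteq> trunc_cone \<Sigma> R"
proof -
  have n: "norm s = 1" if "s \<in> L" for s using that assms sphere_domain_subset[OF \<Sigma>] by auto
  have "sector a b L = (%(r, s). r *\<^sub>R s) ` ({R / 2 * exp (- b)..R / 2 * exp (- a)} \<times> L)" (is "_ = ?S")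
  proof
    show "sector a b L \<subseteq> ?S"
    proof
      fix y assume y: "y \<in> sector a b L"
      have "y = norm y *\<^sub>R sgn y" using sector_pos[OF y] by (simp add: sgn_div_norm)
      then show "y \<in> ?S" using y by (intro image_eqI[of _ _ "(norm y, sgn y)"]) (auto simp: sector_def)
    qed
    show "?S \<subseteq> sector a b L"
    proof
      fix y assume "y \<in> ?S"
      then obtain r s where y: "y = r *\<^sub>R s" "R / 2 * exp (- b) <= r" "r <= R / 2 * exp (- a)" "s \<in> L" by auto
      have "R / 2 * exp (- b) > 0" using R by simp
      then have r: "r > 0" using y by linarith
      then have "norm y = r" "sgn y = s" using y n by (auto simp: sgn_scaleR sgn_div_norm)
      then show "y \<in> sector a b L" using y by (simp add: sector_def)
    qed
  qed
  then show "compact (sector a b L)"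
    using assms(1) by (auto intro!: compact_continuous_image compact_Times continuous_intros simp: case_prod_unfold)
  show "sector a b L \<subseteq> trunc_cone \<Sigma> R"
  proof
    fix y assume y: "y \<in> sector a b L"
    have "R / 2 * exp (- a) <= R / 2 * 1" using assms R by (intro mult_left_mono) auto
    moreover have "norm y <= R / 2 * exp (- a)" using y by (simp add: sector_def)
    ultimately have "norm y < R" using R by linarith
    then show "y \<in> trunc_cone \<Sigma> R" using y sector_pos[OF y] assms by (auto simp: trunc_cone_iff[OF \<Sigma>] sector_def)
  qed
qed

definition vw :: "(real => real) => real => 'a set => 'a => real" where
  "vw \<eta> T L y = w y * ((norm y powr (\<alpha> - real DIM('a)) * \<eta> (tt y)) * indicator (sector 0 T L) y)"
definition sw :: "'a set => 'a => real" where
  "sw L y = w y * (norm y powr (\<alpha> - real DIM('a)) * indicator (sector 1 2 L) y)"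
definition pw :: "(real => real) => real => 'a set => 'a => real" where
  "pw \<eta> T L y = w y powr p * ((norm y powr (\<alpha> * p - real DIM('a)) * \<eta> (tt y)) * indicator (sector 0 T L) y)"
definition tw :: "real => 'a => real" where
  "tw q y = norm y powr (- real DIM('a)) / (1 + q\<^sup>2 * (tt y)\<^sup>2)"

lemma weights_integrable:
  assumes L: "compact L" "L \<subseteq> \<Sigma>" and \<eta>: "continuous_on UNIV \<eta>"
  shows "integrable lebesgue (vw \<eta> T L)" "integrable lebesgue (sw L)" "integrable lebesgue (pw \<eta> T L)"
proof -
  have c: "continuous_on (sector a b L) (%y. norm y powr c)" for a b c
    by (intro continuous_intros) (use sector_pos in fastforce)
  have t: "continuous_on (sector a b L) tt" for a b
    unfolding tt_def[abs_def] by (intro continuous_intros) (use sector_pos in fastforce)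
  have e: "continuous_on (sector a b L) (%y. \<eta> (tt y))" for a b
    by (rule continuous_on_compose2[OF \<eta> t]) auto
  note s = sector_compact[OF L]
  show "integrable lebesgue (vw \<eta> T L)"
    unfolding vw_def[abs_def] by (rule integrable_continuous_on_compact[OF w_loc s(1)]) (use s c e in \<open>auto intro!: continuous_on_mult\<close>)
  show "integrable lebesgue (sw L)"
    unfolding sw_def[abs_def] by (rule integrable_continuous_on_compact[OF w_loc s(1)]) (use s c in auto)
  show "integrable lebesgue (pw \<eta> T L)"
    unfolding pw_def[abs_def] by (rule integrable_continuous_on_compact[OF wp_loc s(1)]) (use s c e in \<open>auto intro!: continuous_on_mult\<close>)
qed

lemma tw_bound:
  "\<exists>D>0. \<forall>q>0. \<forall>s::'a. \<forall>e. norm s = 1 & 0 < e & e <= 1/2 --> integrable lebesgue (%y. tw q y * bump e (s \<bullet> sgn y)) &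
    (\<integral>y. tw q y * bump e (s \<bullet> sgn y) \<partial>lebesgue) <= D / q * e ^ (DIM('a) - 1)"
proof -
  obtain C where C: "C > 0" "!!(s::'a) e. norm s = 1 ==> 0 < e ==> e <= 1/2 ==>
    (\<integral>\<^sup>+x. ennreal (bump e (s \<bullet> sgn x)) * indicator (ball 0 1) x \<partial>lborel) <= ennreal (C * e ^ (DIM('a) - 1))"
    using bump_mass_le[where 'a='a] by auto
  define D where "D = real DIM('a) * pi * C"
  have "integrable lebesgue (%y. tw q y * bump e (s \<bullet> sgn y)) &
    (\<integral>y. tw q y * bump e (s \<bullet> sgn y) \<partial>lebesgue) <= D / q * e ^ (DIM('a) - 1)"
    if q: "q > 0" and s: "norm s = 1" and e: "0 < e" "e <= 1/2" for q e :: real and s :: 'a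
  proof -
    have den: "1 + q\<^sup>2 * x\<^sup>2 >= 0" for x :: real by simp
    have m: "(%y. tw q y * bump e (s \<bullet> sgn y)) \<in> borel_measurable borel" unfolding tw_def tt_def by measurable
    have nn: "tw q y * bump e (s \<bullet> sgn y) >= 0" for y
      unfolding tw_def by (intro mult_nonneg_nonneg divide_nonneg_nonneg den bump_nonneg) auto
    have "(\<integral>\<^sup>+y. ennreal (tw q y * bump e (s \<bullet> sgn y)) \<partial>lborel) = ennreal (real DIM('a) * (pi / q)) * (\<integral>\<^sup>+x. ennreal (bump e (s \<bullet> sgn x)) * indicator (ball 0 1) x \<partial>lborel)"
      unfolding tw_def tt_def by (rule log_cauchy_kernel[OF q]) (use N3 in simp)
    also have "\<dots> <= ennreal (real DIM('a) * (pi / q)) * ennreal (C * e ^ (DIM('a) - 1))"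
      by (intro mult_left_mono C(2) s e) auto
    also have "\<dots> = ennreal (D / q * e ^ (DIM('a) - 1))"
      using q e C by (simp add: D_def ennreal_mult'[symmetric])
    finally have le: "(\<integral>\<^sup>+y. ennreal (tw q y * bump e (s \<bullet> sgn y)) \<partial>lborel) <= ennreal (D / q * e ^ (DIM('a) - 1))" .
    have i: "integrable lborel (%y. tw q y * bump e (s \<bullet> sgn y))"
by (rule integrableI_nonneg) (use m nn le_less_trans[OF le ennreal_less_top] in auto)
    have "ennreal (\<integral>y. tw q y * bump e (s \<bullet> sgn y) \<partial>lborel) <= ennreal (D / q * e ^ (DIM('a) - 1))"
      using nn_integral_eq_integral[OF i] nn le by simp
    moreover have "D / q * e ^ (DIM('a) - 1) >= 0" using C q e by (simp add: D_def)
    ultimately have "(\<integral>y. tw q y * bump e (s \<bullet> sgn y) \<partial>lborel) <= D / q * e ^ (DIM('a) - 1)" by (simp add: ennreal_le_iff)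
    then show ?thesis using i m by (simp add: integrable_completion integral_completion)
  qed
  moreover have "D > 0" using C by (simp add: D_def)
  ultimately show ?thesis by blast
qed

lemma testing:
  fixes \<eta> \<eta>' \<eta>'' :: "real => real" and s :: 'a
  assumes \<eta>s: "smooth_on UNIV \<eta>" and d: "!!t. (\<eta> has_real_derivative \<eta>' t) (at t)" "!!t. (\<eta>' has_real_derivative \<eta>'' t) (at t)"
    and \<eta>0: "!!t. \<eta> t >= 0" and T: "T >= 2" and \<eta>z: "!!t. t < 0 \<or> t > T ==> \<eta> t = 0"
    and q: "q > 0" and \<tau>: "\<tau> >= 0"
    and key: "!!t W. W >= 0 ==> W * (\<eta>'' t + 2 * \<kappa> * \<eta>' t) + \<tau> * (W powr p * \<eta> t)
         >= - Q * (W * \<eta> t) + b * (indicator {1..2} t * W) - \<tau> * (1 / q / (1 + q\<^sup>2 * t\<^sup>2))"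
    and L: "compact L" "L \<subseteq> \<Sigma>" and s: "norm s = 1" and e: "e > 0"
    and cap: "!!t. norm t = 1 ==> bump e (s \<bullet> t) ~= 0 ==> t \<in> L"
    and itw: "integrable lebesgue (%y. tw q y * bump e (s \<bullet> sgn y))"
  shows "(lam - Q) * (\<integral>y. vw \<eta> T L y * bump e (s \<bullet> sgn y) \<partial>lebesgue) + b * (\<integral>y. sw L y * bump e (s \<bullet> sgn y) \<partial>lebesgue)
     + (R powr (2 - \<alpha> * (p - 1)) - \<tau>) * (\<integral>y. pw \<eta> T L y * bump e (s \<bullet> sgn y) \<partial>lebesgue)
     - \<tau> / q * (\<integral>y. tw q y * bump e (s \<bullet> sgn y) \<partial>lebesgue)
     <= - laplacian (%x. \<integral>y. vw \<eta> T L y * bump e (sgn x \<bullet> sgn y) \<partial>lebesgue) s"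
proof -
  let ?N = "real DIM('a)" and ?k = "%y. bump e (s \<bullet> sgn y)"
  define mm where "mm = (?N - 2) / 2 + \<kappa>"
  define cc where "cc = lam + ((?N - 2) / 2)\<^sup>2 - \<kappa>\<^sup>2"
  obtain G' G'' G3 where GA: "\<forall>t. (bump e has_real_derivative G' t) (at t)" "\<forall>t. (G' has_real_derivative G'' t) (at t)"
    "\<forall>t. (G'' has_real_derivative G3 t) (at t)" "continuous_on UNIV G3" "\<forall>t. bump e t = 0 --> G' t = 0 & G'' t = 0"
    using bump_derivatives[OF e] by (elim exE conjE)
  note G = GA[rule_format]
  let ?zl = "%y. zonal_lap DIM('a) G' G'' (s \<bullet> sgn y)"
  define h where "h = (%l. exp (- mm * l) * \<eta> (ln (R / 2) - l))"
  define h' where "h' = (%l. exp (- mm * l) * (- mm * \<eta> (ln (R / 2) - l) - \<eta>' (ln (R / 2) - l)))"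
  define h'' where "h'' = (%l. exp (- mm * l) * (mm\<^sup>2 * \<eta> (ln (R / 2) - l) + 2 * mm * \<eta>' (ln (R / 2) - l) + \<eta>'' (ln (R / 2) - l)))"
  have dr: "((%l. f (ln (R / 2) - l)) has_real_derivative - f' (ln (R / 2) - l)) (at l)"
    if "!!t. (f has_real_derivative f' t) (at t)" for f f' l
  proof -
    have "((%l. ln (R / 2) - l) has_real_derivative - 1) (at l)" by (auto intro!: derivative_eq_intros)
    from DERIV_chain2[OF that this] show ?thesis by simp
  qed
  have de: "((%l. exp (- mm * l)) has_real_derivative - mm * exp (- mm * l)) (at l)" for l
    by (auto intro!: derivative_eq_intros)
  have dh: "(h has_real_derivative h' l) (at l)" for l
    unfolding h_def h'_def by (rule DERIV_cong[OF DERIV_mult[OF de dr[OF d(1)]]]) (simp add: algebra_simps)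
  have dh': "(h' has_real_derivative h'' l) (at l)" for l
    unfolding h'_def h''_def
    by (rule DERIV_cong[OF DERIV_mult[OF de DERIV_diff[OF DERIV_cmult[OF dr[OF d(1)]] dr[OF d(2)]]]])
       (simp add: algebra_simps power2_eq_square)
  have hs: "smooth_on UNIV h"
    unfolding h_def
    by (intro smooth_on_mult smooth_on_compose_real[OF _ _ _ smooth_on_exp[of UNIV]] smooth_on_compose_real[OF _ _ _ \<eta>s] smooth_on_diff smooth_on_const smooth_on_ident) auto
  have hz: "h l = 0" if "l < ln (R / 2) - T \<or> l > ln (R / 2)" for l using that \<eta>z[of "ln (R / 2) - l"] by (auto simp: h_def)
  define \<phi> where "\<phi> = separated h (%x. bump e (s \<bullet> x))"
  have \<phi>s: "smooth_on (UNIV - {0}) (%y::'a. bump e (s \<bullet> sgn y))" by (rule smooth_on_zonal[OF bump_smooth])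
  have tf: "test_fun (trunc_cone \<Sigma> R) \<phi>"
    unfolding \<phi>_def
  proof (rule separated_test_fun[OF hs hz \<phi>s L(1)])
    show "{\<sigma> \<in> sphere 0 1. bump e (s \<bullet> \<sigma>) ~= 0} \<subseteq> L" using cap by auto
    fix r s' assume r: "exp (ln (R / 2) - T) <= r" "r <= exp (ln (R / 2))" and s': "s' \<in> L"
    have "r <= R / 2" using r(2) R by simp
    moreover have "r > 0" using r(1) by (rule less_le_trans[OF exp_gt_zero])
    ultimately show "r *\<^sub>R s' \<in> trunc_cone \<Sigma> R" unfolding trunc_cone_def using s' L R
      by (intro CollectI exI[of _ r] exI[of _ s']) auto
  qed
  have \<phi>0: "\<phi> y >= 0" for y unfolding \<phi>_def separated_def h_def using \<eta>0 bump_nonneg by simp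
  let ?lhs = "%y. w y * (- laplacian \<phi> y - cc / (norm y)\<^sup>2 * \<phi> y) - w y powr p * \<phi> y"
  let ?rhs = "%y. - (lam - Q) * (vw \<eta> T L y * ?k y) - b * (sw L y * ?k y) - (R powr (2 - \<alpha> * (p - 1)) - \<tau>) * (pw \<eta> T L y * ?k y)
     + \<tau> / q * (tw q y * ?k y) - vw \<eta> T L y * ?zl y"
  have K0: "compact (tsupport \<phi>)" "tsupport \<phi> \<subseteq> trunc_cone \<Sigma> R" and \<phi>S: "smooth_on UNIV \<phi>" using tf by (auto simp: test_fun_def)
  have n0: "norm y ~= 0" if "y \<in> tsupport \<phi>" for y using K0(2) that by (auto simp: trunc_cone_iff[OF \<Sigma>])
  have c\<phi>: "continuous_on A \<phi>" for A by (rule continuous_on_subset[OF smooth_on_continuous[OF \<phi>S]]) simp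
  have \<phi>ind: "\<phi> y * indicator (tsupport \<phi>) y = \<phi> y" for y
    using in_tsupport[of \<phi> y] by (cases "\<phi> y = 0") (auto simp: indicator_def)
  have i1: "integrable lebesgue (%y. w y * (cc / (norm y)\<^sup>2 * \<phi> y))"
  proof -
    have "integrable lebesgue (%y. w y * ((cc / (norm y)\<^sup>2 * \<phi> y) * indicator (tsupport \<phi>) y))"
      by (rule integrable_continuous_on_compact[OF w_loc[OF K0] K0(1)]) (use n0 in \<open>auto intro!: continuous_intros c\<phi>\<close>)
    then show ?thesis by (simp only: mult.assoc \<phi>ind)
  qed
  have i2: "integrable lebesgue (%y. w y powr p * \<phi> y)"
    using integrable_continuous_on_compact[OF wp_loc[OF K0] K0(1) c\<phi>] by (simp only: \<phi>ind)
  have i3: "integrable lebesgue (%y. w y * (- laplacian \<phi> y - cc / (norm y)\<^sup>2 * \<phi> y))"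
    using Bochner_Integration.integrable_diff[OF integrable_minus[OF w_laplacian_integrable[OF tf]] i1]
    by (simp add: right_diff_distrib)
  have c\<eta>: "continuous_on UNIV \<eta>" by (rule smooth_on_continuous[OF \<eta>s])
  note iw = weights_integrable(1)[OF L c\<eta>, of T] weights_integrable(2)[OF L c\<eta>] weights_integrable(3)[OF L c\<eta>, of T]
  have cb: "continuous_on UNIV (bump e)" by (rule smooth_on_continuous[OF bump_smooth])
  have cG: "continuous_on UNIV G'" "continuous_on UNIV G''"
    using G(2,3) by (auto intro!: continuous_at_imp_continuous_on DERIV_isCont)
  have cz: "continuous_on UNIV (zonal_lap DIM('a) G' G'')"
    unfolding zonal_lap_def[abs_def] by (intro continuous_intros cG)
  note j = integrable_times_zonal[OF iw(1) cb, of s] integrable_times_zonal[OF iw(2) cb, of s] integrable_times_zonal[OF iw(3) cb, of s]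
    integrable_times_zonal[OF iw(1) cz, of s]
  have le: "?lhs y <= ?rhs y" if y: "y ~= 0" for y
  proof -
    define X where "X = norm y"
    have X: "X > 0" using y by (simp add: X_def)
    define t where "t = tt y"
    define n where "n = X powr (- ?N)"
    define W where "W = X powr \<alpha> * w y"
    have W0: "W >= 0" and nn: "n >= 0" using w_nonneg by (auto simp: W_def n_def)
    have ss: "sgn (sgn y) = sgn y" "norm (sgn y) = 1" "sgn y ~= 0" using y by (auto simp: sgn_sgn_vector norm_sgn sgn_zero_iff)
    have E: "exp (- mm * ln X) = X powr (- mm)" using X by (simp add: powr_def)
    have lap: "laplacian \<phi> y = X powr (- mm) * ((\<eta>'' t + 2 * \<kappa> * \<eta>' t + (lam - cc) * \<eta> t) * ?k y + \<eta> t * ?zl y) / X\<^sup>2"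
    proof -
      have "laplacian \<phi> y = ((h'' (ln X) + (?N - 2) * h' (ln X)) * ?k y + h (ln X) * laplacian (%y. ?k y) (sgn y)) / X\<^sup>2"
        unfolding \<phi>_def X_def by (rule laplacian_separated'[OF hs hz \<phi>s y dh dh'])
      also have "laplacian (%y. ?k y) (sgn y) = ?zl y"
        using laplacian_zonal[OF ss(3) s G(1,2)] by (simp add: ss)
      also have "h'' (ln X) + (?N - 2) * h' (ln X) = X powr (- mm) * (\<eta>'' t + 2 * \<kappa> * \<eta>' t + (lam - cc) * \<eta> t)"
      proof -
        have "mm\<^sup>2 - (?N - 2) * mm = lam - cc" "2 * mm - (?N - 2) = 2 * \<kappa>"
          by (simp_all add: mm_def cc_def power2_eq_square field_simps)
        then have "mm\<^sup>2 * a + 2 * mm * a' + a'' + (?N - 2) * (- mm * a - a') = a'' + 2 * \<kappa> * a' + (lam - cc) * a" for a a' a''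
          by algebra
        from this[of "\<eta> t" "\<eta>' t" "\<eta>'' t"] show ?thesis
          unfolding h''_def h'_def E t_def tt_def X_def[symmetric]
          by (metis (no_types, lifting) distrib_left mult.left_commute)
      qed
      also have "h (ln X) = X powr (- mm) * \<eta> t" unfolding h_def E t_def tt_def X_def[symmetric] ..
      finally show ?thesis by (simp add: algebra_simps)
    qed
    have ph: "\<phi> y = X powr (- mm) * \<eta> t * ?k y"
      unfolding \<phi>_def separated_def h_def using y E by (simp add: t_def tt_def X_def)
    have rho: "X powr (- mm) / X\<^sup>2 = n * X powr \<alpha>"
    proof -
      have "X powr (- mm) / X\<^sup>2 = X powr (- mm) * X powr (- 2)" using X by (simp add: powr_minus divide_inverse powr_realpow)
      also have "\<dots> = X powr (- ?N + \<alpha>)"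
      proof -
        have "- mm + - 2 = - ?N + \<alpha>" by (simp add: mm_def \<alpha>_def field_simps)
        then show ?thesis by (simp only: powr_add[symmetric])
      qed
      finally show ?thesis by (simp only: n_def powr_add)
    qed
    have lhs: "?lhs y = - (n * W * (\<eta>'' t + 2 * \<kappa> * \<eta>' t) * ?k y) - lam * (n * W * \<eta> t * ?k y) - n * W * \<eta> t * ?zl y - w y powr p * \<phi> y"
    proof -
      have "laplacian \<phi> y = (n * X powr \<alpha>) * ((\<eta>'' t + 2 * \<kappa> * \<eta>' t + (lam - cc) * \<eta> t) * ?k y + \<eta> t * ?zl y)"
        unfolding lap rho[symmetric] by (simp only: times_divide_eq_left)
      moreover have "cc / (norm y)\<^sup>2 * \<phi> y = cc * ((n * X powr \<alpha>) * (\<eta> t * ?k y))"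
        unfolding ph rho[symmetric] X_def[symmetric] by (simp add: divide_inverse mult_ac)
      moreover have "x * (- ((n * a) * ((A + (lam - cc) * g) * k + g * z)) - cc * ((n * a) * (g * k))) - B
          = - (n * (a * x) * A * k) - lam * (n * (a * x) * g * k) - n * (a * x) * g * z - B" for x a A g k z B :: real
        by (simp add: algebra_simps)
      ultimately show ?thesis unfolding W_def by (simp only:)
    qed
    show ?thesis
    proof (cases "?k y = 0")
      case True
      then have "?zl y = 0" using G(5) by (simp add: zonal_lap_def)
      then show ?thesis unfolding lhs using True by (simp add: ph)
    next
      case False
      then have sL: "sgn y \<in> L" using cap ss by simp
      have k0: "?k y >= 0" by (rule bump_nonneg)
      have sec: "y \<in> sector a b L \<longleftrightarrow> a <= t & t <= b" for a b using sector_iff[OF y] sL by (simp add: t_def)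
      have nX: "X powr (\<alpha> - ?N) = n * X powr \<alpha>" unfolding n_def powr_add[symmetric] by (simp add: add.commute)
      have zz: "\<eta> t = 0 \<or> (0 <= t & t <= T)" using \<eta>z[of t] by (cases "t < 0 \<or> t > T") auto
      have ve: "vw \<eta> T L y = n * W * \<eta> t"
        using zz unfolding vw_def X_def[symmetric] t_def[symmetric] nX W_def by (auto simp: sec indicator_def)
      have se: "sw L y = n * W * indicator {1..2} t"
        unfolding sw_def X_def[symmetric] nX W_def by (auto simp: sec indicator_def)
      have "W powr p = X powr (\<alpha> * p) * w y powr p" unfolding W_def using w_nonneg by (simp add: powr_mult powr_powr)
      moreover have "X powr (\<alpha> * p - ?N) = n * X powr (\<alpha> * p)" unfolding n_def powr_add[symmetric] by (simp add: add.commute)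
      ultimately have pe: "pw \<eta> T L y = n * W powr p * \<eta> t"
        using zz unfolding pw_def X_def[symmetric] t_def[symmetric] by (auto simp: sec indicator_def)
      have te: "tw q y = n / (1 + q\<^sup>2 * t\<^sup>2)" by (simp add: tw_def n_def X_def t_def)
      have po: "R powr (2 - \<alpha> * (p - 1)) * (pw \<eta> T L y * ?k y) <= w y powr p * \<phi> y"
      proof (cases "y \<in> sector 0 T L")
        case False
        then have "pw \<eta> T L y = 0" by (simp add: pw_def)
        then show ?thesis using \<phi>0[of y] by simp
      next
        case True
        then have "X <= R" using R by (simp add: sector_def X_def)
        then have "R powr (2 - \<alpha> * (p - 1)) <= X powr (2 - \<alpha> * (p - 1))"
          using X crit by (intro powr_mono2') (auto simp: \<alpha>_def)
        then have "R powr (2 - \<alpha> * (p - 1)) * X powr (\<alpha> * p - ?N) <= X powr (2 - \<alpha> * (p - 1)) * X powr (\<alpha> * p - ?N)"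
          by (intro mult_right_mono) auto
        also have "\<dots> = X powr (- mm)"
        proof -
          have "2 - \<alpha> * (p - 1) + (\<alpha> * p - ?N) = - mm" by (simp add: mm_def \<alpha>_def field_simps)
          then show ?thesis by (simp only: powr_add[symmetric])
        qed
        finally have "(R powr (2 - \<alpha> * (p - 1)) * X powr (\<alpha> * p - ?N)) * (w y powr p * \<eta> t * ?k y) <= X powr (- mm) * (w y powr p * \<eta> t * ?k y)"
          using k0 \<eta>0 by (intro mult_right_mono) auto
        then show ?thesis unfolding pw_def ph X_def[symmetric] t_def[symmetric] using True by (simp add: mult_ac)
      qed
      have "(n * ?k y) * (- (W * (\<eta>'' t + 2 * \<kappa> * \<eta>' t))) <= (n * ?k y) * (\<tau> * (W powr p * \<eta> t) + Q * (W * \<eta> t) - b * (indicator {1..2} t * W) + \<tau> * (1 / q / (1 + q\<^sup>2 * t\<^sup>2)))"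
        using key[OF W0, of t] nn k0 by (intro mult_left_mono) auto
      then have "- (n * W * (\<eta>'' t + 2 * \<kappa> * \<eta>' t) * ?k y) <= \<tau> * (n * W powr p * \<eta> t * ?k y) + Q * (n * W * \<eta> t * ?k y) - b * (n * W * indicator {1..2} t * ?k y) + \<tau> / q * (n / (1 + q\<^sup>2 * t\<^sup>2) * ?k y)"
        by (simp add: algebra_simps)
      then show ?thesis unfolding lhs using po unfolding ve se pe te by (simp add: algebra_simps)
    qed
  qed
  have "0 <= (\<integral>y. ?lhs y \<partial>lebesgue)"
    using super[OF tf \<phi>0] Bochner_Integration.integral_diff[OF i3 i2] unfolding cc_def[symmetric] by simp
  also have "\<dots> <= (\<integral>y. ?rhs y \<partial>lebesgue)"
  proof (rule integral_mono_AE)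
    have "AE y in lebesgue. y ~= (0::'a)" by (rule AE_completion[OF AE_lborel_singleton])
    then show "AE y in lebesgue. ?lhs y <= ?rhs y" by eventually_elim (rule le)
  qed (intro Bochner_Integration.integrable_diff Bochner_Integration.integrable_add integrable_mult_right i3 i2 j itw)+
  also have "\<dots> = - (lam - Q) * (\<integral>y. vw \<eta> T L y * ?k y \<partial>lebesgue) - b * (\<integral>y. sw L y * ?k y \<partial>lebesgue)
     - (R powr (2 - \<alpha> * (p - 1)) - \<tau>) * (\<integral>y. pw \<eta> T L y * ?k y \<partial>lebesgue)
     + \<tau> / q * (\<integral>y. tw q y * ?k y \<partial>lebesgue) - (\<integral>y. vw \<eta> T L y * ?zl y \<partial>lebesgue)"
    by (simp only: Bochner_Integration.integral_diff Bochner_Integration.integral_add integral_mult_right_zero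
        Bochner_Integration.integrable_diff Bochner_Integration.integrable_add integrable_mult_right j itw)
  also have "(\<integral>y. vw \<eta> T L y * ?zl y \<partial>lebesgue) = laplacian (%x. \<integral>y. vw \<eta> T L y * bump e (sgn x \<bullet> sgn y) \<partial>lebesgue) s"
    by (rule laplacian_zonal_potential[OF iw(1) _ s G(1-4), symmetric]) (simp add: vw_def)
  finally show ?thesis by (simp add: algebra_simps)
qed

end

lemma balance:
  fixes p Q D E Y S b \<delta> C :: real
  assumes p: "p > 1" and pos: "Q > 0" "D > 0" "E > 0" "Y > 0" "b >= 0" "\<delta> >= 0" "C >= 0" and S: "S >= \<delta> * E"
  shows "min (b * \<delta>) (C * (1 / (2 * D)) powr (p - 1)) * Q powr ((p - 1) / p)
    <= b * S / Y + C * (Y * Q / (2 * D * E)) powr (p - 1)"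
proof (cases "E / Y >= Q powr ((p - 1) / p)")
  case True
  have "min (b * \<delta>) (C * (1 / (2 * D)) powr (p - 1)) * Q powr ((p - 1) / p) <= (b * \<delta>) * Q powr ((p - 1) / p)"
    by (intro mult_right_mono) auto
  also have "\<dots> <= (b * \<delta>) * (E / Y)" using True pos by (intro mult_left_mono) auto
  also have "\<dots> = b * (\<delta> * E) / Y" by simp
  also have "\<dots> <= b * S / Y" using pos S by (intro divide_right_mono mult_left_mono) auto
  also have "\<dots> <= b * S / Y + C * (Y * Q / (2 * D * E)) powr (p - 1)" using pos by simp
  finally show ?thesis .
next
  case False
  then have "E <= Q powr ((p - 1) / p) * Y" using pos by (simp add: divide_le_eq not_le less_imp_le pos_divide_less_eq)
  have q1: "Q powr (1 / p) * Q powr ((p - 1) / p) = Q"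
  proof -
    have "1 / p + (p - 1) / p = 1" using p by (simp add: field_simps)
    then show ?thesis unfolding powr_add[symmetric] using pos by simp
  qed
  have "Q powr (1 / p) * (1 / (2 * D)) <= Y * Q / (2 * D * E)"
  proof -
    have "Q powr (1 / p) * E <= Q powr (1 / p) * (Q powr ((p - 1) / p) * Y)" using \<open>E <= _\<close> by (intro mult_left_mono) auto
    also have "\<dots> = Y * Q" using q1 by (simp add: mult.assoc[symmetric] mult.commute)
    finally show ?thesis using pos by (simp add: field_simps)
  qed
  then have "(Q powr (1 / p) * (1 / (2 * D))) powr (p - 1) <= (Y * Q / (2 * D * E)) powr (p - 1)"
    using p pos by (intro powr_mono2) auto
  moreover have "(Q powr (1 / p) * (1 / (2 * D))) powr (p - 1) = (1 / (2 * D)) powr (p - 1) * Q powr ((p - 1) / p)"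
    using pos by (simp add: powr_mult powr_powr powr_divide)
  ultimately have "C * ((1 / (2 * D)) powr (p - 1) * Q powr ((p - 1) / p)) <= C * (Y * Q / (2 * D * E)) powr (p - 1)"
    using pos by (intro mult_left_mono) auto
  moreover have "min (b * \<delta>) (C * (1 / (2 * D)) powr (p - 1)) * Q powr ((p - 1) / p) <= (C * (1 / (2 * D)) powr (p - 1)) * Q powr ((p - 1) / p)"
    by (intro mult_right_mono) auto
  moreover have "b * S / Y >= 0"
  proof -
    have "\<delta> * E >= 0" using pos by simp
    then have "S >= 0" using S by linarith
    then show ?thesis using pos by simp
  qed
  ultimately show ?thesis by (simp add: mult.assoc)
qed

context hardy_supersolution
begin

lemma sw_lower:
  assumes nz: "\<not> (AE x in lebesgue. w x = 0)" and K: "compact K" "K \<subseteq> \<Sigma>"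
  shows "\<exists>\<delta>>0. \<exists>e1>0. \<forall>s\<in>K. \<forall>e L. 0 < e & e < e1 & compact L & L \<subseteq> \<Sigma> & (\<forall>t. norm t = 1 --> bump e (s \<bullet> t) ~= 0 --> t \<in> L)
    --> \<delta> * e ^ (DIM('a) - 1) <= (\<integral>y. sw L y * bump e (s \<bullet> sgn y) \<partial>lebesgue)"
proof -
  define r1 where "r1 = R / 2 * exp (- 2)"
  define r2 where "r2 = R / 2 * exp (- 1)"
  have r: "0 < r1" "r1 < r2" "r2 < R"
  proof -
    show "0 < r1" "r1 < r2" using R by (auto simp: r1_def r2_def)
    have "R / 2 * exp (- 1) <= R / 2 * 1" using R by (intro mult_left_mono) auto
    then show "r2 < R" using R unfolding r2_def by linarith
  qed
  have KS: "K \<subseteq> sphere 0 1" using K sphere_domain_subset[OF \<Sigma>] by blast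
  have sub: "\<rho> *\<^sub>R s \<in> trunc_cone \<Sigma> R" if "r1 <= \<rho>" "\<rho> <= r2" "s \<in> K" for \<rho> s
    unfolding trunc_cone_def using that r K by (intro CollectI exI[of _ \<rho>] exI[of _ s]) auto
  have "\<exists>c>0. \<exists>e1>0. \<forall>s\<in>K. \<forall>e. 0 < e & e < e1 &
     integrable lebesgue (%y. w y * (indicator {y. r1 <= norm y & norm y <= r2} y * bump e (s \<bullet> sgn y))) -->
     c * e ^ (DIM('a) - 1) <= (\<integral>y. w y * (indicator {y. r1 <= norm y & norm y <= r2} y * bump e (s \<bullet> sgn y)) \<partial>lebesgue)"
    by (rule cap_lower[OF trunc_cone_connected[OF \<Sigma>] nz K(1) KS r(1,2)], rule sub)
  then obtain c e1 where c: "c > 0" "e1 > 0" and cl: "\<forall>s\<in>K. \<forall>e. 0 < e & e < e1 &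
     integrable lebesgue (%y. w y * (indicator {y. r1 <= norm y & norm y <= r2} y * bump e (s \<bullet> sgn y))) -->
     c * e ^ (DIM('a) - 1) <= (\<integral>y. w y * (indicator {y. r1 <= norm y & norm y <= r2} y * bump e (s \<bullet> sgn y)) \<partial>lebesgue)"
    by (elim exE conjE)
  define cW where "cW = r2 powr (\<alpha> - real DIM('a))"
  have cW: "cW > 0" using r by (simp add: cW_def)
  have fin: "cW * c * e ^ (DIM('a) - 1) <= (\<integral>y. sw L y * bump e (s \<bullet> sgn y) \<partial>lebesgue)"
    if s: "s \<in> K" and e: "0 < e" "e < e1" and L: "compact L" "L \<subseteq> \<Sigma>" and cap: "\<forall>t. norm t = 1 --> bump e (s \<bullet> t) ~= 0 --> t \<in> L" for s e L
  proof -
    let ?k = "%y. bump e (s \<bullet> sgn y)"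
    have cb: "continuous_on UNIV (bump e)" by (rule smooth_on_continuous[OF bump_smooth])
    have eq: "w y * (indicator {y. r1 <= norm y & norm y <= r2} y * ?k y) = (w y * indicator (sector 1 2 L) y) * ?k y" for y
    proof (cases "y = 0 \<or> ?k y = 0")
      case True
      then show ?thesis using r sector_pos[of y 1 2 L] by (auto simp: indicator_def)
    next
      case False
      then have "sgn y \<in> L" using cap by (simp add: norm_sgn)
      then show ?thesis by (simp add: indicator_def sector_def r1_def r2_def)
    qed
    have ii: "integrable lebesgue (%y. (w y * indicator (sector 1 2 L) y) * ?k y)"
      by (rule integrable_times_zonal[OF w_loc[OF sector_compact[OF L]] cb]) auto
    have "c * e ^ (DIM('a) - 1) <= (\<integral>y. (w y * indicator (sector 1 2 L) y) * ?k y \<partial>lebesgue)"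
      using bspec[OF cl s, THEN spec[of _ e]] e ii unfolding eq by blast
    then have "cW * (c * e ^ (DIM('a) - 1)) <= cW * (\<integral>y. (w y * indicator (sector 1 2 L) y) * ?k y \<partial>lebesgue)"
      using cW by (intro mult_left_mono) auto
    also have "\<dots> = (\<integral>y. cW * ((w y * indicator (sector 1 2 L) y) * ?k y) \<partial>lebesgue)" by (simp only: integral_mult_right_zero)
    also have "\<dots> <= (\<integral>y. sw L y * ?k y \<partial>lebesgue)"
    proof (rule integral_mono)
      show "integrable lebesgue (%y. cW * ((w y * indicator (sector 1 2 L) y) * ?k y))" using ii by (rule integrable_mult_right)
      have c\<eta>: "continuous_on UNIV (%_::real. 0::real)" by simp
      show "integrable lebesgue (%y. sw L y * ?k y)" by (rule integrable_times_zonal[OF weights_integrable(2)[OF L c\<eta>] cb])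
      fix y
      show "cW * ((w y * indicator (sector 1 2 L) y) * ?k y) <= sw L y * ?k y"
      proof (cases "y \<in> sector 1 2 L")
        case True
        have "\<alpha> - real DIM('a) <= 0" using \<kappa> N3 by (simp add: \<alpha>_def field_simps)
        then have "cW <= norm y powr (\<alpha> - real DIM('a))"
          unfolding cW_def using sector_pos[OF True] True by (intro powr_mono2') (auto simp: sector_def r2_def)
        then have "cW * (w y * ?k y) <= norm y powr (\<alpha> - real DIM('a)) * (w y * ?k y)"
          using w_nonneg bump_nonneg by (intro mult_right_mono) auto
        then show ?thesis using True by (simp add: sw_def mult_ac)
      qed (simp add: sw_def)
    qed
    finally show ?thesis by (simp only: mult.assoc)
  qed
  have pc: "cW * c > 0" using cW c by simp
  show ?thesis
    by (rule exI[of _ "cW * c"], rule conjI[OF pc], rule exI[of _ e1], rule conjI[OF c(2)], intro ballI allI impI, elim conjE, rule fin, assumption+)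
qed

lemma vanish:
  assumes lam: "lam = lambda1 \<Sigma>"
  shows "AE x in lebesgue. w x = 0"
proof (rule ccontr)
  assume nz: "\<not> (AE x in lebesgue. w x = 0)"
  let ?N = "real DIM('a)" and ?n = "DIM('a) - 1"
  have lam0: "lam >= 0" using lambda1_nonneg[OF \<Sigma>] by (simp add: lam)
  obtain b m where bm: "b > 0" "m > 0" and wt: "\<forall>q. 0 < q & q <= 1/16 --> (\<forall>\<tau>>0. \<exists>(\<eta>::real => real) (\<eta>'::real => real) (\<eta>''::real => real) T.
     smooth_on UNIV \<eta> & (\<forall>t. (\<eta> has_real_derivative \<eta>' t) (at t)) & (\<forall>t. (\<eta>' has_real_derivative \<eta>'' t) (at t)) &
     (\<forall>t. \<eta> t >= 0) & T > 0 & (\<forall>t. t < 0 \<or> t > T --> \<eta> t = 0) & (\<forall>t\<in>{1..2}. \<eta> t >= m) &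
     (\<forall>t. (q\<^sup>2 + \<kappa> * q) * \<eta> t <= 2 * q / (1 + q\<^sup>2 * t\<^sup>2)) &
     (\<forall>t W. W >= 0 --> W * (\<eta>'' t + 2 * \<kappa> * \<eta>' t) + \<tau> * (W powr p * \<eta> t)
        >= - 64 * (q\<^sup>2 + \<kappa> * q) * (W * \<eta> t) + b * (indicator {1..2} t * W) - \<tau> * (1 / q / (1 + q\<^sup>2 * t\<^sup>2))))"
    using weight_exists[OF \<kappa> p] by (elim exE conjE)
  have \<Lambda>0: "lam + 1 >= 0" using lam0 by simp
  obtain \<delta>0 where \<delta>0: "\<delta>0 > 0" and equi: "\<forall>\<phi> B. smooth_on (UNIV - {0}) (%y::'a. \<phi> (sgn y)) --> dirichlet \<phi> <= (lam + 1) * mass \<phi> -->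
      B \<in> sets borel --> (\<integral>\<^sup>+x. indicator B (sgn x) * indicator (ball 0 1) x \<partial>lborel) <= ennreal \<delta>0 -->
      (\<integral>\<^sup>+x. ennreal ((\<phi> (sgn x))\<^sup>2) * indicator B (sgn x) * indicator (ball 0 1) x \<partial>lborel) <= ennreal (mass \<phi> / 2)"
  proof (rule mass_equiintegrable[where 'a='a, OF \<Lambda>0], goal_cases)
    case (1 d)
    show ?case by (rule 1(1)[OF 1(2)], intro allI impI, rule 1(3), assumption+)
  qed
  obtain K where K: "compact K" "K \<subseteq> \<Sigma>" "\<Sigma> - K \<in> sets borel"
    "(\<integral>\<^sup>+x. indicator (\<Sigma> - K) (sgn x) * indicator (ball 0 1) x \<partial>lborel) <= ennreal \<delta>0"
    by (rule compact_exhaustion_measure[OF \<Sigma> \<delta>0])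
  obtain \<delta> e1 where \<delta>: "\<delta> > 0" "e1 > 0" and low: "\<forall>s\<in>K. \<forall>e L. 0 < e & e < e1 & compact L & L \<subseteq> \<Sigma> & (\<forall>t. norm t = 1 --> bump e (s \<bullet> t) ~= 0 --> t \<in> L)
    --> \<delta> * e ^ ?n <= (\<integral>y. sw L y * bump e (s \<bullet> sgn y) \<partial>lebesgue)"
    using sw_lower[OF nz K(1,2)] by (elim exE conjE)
  obtain D where D: "D > 0" and Db: "\<forall>q>0. \<forall>s::'a. \<forall>e. norm s = 1 & 0 < e & e <= 1/2 --> integrable lebesgue (%y. tw q y * bump e (s \<bullet> sgn y)) &
    (\<integral>y. tw q y * bump e (s \<bullet> sgn y) \<partial>lebesgue) <= D / q * e ^ ?n"
    using tw_bound by (elim exE conjE)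
  define C0 where "C0 = R powr (2 - \<alpha> * (p - 1))"
  have C0: "C0 > 0" using R by (simp add: C0_def)
  define C3 where "C3 = min (b * \<delta>) (C0 / 2 * (1 / (2 * D)) powr (p - 1))"
  have C3: "C3 > 0" using bm \<delta> C0 D by (simp add: C3_def)
  define Q0 where "Q0 = (C3 / 132) powr p"
  have Q0: "Q0 > 0" using C3 by (simp add: Q0_def)
  define q where "q = min (1/16) (min (1 / (1 + \<kappa>)) (Q0 / (2 * (1 + \<kappa>))))"
  define Q where "Q = q\<^sup>2 + \<kappa> * q"
  have \<kappa>1: "1 + \<kappa> > 0" using \<kappa> by simp
  have q: "0 < q" "q <= 1/16" "q <= 1 / (1 + \<kappa>)" "q <= Q0 / (2 * (1 + \<kappa>))"
  proof -
    show "0 < q" using \<kappa>1 Q0 by (simp add: q_def)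
    show "q <= 1/16" unfolding q_def by (rule min.cobounded1)
    show "q <= 1 / (1 + \<kappa>)" unfolding q_def by (rule min.coboundedI2, rule min.cobounded1)
    show "q <= Q0 / (2 * (1 + \<kappa>))" unfolding q_def by (rule min.coboundedI2, rule min.cobounded2)
  qed
  have Qpos: "Q > 0" unfolding Q_def using q \<kappa> by (intro add_pos_nonneg) auto
  have Qle: "Q <= q * (1 + \<kappa>)"
  proof -
    have "q * q <= q * 1" using q by (intro mult_left_mono) auto
    then show ?thesis by (simp add: Q_def power2_eq_square algebra_simps)
  qed
  have Q1: "Q <= 1" using Qle q(3) \<kappa>1 by (simp add: field_simps)
  have QQ: "Q < Q0" using Qle q(4) \<kappa>1 Q0 by (simp add: field_simps)
  have small: "132 * Q < C3 * Q powr ((p - 1) / p)"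
  proof -
    have "Q powr (1 / p) < Q0 powr (1 / p)" using QQ Qpos p by (intro powr_less_mono2) auto
    also have "\<dots> = C3 / 132" using p C3 by (simp add: Q0_def powr_powr)
    finally have "132 * Q powr (1 / p) < C3" by simp
    then have "(132 * Q powr (1 / p)) * Q powr ((p - 1) / p) < C3 * Q powr ((p - 1) / p)"
      using Qpos by (intro mult_strict_right_mono) auto
    moreover have "Q powr (1 / p) * Q powr ((p - 1) / p) = Q"
    proof -
      have "1 / p + (p - 1) / p = 1" using p by (simp add: field_simps)
      then show ?thesis unfolding powr_add[symmetric] using Qpos by simp
    qed
    ultimately show ?thesis by (simp only: mult.assoc)
  qed
  have "lambda1 \<Sigma> < lam + Q" using Qpos by (simp add: lam)
  then obtain \<phi> where adm: "admissible \<Sigma> \<phi>" and dir: "dirichlet \<phi> <= (lam + Q) * mass \<phi>" and mpos: "mass \<phi> > 0"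
    by (rule lambda1_lessD[OF \<Sigma>])
  have \<phi>s: "smooth_on (UNIV - {0}) (%y. \<phi> (sgn y))" using adm by (simp add: admissible_def)
  define S where "S = closure {s \<in> sphere 0 1. \<phi> s ~= 0}"
  have S: "compact S" "S \<subseteq> \<Sigma>"
  proof -
    have "bounded {s \<in> sphere (0::'a) 1. \<phi> s ~= 0}" by (rule bounded_subset[OF bounded_sphere[of 0 1]]) auto
    then show "compact S" by (simp add: S_def compact_closure)
    show "S \<subseteq> \<Sigma>" using adm by (simp add: S_def admissible_def)
  qed
  have S1: "norm s = 1" if "s \<in> S" for s using S(2) that sphere_domain_subset[OF \<Sigma>] by auto
  obtain \<delta>2 e2 where \<delta>2: "\<delta>2 > 0" "e2 > 0" and low2: "\<forall>s\<in>S. \<forall>e L. 0 < e & e < e2 & compact L & L \<subseteq> \<Sigma> & (\<forall>t. norm t = 1 --> bump e (s \<bullet> t) ~= 0 --> t \<in> L)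
    --> \<delta>2 * e ^ ?n <= (\<integral>y. sw L y * bump e (s \<bullet> sgn y) \<partial>lebesgue)"
    using sw_lower[OF nz S] by (elim exE conjE)
  obtain L d where L: "compact L" "L \<subseteq> \<Sigma>" and d: "d > 0" and Ld: "!!s t. s \<in> S ==> norm t = 1 ==> norm (s - t) <= d ==> t \<in> L"
    by (rule compact_sphere_neighbourhood[OF \<Sigma> S]) blast
  define e where "e = min (min (e1 / 2) (e2 / 2)) (min (d / 2) (1 / 2))"
  have e: "0 < e" "e < e1" "e < e2" "2 * e <= d" "e <= 1/2" using \<delta> \<delta>2 d by (auto simp: e_def min_def)
  have cap: "\<forall>t. norm t = 1 --> bump e (s \<bullet> t) ~= 0 --> t \<in> L" if "s \<in> S" for s
  proof (intro allI impI)
    fix t :: 'a assume t: "norm t = 1" "bump e (s \<bullet> t) ~= 0"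
    show "t \<in> L" by (rule Ld[OF that t(1) order_trans[OF bump_support[OF S1[OF that] t(1) e(1) t(2)] e(4)]])
  qed
  define E where "E = e ^ ?n"
  have E: "E > 0" using e by (simp add: E_def)
  define \<tau> where "\<tau> = min (C0 / 2) (Q * (m * \<delta>2 * E) * q\<^sup>2 / (D * E))"
  have \<tau>: "\<tau> > 0" "\<tau> <= C0 / 2"
    using C0 Qpos bm \<delta>2 E q D by (simp_all only: \<tau>_def min.cobounded1) simp
  have \<tau>2: "\<tau> / q * (D / q * E) <= Q * (m * \<delta>2 * E)"
  proof -
    have "\<tau> <= Q * (m * \<delta>2 * E) * q\<^sup>2 / (D * E)" unfolding \<tau>_def by (rule min.cobounded2)
    then have "\<tau> * (D * E) <= Q * (m * \<delta>2 * E) * q\<^sup>2" using D E by (simp add: pos_le_divide_eq)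
    then have "\<tau> * (D * E) / q\<^sup>2 <= Q * (m * \<delta>2 * E)" using q by (simp add: pos_divide_le_eq)
    then show ?thesis by (simp add: power2_eq_square mult_ac)
  qed
  obtain \<eta> \<eta>' \<eta>'' :: "real => real" and T where
    h0: "smooth_on UNIV \<eta>" "\<forall>t. (\<eta> has_real_derivative \<eta>' t) (at t)" "\<forall>t. (\<eta>' has_real_derivative \<eta>'' t) (at t)"
     "\<forall>t. \<eta> t >= 0" "T > 0" "\<forall>t. t < 0 \<or> t > T --> \<eta> t = 0" "\<forall>t\<in>{1..2}. \<eta> t >= m"
     "\<forall>t. (q\<^sup>2 + \<kappa> * q) * \<eta> t <= 2 * q / (1 + q\<^sup>2 * t\<^sup>2)"
     "\<forall>t W. W >= 0 --> W * (\<eta>'' t + 2 * \<kappa> * \<eta>' t) + \<tau> * (W powr p * \<eta> t)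
        >= - 64 * (q\<^sup>2 + \<kappa> * q) * (W * \<eta> t) + b * (indicator {1..2} t * W) - \<tau> * (1 / q / (1 + q\<^sup>2 * t\<^sup>2))"
    using wt[rule_format, OF conjI[OF q(1,2)] \<tau>(1)] by (elim exE conjE)
  note h = h0[rule_format]
  have T2: "T >= 2"
  proof (rule ccontr)
    assume "\<not> T >= 2"
    then have "\<eta> 2 = 0" by (intro h(6)) simp
    then show False using h(7)[of 2] bm by simp
  qed
  let ?v = "vw \<eta> T L"
  define Y where "Y = (%x. \<integral>y. ?v y * bump e (sgn x \<bullet> sgn y) \<partial>lebesgue)"
  have c\<eta>: "continuous_on UNIV \<eta>" by (rule smooth_on_continuous[OF h(1)])
  have cb: "continuous_on UNIV (bump e)" by (rule smooth_on_continuous[OF bump_smooth])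
  note iw = weights_integrable(1)[OF L c\<eta>, of T] weights_integrable(2)[OF L c\<eta>] weights_integrable(3)[OF L c\<eta>, of T]
  have Ys: "smooth_on (UNIV - {0}) Y"
    unfolding Y_def by (rule smooth_on_compose_sgn[OF zonal_potential_smooth[OF iw(1) bump_smooth]])
  have Yh: "Y x = Y (sgn x)" for x by (simp add: Y_def sgn_sgn_vector)
  have main: "Y s >= m * \<delta>2 * E & (lam - 65 * Q) * Y s + b * (\<integral>y. sw L y * bump e (s \<bullet> sgn y) \<partial>lebesgue)
       + C0 / 2 * ((Y s * Q / (2 * D * E)) powr (p - 1) * Y s) <= - laplacian Y s" if s: "s \<in> S" for s
  proof -
    let ?k = "%y. bump e (s \<bullet> sgn y)"
    have s1: "norm s = 1" "sgn s = s" using S1[OF s] by (auto simp: sgn_div_norm)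
    have Yeq: "Y s = (\<integral>y. ?v y * ?k y \<partial>lebesgue)" by (simp add: Y_def s1)
    note j = integrable_times_zonal[OF iw(1) cb, of s] integrable_times_zonal[OF iw(2) cb, of s] integrable_times_zonal[OF iw(3) cb, of s]
    have JJ: "integrable lebesgue (%y. tw q y * ?k y) & (\<integral>y. tw q y * ?k y \<partial>lebesgue) <= D / q * e ^ ?n"
      by (rule mp[OF spec[OF spec[OF mp[OF spec[OF Db, of q] q(1)], of s], of e]]) (use s1 e in blast)
    then have jt: "integrable lebesgue (%y. tw q y * ?k y)" and J: "(\<integral>y. tw q y * ?k y \<partial>lebesgue) <= D / q * E"
      unfolding E_def by (rule conjunct1, rule conjunct2)
    have k0: "?k y >= 0" for y by (rule bump_nonneg)
    have Slow: "\<delta>2 * E <= (\<integral>y. sw L y * ?k y \<partial>lebesgue)"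
      unfolding E_def by (rule mp[OF spec[OF spec[OF bspec[OF low2 s], of e], of L]]) (use e L cap[OF s] in blast)
    have "m * (\<delta>2 * E) <= m * (\<integral>y. sw L y * ?k y \<partial>lebesgue)" using Slow bm by (intro mult_left_mono) auto
    also have "\<dots> = (\<integral>y. m * (sw L y * ?k y) \<partial>lebesgue)" by (simp only: integral_mult_right_zero)
    also have "\<dots> <= (\<integral>y. ?v y * ?k y \<partial>lebesgue)"
    proof (rule integral_mono[OF integrable_mult_right[OF j(2)] j(1)])
      fix y
      have "m * sw L y <= ?v y"
      proof (cases "y \<in> sector 1 2 L")
        case True
        have y0: "y ~= 0" using sector_pos[OF True] by auto
        have t: "1 <= tt y" "tt y <= 2" "sgn y \<in> L" using True unfolding sector_iff[OF y0] by auto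
        then have "y \<in> sector 0 T L" unfolding sector_iff[OF y0] using T2 by simp
        moreover have "(w y * norm y powr (\<alpha> - ?N)) * m <= (w y * norm y powr (\<alpha> - ?N)) * \<eta> (tt y)"
          using h(7)[of "tt y"] t w_nonneg by (intro mult_left_mono) auto
        ultimately show ?thesis using True by (simp add: sw_def vw_def mult_ac)
      next
        case False
        then show ?thesis using w_nonneg h(4) by (simp add: sw_def vw_def)
      qed
      then have "(m * sw L y) * ?k y <= ?v y * ?k y" by (intro mult_right_mono k0)
      then show "m * (sw L y * ?k y) <= ?v y * ?k y" by (simp only: mult.assoc)
    qed
    finally have Ylow: "m * \<delta>2 * E <= Y s" unfolding Yeq by (simp only: mult.assoc)
    have Ypos: "Y s > 0"
    proof -
      have "m * \<delta>2 * E > 0" using bm \<delta>2 E by simp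
      then show ?thesis using Ylow by linarith
    qed
    define z where "z = Y s * Q / (2 * D * E)"
    have z0: "z > 0" using Ypos Qpos D E by (simp add: z_def)
    have P: "z powr (p - 1) * Y s <= (\<integral>y. pw \<eta> T L y * ?k y \<partial>lebesgue)"
    proof -
      let ?A = "p * z powr (p - 1)" and ?B = "(p - 1) * z powr p * (2 * q / Q)"
      have "z powr p = z powr (p - 1) * z"
        using powr_add[of z "p - 1" 1] z0 by simp
      moreover have "z * (2 * D * E / Q) = Y s" using Qpos D E by (simp add: z_def)
      ultimately have "z powr p * (2 * D * E / Q) = z powr (p - 1) * Y s" by (simp only: mult.assoc)
      then have "z powr (p - 1) * Y s = ?A * Y s - (p - 1) * (z powr p * (2 * D * E / Q))" by (simp add: algebra_simps)
      also have "\<dots> = ?A * Y s - ?B * (D / q * E)" using q by simp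
      also have "\<dots> <= ?A * Y s - ?B * (\<integral>y. tw q y * ?k y \<partial>lebesgue)"
        using J p q Qpos by (intro diff_left_mono mult_left_mono) auto
      also have "\<dots> = (\<integral>y. ?A * (?v y * ?k y) - ?B * (tw q y * ?k y) \<partial>lebesgue)"
        unfolding Yeq using Bochner_Integration.integral_diff[OF integrable_mult_right[OF j(1), of ?A] integrable_mult_right[OF jt, of ?B]]
        by (simp only: integral_mult_right_zero)
      also have "\<dots> <= (\<integral>y. pw \<eta> T L y * ?k y \<partial>lebesgue)"
      proof (rule integral_mono[OF _ j(3)])
        show "integrable lebesgue (%y. ?A * (?v y * ?k y) - ?B * (tw q y * ?k y))"
          by (intro Bochner_Integration.integrable_diff integrable_mult_right j jt)
        fix y
        have B0: "?B >= 0" using p q Qpos by simp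
        have tw0: "tw q y >= 0" unfolding tw_def by simp
        have "?A * ?v y - ?B * tw q y <= pw \<eta> T L y"
        proof (cases "y \<in> sector 0 T L")
          case False
          then have "?v y = 0" "pw \<eta> T L y = 0" by (auto simp: vw_def pw_def)
          then show ?thesis using mult_nonneg_nonneg[OF B0 tw0] by simp
        next
          case True
          define X where "X = norm y"
          have X: "X > 0" using sector_pos[OF True] by (simp add: X_def)
          define n where "n = X powr (- ?N)"
          define W where "W = X powr \<alpha> * w y"
          have W0: "W >= 0" and n0: "n >= 0" using w_nonneg by (auto simp: W_def n_def)
          have "X powr (\<alpha> - ?N) = n * X powr \<alpha>" unfolding n_def powr_add[symmetric] by (simp add: add.commute)
          then have ve: "?v y = (n * \<eta> (tt y)) * W" using True by (simp add: vw_def W_def flip: X_def)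
          have "W powr p = X powr (\<alpha> * p) * w y powr p" unfolding W_def using w_nonneg by (simp add: powr_mult powr_powr)
          moreover have "X powr (\<alpha> * p - ?N) = n * X powr (\<alpha> * p)" unfolding n_def powr_add[symmetric] by (simp add: add.commute)
          ultimately have pe: "pw \<eta> T L y = (n * \<eta> (tt y)) * W powr p" using True by (simp add: pw_def flip: X_def)
          have "Q * \<eta> (tt y) <= 2 * q / (1 + q\<^sup>2 * (tt y)\<^sup>2)" using h(8) by (simp add: Q_def)
          then have "\<eta> (tt y) <= 2 * q / (1 + q\<^sup>2 * (tt y)\<^sup>2) / Q" by (simp only: pos_le_divide_eq[OF Qpos] mult.commute)
          then have "n * \<eta> (tt y) <= n * (2 * q / (1 + q\<^sup>2 * (tt y)\<^sup>2) / Q)" by (rule mult_left_mono[OF _ n0])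
          also have "\<dots> = (2 * q / Q) * tw q y" by (simp only: tw_def n_def X_def divide_inverse mult_ac)
          finally have "((p - 1) * z powr p) * (n * \<eta> (tt y)) <= ((p - 1) * z powr p) * ((2 * q / Q) * tw q y)"
            using p by (intro mult_left_mono) auto
          then have b2: "((p - 1) * z powr p) * (n * \<eta> (tt y)) <= ?B * tw q y" by (simp only: mult.assoc)
          have "(n * \<eta> (tt y)) * (p * z powr (p - 1) * W - (p - 1) * z powr p) <= (n * \<eta> (tt y)) * W powr p"
            using powr_tangent[OF p W0, of z] z0 n0 h(4) by (intro mult_left_mono) auto
          then have "?A * ?v y - ((p - 1) * z powr p) * (n * \<eta> (tt y)) <= pw \<eta> T L y"
            unfolding ve pe by (simp add: algebra_simps)
          then show ?thesis using b2 by linarith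
        qed
        then have "(?A * ?v y - ?B * tw q y) * ?k y <= pw \<eta> T L y * ?k y" by (intro mult_right_mono k0)
        then show "?A * (?v y * ?k y) - ?B * (tw q y * ?k y) <= pw \<eta> T L y * ?k y"
          by (simp only: left_diff_distrib mult.assoc)
      qed
      finally show ?thesis .
    qed
    have lY: "laplacian Y s = laplacian (%x. \<integral>y. ?v y * bump e (sgn x \<bullet> sgn y) \<partial>lebesgue) s" by (simp only: Y_def)
    have test: "(lam - 64 * Q) * Y s + b * (\<integral>y. sw L y * ?k y \<partial>lebesgue)
     + (C0 - \<tau>) * (\<integral>y. pw \<eta> T L y * ?k y \<partial>lebesgue)
     - \<tau> / q * (\<integral>y. tw q y * ?k y \<partial>lebesgue) <= - laplacian Y s"
      unfolding Yeq C0_def lY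
    proof (rule testing[where \<eta>'=\<eta>' and \<eta>''=\<eta>''])
      show "W * (\<eta>'' t + 2 * \<kappa> * \<eta>' t) + \<tau> * (W powr p * \<eta> t)
         >= - (64 * Q) * (W * \<eta> t) + b * (indicator {1..2} t * W) - \<tau> * (1 / q / (1 + q\<^sup>2 * t\<^sup>2))" if "W >= 0" for t W
        using h(9)[OF that, of t] by (simp add: Q_def)
      show "t \<in> L" if "norm t = 1" "bump e (s \<bullet> t) ~= 0" for t using cap[OF s] that by blast
    qed (use h T2 q \<tau> L s1 e jt in auto)
    have "\<tau> / q * (\<integral>y. tw q y * ?k y \<partial>lebesgue) <= \<tau> / q * (D / q * E)" using J \<tau> q by (intro mult_left_mono) auto
    also have "\<dots> <= Q * Y s" using \<tau>2 mult_left_mono[OF Ylow, of Q] Qpos by linarith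
    finally have tail: "\<tau> / q * (\<integral>y. tw q y * ?k y \<partial>lebesgue) <= Q * Y s" .
    have zY: "z powr (p - 1) * Y s >= 0" using Ypos by simp
    then have "C0 / 2 * (z powr (p - 1) * Y s) <= (C0 - \<tau>) * (\<integral>y. pw \<eta> T L y * ?k y \<partial>lebesgue)"
      using P \<tau> C0 by (intro mult_mono) auto
    then have "(lam - 64 * Q) * Y s + b * (\<integral>y. sw L y * ?k y \<partial>lebesgue) + C0 / 2 * (z powr (p - 1) * Y s) - Q * Y s <= - laplacian Y s"
      using test tail by linarith
    then show ?thesis using Ylow unfolding z_def by (simp add: algebra_simps)
  qed
  have Ypos: "Y s > 0" if "s \<in> S" for s
  proof -
    have "m * \<delta>2 * E > 0" using bm \<delta>2 E by simp
    then show ?thesis using conjunct1[OF main[OF that]] by linarith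
  qed
  define P where "P = (%s. (\<phi> (sgn s))\<^sup>2 * (- laplacian Y s) / Y s)"
  have sP: "smooth_on (UNIV - {0}) P" and AP: "sphere_integral P <= dirichlet \<phi>"
    unfolding P_def using allegretto_piepenbrink[OF Ys Yh \<phi>s] Ypos by (auto simp: S_def)
  define C4 where "C4 = C3 * Q powr ((p - 1) / p)"
  have C4: "C4 >= 0" using C3 by (simp add: C4_def)
  define F where "F = (%x. (lam - 65 * Q) * (\<phi> (sgn x))\<^sup>2 + C4 * ((\<phi> (sgn x))\<^sup>2 * indicator K (sgn x)))"
  have pt: "F s <= P s" if s1: "norm s = 1" for s
  proof (cases "\<phi> s = 0")
    case True
    then show ?thesis using s1 by (simp add: F_def P_def sgn_div_norm)
  next
    case False
    then have s: "s \<in> S" unfolding S_def using s1 by (intro subsetD[OF closure_subset]) auto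
    have ss: "sgn s = s" using s1 by (simp add: sgn_div_norm)
    let ?I = "\<integral>y. sw L y * bump e (s \<bullet> sgn y) \<partial>lebesgue"
    let ?z = "(Y s * Q / (2 * D * E)) powr (p - 1)"
    note m1 = main[OF s, THEN conjunct2] and y0 = Ypos[OF s]
    have "(lam - 65 * Q) + (b * ?I / Y s + C0 / 2 * ?z) = ((lam - 65 * Q) * Y s + b * ?I + C0 / 2 * (?z * Y s)) / Y s"
      using y0 by (simp add: field_simps)
    also have "\<dots> <= - laplacian Y s / Y s" using m1 y0 by (intro divide_right_mono) auto
    finally have l1: "(lam - 65 * Q) + (b * ?I / Y s + C0 / 2 * ?z) <= - laplacian Y s / Y s" .
    have "C4 * indicator K s <= b * ?I / Y s + C0 / 2 * ?z"
    proof (cases "s \<in> K")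
      case True
      have "?I >= \<delta> * E" unfolding E_def by (rule mp[OF spec[OF spec[OF bspec[OF low True], of e], of L]]) (use e L cap[OF s] in blast)
      then have "C4 <= b * ?I / Y s + C0 / 2 * ?z"
        unfolding C4_def C3_def using bm \<delta> C0 D E y0 Qpos p by (intro balance) auto
      then show ?thesis using True by simp
    next
      case False
      have "?I >= \<delta>2 * E" unfolding E_def by (rule mp[OF spec[OF spec[OF bspec[OF low2 s], of e], of L]]) (use e L cap[OF s] in blast)
      moreover have "\<delta>2 * E > 0" using \<delta>2 E by simp
      ultimately have "?I >= 0" by linarith
      then show ?thesis using False bm y0 C0 by simp
    qed
    then have "(\<phi> s)\<^sup>2 * ((lam - 65 * Q) + C4 * indicator K s) <= (\<phi> s)\<^sup>2 * (- laplacian Y s / Y s)"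
      using l1 by (intro mult_left_mono) auto
    then show ?thesis by (simp add: F_def P_def ss algebra_simps)
  qed
  have s\<phi>2: "smooth_on (UNIV - {0}) (%y. (\<phi> (sgn y))\<^sup>2)" by (rule hom_smooth(2)[OF \<phi>s])
  note m\<phi>[measurable] = smooth_on_borel_measurable[OF s\<phi>2]
  obtain B1 where B1: "!!x. norm x = 1 ==> \<bar>(\<phi> (sgn x))\<^sup>2\<bar> <= B1"
    by (rule continuous_bounded_on_sphere[OF smooth_on_continuous[OF s\<phi>2]]) blast
  obtain B2 where B2: "!!x. norm x = 1 ==> \<bar>P x\<bar> <= B2"
    by (rule continuous_bounded_on_sphere[OF smooth_on_continuous[OF sP]]) blast
  have [measurable]: "K \<in> sets borel" using K(1) by (simp add: compact_imp_closed)
  let ?gK = "%x. (\<phi> (sgn x))\<^sup>2 * indicator K (sgn x) :: real"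
  let ?gB = "%x. (\<phi> (sgn x))\<^sup>2 * indicator (\<Sigma> - K) (sgn x) :: real"
  have mK: "?gK \<in> borel_measurable borel" by measurable
  have mB: "?gB \<in> borel_measurable borel" using K(3) by measurable
  have mF: "F \<in> borel_measurable borel" unfolding F_def by measurable
  have bK: "\<bar>?gK x\<bar> <= B1" if "norm x = 1" for x
    using B1[OF that] order_trans[OF abs_ge_zero B1[OF that]] by (auto simp: indicator_def)
  have bB: "\<bar>?gB x\<bar> <= B1" if "norm x = 1" for x
    using B1[OF that] order_trans[OF abs_ge_zero B1[OF that]] by (auto simp: indicator_def)
  have bF: "\<bar>F x\<bar> <= \<bar>lam - 65 * Q\<bar> * B1 + C4 * B1" if "norm x = 1" for x
  proof -
    have "\<bar>F x\<bar> <= \<bar>lam - 65 * Q\<bar> * \<bar>(\<phi> (sgn x))\<^sup>2\<bar> + C4 * \<bar>?gK x\<bar>"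
      unfolding F_def using C4 abs_triangle_ineq[of "(lam - 65 * Q) * (\<phi> (sgn x))\<^sup>2" "C4 * ?gK x"] by (simp add: abs_mult)
    also have "\<dots> <= \<bar>lam - 65 * Q\<bar> * B1 + C4 * B1" using B1[OF that] bK[OF that] C4 by (intro add_mono mult_left_mono) auto
    finally show ?thesis .
  qed
  have FP: "sphere_integral F <= sphere_integral P"
    by (rule sphere_integral_mono[OF mF bF smooth_on_borel_measurable[OF sP] B2 pt])
  have i\<phi>: "integrable lborel (%x. (\<phi> (sgn x))\<^sup>2 * indicator (ball 0 1) x)"
  proof -
    have "integrable lborel (%x. (\<phi> (sgn (sgn x)))\<^sup>2 * indicator (ball 0 1) x)" by (rule sphere_integrable[OF m\<phi> B1])
    then show ?thesis by (simp only: sgn_sgn_vector)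
  qed
  have iK: "integrable lborel (%x. ?gK x * indicator (ball 0 1) x)"
  proof -
    have "integrable lborel (%x. ?gK (sgn x) * indicator (ball 0 1) x)" by (rule sphere_integrable[OF mK bK])
    then show ?thesis by (simp only: sgn_sgn_vector)
  qed
  have iB: "integrable lborel (%x. ?gB x * indicator (ball 0 1) x)"
  proof -
    have "integrable lborel (%x. ?gB (sgn x) * indicator (ball 0 1) x)" by (rule sphere_integrable[OF mB bB])
    then show ?thesis by (simp only: sgn_sgn_vector)
  qed
  have "sphere_integral F = (\<integral>x. (lam - 65 * Q) * ((\<phi> (sgn x))\<^sup>2 * indicator (ball 0 1) x) + C4 * (?gK x * indicator (ball 0 1) x) \<partial>lborel)"
    unfolding sphere_integral_def F_def by (intro Bochner_Integration.integral_cong refl) (simp add: sgn_sgn_vector algebra_simps)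
  also have "\<dots> = (lam - 65 * Q) * mass \<phi> + C4 * sphere_integral ?gK"
    unfolding mass_def sphere_integral_def sgn_sgn_vector
    using Bochner_Integration.integral_add[OF integrable_mult_right[OF i\<phi>, of "lam - 65 * Q"] integrable_mult_right[OF iK, of C4]]
    by (simp only: integral_mult_right_zero)
  finally have F1: "sphere_integral F = (lam - 65 * Q) * mass \<phi> + C4 * sphere_integral ?gK" .
  have split: "mass \<phi> = sphere_integral ?gK + sphere_integral ?gB"
  proof -
    have e0: "(\<phi> (sgn x))\<^sup>2 * indicator (ball 0 1) x = ?gK x * indicator (ball 0 1) x + ?gB x * indicator (ball 0 1) x" if "x ~= 0" for x
    proof (cases "\<phi> (sgn x) = 0")
      case False
      then have "sgn x \<in> S" unfolding S_def using that by (intro subsetD[OF closure_subset]) (auto simp: norm_sgn)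
      then show ?thesis using S(2) by (auto simp: indicator_def)
    qed simp
    have "AE x in lborel. (\<phi> (sgn x))\<^sup>2 * indicator (ball 0 1) x = ?gK x * indicator (ball 0 1) x + ?gB x * indicator (ball 0 1) x"
      using AE_lborel_singleton[of "0::'a"] by eventually_elim (rule e0)
    then have "(\<integral>x. (\<phi> (sgn x))\<^sup>2 * indicator (ball 0 1) x \<partial>lborel) = (\<integral>x. ?gK x * indicator (ball 0 1) x + ?gB x * indicator (ball 0 1) x \<partial>lborel)"
      by (rule integral_cong_AE[OF borel_measurable_integrable[OF i\<phi>] borel_measurable_integrable[OF Bochner_Integration.integrable_add[OF iK iB]]])
    then show ?thesis unfolding mass_def sphere_integral_def sgn_sgn_vector
      by (rule trans[OF _ Bochner_Integration.integral_add[OF iK iB]])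
  qed
  have pB: "?gB x >= 0" for x by simp
  have "sphere_integral ?gB <= mass \<phi> / 2"
  proof -
    have "(\<integral>\<^sup>+x. ennreal (?gB (sgn x)) * indicator (ball 0 1) x \<partial>lborel) = (\<integral>\<^sup>+x. ennreal ((\<phi> (sgn x))\<^sup>2) * indicator (\<Sigma> - K) (sgn x) * indicator (ball 0 1) x \<partial>lborel)"
      by (intro nn_integral_cong) (auto simp: indicator_def sgn_sgn_vector)
    also have "\<dots> <= ennreal (mass \<phi> / 2)"
    proof (rule equi[rule_format, OF \<phi>s _ K(3,4)])
      show "dirichlet \<phi> <= (lam + 1) * mass \<phi>" using dir Q1 mpos mult_right_mono[of "lam + Q" "lam + 1" "mass \<phi>"] by linarith
    qed
    finally have "(\<integral>\<^sup>+x. ennreal (?gB (sgn x)) * indicator (ball 0 1) x \<partial>lborel) <= ennreal (mass \<phi> / 2)" .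
    from ord_eq_le_trans[OF nn_sphere_integral[OF mB bB pB, symmetric] this]
    have "ennreal (sphere_integral ?gB) <= ennreal (mass \<phi> / 2)" .
    then show ?thesis using mpos by (simp add: ennreal_le_iff)
  qed
  then have "sphere_integral ?gK >= mass \<phi> / 2" using split by linarith
  then have "C4 * (mass \<phi> / 2) <= C4 * sphere_integral ?gK" using C4 by (rule mult_left_mono)
  then have "(lam - 65 * Q) * mass \<phi> + C4 * (mass \<phi> / 2) <= (lam + Q) * mass \<phi>" using F1 FP AP dir by linarith
  then have "C4 * mass \<phi> <= (132 * Q) * mass \<phi>" by (simp add: algebra_simps)
  then have "C4 <= 132 * Q" using mpos by simp
  then show False using small by (simp add: C4_def)
qed

end

theorem theorem0p1:
  fixes \<Sigma> :: "'a::euclidean_space set" and R c p :: real and u :: "'a \<Rightarrow> real"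
  assumes "DIM('a) \<ge> 3"
    and "sphere_domain \<Sigma>"
    and "R > 0"
    and "lambda1 \<Sigma> < c" and "c \<le> hardy_const \<Sigma>"
    and "p > 1"
    and "Lp_loc p (trunc_cone \<Sigma> R) u"
    and "\<forall>x\<in>trunc_cone \<Sigma> R. u x \<ge> 0"
    and "\<And>\<phi>. test_fun (trunc_cone \<Sigma> R) \<phi> \<Longrightarrow> (\<forall>x. \<phi> x \<ge> 0) \<Longrightarrow>
           set_lebesgue_integral lebesgue (trunc_cone \<Sigma> R)
             (\<lambda>x. u x * (- laplacian \<phi> x - c / (norm x)\<^sup>2 * \<phi> x))
         \<ge> set_lebesgue_integral lebesgue (trunc_cone \<Sigma> R) (\<lambda>x. u x powr p * \<phi> x)"
    and "p \<ge> p_Sigma \<Sigma> c"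
  shows "AE x in lebesgue. x \<in> trunc_cone \<Sigma> R \<longrightarrow> u x = 0"
proof -
  let ?\<Omega> = "trunc_cone \<Sigma> R"
  let ?M = "(real DIM('a) - 2) / 2"
  define w where "w = (%x. if x \<in> ?\<Omega> then u x else 0)"
  define \<kappa> where "\<kappa> = sqrt (hardy_const \<Sigma> - c)"
  note \<Sigma> = assms(2)
  have \<kappa>0: "\<kappa> >= 0" using assms(5) by (simp add: \<kappa>_def)
  have \<kappa>2: "\<kappa>\<^sup>2 = ?M\<^sup>2 + lambda1 \<Sigma> - c" using assms(5) hardy_const_eq[OF \<Sigma>] by (simp add: \<kappa>_def)
  have cc: "lambda1 \<Sigma> + ?M\<^sup>2 - \<kappa>\<^sup>2 = c" using \<kappa>2 by simp
  have c0: "c > 0" using lambda1_nonneg[OF \<Sigma>] assms(4) by linarith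
  have "?M > 0" using assms(1) by simp
  moreover have "\<kappa>\<^sup>2 < ?M\<^sup>2" using \<kappa>2 assms(4) by simp
  ultimately have \<alpha>0: "?M - \<kappa> > 0" using power_less_imp_less_base[of \<kappa> 2 ?M] by simp
  have "1 + 2 / (?M - \<kappa>) <= p" using assms(10) by (simp add: p_Sigma_def alpha_minus_def \<kappa>_def)
  then have crit: "(?M - \<kappa>) * (p - 1) >= 2" using \<alpha>0 by (simp add: field_simps)
  have opn: "open ?\<Omega>" by (rule trunc_cone_open[OF \<Sigma>])
  then have om: "?\<Omega> \<in> sets lebesgue" by (simp add: borel_open sets_completionI_sets)
  have um: "u \<in> borel_measurable lebesgue" using assms(7) by (simp add: Lp_loc_def)
  have wm: "w \<in> borel_measurable lebesgue" unfolding w_def using um om by (intro measurable_If_set) auto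
  have w0: "w x >= 0" for x using assms(8) by (simp add: w_def)
  have wz: "w x = 0" if "x \<notin> ?\<Omega>" for x using that by (simp add: w_def)
  have Kl: "K \<in> sets lebesgue" if "compact K" for K :: "'a set"
    using that by (simp add: borel_closed compact_imp_closed sets_completionI_sets)
  have wp: "integrable lebesgue (%x. w x powr p * indicator K x)" if K: "compact K" "K \<subseteq> ?\<Omega>" for K
  proof (rule integrableI_nonneg)
    show "(%x. w x powr p * indicator K x) \<in> borel_measurable lebesgue"
      using wm Kl[OF K(1)] by (intro borel_measurable_times borel_measurable_indicator) measurable
    have "(\<integral>\<^sup>+x. ennreal (w x powr p * indicator K x) \<partial>lebesgue) = (\<integral>\<^sup>+x\<in>K. ennreal (\<bar>u x\<bar> powr p) \<partial>lebesgue)"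
      using K(2) assms(8) by (intro nn_integral_cong) (auto simp: indicator_def w_def subset_iff)
    also have "\<dots> < \<infinity>" using assms(7) K by (simp add: Lp_loc_def)
    finally show "(\<integral>\<^sup>+x. ennreal (w x powr p * indicator K x) \<partial>lebesgue) < \<infinity>" .
  qed simp
  have wl: "integrable lebesgue (%x. w x * indicator K x)" if K: "compact K" "K \<subseteq> ?\<Omega>" for K
  proof (rule Bochner_Integration.integrable_bound)
    have "emeasure lebesgue K < \<infinity>" using emeasure_compact_finite[OF K(1)] K(1) by (simp add: borel_closed compact_imp_closed)
    then have "integrable lebesgue (%x. indicator K x :: real)"
      using Kl[OF K(1)] by (intro integrable_real_indicator)
    then show "integrable lebesgue (%x. indicator K x + w x powr p * indicator K x)"
      using wp[OF K] by (rule Bochner_Integration.integrable_add)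
    show "(%x. w x * indicator K x) \<in> borel_measurable lebesgue"
      using wm Kl[OF K(1)] by (intro borel_measurable_times borel_measurable_indicator)
    show "AE x in lebesgue. norm (w x * indicator K x) <= norm (indicator K x + w x powr p * indicator K x)"
    proof (rule AE_I2)
      fix x
      have "w x <= 1 + w x powr p"
      proof (cases "w x <= 1")
        case True
        then show ?thesis using powr_ge_zero[of "w x" p] by linarith
      next
        case False
        then have "w x powr 1 <= w x powr p" using assms(6) by (intro powr_mono) auto
        then show ?thesis using False by simp
      qed
      then show "norm (w x * indicator K x) <= norm (indicator K x + w x powr p * indicator K x)"
        using w0[of x] by (simp add: indicator_def)
    qed
  qed
  have sup: "(\<integral>x. w x powr p * \<phi> x \<partial>lebesgue) <= (\<integral>x. w x * (- laplacian \<phi> x - c / (norm x)\<^sup>2 * \<phi> x) \<partial>lebesgue)"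
    if "test_fun ?\<Omega> \<phi>" "!!x. \<phi> x >= 0" for \<phi>
  proof -
    have "(%x. indicator ?\<Omega> x *\<^sub>R (u x powr p * \<phi> x)) = (%x. w x powr p * \<phi> x)"
      using assms(6) by (auto simp: fun_eq_iff w_def indicator_def)
    moreover have "(%x. indicator ?\<Omega> x *\<^sub>R (u x * (- laplacian \<phi> x - c / (norm x)\<^sup>2 * \<phi> x))) = (%x. w x * (- laplacian \<phi> x - c / (norm x)\<^sup>2 * \<phi> x))"
      by (auto simp: fun_eq_iff w_def indicator_def)
    ultimately show ?thesis using assms(9)[OF that(1)] that(2) unfolding set_lebesgue_integral_def by simp
  qed
  have super: "superharmonic ?\<Omega> w"
  proof
    fix \<phi> :: "'a \<Rightarrow> real" assume tf: "test_fun ?\<Omega> \<phi>" and \<phi>0: "!!x. \<phi> x >= 0"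
    have K: "compact (tsupport \<phi>)" "tsupport \<phi> \<subseteq> ?\<Omega>" and \<phi>S: "smooth_on UNIV \<phi>" using tf by (auto simp: test_fun_def)
    have n0: "norm y ~= 0" if "y \<in> tsupport \<phi>" for y using K(2) that by (auto simp: trunc_cone_iff[OF \<Sigma>])
    have c\<phi>: "continuous_on A \<phi>" for A by (rule continuous_on_subset[OF smooth_on_continuous[OF \<phi>S]]) simp
    have cl: "continuous_on A (laplacian \<phi>)" for A
      by (rule continuous_on_subset[OF smooth_on_continuous[OF smooth_on_laplacian[OF open_UNIV \<phi>S]]]) simp
    obtain C where lz: "!!x. x \<notin> tsupport \<phi> ==> laplacian \<phi> x = 0" by (rule laplacian_test_fun[OF tf]) blast
    have "\<phi> y = 0" if "y \<notin> tsupport \<phi>" for y using in_tsupport[of \<phi> y] that by blast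
    then have ind: "(c / (norm y)\<^sup>2 * \<phi> y) * indicator (tsupport \<phi>) y = c / (norm y)\<^sup>2 * \<phi> y"
      "(- laplacian \<phi> y) * indicator (tsupport \<phi>) y = - laplacian \<phi> y" for y
      using lz by (auto simp: indicator_def)
    have i1: "integrable lebesgue (%y. w y * ((c / (norm y)\<^sup>2 * \<phi> y) * indicator (tsupport \<phi>) y))"
      by (rule integrable_continuous_on_compact[OF wl[OF K] K(1)]) (use n0 in \<open>auto intro!: continuous_intros c\<phi>\<close>)
    have i2: "integrable lebesgue (%y. w y * ((- laplacian \<phi> y) * indicator (tsupport \<phi>) y))"
      by (rule integrable_continuous_on_compact[OF wl[OF K] K(1)]) (intro continuous_on_minus cl)
    have "0 <= (\<integral>x. w x powr p * \<phi> x \<partial>lebesgue)" using \<phi>0 by (intro integral_nonneg_AE) auto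
    also have "\<dots> <= (\<integral>x. w x * (- laplacian \<phi> x - c / (norm x)\<^sup>2 * \<phi> x) \<partial>lebesgue)" by (rule sup[OF tf \<phi>0])
    also have "\<dots> = (\<integral>x. w x * - laplacian \<phi> x \<partial>lebesgue) - (\<integral>x. w x * (c / (norm x)\<^sup>2 * \<phi> x) \<partial>lebesgue)"
      using Bochner_Integration.integral_diff[OF i2[unfolded ind] i1[unfolded ind]] by (simp only: right_diff_distrib)
    also have "\<dots> <= (\<integral>x. w x * - laplacian \<phi> x \<partial>lebesgue)"
    proof -
      have "0 <= w x * (c / (norm x)\<^sup>2 * \<phi> x)" for x
        using \<phi>0[of x] w0[of x] c0 by (intro mult_nonneg_nonneg divide_nonneg_nonneg) auto
      then have "0 <= (\<integral>x. w x * (c / (norm x)\<^sup>2 * \<phi> x) \<partial>lebesgue)" by (rule Bochner_Integration.integral_nonneg)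
      then show ?thesis by simp
    qed
    finally show "0 <= (\<integral>x. w x * - laplacian \<phi> x \<partial>lebesgue)" .
  qed (use assms(1) opn wm w0 wz wl in auto)
  have "hardy_supersolution \<Sigma> R w p \<kappa> (lambda1 \<Sigma>)"
    by (intro hardy_supersolution.intro super hardy_supersolution_axioms.intro)
       (use assms \<Sigma> \<kappa>0 crit wp sup cc in auto)
  then have "AE x in lebesgue. w x = 0" by (rule hardy_supersolution.vanish) simp
  then show ?thesis by eventually_elim (auto simp: w_def split: if_splits)
qed

end
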